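(* For $n>0$ let $b=b^*(n)$ be the bifurcation curve corresponding to the saddle loop homoclinic connection for the Bogdanov-Takens system $$\dot x=y,\qquad \dot y=-n+by+x^2+xy.$$ Then $b^*(n)=H(\sqrt n)$, where $H$ is a (real) analytic function on $[0,\infty)$. Moreover: (i) For $0<n\le 1/40$, $$\left|\frac57\sqrt n+\frac{72}{2401}n-b^*(n)\right|<\frac{11}4\,n^{5/4}.$$ (ii) For $n>0$ small enough (that is, as $n\to0^+$), $$b^*(n)=\frac57n^{1/2}+\frac{72}{2401}n-\frac{30024}{45294865}n^{3/2}-\frac{2352961656}{11108339166925}n^2+O(n^{5/2}).$$
   Context: Definition of $b^*$. Consider the system $\dot x=y$, $\dot y=-n+by+x^2+xy$ with real parameters $n,b$. For $n>0$ its critical points are the saddle $(\sqrt n,0)$ and the focus or node $(-\sqrt n,0)$. It is known that for each $n>0$ there is a unique value $b=b^*(n)$ for which the system has a homoclinic loop at the saddle (an orbit whose $\alpha$- and $\omega$-limit sets are both the saddle), and that the system has a limit cycle (which is then unique and hyperbolic) if and only if $n>0$ and $b^*(n)<b<\sqrt n$. A function is analytic on $[0,\infty)$ if it is the restriction of a real analytic function on an open neighbourhood of $[0,\infty)$ in $\mathbb{R}$. *)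

theory Defs
  imports "HOL-Analysis.Analysis" "HOL-Library.Landau_Symbols"
begin

definition bt_field :: "real \<Rightarrow> real \<Rightarrow> real \<times> real \<Rightarrow> real \<times> real" where
  "bt_field n b = (\<lambda>(x, y). (y, - n + b * y + x\<^sup>2 + x * y))"

text \<open>
  Solutions are defined on the whole real line. This is no restriction for homoclinic orbits:
  a maximal solution that blows up in finite time leaves every compact set for good, so that its
  limit set at that end is empty.
\<close>
definition bt_solution :: "real \<Rightarrow> real \<Rightarrow> (real \<Rightarrow> real \<times> real) \<Rightarrow> bool" where
  "bt_solution n b \<gamma> \<longleftrightarrow>
     (\<forall>t. (\<gamma> has_vector_derivative bt_field n b (\<gamma> t)) (at t))"

definition omega_limit_set :: "(real \<Rightarrow> 'a::topological_space) \<Rightarrow> 'a set" where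
  "omega_limit_set \<gamma> =
     {p. \<exists>t :: nat \<Rightarrow> real. filterlim t at_top sequentially \<and> (\<lambda>k. \<gamma> (t k)) \<longlonglongrightarrow> p}"

definition alpha_limit_set :: "(real \<Rightarrow> 'a::topological_space) \<Rightarrow> 'a set" where
  "alpha_limit_set \<gamma> =
     {p. \<exists>t :: nat \<Rightarrow> real. filterlim t at_bot sequentially \<and> (\<lambda>k. \<gamma> (t k)) \<longlonglongrightarrow> p}"

text \<open>
  The saddle is \<open>(sqrt n, 0)\<close>. The stationary solution at the saddle also has both limit sets
  equal to the saddle, so it has to be excluded.
\<close>
definition has_saddle_loop :: "real \<Rightarrow> real \<Rightarrow> bool" where
  "has_saddle_loop n b \<longleftrightarrow>
     (\<exists>\<gamma>. bt_solution n b \<gamma> \<and> (\<exists>t. \<gamma> t \<noteq> (sqrt n, 0)) \<and>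
          alpha_limit_set \<gamma> = {(sqrt n, 0)} \<and> omega_limit_set \<gamma> = {(sqrt n, 0)})"

text \<open>Only meaningful for \<open>n > 0\<close>, where exactly one such \<open>b\<close> exists.\<close>
definition bstar :: "real \<Rightarrow> real" where
  "bstar n = (THE b. has_saddle_loop n b)"

definition real_analytic_on :: "(real \<Rightarrow> real) \<Rightarrow> real set \<Rightarrow> bool" where
  "real_analytic_on f U \<longleftrightarrow> (\<forall>x\<in>U. \<exists>F. (\<lambda>h. f (x + h)) has_fps_expansion F)"

text \<open>
  Analyticity on a set that need not be open: restriction of a real analytic function on an open
  neighbourhood. The values of \<open>f\<close> outside \<open>S\<close> are irrelevant.
\<close>
definition analytic_restriction_on :: "(real \<Rightarrow> real) \<Rightarrow> real set \<Rightarrow> bool" where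
  "analytic_restriction_on f S \<longleftrightarrow>
     (\<exists>U g. open U \<and> S \<subseteq> U \<and> real_analytic_on g U \<and> (\<forall>x\<in>S. f x = g x))"

end

theory Submission
  imports Defs "HOL-Complex_Analysis.Complex_Analysis"
begin

text \<open>
  With \<open>n = \<epsilon>^4\<close>, \<open>x = \<epsilon>^2 X\<close>, \<open>y = \<epsilon>^3 Y\<close>, \<open>b = \<epsilon> \<kappa>\<close> and a rescaled time the system becomes
  \<open>X' = Y\<close>, \<open>Y' = X^2 - 1 + (\<kappa> + \<epsilon> X) Y\<close>, a perturbation of a Hamiltonian system. A homoclinic loop
  consists of two graphs over the \<open>X\<close>-axis, and comparing these with a second closed curve shows that
  \<open>k = \<kappa> + \<epsilon>\<close> is determined by \<open>\<epsilon>\<close>. After a square root substitution at the turning point, the two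
  graphs solve an equation on a fixed interval that is quadratic in all unknowns. The linearised
  problem can be solved explicitly, so a loop continues as a convergent power series in \<open>\<epsilon>\<close>. Together
  with a priori bounds and compactness this yields a loop for every \<open>\<epsilon> \<ge> 0\<close> and the analyticity of
  \<open>k\<close>. Reflecting time shows that \<open>k\<close> is odd, hence \<open>b = \<epsilon> (k - \<epsilon>)\<close> is analytic in \<open>\<epsilon>^2 = sqrt n\<close>.
  For (i) and (ii), truncations of the formal expansion of the loop with a slightly changed \<open>k\<close> are
  closed curves that all orbits cross in one direction, which confines the true \<open>k\<close>.
\<close>

section \<open>Comparison of loops\<close>

text \<open>Both ends of the interval are singular: at the saddle the equation for a graph
  degenerates, and at the turning point \<open>f\<close> vanishes like a square root. The
  substitution turns both into zeros of the fixed weight \<open>w * (1 - w^2)\<close>, and all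
  estimates are relative to it. Integrating the linearised equation from the saddle leaves one
  condition for each half of the loop: the variation has to vanish at the turning point. Two numbers
  are free to achieve this, a rescaling of the loop and an extra damping. The rescaling moves both
  end values equally, the damping moves them in opposite senses, so the conditions can be met at
  every loop and not only for small \<epsilon>. Continuation could fail only if loops became
  unbounded or approached the second equilibrium \<open>u = 2\<close>; energy comparison excludes
  this on bounded ranges of \<epsilon>. The expansions use \<open>sqrt 2 * \<epsilon>\<close> and
  \<open>sqrt 2 * k\<close>, which makes all coefficients rational.\<close>

text \<open>
  The part of a loop in \<open>Y > 0\<close> is the graph of \<open>Y = f u\<close> with \<open>u = 1 - X\<close>; the loop meets the axis
  at \<open>u = 0\<close> (the saddle) and at \<open>u = B\<close>. Time reversal turns the part in \<open>Y < 0\<close> into such a graph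
  for the parameters \<open>- \<epsilon>\<close> and \<open>- k\<close>.
\<close>
definition half_loop :: "real \<Rightarrow> real \<Rightarrow> real \<Rightarrow> (real \<Rightarrow> real) \<Rightarrow> bool" where
  "half_loop \<epsilon> k B f \<longleftrightarrow> 2 < B \<and>
     (\<forall>u\<in>{0<..<B}. 0 < f u \<and> (f has_real_derivative u * (2 - u) / f u - (k - \<epsilon> * u)) (at u)) \<and>
     (f \<longlongrightarrow> 0) (at_right 0) \<and> (f \<longlongrightarrow> 0) (at_left B)"

definition loop_graph :: "real \<Rightarrow> real \<Rightarrow> real \<Rightarrow> (real \<Rightarrow> real) \<Rightarrow> (real \<Rightarrow> real) \<Rightarrow> bool" where
  "loop_graph \<epsilon> k B f g \<longleftrightarrow> half_loop \<epsilon> k B f \<and> half_loop (-\<epsilon>) (-k) B g"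

text \<open>The difference \<open>h - f\<close> satisfies a strict linear inequality with
  coefficient \<open>- u * (2 - u) / (f * h)\<close>. Up to \<open>u = 2\<close> a nonnegative value
  would have to grow further as \<open>u\<close> decreases to 0, against the common limit at the
  saddle; this takes the place of an initial condition, since the equation is singular at 0. Beyond
  2 the coefficient changes sign, but at a zero of the difference the derivative is still negative,
  so a negative difference cannot return to 0.\<close>

lemma graph_comparison:
  fixes f h :: "real \<Rightarrow> real"
  assumes "0 < b"
    and f: "\<And>u. u \<in> {0<..<b} \<Longrightarrow> 0 < f u \<and> (f has_real_derivative f' u) (at u)"
    and h: "\<And>u. u \<in> {0<..<b} \<Longrightarrow> 0 < h u \<and> (h has_real_derivative h' u) (at u)"
    and less: "\<And>u. u \<in> {0<..<b} \<Longrightarrow> h' u - f' u < u * (2 - u) / h u - u * (2 - u) / f u"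
    and lim: "((\<lambda>u. h u - f u) \<longlongrightarrow> 0) (at_right 0)"
    and u: "u \<in> {0<..<b}"
  shows "h u < f u"
proof -
  define D where "D = (\<lambda>u. h u - f u)"
  define D' where "D' = (\<lambda>u. h' u - f' u)"
  have der: "(D has_real_derivative D' u) (at u)" if "u \<in> {0<..<b}" for u
    unfolding D_def D'_def using f[OF that] h[OF that] by (intro derivative_intros) auto
  have D': "D' u < - (u * (2 - u) / (f u * h u)) * D u" if "u \<in> {0<..<b}" for u
  proof -
    have "0 < f u" "0 < h u" using f[OF that] h[OF that] by auto
    then have "- (u * (2 - u) / (f u * h u)) * D u = u * (2 - u) / h u - u * (2 - u) / f u"
      unfolding D_def by (simp add: field_simps)
    then show ?thesis using less[OF that] unfolding D'_def by linarith
  qed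
  have cont: "isCont D u" if "u \<in> {0<..<b}" for u
    using der[OF that] DERIV_isCont by blast
  have neg2: "D u < 0" if "u \<in> {0<..<b}" "u \<le> 2" for u
  proof (rule ccontr)
    assume "\<not> D u < 0"
    then have Du: "0 \<le> D u" by simp
    have u_in: "0 < u" "u < b" using that by auto
    text \<open>Below a point where \<open>D \<ge> 0\<close> the difference can only grow towards \<open>0\<close>.\<close>
    have mono: "D u < D v" if v: "v \<in> {0<..<u}" for v
    proof (rule ccontr)
      assume "\<not> D u < D v"
      then have le: "D v \<le> D u" by simp
      have "continuous_on {v..u} D"
        using v that \<open>u \<in> _\<close> by (intro continuous_at_imp_continuous_on ballI cont) auto
      then obtain m where m: "m \<in> {v..u}" "\<And>y. y \<in> {v..u} \<Longrightarrow> D y \<le> D m"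
        using continuous_attains_sup[of "{v..u}" D] v by auto
      \<comment> \<open>If \<open>u\<close> is among the maximisers, it is preferred; this keeps the
        chosen maximiser away from \<open>v\<close>, so that there is room to its left.\<close>
      define p where "p = (if D m = D u then u else m)"
      have p: "p \<in> {v..u}" "\<And>y. y \<in> {v..u} \<Longrightarrow> D y \<le> D p"
        using m v unfolding p_def by auto
      have "0 \<le> D p" using p(2)[of u] v Du by auto
      moreover have pb: "p \<in> {0<..<b}" using p v \<open>u \<in> {0<..<b}\<close> by auto
      moreover have "0 < f p" "0 < h p" using f[OF pb] h[OF pb] by auto
      moreover have "p \<le> 2" using p \<open>u \<le> 2\<close> by auto
      ultimately have "0 \<le> (p * (2 - p) / (f p * h p)) * D p"
        by (intro mult_nonneg_nonneg divide_nonneg_nonneg) auto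
      then have "D' p < 0" using D'[OF pb] by linarith
      have "p \<noteq> v"
      proof
        assume "p = v"
        have "D u \<le> D p" using p(2)[of u] v by simp
        then have "D p = D u" using le \<open>p = v\<close> by simp
        then have "p = u" unfolding p_def by presburger
        then show False using \<open>p = v\<close> v by simp
      qed
      then have "v < p" using p by auto
      from DERIV_neg_dec_left[OF der[OF pb] \<open>D' p < 0\<close>] obtain d where
        d: "0 < d" "\<And>t. 0 < t \<Longrightarrow> t < d \<Longrightarrow> D p < D (p - t)" by blast
      define t where "t = min (d / 2) (p - v)"
      have "D p < D (p - t)" using d \<open>v < p\<close> unfolding t_def by (intro d(2)) auto
      moreover have "p - t \<in> {v..u}" using d \<open>v < p\<close> p unfolding t_def by (auto simp: min_def)
      ultimately show False using p(2)[of "p - t"] by linarith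
    qed
    \<comment> \<open>To the left of this point \<open>D\<close> stays above the positive number
      \<open>D v\<close>, which contradicts the limit 0.\<close>
    define v where "v = u / 2"
    have v: "v \<in> {0<..<u}" using that unfolding v_def by auto
    have "\<forall>y\<in>{0<..<v}. D u \<le> D y" using mono v by (auto intro!: less_imp_le)
    have Dv: "0 < D v" using mono[OF v] Du by simp
    have "D v < D y" if y: "y \<in> {0<..<v}" for y
    proof (rule ccontr)
      assume "\<not> D v < D y"
      have "continuous_on {y..v} D"
        using v y \<open>u \<in> _\<close> by (intro continuous_at_imp_continuous_on ballI cont) auto
      moreover have "y < v" using y by auto
      ultimately obtain z where z: "y < z" "z < v" "D v - D y = (v - y) * D' z"
        using MVT2[of y v D D'] der v y \<open>u \<in> _\<close> by auto
      have zb: "z \<in> {0<..<b}" using z y v u_in that by auto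
      have "0 < D z" using mono[of z] z y v Du by auto
      moreover have "0 < f z" "0 < h z" using f[OF zb] h[OF zb] by auto
      moreover have "0 < z" "z \<le> 2" using z y v \<open>u \<le> 2\<close> by auto
      ultimately have "0 \<le> (z * (2 - z) / (f z * h z)) * D z"
        by (intro mult_nonneg_nonneg divide_nonneg_nonneg) auto
      then have "D' z < 0" using D'[OF zb] by linarith
      then have "D v < D y" using z \<open>y < v\<close> by (smt (verit) mult_pos_neg)
      then show False using \<open>\<not> D v < D y\<close> by simp
    qed
    then have "eventually (\<lambda>y. D v \<le> D y) (at_right 0)"
      using v eventually_at_right_field[of "\<lambda>y. D v \<le> D y" 0]
      by (intro eventually_at_rightI[of 0 v]) (auto intro!: less_imp_le)
    then have "D v \<le> 0"
      using lim tendsto_lowerbound trivial_limit_at_right_real unfolding D_def by blast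
    with Dv show False by simp
  qed
  show ?thesis
  proof (rule ccontr)
    assume "\<not> h u < f u"
    then have Du: "0 \<le> D u" unfolding D_def by simp
    then have "2 < u" using neg2[OF u] by force
    then have "D 2 < 0" using neg2[of 2] u by auto
    have ex: "\<exists>m. 2 \<le> m \<and> m \<le> u \<and> D m = 0"
      using u \<open>2 < u\<close> \<open>D 2 < 0\<close> Du by (intro IVT') (auto intro!: continuous_at_imp_continuous_on cont)
    define S where "S = {m \<in> {2..u}. D m = 0}"
    have "compact S"
    proof -
      have "continuous_on {2..u} D" using u by (intro continuous_at_imp_continuous_on ballI cont) auto
      then have "closed S" unfolding S_def
        using continuous_closed_preimage_constant[of "{2..u}" D 0] by auto
      moreover have "bounded S" unfolding S_def by (rule bounded_subset[of "{2..u}"]) auto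
      ultimately show ?thesis using compact_eq_bounded_closed by blast
    qed
    moreover have "S \<noteq> {}" using ex unfolding S_def by auto
    ultimately obtain m where m: "m \<in> S" "\<And>x. x \<in> S \<Longrightarrow> m \<le> x"
      using compact_attains_inf[of S] by metis
    have mb: "m \<in> {0<..<b}" "D m = 0" "2 < m" using m u \<open>D 2 < 0\<close> unfolding S_def
      by (auto simp: less_le)
    have "D' m < 0" using D'[OF mb(1)] mb by auto
    from DERIV_neg_dec_left[OF der[OF mb(1)] this] obtain d where
      d: "0 < d" "\<And>t. 0 < t \<Longrightarrow> t < d \<Longrightarrow> D m < D (m - t)" by blast
    define t where "t = min (d / 2) ((m - 2) / 2)"
    have t: "0 < t" "t < d" "2 < m - t" using d mb unfolding t_def by (auto simp: min_def field_simps)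
    have "0 < D (m - t)" using d(2)[OF t(1,2)] mb by simp
    then have "\<exists>x. 2 \<le> x \<and> x \<le> m - t \<and> D x = 0"
      using mb \<open>D 2 < 0\<close> t by (intro IVT') (auto intro!: continuous_at_imp_continuous_on cont)
    then show False using m t mb unfolding S_def by force
  qed
qed

lemma half_loopD:
  assumes "half_loop \<epsilon> k B f"
  shows "2 < B" "\<And>u. 0 < u \<Longrightarrow> u < B \<Longrightarrow> 0 < f u"
    "\<And>u. 0 < u \<Longrightarrow> u < B \<Longrightarrow> (f has_real_derivative u * (2 - u) / f u - (k - \<epsilon> * u)) (at u)"
    "(f \<longlongrightarrow> 0) (at_right 0)" "(f \<longlongrightarrow> 0) (at_left B)"
  using assms unfolding half_loop_def by auto

text \<open>\<open>h\<close> is a strict subsolution, so the comparison applies up to the smaller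
  end point. If the loop ended before \<open>B'\<close>, the positive value \<open>h B\<close> would
  be squeezed below the limit 0 of \<open>f\<close>.\<close>

lemma half_loop_barrier_less:
  assumes f: "half_loop \<epsilon> k B f"
    and h: "\<And>u. u \<in> {0<..<B'} \<Longrightarrow> 0 < h u \<and> (h has_real_derivative h' u) (at u) \<and>
              h' u < u * (2 - u) / h u - (k - \<epsilon> * u)"
    and h0: "(h \<longlongrightarrow> 0) (at_right 0)" and "0 < B'"
  shows "\<And>u. u \<in> {0<..<min B B'} \<Longrightarrow> h u < f u" "B' \<le> B"
proof -
  show 1: "h u < f u" if "u \<in> {0<..<min B B'}" for u
  proof (rule graph_comparison[of "min B B'" f "\<lambda>u. u * (2 - u) / f u - (k - \<epsilon> * u)" h h'])
    show "((\<lambda>u. h u - f u) \<longlongrightarrow> 0) (at_right 0)"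
      using tendsto_diff[OF h0 half_loopD(4)[OF f]] by simp
  qed (use that half_loopD[OF f] h \<open>0 < B'\<close> in force)+
  show "B' \<le> B"
  proof (rule ccontr)
    assume "\<not> B' \<le> B"
    then have "B < B'" by simp
    have "isCont h B" using h[of B] \<open>B < B'\<close> half_loopD(1)[OF f] by (auto dest: DERIV_isCont)
    then have "(h \<longlongrightarrow> h B) (at_left B)"
      unfolding isCont_def by (rule filterlim_mono) (auto simp: at_le)
    moreover have "(f \<longlongrightarrow> 0) (at_left B)" using half_loopD[OF f] by simp
    moreover have "eventually (\<lambda>u. h u \<le> f u) (at_left B)"
      using 1 \<open>B < B'\<close> half_loopD(1)[OF f] by (intro eventually_at_leftI[of 0]) (auto intro!: less_imp_le)
    ultimately have "h B \<le> 0" using tendsto_le[of "at_left B" f 0 h "h B"] by auto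
    then show False using h[of B] \<open>B < B'\<close> half_loopD(1)[OF f] by auto
  qed
qed

lemma half_loop_barrier_greater:
  assumes f: "half_loop \<epsilon> k B f"
    and h: "\<And>u. u \<in> {0<..<B'} \<Longrightarrow> 0 < h u \<and> (h has_real_derivative h' u) (at u) \<and>
              u * (2 - u) / h u - (k - \<epsilon> * u) < h' u"
    and h0: "(h \<longlongrightarrow> 0) (at_right 0)" and "0 < B'"
  shows "\<And>u. u \<in> {0<..<min B B'} \<Longrightarrow> f u < h u"
  and "(h \<longlongrightarrow> 0) (at_left B') \<Longrightarrow> B \<le> B'"
proof -
  show 1: "f u < h u" if "u \<in> {0<..<min B B'}" for u
  proof (rule graph_comparison[of "min B B'" h h' f "\<lambda>u. u * (2 - u) / f u - (k - \<epsilon> * u)"])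
    show "((\<lambda>u. f u - h u) \<longlongrightarrow> 0) (at_right 0)"
      using tendsto_diff[OF half_loopD(4)[OF f] h0] by simp
  qed (use that half_loopD[OF f] h \<open>0 < B'\<close> in force)+
  assume h1: "(h \<longlongrightarrow> 0) (at_left B')"
  show "B \<le> B'"
  proof (rule ccontr)
    assume "\<not> B \<le> B'"
    then have "B' < B" by simp
    have "isCont f B'" using half_loopD(3)[OF f, of B'] \<open>0 < B'\<close> \<open>B' < B\<close> by (auto dest: DERIV_isCont)
    then have "(f \<longlongrightarrow> f B') (at_left B')"
      unfolding isCont_def by (rule filterlim_mono) (auto simp: at_le)
    moreover have "eventually (\<lambda>u. f u \<le> h u) (at_left B')"
      using 1 \<open>B' < B\<close> \<open>0 < B'\<close> by (intro eventually_at_leftI[of 0]) (auto intro!: less_imp_le)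
    ultimately have "f B' \<le> 0" using tendsto_le[of "at_left B'" h 0 f "f B'"] h1 by auto
    then show False using half_loopD(2)[OF f, of B'] \<open>0 < B'\<close> \<open>B' < B\<close> by auto
  qed
qed

text \<open>The graphs of \<open>h\<close> and \<open>- l\<close> form a closed curve that all orbits cross in the same direction.\<close>
lemma no_loop_if_barrier:
  assumes fg: "loop_graph \<epsilon> k B f g"
    and h: "\<And>u. u \<in> {0<..<B'} \<Longrightarrow> 0 < h u \<and> (h has_real_derivative h' u) (at u) \<and>
              h' u < u * (2 - u) / h u - (k - \<epsilon> * u)"
    and h0: "(h \<longlongrightarrow> 0) (at_right 0)" and h1: "(h \<longlongrightarrow> 0) (at_left B')"
    and l: "\<And>u. u \<in> {0<..<B'} \<Longrightarrow> 0 < l u \<and> (l has_real_derivative l' u) (at u) \<and>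
              u * (2 - u) / l u + (k - \<epsilon> * u) < l' u"
    and l0: "(l \<longlongrightarrow> 0) (at_right 0)" and l1: "(l \<longlongrightarrow> 0) (at_left B')" and "0 < B'"
  shows False
proof -
  have f: "half_loop \<epsilon> k B f" and g: "half_loop (-\<epsilon>) (-k) B g" using fg unfolding loop_graph_def by auto
  note less = half_loop_barrier_less[OF f h h0 \<open>0 < B'\<close>]
  have "B \<le> B'" using l by (intro half_loop_barrier_greater(2)[OF g _ l0 \<open>0 < B'\<close> l1, where h' = l']) (force simp: algebra_simps)
  then have B: "B' = B" using less(2) by simp
  have B2: "2 < B" using half_loopD(1)[OF f] .
  \<comment> \<open>The end points now coincide, so the contradiction comes from the gap
    \<open>f - h\<close>: for \<open>u > 2\<close> the term \<open>u * (2 - u) / y\<close> increases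
    with \<open>y\<close>, hence the gap grows, whereas it has to close at \<open>B\<close>.\<close>
  define D where "D = (\<lambda>u. f u - h u)"
  have D_pos: "0 < D u" if "u \<in> {0<..<B}" for u using less(1)[of u] that unfolding B D_def by auto
  have D_inc: "D x < D y" if "2 < x" "x < y" "y < B" for x y
  proof (rule DERIV_pos_imp_increasing_open[OF \<open>x < y\<close>])
    fix u assume u: "x < u" "u < y"
    then have ub: "0 < u" "u < B" using that by auto
    have pos: "0 < h u" "h u < f u" "0 < f u"
      using h[of u] D_pos[of u] half_loopD(2)[OF f ub] ub unfolding B D_def by auto
    have "u * (2 - u) / h u \<le> u * (2 - u) / f u"
      using pos u that ub by (intro divide_left_mono_neg mult_pos_pos) (auto simp: mult_le_0_iff)
    moreover have "(D has_real_derivative (u * (2 - u) / f u - (k - \<epsilon> * u)) - h' u) (at u)"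
      unfolding D_def using h[of u] half_loopD(3)[OF f ub] ub unfolding B by (intro DERIV_diff) auto
    moreover have "h' u < u * (2 - u) / h u - (k - \<epsilon> * u)" using h[of u] ub B by auto
    ultimately show "\<exists>y. (D has_real_derivative y) (at u) \<and> y > 0"
      by (intro exI[of _ "(u * (2 - u) / f u - (k - \<epsilon> * u)) - h' u"]) auto
  next
    show "continuous_on {x..y} D"
    proof (intro continuous_at_imp_continuous_on ballI)
      fix u assume "u \<in> {x..y}"
      then have ub: "0 < u" "u < B" using that by auto
      show "isCont D u" unfolding D_def using h[of u] half_loopD(3)[OF f ub] ub unfolding B
        by (intro continuous_diff) (auto intro: DERIV_isCont)
    qed
  qed
  define x where "x = (2 + B) / 2"
  have x: "2 < x" "x < B" using B2 unfolding x_def by auto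
  have "(D \<longlongrightarrow> 0) (at_left B)" unfolding D_def using tendsto_diff[OF half_loopD(5)[OF f] h1[unfolded B]] by simp
  moreover have "eventually (\<lambda>u. D x \<le> D u) (at_left B)"
    using x D_inc by (intro eventually_at_leftI[of x]) (auto intro!: less_imp_le)
  ultimately have "D x \<le> 0" using tendsto_lowerbound trivial_limit_at_left_real by blast
  then show False using D_pos[of x] x by auto
qed

lemma loop_graph_swap: "loop_graph \<epsilon> k B f g \<Longrightarrow> loop_graph (-\<epsilon>) (-k) B g f"
  unfolding loop_graph_def by auto

text \<open>A loop for a larger value of \<open>k\<close> is itself a closed strict barrier for a
  smaller value.\<close>

lemma loop_graph_unique:
  assumes "loop_graph \<epsilon> k B f g" "loop_graph \<epsilon> k' B' f' g'"
  shows "k = k'"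
proof -
  have no: False if *: "loop_graph \<epsilon> k B f g" "loop_graph \<epsilon> k' B' f' g'" "k < k'" for k B f g k' B' f' g'
  proof -
    have f: "half_loop \<epsilon> k' B' f'" and g: "half_loop (-\<epsilon>) (-k') B' g'"
      using *(2) unfolding loop_graph_def by auto
    show False
      by (rule no_loop_if_barrier[OF *(1), where B' = B' and h = f' and l = g' and
            h' = "\<lambda>u. u * (2 - u) / f' u - (k' - \<epsilon> * u)" and l' = "\<lambda>u. u * (2 - u) / g' u + (k' - \<epsilon> * u)"])
        (use \<open>k < k'\<close> half_loopD[OF f] half_loopD[OF g] in \<open>auto simp: algebra_simps\<close>)
  qed
  show ?thesis using no[OF assms] no[OF assms(2,1)] by (meson linorder_neqE_linordered_idom)
qed

text \<open>The loop of the Hamiltonian system \<open>\<epsilon> = 0\<close> is a barrier for all other parameters.\<close>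
lemma loop_graph_k_bounds:
  assumes lg: "loop_graph \<epsilon> k B f g" and "0 < \<epsilon>"
  shows "0 < k" "k < 3 * \<epsilon>"
proof -
  \<comment> \<open>The zero level of the energy \<open>y^2 / 2 - u^2 + u^3 / 3\<close>, which ends
    at \<open>u = 3\<close>. Its equation lacks the damping term, and that term has one sign on
    \<open>(0, 3)\<close> as soon as \<open>k \<le> 0\<close> or
    \<open>k \<ge> 3 * \<epsilon>\<close>.\<close>
  define h where "h = (\<lambda>u::real. u * sqrt (2 - 2 * u / 3))"
  have pos: "0 < h u" if "u \<in> {0<..<3}" for u using that unfolding h_def by auto
  have der: "(h has_real_derivative u * (2 - u) / h u) (at u)" if "u \<in> {0<..<3}" for u
  proof -
    have s: "0 < sqrt (2 - 2 * u / 3)" "sqrt (2 - 2 * u / 3) * sqrt (2 - 2 * u / 3) = 2 - 2 * u / 3"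
      using that by auto
    have "u * (2 - u) / h u = sqrt (2 - 2 * u / 3) + u * ((- 2 / 3) * (inverse (sqrt (2 - 2 * u / 3)) / 2))"
      using s that unfolding h_def by (simp add: divide_simps) (simp add: field_simps)
    then show ?thesis using s that unfolding h_def
      by (auto intro!: derivative_eq_intros simp: field_simps)
  qed
  have c: "isCont h u" for u unfolding h_def by (intro continuous_intros) simp
  have "(h \<longlongrightarrow> h 0) (at_right 0)" "(h \<longlongrightarrow> h 3) (at_left 3)"
    using c[of 0] c[of 3] unfolding isCont_def by (simp_all add: filterlim_at_split)
  moreover have "h 0 = 0" unfolding h_def by simp
  moreover have "h 3 = 0" unfolding h_def by simp
  ultimately have lim: "(h \<longlongrightarrow> 0) (at_right 0)" "(h \<longlongrightarrow> 0) (at_left 3)" by simp_all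
  show "0 < k"
  proof (rule ccontr)
    assume "\<not> 0 < k"
    then have "k - \<epsilon> * u < 0" if "u \<in> {0<..<3}" for u
      using \<open>0 < \<epsilon>\<close> that by (smt (verit) greaterThanLessThan_iff mult_pos_pos)
    then show False
      using no_loop_if_barrier[OF lg, of 3 h "\<lambda>u. u * (2 - u) / h u" h "\<lambda>u. u * (2 - u) / h u"] pos der lim
      by force
  qed
  show "k < 3 * \<epsilon>"
  proof (rule ccontr)
    assume "\<not> k < 3 * \<epsilon>"
    then have "0 < k - \<epsilon> * u" if "u \<in> {0<..<3}" for u
    proof -
      have "\<epsilon> * u < \<epsilon> * 3" using that \<open>0 < \<epsilon>\<close> by simp
      then show ?thesis using \<open>\<not> k < 3 * \<epsilon>\<close> by linarith
    qed
    then show False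
      using no_loop_if_barrier[OF loop_graph_swap[OF lg], of 3 h "\<lambda>u. u * (2 - u) / h u" h "\<lambda>u. u * (2 - u) / h u"] pos der lim
      by force
  qed
qed

section \<open>The linearised loop problem\<close>

text \<open>
  The equation of \<open>half_loop\<close> after substituting \<open>u = (1 - w^2) / R\<close>, \<open>f = V / R^2\<close>, \<open>B = 1 / R\<close> and
  \<open>k = K / R\<close>. The bounds say that \<open>V\<close> leaves both end points at a nonzero angle.
\<close>
definition wbranch :: "real \<Rightarrow> real \<Rightarrow> real \<Rightarrow> real \<Rightarrow> (real \<Rightarrow> real) \<Rightarrow> bool" where
  "wbranch d \<epsilon> R K V \<longleftrightarrow> 0 < d \<and> 0 < R \<and>
     (\<forall>w\<in>{0<..<1}. d * (w * (1 - w\<^sup>2)) \<le> V w \<and> V w \<le> w * (1 - w\<^sup>2) / d \<and>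
        (V has_real_derivative - 2 * w * (1 - w\<^sup>2) * (2 * R\<^sup>2 - R * (1 - w\<^sup>2)) / V w + 2 * w * (K - \<epsilon> * (1 - w\<^sup>2))) (at w))"

section \<open>Boundary limits and antiderivatives on open intervals\<close>

lemma bounded_derivative_limits:
  fixes f :: "real \<Rightarrow> real"
  assumes "a < b" and der: "\<And>x. a < x \<Longrightarrow> x < b \<Longrightarrow> (f has_real_derivative f' x) (at x)"
    and bd: "\<And>x. a < x \<Longrightarrow> x < b \<Longrightarrow> \<bar>f' x\<bar> \<le> M"
  shows "\<exists>l. (f \<longlongrightarrow> l) (at_right a)" "\<exists>l. (f \<longlongrightarrow> l) (at_left b)"
proof -
  have "0 \<le> M" using bd[of "(a + b) / 2"] \<open>a < b\<close> by auto
  have lip: "\<bar>f x - f y\<bar> \<le> M * \<bar>x - y\<bar>" if "x \<in> {a<..<b}" "y \<in> {a<..<b}" for x y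
    using field_differentiable_bound[of "{a<..<b}" f f' M x y] der bd that
    by (auto simp: has_field_derivative_at_within)
  have "uniformly_continuous_on {a<..<b} f"
    unfolding uniformly_continuous_on_def
  proof (intro allI impI)
    fix e :: real assume "0 < e"
    have "dist (f x') (f x) < e" if "x \<in> {a<..<b}" "x' \<in> {a<..<b}" "dist x' x < e / (M + 1)" for x x'
    proof -
      have "\<bar>f x' - f x\<bar> \<le> M * \<bar>x' - x\<bar>" using lip that by blast
      also have "\<dots> \<le> (M + 1) * \<bar>x' - x\<bar>" by (simp add: algebra_simps)
      also have "\<dots> < e" using that \<open>0 \<le> M\<close> by (simp add: dist_real_def field_simps)
      finally show ?thesis by (simp add: dist_real_def)
    qed
    then show "\<exists>d>0. \<forall>x\<in>{a<..<b}. \<forall>x'\<in>{a<..<b}. dist x' x < d \<longrightarrow> dist (f x') (f x) < e"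
      using \<open>0 < e\<close> \<open>0 \<le> M\<close> by (intro exI[of _ "e / (M + 1)"]) auto
  qed
  then obtain g where g: "uniformly_continuous_on (closure {a<..<b}) g" "\<And>x. x \<in> {a<..<b} \<Longrightarrow> f x = g x"
    using uniformly_continuous_on_extension_on_closure by metis
  have "continuous_on {a..b} g" using g(1) \<open>a < b\<close> uniformly_continuous_imp_continuous by auto
  then have "(g \<longlongrightarrow> g a) (at_right a)" "(g \<longlongrightarrow> g b) (at_left b)"
    using \<open>a < b\<close> continuous_on_Icc_at_rightD continuous_on_Icc_at_leftD by blast+
  moreover have "eventually (\<lambda>x. g x = f x) (at_right a)" "eventually (\<lambda>x. g x = f x) (at_left b)"
    using g(2) \<open>a < b\<close> by (auto intro!: eventually_at_rightI[of a b] eventually_at_leftI[of a b])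
  ultimately have "(f \<longlongrightarrow> g a) (at_right a)" "(f \<longlongrightarrow> g b) (at_left b)"
    by (auto elim: Lim_transform_eventually)
  then show "\<exists>l. (f \<longlongrightarrow> l) (at_right a)" "\<exists>l. (f \<longlongrightarrow> l) (at_left b)" by auto
qed

lemma bounded_derivative_diff:
  fixes f :: "real \<Rightarrow> real"
  assumes "x \<le> y" and der: "\<And>t. x \<le> t \<Longrightarrow> t \<le> y \<Longrightarrow> (f has_real_derivative f' t) (at t)"
    and bd: "\<And>t. x \<le> t \<Longrightarrow> t \<le> y \<Longrightarrow> \<bar>f' t\<bar> \<le> M"
  shows "\<bar>f y - f x\<bar> \<le> M * (y - x)"
  using field_differentiable_bound[of "{x..y}" f f' M y x] der bd \<open>x \<le> y\<close>
  by (auto simp: has_field_derivative_at_within)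

lemma antiderivative_open_interval:
  fixes f :: "real \<Rightarrow> real"
  assumes "continuous_on {0<..<1} f"
  shows "\<exists>F. \<forall>x\<in>{0<..<1}. (F has_real_derivative f x) (at x)"
proof -
  have "isCont f x" if "0 < x" "x < 1" for x
    using assms that continuous_on_interior[of "{0<..<1}" f x] by simp
  then have "\<exists>F. \<forall>x. ereal 0 < ereal x \<longrightarrow> ereal x < ereal 1 \<longrightarrow> (F has_vector_derivative f x) (at x)"
    by (intro einterval_antiderivative) auto
  then obtain F where "\<And>x. 0 < x \<Longrightarrow> x < 1 \<Longrightarrow> (F has_vector_derivative f x) (at x)" by auto
  then show ?thesis by (intro exI[of _ F]) (simp add: has_real_derivative_iff_has_vector_derivative)
qed

lemma wbranchD:
  assumes "wbranch d \<epsilon> R K V"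
  shows "0 < d" "0 < R" "\<And>w. 0 < w \<Longrightarrow> w < 1 \<Longrightarrow> d * (w * (1 - w\<^sup>2)) \<le> V w"
    "\<And>w. 0 < w \<Longrightarrow> w < 1 \<Longrightarrow> V w \<le> w * (1 - w\<^sup>2) / d"
    "\<And>w. 0 < w \<Longrightarrow> w < 1 \<Longrightarrow> 0 < V w"
    "\<And>w. 0 < w \<Longrightarrow> w < 1 \<Longrightarrow> (V has_real_derivative - 2 * w * (1 - w\<^sup>2) * (2 * R\<^sup>2 - R * (1 - w\<^sup>2)) / V w + 2 * w * (K - \<epsilon> * (1 - w\<^sup>2))) (at w)"
    "continuous_on {0<..<1} V"
proof -
  show *: "0 < d" "0 < R" "\<And>w. 0 < w \<Longrightarrow> w < 1 \<Longrightarrow> d * (w * (1 - w\<^sup>2)) \<le> V w"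
    "\<And>w. 0 < w \<Longrightarrow> w < 1 \<Longrightarrow> V w \<le> w * (1 - w\<^sup>2) / d"
    "\<And>w. 0 < w \<Longrightarrow> w < 1 \<Longrightarrow> (V has_real_derivative - 2 * w * (1 - w\<^sup>2) * (2 * R\<^sup>2 - R * (1 - w\<^sup>2)) / V w + 2 * w * (K - \<epsilon> * (1 - w\<^sup>2))) (at w)"
    using assms unfolding wbranch_def by auto
  show "0 < V w" if "0 < w" "w < 1" for w
  proof -
    have "0 < d * (w * (1 - w\<^sup>2))" using that * by (intro mult_pos_pos) (auto simp: abs_square_less_1)
    then show ?thesis using *(3)[OF that] by simp
  qed
  show "continuous_on {0<..<1} V"
    using *(5) by (intro continuous_at_imp_continuous_on ballI) (meson DERIV_isCont greaterThanLessThan_iff)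
qed

lemma one_minus_sq:
  fixes w :: real assumes "0 < w" "w < 1"
  shows "0 < 1 - w\<^sup>2" "1 - w\<^sup>2 \<le> 1" "1 - w \<le> 1 - w\<^sup>2"
  using assms by (simp_all add: abs_square_less_1) (simp add: power2_eq_square)

section \<open>The linearised equation for one half, integrated from the saddle\<close>

text \<open>For a variation \<open>v\<close> of \<open>V\<close> put \<open>e = V * v\<close>. The
  linearisation of the equation for \<open>V^2 / 2\<close> then reads
  \<open>e' = bcoeff * e + forcing\<close>. The coefficient is bounded near the turning point
  \<open>w = 0\<close> but may have a pole at the saddle \<open>w = 1\<close>.\<close>

definition bcoeff :: "real \<Rightarrow> real \<Rightarrow> (real \<Rightarrow> real) \<Rightarrow> real \<Rightarrow> real" where
  "bcoeff \<epsilon> K V w = 2 * w * (K - \<epsilon> * (1 - w\<^sup>2)) / V w"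

lemma bcoeff_bound:
  assumes "wbranch d \<epsilon> R K V" "0 < w" "w < 1"
  shows "\<bar>bcoeff \<epsilon> K V w\<bar> \<le> 2 * (\<bar>K\<bar> + \<bar>\<epsilon>\<bar>) / (d * (1 - w\<^sup>2))"
proof -
  note V = wbranchD[OF assms(1)]
  have U: "0 < 1 - w\<^sup>2" "1 - w\<^sup>2 \<le> 1" using one_minus_sq assms by auto
  have "\<bar>\<epsilon> * (1 - w\<^sup>2)\<bar> \<le> \<bar>\<epsilon>\<bar> * 1" unfolding abs_mult using U by (intro mult_left_mono) auto
  then have num: "\<bar>K - \<epsilon> * (1 - w\<^sup>2)\<bar> \<le> \<bar>K\<bar> + \<bar>\<epsilon>\<bar>" by linarith
  have "\<bar>bcoeff \<epsilon> K V w\<bar> = 2 * w * \<bar>K - \<epsilon> * (1 - w\<^sup>2)\<bar> / V w"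
    unfolding bcoeff_def using V(5)[OF assms(2,3)] assms by (simp add: abs_mult)
  also have "\<dots> \<le> 2 * w * (\<bar>K\<bar> + \<bar>\<epsilon>\<bar>) / (d * (w * (1 - w\<^sup>2)))"
    using num assms V U by (intro frac_le mult_left_mono mult_pos_pos) auto
  also have "\<dots> = 2 * (\<bar>K\<bar> + \<bar>\<epsilon>\<bar>) / (d * (1 - w\<^sup>2))" using assms by simp
  finally show ?thesis .
qed

lemma bcoeff_continuous:
  assumes "wbranch d \<epsilon> R K V"
  shows "continuous_on {0<..<1} (bcoeff \<epsilon> K V)"
  unfolding bcoeff_def using wbranchD(7,5)[OF assms]
  by (intro continuous_intros) (auto simp: less_imp_neq[symmetric])

text \<open>Variation of constants starting at the saddle \<open>w = 1\<close> gives the solution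
  that decays there, and its limit at the turning point is then determined by \<open>F\<close>. The
  sign of that limit for positive \<open>F\<close> is what makes the two end conditions of a loop
  independent. The constant is quantified before \<open>F\<close> and \<open>S\<close>, so it
  depends on the branch alone.\<close>

lemma branch_solve:
  assumes V: "wbranch d \<epsilon> R K V"
  shows "\<exists>C>0. \<forall>F S. continuous_on {0<..<1} F \<longrightarrow> 0 \<le> S \<longrightarrow> (\<forall>w\<in>{0<..<1}. \<bar>F w\<bar> \<le> S * (w * (1 - w\<^sup>2))) \<longrightarrow>
    (\<exists>e l. (e \<longlongrightarrow> l) (at_right 0) \<and> ((\<forall>w\<in>{0<..<1}. 0 < F w) \<longrightarrow> l < 0) \<and>
      (\<forall>w\<in>{0<..<1}. \<bar>e w\<bar> \<le> C * S * (1 - w\<^sup>2)\<^sup>2 \<and>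
         (e has_real_derivative bcoeff \<epsilon> K V w * e w + F w) (at w)))"
proof -
  define a where "a = bcoeff \<epsilon> K V"
  note VD = wbranchD[OF V]
  obtain A where A: "\<And>x. 0 < x \<Longrightarrow> x < 1 \<Longrightarrow> (A has_real_derivative a x) (at x)"
    using antiderivative_open_interval[OF bcoeff_continuous[OF V]] unfolding a_def
    by (metis greaterThanLessThan_iff)
  define \<mu> where "\<mu> = (\<lambda>w. exp (- A w))"
  have \<mu>_pos: "0 < \<mu> w" for w unfolding \<mu>_def by simp
  have \<mu>_der: "(\<mu> has_real_derivative - a w * \<mu> w) (at w)" if "0 < w" "w < 1" for w
    unfolding \<mu>_def using A[OF that] by (auto intro!: derivative_eq_intros)
  \<comment> \<open>Past \<open>w0\<close> one has \<open>1 - w^2 \<le> 2 * R\<close>, that is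
    \<open>u \<le> 2\<close>, and there the conservative term of \<open>V'\<close> is
    nonpositive.\<close>
  define w0 where "w0 = max (1/2) (sqrt (max 0 (1 - 2 * R)))"
  have w0: "1/2 \<le> w0" "w0 < 1" unfolding w0_def using VD(2) by (auto simp: max_def real_less_lsqrt)
  have w0U: "1 - w\<^sup>2 \<le> 2 * R" if "w0 \<le> w" for w
  proof -
    have "sqrt (max 0 (1 - 2 * R)) \<le> w" using that unfolding w0_def by simp
    then have "max 0 (1 - 2 * R) \<le> w\<^sup>2" by (rule sqrt_le_D)
    then show ?thesis by simp
  qed
  define a0 where "a0 = 2 * (\<bar>K\<bar> + \<bar>\<epsilon>\<bar>) / (d * (1 - w0\<^sup>2))"
  have U0: "0 < 1 - w0\<^sup>2" using w0 by (auto simp: abs_square_less_1)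
  have a0: "0 \<le> a0" unfolding a0_def using U0 VD(1) by auto
  have a_bound: "\<bar>a w\<bar> \<le> a0" if "0 < w" "w \<le> w0" for w
  proof -
    have "w\<^sup>2 \<le> w0\<^sup>2" using that w0 by (intro power_mono) auto
    then have "2 * (\<bar>K\<bar> + \<bar>\<epsilon>\<bar>) / (d * (1 - w\<^sup>2)) \<le> a0"
      unfolding a0_def using U0 VD(1) by (intro divide_left_mono mult_left_mono mult_pos_pos) auto
    then show ?thesis using bcoeff_bound[OF V, of w] that w0 unfolding a_def by auto
  qed
  have early: "\<mu> s \<le> exp a0 * \<mu> w" if "0 < w" "w \<le> s" "s \<le> w0" for w s
  proof -
    have "\<bar>A s - A w\<bar> \<le> a0 * (s - w)"
      using that w0 by (intro bounded_derivative_diff[of w s A a]) (auto intro!: A a_bound)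
    also have "\<dots> \<le> a0 * 1" using a0 that w0 by (intro mult_left_mono) auto
    finally have "- A s \<le> a0 + - A w" by linarith
    then show ?thesis unfolding \<mu>_def by (simp flip: exp_add)
  qed
  \<comment> \<open>\<open>V\<close> solves the homogeneous linear equation up to that nonpositive
    term, so \<open>\<mu> * V\<close> is nonincreasing. The singular part of the kernel is thus
    controlled by \<open>V\<close> itself, and no expansion at the saddle is required.\<close>
  have late: "\<mu> s * V s \<le> \<mu> w * V w" if "w0 \<le> w" "w \<le> s" "s < 1" for w s
  proof (rule DERIV_nonpos_imp_nonincreasing[OF \<open>w \<le> s\<close>])
    fix x assume x: "w \<le> x" "x \<le> s"
    then have xx: "0 < x" "x < 1" using that w0 by auto
    have Vx: "0 < V x" using VD(5)[OF xx] .
    define y where "y = - 2 * x * (1 - x\<^sup>2) * (2 * R\<^sup>2 - R * (1 - x\<^sup>2)) / V x"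
    have "0 \<le> R * (2 * R - (1 - x\<^sup>2))" using w0U[of x] x that VD(2) by simp
    then have "0 \<le> 2 * x * (1 - x\<^sup>2) * (2 * R\<^sup>2 - R * (1 - x\<^sup>2)) / V x"
      using xx one_minus_sq(1)[OF xx] Vx
      by (intro divide_nonneg_pos mult_nonneg_nonneg) (auto simp: algebra_simps power2_eq_square)
    then have "y \<le> 0" unfolding y_def by simp
    have "((\<lambda>x. \<mu> x * V x) has_real_derivative \<mu> x * y) (at x)"
    proof -
      have *: "(V has_real_derivative y + a x * V x) (at x)"
        using VD(6)[OF xx] Vx unfolding y_def a_def bcoeff_def by simp
      show ?thesis by (rule derivative_eq_intros \<mu>_der[OF xx] * refl)+ (simp add: algebra_simps)
    qed
    moreover have "\<mu> x * y \<le> 0" using \<open>y \<le> 0\<close> \<mu>_pos[of x] by (simp add: mult_le_0_iff)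
    ultimately show "\<exists>z. ((\<lambda>x. \<mu> x * V x) has_real_derivative z) (at x) \<and> z \<le> 0" by blast
  qed
  define c1 where "c1 = 1 / (d * d * w0)"
  have late': "\<mu> s * (1 - s\<^sup>2) \<le> c1 * (\<mu> w * (1 - w\<^sup>2))" if "w0 \<le> w" "w \<le> s" "s < 1" for w s
  proof -
    have sw: "0 < s" "0 < w" "w < 1" using that w0 by auto
    have "d * w0 * (\<mu> s * (1 - s\<^sup>2)) \<le> \<mu> s * (d * (s * (1 - s\<^sup>2)))"
      using that sw \<mu>_pos[of s] VD(1) one_minus_sq(1)[OF sw(1) that(3)] w0
      by (auto simp: mult_ac intro!: mult_left_mono)
    also have "\<dots> \<le> \<mu> s * V s" using VD(3)[OF sw(1) that(3)] \<mu>_pos[of s] by simp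
    also have "\<dots> \<le> \<mu> w * V w" using late that by blast
    also have "\<dots> \<le> \<mu> w * (w * (1 - w\<^sup>2) / d)" using VD(4)[OF sw(2,3)] \<mu>_pos[of w] by (intro mult_left_mono) auto
    also have "\<dots> \<le> \<mu> w * (1 * (1 - w\<^sup>2) / d)"
      using sw VD(1) \<mu>_pos[of w] one_minus_sq(1)[OF sw(2,3)]
      by (intro mult_left_mono divide_right_mono mult_right_mono) auto
    finally show ?thesis unfolding c1_def using VD(1) w0 by (simp add: field_simps)
  qed
  have c1: "0 < c1" unfolding c1_def using VD(1) w0 by auto
  define C where "C = c1 + exp a0 / (1 - w0\<^sup>2) + c1 * exp a0 / (1 - w0\<^sup>2)"
  have C: "c1 \<le> C" "exp a0 / (1 - w0\<^sup>2) \<le> C" "c1 * exp a0 / (1 - w0\<^sup>2) \<le> C"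
    unfolding C_def using c1 U0 by auto
  have Cpos: "0 < C" using c1 C by linarith
  \<comment> \<open>Pairs on both sides of \<open>w0\<close> are combined from the monotonicity past
    \<open>w0\<close> and from the range before it, where \<open>\<mu>\<close> varies by at most the
    factor \<open>exp a0\<close>.\<close>
  have kernel: "\<mu> s * (1 - s\<^sup>2) \<le> C * (\<mu> w * (1 - w\<^sup>2))" if ws: "0 < w" "w \<le> s" "s < 1" for w s
  proof -
    have sw: "0 < s" "w < 1" using that by auto
    have Us: "0 < 1 - s\<^sup>2" "1 - s\<^sup>2 \<le> 1" "0 < 1 - w\<^sup>2" using one_minus_sq ws sw by auto
    have mp: "0 \<le> \<mu> w * (1 - w\<^sup>2)" using \<mu>_pos[of w] Us by simp
    consider "w0 \<le> w" | "w < w0" "s \<le> w0" | "w < w0" "w0 < s" by linarith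
    then show ?thesis
    proof cases
      case 1
      then have "\<mu> s * (1 - s\<^sup>2) \<le> c1 * (\<mu> w * (1 - w\<^sup>2))" using late' that by blast
      also have "\<dots> \<le> C * (\<mu> w * (1 - w\<^sup>2))" using C mp by (intro mult_right_mono) auto
      finally show ?thesis .
    next
      case 2
      have "w\<^sup>2 \<le> w0\<^sup>2" using 2 ws by (intro power_mono) auto
      have "\<mu> s * (1 - s\<^sup>2) \<le> \<mu> s * 1" using Us \<mu>_pos[of s] by (intro mult_left_mono) auto
      also have "\<dots> \<le> exp a0 * \<mu> w" using early ws 2 by simp
      also have "\<dots> = exp a0 / (1 - w0\<^sup>2) * (\<mu> w * (1 - w0\<^sup>2))" using U0 by simp
      also have "\<dots> \<le> exp a0 / (1 - w0\<^sup>2) * (\<mu> w * (1 - w\<^sup>2))"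
        using \<mu>_pos[of w] U0 \<open>w\<^sup>2 \<le> w0\<^sup>2\<close> by (intro mult_left_mono) auto
      also have "\<dots> \<le> C * (\<mu> w * (1 - w\<^sup>2))" using C mp by (intro mult_right_mono) auto
      finally show ?thesis .
    next
      case 3
      have "w\<^sup>2 \<le> w0\<^sup>2" using 3 ws by (intro power_mono) auto
      have "\<mu> s * (1 - s\<^sup>2) \<le> c1 * (\<mu> w0 * (1 - w0\<^sup>2))" using late'[of w0 s] 3 ws by simp
      also have "\<dots> \<le> c1 * (\<mu> w0 * 1)" using U0 \<mu>_pos[of w0] c1 by (intro mult_left_mono) auto
      also have "\<dots> \<le> c1 * (exp a0 * \<mu> w)" using early[of w w0] ws 3 c1 by simp
      also have "\<dots> = c1 * exp a0 / (1 - w0\<^sup>2) * (\<mu> w * (1 - w0\<^sup>2))" using U0 by simp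
      also have "\<dots> \<le> c1 * exp a0 / (1 - w0\<^sup>2) * (\<mu> w * (1 - w\<^sup>2))"
        using \<mu>_pos[of w] U0 \<open>w\<^sup>2 \<le> w0\<^sup>2\<close> c1 by (intro mult_left_mono) auto
      also have "\<dots> \<le> C * (\<mu> w * (1 - w\<^sup>2))" using C mp by (intro mult_right_mono) auto
      finally show ?thesis .
    qed
  qed
  have main: "\<exists>e l. (e \<longlongrightarrow> l) (at_right 0) \<and> ((\<forall>w\<in>{0<..<1}. 0 < F w) \<longrightarrow> l < 0) \<and>
      (\<forall>w\<in>{0<..<1}. \<bar>e w\<bar> \<le> C * S * (1 - w\<^sup>2)\<^sup>2 \<and> (e has_real_derivative a w * e w + F w) (at w))"
    if F: "continuous_on {0<..<1} F" "0 \<le> S" "\<And>w. 0 < w \<Longrightarrow> w < 1 \<Longrightarrow> \<bar>F w\<bar> \<le> S * (w * (1 - w\<^sup>2))" for F S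
  proof -
    have "continuous_on {0<..<1} \<mu>"
      using \<mu>_der by (intro continuous_at_imp_continuous_on ballI) (meson DERIV_isCont greaterThanLessThan_iff)
    then obtain \<Phi> where \<Phi>: "\<And>x. 0 < x \<Longrightarrow> x < 1 \<Longrightarrow> (\<Phi> has_real_derivative \<mu> x * F x) (at x)"
      using antiderivative_open_interval[of "\<lambda>x. \<mu> x * F x"] F(1) continuous_on_mult
      by (metis greaterThanLessThan_iff)
    have bd: "\<bar>\<mu> s * F s\<bar> \<le> C * S * (\<mu> w * (1 - w\<^sup>2))" if "0 < w" "w \<le> s" "s < 1" for w s
    proof -
      have s: "0 < s" using that by simp
      have "\<bar>\<mu> s * F s\<bar> \<le> \<mu> s * (S * (s * (1 - s\<^sup>2)))"
        unfolding abs_mult using F(3)[OF s that(3)] \<mu>_pos[of s] by simp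
      also have "\<dots> \<le> \<mu> s * (S * (1 * (1 - s\<^sup>2)))"
        using \<mu>_pos[of s] F(2) that one_minus_sq(1)[OF s that(3)]
        by (intro mult_left_mono mult_right_mono) auto
      also have "\<dots> = S * (\<mu> s * (1 - s\<^sup>2))" by simp
      also have "\<dots> \<le> S * (C * (\<mu> w * (1 - w\<^sup>2)))" using kernel[OF that] F(2) by (intro mult_left_mono)
      finally show ?thesis by (simp add: mult_ac)
    qed
    have "\<exists>l. (\<Phi> \<longlongrightarrow> l) (at_left 1)"
      by (rule bounded_derivative_limits(2)[of "1/2" 1 \<Phi> "\<lambda>x. \<mu> x * F x" "C * S * (\<mu> (1/2) * (1 - (1/2)\<^sup>2))"])
        (auto intro!: \<Phi> bd)
    then obtain L where L: "(\<Phi> \<longlongrightarrow> L) (at_left 1)" by auto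
    \<comment> \<open>Subtracting the limit \<open>L\<close> of \<open>\<Phi>\<close> at
      \<open>w = 1\<close> selects the solution that decays at the saddle.\<close>
    define e where "e = (\<lambda>w. (\<Phi> w - L) / \<mu> w)"
    have e_der: "(e has_real_derivative a w * e w + F w) (at w)" if "0 < w" "w < 1" for w
      unfolding e_def
      by (rule derivative_eq_intros \<Phi>[OF that] \<mu>_der[OF that] refl)+
        (use \<mu>_pos[of w] in \<open>auto simp: field_simps\<close>)
    have e_bd: "\<bar>e w\<bar> \<le> C * S * (1 - w\<^sup>2)\<^sup>2" if w: "0 < w" "w < 1" for w
    proof -
      have "eventually (\<lambda>s. \<bar>\<Phi> s - \<Phi> w\<bar> \<le> C * S * (\<mu> w * (1 - w\<^sup>2)) * (1 - w\<^sup>2)) (at_left 1)"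
      proof (rule eventually_at_leftI[of w])
        fix s assume s: "s \<in> {w<..<1}"
        have "\<bar>\<Phi> s - \<Phi> w\<bar> \<le> C * S * (\<mu> w * (1 - w\<^sup>2)) * (s - w)"
          by (rule bounded_derivative_diff[of w s \<Phi> "\<lambda>x. \<mu> x * F x"]) (use s w bd \<Phi> in auto)
        also have "\<dots> \<le> C * S * (\<mu> w * (1 - w\<^sup>2)) * (1 - w\<^sup>2)"
          using s one_minus_sq[OF w] Cpos F(2) \<mu>_pos[of w] by (intro mult_left_mono mult_nonneg_nonneg) auto
        finally show "\<bar>\<Phi> s - \<Phi> w\<bar> \<le> C * S * (\<mu> w * (1 - w\<^sup>2)) * (1 - w\<^sup>2)" .
      qed (use w in auto)
      moreover have "((\<lambda>s. \<bar>\<Phi> s - \<Phi> w\<bar>) \<longlongrightarrow> \<bar>L - \<Phi> w\<bar>) (at_left 1)" by (intro tendsto_intros L)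
      ultimately have "\<bar>L - \<Phi> w\<bar> \<le> C * S * (\<mu> w * (1 - w\<^sup>2)) * (1 - w\<^sup>2)"
        using tendsto_upperbound trivial_limit_at_left_real by blast
      then show ?thesis unfolding e_def using \<mu>_pos[of w]
        by (simp add: abs_divide divide_le_eq abs_minus_commute power2_eq_square mult_ac)
    qed
    have "\<exists>l. (e \<longlongrightarrow> l) (at_right 0)"
    proof (rule bounded_derivative_limits(1)[of 0 "1/2" e "\<lambda>w. a w * e w + F w" "a0 * (C * S) + S"])
      fix x :: real assume x: "0 < x" "x < 1 / 2"
      then have x1: "x < 1" by simp
      show "(e has_real_derivative a x * e x + F x) (at x)" using e_der x by auto
      have "\<bar>a x\<bar> \<le> a0" using a_bound[of x] x w0 by auto
      moreover have "\<bar>e x\<bar> \<le> C * S * 1"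
      proof -
        have "(1 - x\<^sup>2)\<^sup>2 \<le> 1" using one_minus_sq[OF x(1) x1] by (simp add: power_le_one)
        then have "C * S * (1 - x\<^sup>2)\<^sup>2 \<le> C * S * 1" using Cpos F(2) by (intro mult_left_mono) auto
        then show ?thesis using e_bd[OF x(1) x1] by linarith
      qed
      ultimately have "\<bar>a x * e x\<bar> \<le> a0 * (C * S)" unfolding abs_mult using a0 by (intro mult_mono) auto
      moreover have "\<bar>F x\<bar> \<le> S"
      proof -
        have "x * (1 - x\<^sup>2) \<le> 1 * 1" using x one_minus_sq[OF x(1) x1] by (intro mult_mono) auto
        then have "S * (x * (1 - x\<^sup>2)) \<le> S * 1" using F(2) by (intro mult_left_mono) auto
        then show ?thesis using F(3)[OF x(1) x1] by simp
      qed
      ultimately show "\<bar>a x * e x + F x\<bar> \<le> a0 * (C * S) + S" by linarith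
    qed auto
    then obtain l where l: "(e \<longlongrightarrow> l) (at_right 0)" by auto
    \<comment> \<open>For positive \<open>F\<close> the function \<open>\<Phi>\<close> increases
      strictly to \<open>L\<close>, so \<open>e\<close> is negative; strictness survives the limit
      because \<open>\<mu>\<close> is bounded near 0.\<close>
    have "l < 0" if pos: "\<And>w. 0 < w \<Longrightarrow> w < 1 \<Longrightarrow> 0 < F w"
    proof -
      have inc: "\<Phi> x < \<Phi> y" if "0 < x" "x < y" "y < 1" for x y
      proof (rule DERIV_pos_imp_increasing[OF \<open>x < y\<close>])
        fix t assume "x \<le> t" "t \<le> y"
        then have "0 < t" "t < 1" using that by auto
        then show "\<exists>z. (\<Phi> has_real_derivative z) (at t) \<and> 0 < z"
          by (intro exI[of _ "\<mu> t * F t"] conjI \<Phi> mult_pos_pos \<mu>_pos pos)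
      qed
      have "\<Phi> (3/4) \<le> L"
      proof (rule tendsto_lowerbound[OF L])
        show "eventually (\<lambda>i. \<Phi> (3/4) \<le> \<Phi> i) (at_left 1)"
          by (rule eventually_at_leftI[of "3/4"]) (use inc in \<open>auto intro: less_imp_le\<close>)
      qed auto
      then have neg: "\<Phi> (1/2) - L < 0" using inc[of "1/2" "3/4"] by simp
      have "eventually (\<lambda>w. e w \<le> (\<Phi> (1/2) - L) / (exp a0 * \<mu> (1/2))) (at_right 0)"
      proof (rule eventually_at_rightI[of 0 "1/2"])
        fix w :: real assume w: "w \<in> {0<..<1/2}"
        have "\<bar>A (1/2) - A w\<bar> \<le> a0 * (1/2 - w)"
          using w w0 by (intro bounded_derivative_diff[of w "1/2" A a]) (auto intro!: A a_bound)
        also have "\<dots> \<le> a0 * 1" using a0 w by (intro mult_left_mono) auto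
        finally have "- A w \<le> a0 + - A (1/2)" by linarith
        then have mw: "\<mu> w \<le> exp a0 * \<mu> (1/2)" unfolding \<mu>_def by (simp flip: exp_add)
        have "\<Phi> w - L \<le> \<Phi> (1/2) - L" using inc[of w "1/2"] w by simp
        then have "e w \<le> (\<Phi> (1/2) - L) / \<mu> w" unfolding e_def using \<mu>_pos[of w] by (simp add: divide_right_mono)
        also have "\<dots> \<le> (\<Phi> (1/2) - L) / (exp a0 * \<mu> (1/2))"
          using mw neg \<mu>_pos[of w] by (intro divide_left_mono_neg) auto
        finally show "e w \<le> (\<Phi> (1/2) - L) / (exp a0 * \<mu> (1/2))" .
      qed auto
      then have "l \<le> (\<Phi> (1/2) - L) / (exp a0 * \<mu> (1/2))"
        using l tendsto_upperbound trivial_limit_at_right_real by blast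
      also have "\<dots> < 0" using neg \<mu>_pos[of "1/2"] by (intro divide_neg_pos) auto
      finally show ?thesis .
    qed
    then show ?thesis using l e_bd e_der by (intro exI[of _ e] exI[of _ l]) auto
  qed
  show ?thesis by (intro exI[of _ C] conjI allI impI Cpos, unfold a_def[symmetric], rule main) auto
qed

lemma wbranch_tendsto_0:
  assumes "wbranch d \<epsilon> R K V"
  shows "(V \<longlongrightarrow> 0) (at_right 0)"
proof (rule tendsto_sandwich[where f = "\<lambda>_. 0" and h = "\<lambda>w. w * (1 - w\<^sup>2) / d"])
  note VD = wbranchD[OF assms]
  show "eventually (\<lambda>w. 0 \<le> V w) (at_right 0)" "eventually (\<lambda>w. V w \<le> w * (1 - w\<^sup>2) / d) (at_right 0)"
    using VD(4,5) by (auto intro!: eventually_at_rightI[of 0 1] simp: less_imp_le)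
  have "((\<lambda>w. w * (1 - w\<^sup>2) / d) \<longlongrightarrow> 0 * (1 - 0\<^sup>2) / d) (at_right 0)"
    using VD(1) by (intro tendsto_intros) auto
  then show "((\<lambda>w. w * (1 - w\<^sup>2) / d) \<longlongrightarrow> 0) (at_right 0)" by simp
qed auto

lemma bounded_derivative_from_0:
  fixes f :: "real \<Rightarrow> real"
  assumes lim: "(f \<longlongrightarrow> 0) (at_right 0)" and "0 < w"
    and der: "\<And>t. 0 < t \<Longrightarrow> t \<le> w \<Longrightarrow> (f has_real_derivative f' t) (at t)"
    and bd: "\<And>t. 0 < t \<Longrightarrow> t \<le> w \<Longrightarrow> \<bar>f' t\<bar> \<le> M"
  shows "\<bar>f w\<bar> \<le> M * w"
proof -
  have "eventually (\<lambda>x. \<bar>f w - f x\<bar> \<le> M * (w - x)) (at_right 0)"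
    using \<open>0 < w\<close> by (intro eventually_at_rightI[of 0 w] bounded_derivative_diff[where f' = f'] der bd) auto
  moreover have "((\<lambda>x. \<bar>f w - f x\<bar>) \<longlongrightarrow> \<bar>f w - 0\<bar>) (at_right 0)" by (intro tendsto_intros lim)
  moreover have "((\<lambda>x. M * (w - x)) \<longlongrightarrow> M * (w - 0)) (at_right 0)" by (intro tendsto_intros)
  ultimately have "\<bar>f w - 0\<bar> \<le> M * (w - 0)" using tendsto_le trivial_limit_at_right_real by blast
  then show ?thesis by simp
qed

lemma damping_bound:
  fixes w :: real
  assumes "0 < w" "w < 1"
  shows "\<bar>K - \<epsilon> * (1 - w\<^sup>2)\<bar> \<le> \<bar>K\<bar> + \<bar>\<epsilon>\<bar>"
proof -
  have "\<bar>\<epsilon> * (1 - w\<^sup>2)\<bar> \<le> \<bar>\<epsilon>\<bar> * 1" unfolding abs_mult using one_minus_sq[OF assms] by (intro mult_left_mono) auto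
  then show ?thesis by linarith
qed

text \<open>In unscaled terms the loop reaches beyond the second equilibrium \<open>u = 2\<close>.
  Otherwise the conservative term of \<open>V'\<close> would be nonpositive throughout, and
  \<open>V\<close> would be at most quadratic in \<open>w\<close> at the turning point, contrary to
  the lower bound by \<open>d * (w * (1 - w^2))\<close>.\<close>

lemma wbranch_R_less:
  assumes V: "wbranch d \<epsilon> R K V"
  shows "R < 1 / 2"
proof (rule ccontr)
  assume "\<not> R < 1 / 2"
  note VD = wbranchD[OF V]
  define c where "c = \<bar>K\<bar> + \<bar>\<epsilon>\<bar> + 1"
  have c: "1 \<le> c" unfolding c_def by simp
  have Vle: "V w \<le> 2 * c * w\<^sup>2" if w: "0 < w" "w < 1" for w
  proof -
    define g where "g = (\<lambda>t. V t - c * t\<^sup>2)"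
    have "g w \<le> g x" if x: "0 < x" "x \<le> w" for x
    proof (rule DERIV_nonpos_imp_nonincreasing[OF \<open>x \<le> w\<close>])
      fix t assume "x \<le> t" "t \<le> w"
      then have t: "0 < t" "t < 1" using x w by auto
      define y where "y = - 2 * t * (1 - t\<^sup>2) * (2 * R\<^sup>2 - R * (1 - t\<^sup>2)) / V t + 2 * t * (K - \<epsilon> * (1 - t\<^sup>2)) - c * (2 * t)"
      have "(g has_real_derivative y) (at t)"
        unfolding g_def y_def by (rule derivative_eq_intros VD(6)[OF t] refl)+ simp
      moreover have "0 \<le> 2 * t * (1 - t\<^sup>2) * (2 * R\<^sup>2 - R * (1 - t\<^sup>2)) / V t"
      proof -
        have "0 \<le> R * (2 * R - (1 - t\<^sup>2))" using \<open>\<not> R < 1/2\<close> one_minus_sq[OF t]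
          by (intro mult_nonneg_nonneg) linarith+
        then have "0 \<le> 2 * R\<^sup>2 - R * (1 - t\<^sup>2)" by (simp add: algebra_simps power2_eq_square)
        then show ?thesis using t VD(5)[OF t] one_minus_sq[OF t]
          by (intro divide_nonneg_pos mult_nonneg_nonneg) auto
      qed
      moreover have "2 * t * (K - \<epsilon> * (1 - t\<^sup>2)) \<le> 2 * t * c"
        using damping_bound[OF t, of K \<epsilon>] t unfolding c_def by (intro mult_left_mono) auto
      ultimately show "\<exists>z. (g has_real_derivative z) (at t) \<and> z \<le> 0"
        unfolding y_def by (intro exI conjI) (assumption, simp add: mult_ac)
    qed
    then have "eventually (\<lambda>x. g w \<le> g x) (at_right 0)" using w by (intro eventually_at_rightI[of 0 w]) auto
    moreover have "(g \<longlongrightarrow> 0 - c * 0\<^sup>2) (at_right 0)" unfolding g_def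
      by (intro tendsto_intros wbranch_tendsto_0[OF V])
    ultimately have "g w \<le> 0 - c * 0\<^sup>2" using tendsto_lowerbound trivial_limit_at_right_real by blast
    then have "V w \<le> c * w\<^sup>2" unfolding g_def by simp
    also have "\<dots> \<le> 2 * c * w\<^sup>2" using c by simp
    finally show ?thesis .
  qed
  define w where "w = min (1/2) (d / (4 * c))"
  have w: "0 < w" "w \<le> 1/2" "w \<le> d / (4 * c)" using VD(1) c unfolding w_def by auto
  have "w\<^sup>2 \<le> (1/2)\<^sup>2" using w by (intro power_mono) auto
  then have U: "3/4 \<le> 1 - w\<^sup>2" by (simp add: power2_eq_square)
  have "d * (w * (3/4)) \<le> d * (w * (1 - w\<^sup>2))" using VD(1) w U by (intro mult_left_mono) auto
  also have "\<dots> \<le> V w" using VD(3) w by simp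
  also have "\<dots> \<le> 2 * c * w\<^sup>2" using Vle w by simp
  also have "\<dots> = w * (2 * c * w)" by (simp add: power2_eq_square)
  also have "\<dots> \<le> w * (d / 2)" using w c by (intro mult_left_mono) (auto simp: field_simps)
  finally have "d * w * (3 / 4) \<le> d * w * (1/2)" by simp
  then show False using VD(1) w by simp
qed

text \<open>A solution that also vanishes at the turning point gains a factor \<open>w^2\<close>:
  integrating once from 0 gives order \<open>w\<close>, and since the forcing is of order
  \<open>w\<close> too, integrating again gives order \<open>w^2\<close>. Hence \<open>e / V\<close>
  has the same weight as \<open>V\<close>, which is what the recursion for the power series needs.
  The constant does not depend on \<open>e\<close>, \<open>F\<close> or \<open>M\<close>.\<close>

lemma vanishing_bound:
  assumes V: "wbranch d \<epsilon> R K V"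
  obtains C where "0 < C" "\<And>e F M. (e \<longlongrightarrow> 0) (at_right 0) \<Longrightarrow> 0 \<le> M \<Longrightarrow>
      (\<forall>w\<in>{0<..<1}. \<bar>e w\<bar> \<le> M * (1 - w\<^sup>2)\<^sup>2 \<and> \<bar>F w\<bar> \<le> M * (w * (1 - w\<^sup>2)) \<and>
        (e has_real_derivative bcoeff \<epsilon> K V w * e w + F w) (at w)) \<Longrightarrow>
      (\<forall>w\<in>{0<..<1}. \<bar>e w\<bar> \<le> C * M * (w * (1 - w\<^sup>2))\<^sup>2)"
proof -
  note VD = wbranchD[OF V]
  define a0 where "a0 = 2 * (\<bar>K\<bar> + \<bar>\<epsilon>\<bar>) / (d * (3/4))"
  have a0: "0 \<le> a0" unfolding a0_def using VD(1) by auto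
  have U34: "3/4 \<le> 1 - w\<^sup>2" if "0 < w" "w \<le> 1/2" for w :: real
  proof -
    have "w\<^sup>2 \<le> (1/2)\<^sup>2" using that by (intro power_mono) auto
    then show ?thesis by (simp add: power2_eq_square)
  qed
  have a: "\<bar>bcoeff \<epsilon> K V w\<bar> \<le> a0" if "0 < w" "w \<le> 1/2" for w
  proof -
    have "2 * (\<bar>K\<bar> + \<bar>\<epsilon>\<bar>) / (d * (1 - w\<^sup>2)) \<le> a0"
      unfolding a0_def using U34[OF that] VD(1) by (intro divide_left_mono mult_left_mono mult_pos_pos) auto
    then show ?thesis using bcoeff_bound[OF V, of w] that by auto
  qed
  define C where "C = 2 * (a0 * (a0 + 1) + 1) + 4"
  have "0 \<le> a0 * (a0 + 1)" using a0 by simp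
  then have C: "0 < C" "2 * (a0 * (a0 + 1) + 1) \<le> C" "4 \<le> C"
    unfolding C_def by (simp_all add: add_nonneg_pos)
  show thesis
  proof (rule that[OF C(1)], rule ballI)
    fix e F :: "real \<Rightarrow> real" and M w assume e0: "(e \<longlongrightarrow> 0) (at_right 0)" and M: "0 \<le> M" and w: "w \<in> {0<..<1::real}"
      and e: "\<forall>w\<in>{0<..<1}. \<bar>e w\<bar> \<le> M * (1 - w\<^sup>2)\<^sup>2 \<and> \<bar>F w\<bar> \<le> M * (w * (1 - w\<^sup>2)) \<and>
        (e has_real_derivative bcoeff \<epsilon> K V w * e w + F w) (at w)"
    have F_le: "\<bar>F t\<bar> \<le> M * t" if "0 < t" "t \<le> 1/2" for t
    proof -
      have "M * (t * (1 - t\<^sup>2)) \<le> M * (t * 1)" using that M by (intro mult_left_mono) auto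
      then show ?thesis using e[rule_format, of t] that by auto
    qed
    have e_le: "\<bar>e t\<bar> \<le> M" if "0 < t" "t \<le> 1/2" for t
    proof -
      have "(1 - t\<^sup>2)\<^sup>2 \<le> 1" using one_minus_sq[of t] that by (intro power_le_one) auto
      then have "M * (1 - t\<^sup>2)\<^sup>2 \<le> M * 1" using M by (intro mult_left_mono) auto
      then show ?thesis using e[rule_format, of t] that by auto
    qed
    have e1: "\<bar>e t\<bar> \<le> ((a0 + 1) * M) * t" if t: "0 < t" "t \<le> 1/2" for t
    proof (rule bounded_derivative_from_0[OF e0 t(1)])
      fix s assume "0 < s" "s \<le> t"
      then have s: "0 < s" "s \<le> 1/2" using t by auto
      show "(e has_real_derivative bcoeff \<epsilon> K V s * e s + F s) (at s)" using e s by auto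
      have "\<bar>bcoeff \<epsilon> K V s * e s\<bar> \<le> a0 * M" unfolding abs_mult using a[OF s] e_le[OF s] a0 by (intro mult_mono) auto
      moreover have "\<bar>F s\<bar> \<le> M" using F_le[OF s] mult_left_mono[of s 1 M] M s by auto
      ultimately show "\<bar>bcoeff \<epsilon> K V s * e s + F s\<bar> \<le> (a0 + 1) * M" by (simp add: algebra_simps)
    qed
    show "\<bar>e w\<bar> \<le> C * M * (w * (1 - w\<^sup>2))\<^sup>2"
    proof (cases "w \<le> 1/2")
      case True
      then have w: "0 < w" "w \<le> 1/2" using w by auto
      have "\<bar>e w\<bar> \<le> ((a0 * (a0 + 1) + 1) * M * w) * w"
      proof (rule bounded_derivative_from_0[OF e0 w(1)])
        fix s assume sw: "0 < s" "s \<le> w"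
        then have s: "0 < s" "s \<le> 1/2" using w by auto
        show "(e has_real_derivative bcoeff \<epsilon> K V s * e s + F s) (at s)" using e s by auto
        have sM: "((a0 + 1) * M) * s \<le> ((a0 + 1) * M) * w" "M * s \<le> M * w" using sw a0 M by (auto intro!: mult_left_mono)
        have "\<bar>bcoeff \<epsilon> K V s * e s\<bar> \<le> a0 * (((a0 + 1) * M) * w)"
          unfolding abs_mult using a[OF s] order_trans[OF e1[OF s] sM(1)] a0 by (intro mult_mono) auto
        moreover have "\<bar>F s\<bar> \<le> M * w" using F_le[OF s] sM by auto
        ultimately show "\<bar>bcoeff \<epsilon> K V s * e s + F s\<bar> \<le> (a0 * (a0 + 1) + 1) * M * w" by (simp add: algebra_simps)
      qed
      also have "\<dots> = (a0 * (a0 + 1) + 1) * M * (w\<^sup>2 * 1)" by (simp add: power2_eq_square)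
      also have "\<dots> \<le> (a0 * (a0 + 1) + 1) * M * (w\<^sup>2 * (2 * (1 - w\<^sup>2)\<^sup>2))"
      proof -
        have "(3/4)\<^sup>2 \<le> (1 - w\<^sup>2)\<^sup>2" using U34[OF w] by (intro power_mono) auto
        then have "1 \<le> 2 * (1 - w\<^sup>2)\<^sup>2" by (simp add: power2_eq_square)
        then show ?thesis using a0 M by (intro mult_left_mono mult_nonneg_nonneg) auto
      qed
      also have "\<dots> = (2 * (a0 * (a0 + 1) + 1)) * (M * (w * (1 - w\<^sup>2))\<^sup>2)" by (simp add: power_mult_distrib)
      also have "\<dots> \<le> C * (M * (w * (1 - w\<^sup>2))\<^sup>2)" using C M by (intro mult_right_mono) auto
      finally show ?thesis by (simp add: mult.assoc)
    next
      case False
      then have "(1/2)\<^sup>2 \<le> w\<^sup>2" by (intro power_mono) auto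
      then have "1 \<le> 4 * w\<^sup>2" by (simp add: power2_eq_square)
      then have "1 * (M * (1 - w\<^sup>2)\<^sup>2) \<le> (4 * w\<^sup>2) * (M * (1 - w\<^sup>2)\<^sup>2)" using M by (intro mult_right_mono) auto
      also have "\<dots> = 4 * (M * (w * (1 - w\<^sup>2))\<^sup>2)" by (simp add: power_mult_distrib)
      also have "\<dots> \<le> C * (M * (w * (1 - w\<^sup>2))\<^sup>2)" using C M by (intro mult_right_mono) auto
      finally show ?thesis using e w by (force simp: mult.assoc)
    qed
  qed
qed

text \<open>The variation of the loop under a change of \<open>R\<close> that keeps the orbit fixed in the unscaled
  coordinates. It solves the linearised equation, but does not vanish at the turning point \<open>w = 0\<close>.\<close>
lemma rescaling_variation:
  assumes V: "wbranch d \<epsilon> R K V"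
  defines "e \<equiv> \<lambda>w. 2 * (V w)\<^sup>2 - (1 - w\<^sup>2)\<^sup>2 * (2 * R\<^sup>2 - R * (1 - w\<^sup>2)) + (1 - w\<^sup>2) * (K - \<epsilon> * (1 - w\<^sup>2)) * V w"
  shows "(e \<longlongrightarrow> R - 2 * R\<^sup>2) (at_right 0)"
    "\<exists>C>0. \<forall>w\<in>{0<..<1}. \<bar>e w\<bar> \<le> C * (1 - w\<^sup>2)\<^sup>2"
    "\<And>w. 0 < w \<Longrightarrow> w < 1 \<Longrightarrow> (e has_real_derivative
        bcoeff \<epsilon> K V w * e w + (R * (- 2 * w * (1 - w\<^sup>2) * (4 * R - (1 - w\<^sup>2))) + K * (2 * w * V w))) (at w)"
proof -
  note VD = wbranchD[OF V]
  have "(e \<longlongrightarrow> 2 * 0\<^sup>2 - (1 - 0\<^sup>2)\<^sup>2 * (2 * R\<^sup>2 - R * (1 - 0\<^sup>2)) + (1 - 0\<^sup>2) * (K - \<epsilon> * (1 - 0\<^sup>2)) * 0) (at_right 0)"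
    unfolding e_def by (intro tendsto_intros wbranch_tendsto_0[OF V])
  then show "(e \<longlongrightarrow> R - 2 * R\<^sup>2) (at_right 0)" by simp
  define C where "C = 2 / d\<^sup>2 + (2 * R\<^sup>2 + R) + (\<bar>K\<bar> + \<bar>\<epsilon>\<bar>) / d"
  have "0 < C" unfolding C_def using VD(1,2) by (intro add_pos_nonneg) auto
  moreover have "\<bar>e w\<bar> \<le> C * (1 - w\<^sup>2)\<^sup>2" if w: "0 < w" "w < 1" for w
  proof -
    define U where "U = 1 - w\<^sup>2"
    have U: "0 < U" "U \<le> 1" using one_minus_sq[OF w] unfolding U_def by auto
    have Vw: "0 < V w" "V w \<le> U / d"
    proof -
      show "0 < V w" using VD(5)[OF w] .
      have "w * U / d \<le> 1 * U / d" using w U VD(1) by (intro divide_right_mono mult_right_mono) auto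
      then show "V w \<le> U / d" using VD(4)[OF w] unfolding U_def by simp
    qed
    have 1: "2 * (V w)\<^sup>2 \<le> 2 / d\<^sup>2 * U\<^sup>2"
      using power_mono[OF Vw(2), of 2] Vw by (simp add: power_divide)
    have "\<bar>2 * R\<^sup>2 - R * U\<bar> \<le> 2 * R\<^sup>2 + R"
    proof -
      have "0 \<le> R * U" "R * U \<le> R * 1" using U VD(2) by (auto intro!: mult_left_mono)
      then show ?thesis using VD(2) zero_le_power2[of R] by linarith
    qed
    then have 2: "\<bar>U\<^sup>2 * (2 * R\<^sup>2 - R * U)\<bar> \<le> (2 * R\<^sup>2 + R) * U\<^sup>2"
      unfolding abs_mult by (simp add: mult.commute mult_left_mono)
    have 3: "\<bar>U * (K - \<epsilon> * U) * V w\<bar> \<le> (\<bar>K\<bar> + \<bar>\<epsilon>\<bar>) / d * U\<^sup>2"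
    proof -
      have "\<bar>U * (K - \<epsilon> * U) * V w\<bar> = U * \<bar>K - \<epsilon> * U\<bar> * V w" using U Vw by (simp add: abs_mult)
      also have "\<dots> \<le> U * (\<bar>K\<bar> + \<bar>\<epsilon>\<bar>) * (U / d)" using U Vw damping_bound[OF w, of K \<epsilon>] unfolding U_def
        by (intro mult_mono mult_left_mono) auto
      finally show ?thesis by (simp add: power2_eq_square mult_ac)
    qed
    have "\<bar>e w\<bar> \<le> 2 * (V w)\<^sup>2 + \<bar>U\<^sup>2 * (2 * R\<^sup>2 - R * U)\<bar> + \<bar>U * (K - \<epsilon> * U) * V w\<bar>"
      unfolding e_def U_def[symmetric] by (smt (verit) zero_le_power2)
    then show ?thesis using 1 2 3 unfolding C_def U_def[symmetric] by (simp add: algebra_simps)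
  qed
  ultimately show "\<exists>C>0. \<forall>w\<in>{0<..<1}. \<bar>e w\<bar> \<le> C * (1 - w\<^sup>2)\<^sup>2" by auto
  fix w :: real assume w: "0 < w" "w < 1"
  define D where "D = - 2 * w * (1 - w\<^sup>2) * (2 * R\<^sup>2 - R * (1 - w\<^sup>2)) / V w + 2 * w * (K - \<epsilon> * (1 - w\<^sup>2))"
  have Dd: "(V has_real_derivative D) (at w)" using VD(6)[OF w] unfolding D_def .
  define c where "c = K - \<epsilon> * (1 - w\<^sup>2)"
  have Vn: "V w \<noteq> 0" using VD(5)[OF w] by simp
  have VDD: "V w * D = - 2 * w * (1 - w\<^sup>2) * (2 * R\<^sup>2 - R * (1 - w\<^sup>2)) + 2 * w * c * V w"
    unfolding D_def c_def using Vn by (simp add: field_simps)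
  have ae: "bcoeff \<epsilon> K V w * e w = 4 * w * c * V w + c * (1 - w\<^sup>2) * D"
    unfolding bcoeff_def e_def D_def c_def[symmetric] using Vn by (simp add: field_simps power2_eq_square)
  have "(e has_real_derivative 4 * (V w * D) + 4 * w * (1 - w\<^sup>2) * (2 * R\<^sup>2 - R * (1 - w\<^sup>2)) - 2 * R * w * (1 - w\<^sup>2)\<^sup>2
     - 2 * w * c * V w + (1 - w\<^sup>2) * (2 * w * \<epsilon>) * V w + (1 - w\<^sup>2) * c * D) (at w)"
    unfolding e_def
    by (rule derivative_eq_intros Dd refl)+ (simp add: c_def algebra_simps power2_eq_square)
  then show "(e has_real_derivative
        bcoeff \<epsilon> K V w * e w + (R * (- 2 * w * (1 - w\<^sup>2) * (4 * R - (1 - w\<^sup>2))) + K * (2 * w * V w))) (at w)"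
    unfolding ae VDD by (rule DERIV_cong) (simp add: c_def algebra_simps power2_eq_square)
qed
text \<open>On each half the response to the given forcing, the response to the damping force
  \<open>2 * w * V\<close> and the rescaling variation are combined so that their values at the
  turning point cancel. The damping responses have negative end values \<open>lV\<close> and
  \<open>lW\<close> but enter with opposite signs; the rescaling contributes the same
  \<open>c > 0\<close> to both halves. The determinant of the resulting linear system for
  \<open>\<alpha>\<close> and \<open>\<beta>\<close> is \<open>- c * (lV + lW)\<close>, which is
  positive.\<close>

lemma loop_solve:
  assumes V: "wbranch d \<epsilon> R K V" and W: "wbranch d (-\<epsilon>) R (-K) W"
  obtains C where "0 < C" "\<And>F G S. continuous_on {0<..<1} F \<Longrightarrow> continuous_on {0<..<1} G \<Longrightarrow> 0 \<le> S \<Longrightarrow>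
      (\<forall>w\<in>{0<..<1}. \<bar>F w\<bar> \<le> S * (w * (1 - w\<^sup>2))) \<Longrightarrow> (\<forall>w\<in>{0<..<1}. \<bar>G w\<bar> \<le> S * (w * (1 - w\<^sup>2))) \<Longrightarrow>
    (\<exists>e g \<rho> k. \<bar>\<rho>\<bar> \<le> C * S \<and> \<bar>k\<bar> \<le> C * S \<and>
      (\<forall>w\<in>{0<..<1}. \<bar>e w\<bar> \<le> C * S * (w * (1 - w\<^sup>2))\<^sup>2 \<and> \<bar>g w\<bar> \<le> C * S * (w * (1 - w\<^sup>2))\<^sup>2 \<and>
         (e has_real_derivative bcoeff \<epsilon> K V w * e w + (\<rho> * (- 2 * w * (1 - w\<^sup>2) * (4 * R - (1 - w\<^sup>2))) + k * (2 * w * V w) + F w)) (at w) \<and>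
         (g has_real_derivative bcoeff (-\<epsilon>) (-K) W w * g w + (\<rho> * (- 2 * w * (1 - w\<^sup>2) * (4 * R - (1 - w\<^sup>2))) + (-k) * (2 * w * W w) + G w)) (at w)))"
proof -
  note VD = wbranchD[OF V] and WD = wbranchD[OF W]
  define c where "c = R - 2 * R\<^sup>2"
  have "0 < R * (1 - 2 * R)" using VD(2) wbranch_R_less[OF V] by simp
  then have c: "0 < c" unfolding c_def by (simp add: algebra_simps power2_eq_square)
  define eV where "eV = (\<lambda>w. 2 * (V w)\<^sup>2 - (1 - w\<^sup>2)\<^sup>2 * (2 * R\<^sup>2 - R * (1 - w\<^sup>2)) + (1 - w\<^sup>2) * (K - \<epsilon> * (1 - w\<^sup>2)) * V w)"
  define eW where "eW = (\<lambda>w. 2 * (W w)\<^sup>2 - (1 - w\<^sup>2)\<^sup>2 * (2 * R\<^sup>2 - R * (1 - w\<^sup>2)) + (1 - w\<^sup>2) * (-K - (-\<epsilon>) * (1 - w\<^sup>2)) * W w)"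
  have RV: "(eV \<longlongrightarrow> c) (at_right 0)"
    "\<And>w. 0 < w \<Longrightarrow> w < 1 \<Longrightarrow> (eV has_real_derivative
        bcoeff \<epsilon> K V w * eV w + (R * (- 2 * w * (1 - w\<^sup>2) * (4 * R - (1 - w\<^sup>2))) + K * (2 * w * V w))) (at w)"
    using rescaling_variation(1,3)[OF V] unfolding eV_def c_def by blast+
  have RW: "(eW \<longlongrightarrow> c) (at_right 0)"
    "\<And>w. 0 < w \<Longrightarrow> w < 1 \<Longrightarrow> (eW has_real_derivative
        bcoeff (-\<epsilon>) (-K) W w * eW w + (R * (- 2 * w * (1 - w\<^sup>2) * (4 * R - (1 - w\<^sup>2))) + (-K) * (2 * w * W w))) (at w)"
    using rescaling_variation(1,3)[OF W] unfolding eW_def c_def by blast+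
  obtain cV where cV: "0 < cV" "\<And>w. 0 < w \<Longrightarrow> w < 1 \<Longrightarrow> \<bar>eV w\<bar> \<le> cV * (1 - w\<^sup>2)\<^sup>2" using rescaling_variation(2)[OF V] unfolding eV_def by (metis greaterThanLessThan_iff)
  obtain cW where cW: "0 < cW" "\<And>w. 0 < w \<Longrightarrow> w < 1 \<Longrightarrow> \<bar>eW w\<bar> \<le> cW * (1 - w\<^sup>2)\<^sup>2" using rescaling_variation(2)[OF W] unfolding eW_def by (metis greaterThanLessThan_iff)
  from branch_solve[OF V] obtain C1 where C1: "0 < C1" and *: "\<forall>F S. continuous_on {0<..<1} F \<longrightarrow> 0 \<le> S \<longrightarrow> (\<forall>w\<in>{0<..<1}. \<bar>F w\<bar> \<le> S * (w * (1 - w\<^sup>2))) \<longrightarrow>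
    (\<exists>e l. (e \<longlongrightarrow> l) (at_right 0) \<and> ((\<forall>w\<in>{0<..<1}. 0 < F w) \<longrightarrow> l < 0) \<and>
      (\<forall>w\<in>{0<..<1}. \<bar>e w\<bar> \<le> C1 * S * (1 - w\<^sup>2)\<^sup>2 \<and>
         (e has_real_derivative bcoeff \<epsilon> K V w * e w + F w) (at w)))"
    by (elim exE conjE) (rule that)
  note sV = *[THEN spec, THEN spec, THEN mp, THEN mp, THEN mp]
  from branch_solve[OF W] obtain C2 where C2: "0 < C2" and *: "\<forall>F S. continuous_on {0<..<1} F \<longrightarrow> 0 \<le> S \<longrightarrow> (\<forall>w\<in>{0<..<1}. \<bar>F w\<bar> \<le> S * (w * (1 - w\<^sup>2))) \<longrightarrow>
    (\<exists>e l. (e \<longlongrightarrow> l) (at_right 0) \<and> ((\<forall>w\<in>{0<..<1}. 0 < F w) \<longrightarrow> l < 0) \<and>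
      (\<forall>w\<in>{0<..<1}. \<bar>e w\<bar> \<le> C2 * S * (1 - w\<^sup>2)\<^sup>2 \<and>
         (e has_real_derivative bcoeff (-\<epsilon>) (-K) W w * e w + F w) (at w)))"
    by (elim exE conjE) (rule that)
  note sW = *[THEN spec, THEN spec, THEN mp, THEN mp, THEN mp]
  obtain C3 where C3: "0 < C3" and vV: "\<And>e F M. (e \<longlongrightarrow> 0) (at_right 0) \<Longrightarrow> 0 \<le> M \<Longrightarrow>
      (\<forall>w\<in>{0<..<1}. \<bar>e w\<bar> \<le> M * (1 - w\<^sup>2)\<^sup>2 \<and> \<bar>F w\<bar> \<le> M * (w * (1 - w\<^sup>2)) \<and>
        (e has_real_derivative bcoeff \<epsilon> K V w * e w + F w) (at w)) \<Longrightarrow>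
      (\<forall>w\<in>{0<..<1}. \<bar>e w\<bar> \<le> C3 * M * (w * (1 - w\<^sup>2))\<^sup>2)"
    by (rule vanishing_bound[OF V], rule that, assumption, meson)
  obtain C4 where C4: "0 < C4" and vW: "\<And>e F M. (e \<longlongrightarrow> 0) (at_right 0) \<Longrightarrow> 0 \<le> M \<Longrightarrow>
      (\<forall>w\<in>{0<..<1}. \<bar>e w\<bar> \<le> M * (1 - w\<^sup>2)\<^sup>2 \<and> \<bar>F w\<bar> \<le> M * (w * (1 - w\<^sup>2)) \<and>
        (e has_real_derivative bcoeff (-\<epsilon>) (-K) W w * e w + F w) (at w)) \<Longrightarrow>
      (\<forall>w\<in>{0<..<1}. \<bar>e w\<bar> \<le> C4 * M * (w * (1 - w\<^sup>2))\<^sup>2)"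
    by (rule vanishing_bound[OF W], rule that, assumption, meson)
  have r2_bd: "\<bar>2 * w * V w\<bar> \<le> 2 / d * (w * (1 - w\<^sup>2))" "\<bar>2 * w * W w\<bar> \<le> 2 / d * (w * (1 - w\<^sup>2))" if w: "0 < w" "w < 1" for w
  proof -
    have *: "\<bar>2 * w * x\<bar> \<le> 2 / d * (w * (1 - w\<^sup>2))" if "0 < x" "x \<le> w * (1 - w\<^sup>2) / d" for x
    proof -
      have "\<bar>2 * w * x\<bar> = 2 * w * x" using w that by simp
      also have "\<dots> \<le> 2 * 1 * x" using w that by (intro mult_right_mono) auto
      finally show ?thesis using that by simp
    qed
    show "\<bar>2 * w * V w\<bar> \<le> 2 / d * (w * (1 - w\<^sup>2))" using * VD(4,5)[OF w] by blast
    show "\<bar>2 * w * W w\<bar> \<le> 2 / d * (w * (1 - w\<^sup>2))" using * WD(4,5)[OF w] by blast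
  qed
  have "continuous_on {0<..<1} (\<lambda>w. 2 * w * V w)" "continuous_on {0<..<1} (\<lambda>w. 2 * w * W w)"
    using VD(7) WD(7) by (auto intro!: continuous_intros)
  note cont2 = this
  obtain pV lV where pV: "(pV \<longlongrightarrow> lV) (at_right 0)" "lV < 0"
    "\<And>w. 0 < w \<Longrightarrow> w < 1 \<Longrightarrow> \<bar>pV w\<bar> \<le> C1 * (2 / d) * (1 - w\<^sup>2)\<^sup>2"
    "\<And>w. 0 < w \<Longrightarrow> w < 1 \<Longrightarrow> (pV has_real_derivative bcoeff \<epsilon> K V w * pV w + 2 * w * V w) (at w)"
    using sV[OF cont2(1), of "2 / d"] r2_bd(1) VD(1,5) by (auto simp: mult_pos_pos)
  obtain pW lW where pW: "(pW \<longlongrightarrow> lW) (at_right 0)" "lW < 0"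
    "\<And>w. 0 < w \<Longrightarrow> w < 1 \<Longrightarrow> \<bar>pW w\<bar> \<le> C2 * (2 / d) * (1 - w\<^sup>2)\<^sup>2"
    "\<And>w. 0 < w \<Longrightarrow> w < 1 \<Longrightarrow> (pW has_real_derivative bcoeff (-\<epsilon>) (-K) W w * pW w + 2 * w * W w) (at w)"
    using sW[OF cont2(2), of "2 / d"] r2_bd(2) WD(1,5) by (auto simp: mult_pos_pos)
  define b0 where "b0 = (C1 + C2) / \<bar>lV + lW\<bar>"
  define a0 where "a0 = (C1 + b0 * \<bar>lV\<bar>) / c"
  have b0: "0 \<le> b0" and a0: "0 \<le> a0" unfolding a0_def b0_def using C1 C2 c by auto
  \<comment> \<open>One constant that dominates the combined solutions and their total forcing on
    both halves, as the gain of the factor \<open>w^2\<close> is stated with a common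
    \<open>M\<close>.\<close>
  define M where "M = (C1 + b0 * (C1 * (2 / d)) + a0 * cV) + (C2 + b0 * (C2 * (2 / d)) + a0 * cW)
     + (a0 * R * (2 * (4 * R + 1)) + (a0 * \<bar>K\<bar> + b0) * (2 / d) + 1)"
  have M_nonneg: "0 \<le> C1 + b0 * (C1 * (2 / d)) + a0 * cV" "0 \<le> C2 + b0 * (C2 * (2 / d)) + a0 * cW"
     "0 \<le> a0 * R * (2 * (4 * R + 1)) + (a0 * \<bar>K\<bar> + b0) * (2 / d) + 1"
    using C1 C2 b0 a0 cV cW VD(1,2) by (auto intro!: add_nonneg_nonneg mult_nonneg_nonneg)
  have M: "C1 + b0 * (C1 * (2 / d)) + a0 * cV \<le> M" "C2 + b0 * (C2 * (2 / d)) + a0 * cW \<le> M"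
    "a0 * R * (2 * (4 * R + 1)) + (a0 * \<bar>K\<bar> + b0) * (2 / d) + 1 \<le> M" "0 \<le> M"
    using M_nonneg unfolding M_def by linarith+
  define C where "C = C3 * M + C4 * M + (a0 * R + a0 * \<bar>K\<bar> + b0 + 1)"
  have nn: "0 \<le> C3 * M" "0 \<le> C4 * M" "0 \<le> a0 * R" "0 \<le> a0 * \<bar>K\<bar>" using C3 C4 M a0 VD(2) by auto
  have C: "C3 * M \<le> C" "C4 * M \<le> C" "a0 * R \<le> C" "a0 * \<bar>K\<bar> + b0 \<le> C" "0 < C"
    using nn b0 unfolding C_def by linarith+
  have main: "\<exists>e g \<rho> k. \<bar>\<rho>\<bar> \<le> C * S \<and> \<bar>k\<bar> \<le> C * S \<and>
      (\<forall>w\<in>{0<..<1}. \<bar>e w\<bar> \<le> C * S * (w * (1 - w\<^sup>2))\<^sup>2 \<and> \<bar>g w\<bar> \<le> C * S * (w * (1 - w\<^sup>2))\<^sup>2 \<and>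
         (e has_real_derivative bcoeff \<epsilon> K V w * e w + (\<rho> * (- 2 * w * (1 - w\<^sup>2) * (4 * R - (1 - w\<^sup>2))) + k * (2 * w * V w) + F w)) (at w) \<and>
         (g has_real_derivative bcoeff (-\<epsilon>) (-K) W w * g w + (\<rho> * (- 2 * w * (1 - w\<^sup>2) * (4 * R - (1 - w\<^sup>2))) + (-k) * (2 * w * W w) + G w)) (at w))"
    if F: "continuous_on {0<..<1} F" and G: "continuous_on {0<..<1} G" and S: "0 \<le> S"
      and Fb: "\<forall>w\<in>{0<..<1}. \<bar>F w\<bar> \<le> S * (w * (1 - w\<^sup>2))" and Gb: "\<forall>w\<in>{0<..<1}. \<bar>G w\<bar> \<le> S * (w * (1 - w\<^sup>2))" for F G S
  proof -
    obtain eF lF where eF: "(eF \<longlongrightarrow> lF) (at_right 0)"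
      "\<And>w. 0 < w \<Longrightarrow> w < 1 \<Longrightarrow> \<bar>eF w\<bar> \<le> C1 * S * (1 - w\<^sup>2)\<^sup>2"
      "\<And>w. 0 < w \<Longrightarrow> w < 1 \<Longrightarrow> (eF has_real_derivative bcoeff \<epsilon> K V w * eF w + F w) (at w)"
      using sV[OF F S Fb] by (auto simp: Ball_def)
    obtain eG lG where eG: "(eG \<longlongrightarrow> lG) (at_right 0)"
      "\<And>w. 0 < w \<Longrightarrow> w < 1 \<Longrightarrow> \<bar>eG w\<bar> \<le> C2 * S * (1 - w\<^sup>2)\<^sup>2"
      "\<And>w. 0 < w \<Longrightarrow> w < 1 \<Longrightarrow> (eG has_real_derivative bcoeff (-\<epsilon>) (-K) W w * eG w + G w) (at w)"
      using sW[OF G S Gb] by (auto simp: Ball_def)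
    have lim_bd: "\<bar>l\<bar> \<le> C' * S" if "(e \<longlongrightarrow> l) (at_right 0)" "0 < C'"
      "\<And>w. 0 < w \<Longrightarrow> w < 1 \<Longrightarrow> \<bar>e w\<bar> \<le> C' * S * (1 - w\<^sup>2)\<^sup>2" for e l C'
    proof -
      have "((\<lambda>w. \<bar>e w\<bar>) \<longlongrightarrow> \<bar>l\<bar>) (at_right 0)" using that by (intro tendsto_intros)
      moreover have "eventually (\<lambda>w. \<bar>e w\<bar> \<le> C' * S) (at_right 0)"
      proof (rule eventually_at_rightI[of 0 1])
        fix w :: real assume "w \<in> {0<..<1}"
        then have w: "0 < w" "w < 1" by auto
        have "(1 - w\<^sup>2)\<^sup>2 \<le> 1" using one_minus_sq[OF w] by (intro power_le_one) auto
        then have "C' * S * (1 - w\<^sup>2)\<^sup>2 \<le> C' * S * 1" using that S by (intro mult_left_mono) auto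
        then show "\<bar>e w\<bar> \<le> C' * S" using that(3)[OF w] by linarith
      qed auto
      ultimately show ?thesis using tendsto_upperbound trivial_limit_at_right_real by blast
    qed
    have lF: "\<bar>lF\<bar> \<le> C1 * S" and lG: "\<bar>lG\<bar> \<le> C2 * S" using lim_bd eF eG C1 C2 by blast+
    \<comment> \<open>Subtracting the two end conditions eliminates \<open>\<alpha>\<close>; the
      denominator is a sum of two negative numbers.\<close>
    define \<beta> where "\<beta> = (lG - lF) / (lV + lW)"
    define \<alpha> where "\<alpha> = - (lF + \<beta> * lV) / c"
    have \<beta>: "\<bar>\<beta>\<bar> \<le> b0 * S"
    proof -
      have "\<bar>lG - lF\<bar> \<le> (C1 + C2) * S" using lF lG by (simp add: algebra_simps)
      then have "\<bar>lG - lF\<bar> / \<bar>lV + lW\<bar> \<le> (C1 + C2) * S / \<bar>lV + lW\<bar>" by (intro divide_right_mono) auto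
      then show ?thesis unfolding \<beta>_def b0_def by simp
    qed
    have \<alpha>: "\<bar>\<alpha>\<bar> \<le> a0 * S"
    proof -
      have "\<bar>\<beta> * lV\<bar> \<le> b0 * S * \<bar>lV\<bar>" unfolding abs_mult using \<beta> by (intro mult_right_mono) auto
      then have "\<bar>lF + \<beta> * lV\<bar> \<le> (C1 + b0 * \<bar>lV\<bar>) * S" using lF by (simp add: algebra_simps)
      then have "\<bar>lF + \<beta> * lV\<bar> / c \<le> (C1 + b0 * \<bar>lV\<bar>) * S / c" using c by (intro divide_right_mono) auto
      then show ?thesis unfolding \<alpha>_def a0_def using c by (simp only: abs_divide abs_minus_cancel) simp
    qed
    have lin: "lF + \<beta> * lV + \<alpha> * c = 0" "lG - \<beta> * lW + \<alpha> * c = 0"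
    proof -
      show "lF + \<beta> * lV + \<alpha> * c = 0" unfolding \<alpha>_def using c by simp
      moreover have "\<beta> * (lV + lW) = lG - lF" unfolding \<beta>_def using pV(2) pW(2) by simp
      ultimately show "lG - \<beta> * lW + \<alpha> * c = 0" by (simp add: algebra_simps)
    qed
    define e where "e = (\<lambda>w. eF w + \<beta> * pV w + \<alpha> * eV w)"
    define g where "g = (\<lambda>w. eG w - \<beta> * pW w + \<alpha> * eW w)"
    \<comment> \<open>The rescaling variation changes \<open>R\<close> and \<open>K\<close> in
      proportion to their own values, so it contributes to both parameters; \<open>\<beta>\<close>
      acts on the damping alone.\<close>
    define \<rho> where "\<rho> = \<alpha> * R"
    define k where "k = \<alpha> * K + \<beta>"
    define F' where "F' = (\<lambda>w. \<rho> * (- 2 * w * (1 - w\<^sup>2) * (4 * R - (1 - w\<^sup>2))) + k * (2 * w * V w) + F w)"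
    define G' where "G' = (\<lambda>w. \<rho> * (- 2 * w * (1 - w\<^sup>2) * (4 * R - (1 - w\<^sup>2))) + (-k) * (2 * w * W w) + G w)"
    have e0: "(e \<longlongrightarrow> 0) (at_right 0)" and g0: "(g \<longlongrightarrow> 0) (at_right 0)"
    proof -
      have "(e \<longlongrightarrow> lF + \<beta> * lV + \<alpha> * c) (at_right 0)" unfolding e_def by (intro tendsto_intros eF pV RV(1))
      then show "(e \<longlongrightarrow> 0) (at_right 0)" using lin by simp
      have "(g \<longlongrightarrow> lG - \<beta> * lW + \<alpha> * c) (at_right 0)" unfolding g_def by (intro tendsto_intros eG pW RW(1))
      then show "(g \<longlongrightarrow> 0) (at_right 0)" using lin by simp
    qed
    have \<rho>: "\<bar>\<rho>\<bar> \<le> (a0 * R) * S" unfolding \<rho>_def abs_mult using \<alpha> VD(2) by (simp add: mult_right_mono mult_ac)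
    have k: "\<bar>k\<bar> \<le> (a0 * \<bar>K\<bar> + b0) * S"
    proof -
      have "\<bar>\<alpha> * K\<bar> \<le> a0 * S * \<bar>K\<bar>" unfolding abs_mult using \<alpha> by (intro mult_right_mono) auto
      then show ?thesis unfolding k_def using \<beta> by (simp add: algebra_simps)
    qed
    have combine: "\<bar>x + \<beta>' * y + \<alpha> * z\<bar> \<le> M * S * u" if "\<bar>x\<bar> \<le> C' * S * u" "\<bar>y\<bar> \<le> C' * (2 / d) * u" "\<bar>z\<bar> \<le> c' * u"
      "\<bar>\<beta>'\<bar> \<le> b0 * S" "0 \<le> u" "C' + b0 * (C' * (2 / d)) + a0 * c' \<le> M" for x y z u \<beta>' C' c'
    proof -
      have "\<bar>\<beta>' * y\<bar> \<le> (b0 * S) * (C' * (2 / d) * u)" unfolding abs_mult using that b0 S by (intro mult_mono) auto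
      moreover have "\<bar>\<alpha> * z\<bar> \<le> (a0 * S) * (c' * u)" unfolding abs_mult using that \<alpha> a0 S by (intro mult_mono) auto
      ultimately have "\<bar>x + \<beta>' * y + \<alpha> * z\<bar> \<le> (C' + b0 * (C' * (2 / d)) + a0 * c') * (S * u)"
        using that(1) by (simp add: algebra_simps)
      also have "\<dots> \<le> M * (S * u)" using that S by (intro mult_right_mono) auto
      finally show ?thesis by (simp add: mult_ac)
    qed
    have r1_bd: "\<bar>- 2 * w * (1 - w\<^sup>2) * (4 * R - (1 - w\<^sup>2))\<bar> \<le> 2 * (4 * R + 1) * (w * (1 - w\<^sup>2))" if w: "0 < w" "w < 1" for w
    proof -
      have "\<bar>4 * R - (1 - w\<^sup>2)\<bar> \<le> 4 * R + 1" using one_minus_sq[OF w] VD(2) by linarith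
      then have "(2 * w * (1 - w\<^sup>2)) * \<bar>4 * R - (1 - w\<^sup>2)\<bar> \<le> (2 * w * (1 - w\<^sup>2)) * (4 * R + 1)"
        using w one_minus_sq[OF w] by (intro mult_left_mono) auto
      moreover have "\<bar>- 2 * w * (1 - w\<^sup>2) * (4 * R - (1 - w\<^sup>2))\<bar> = (2 * w * (1 - w\<^sup>2)) * \<bar>4 * R - (1 - w\<^sup>2)\<bar>"
        using w one_minus_sq[OF w] by (simp add: abs_mult)
      ultimately show ?thesis by (simp add: algebra_simps)
    qed
    have combine': "\<bar>\<rho> * x + k' * y + z\<bar> \<le> M * S * u" if "\<bar>x\<bar> \<le> 2 * (4 * R + 1) * u" "\<bar>y\<bar> \<le> 2 / d * u" "\<bar>z\<bar> \<le> S * u"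
      "\<bar>k'\<bar> = \<bar>k\<bar>" "0 \<le> u" for x y z u k'
    proof -
      have "\<bar>\<rho> * x\<bar> \<le> (a0 * R * S) * (2 * (4 * R + 1) * u)" unfolding abs_mult using that \<rho> a0 S VD(2) by (intro mult_mono) auto
      moreover have "\<bar>k' * y\<bar> \<le> ((a0 * \<bar>K\<bar> + b0) * S) * (2 / d * u)" unfolding abs_mult using that k a0 b0 S by (intro mult_mono) auto
      ultimately have "\<bar>\<rho> * x + k' * y + z\<bar> \<le> (a0 * R * (2 * (4 * R + 1)) + (a0 * \<bar>K\<bar> + b0) * (2 / d) + 1) * (S * u)"
        using that(3) by (simp add: algebra_simps)
      also have "\<dots> \<le> M * (S * u)" using that S M by (intro mult_right_mono) auto
      finally show ?thesis by (simp add: mult_ac)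
    qed
    have e_all: "\<bar>e w\<bar> \<le> M * S * (1 - w\<^sup>2)\<^sup>2 \<and> \<bar>F' w\<bar> \<le> M * S * (w * (1 - w\<^sup>2)) \<and>
        (e has_real_derivative bcoeff \<epsilon> K V w * e w + F' w) (at w)" if "w \<in> {0<..<1}" for w
    proof -
      have w: "0 < w" "w < 1" using that by auto
      have "\<bar>e w\<bar> \<le> M * S * (1 - w\<^sup>2)\<^sup>2" unfolding e_def
        by (rule combine[OF eF(2)[OF w] pV(3)[OF w] cV(2)[OF w] \<beta> _ M(1)]) simp
      moreover have "\<bar>F' w\<bar> \<le> M * S * (w * (1 - w\<^sup>2))" unfolding F'_def
        by (rule combine'[OF r1_bd[OF w] r2_bd(1)[OF w]]) (use Fb that w one_minus_sq[OF w] in auto)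
      moreover have "(e has_real_derivative bcoeff \<epsilon> K V w * e w + F' w) (at w)" unfolding e_def F'_def
        by (rule derivative_eq_intros eF(3)[OF w] pV(4)[OF w] RV(2)[OF w] refl)+
          (simp add: \<rho>_def k_def algebra_simps)
      ultimately show ?thesis by blast
    qed
    have g_all: "\<bar>g w\<bar> \<le> M * S * (1 - w\<^sup>2)\<^sup>2 \<and> \<bar>G' w\<bar> \<le> M * S * (w * (1 - w\<^sup>2)) \<and>
        (g has_real_derivative bcoeff (-\<epsilon>) (-K) W w * g w + G' w) (at w)" if "w \<in> {0<..<1}" for w
    proof -
      have w: "0 < w" "w < 1" using that by auto
      have "\<bar>eG w + (-\<beta>) * pW w + \<alpha> * eW w\<bar> \<le> M * S * (1 - w\<^sup>2)\<^sup>2"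
        by (rule combine[OF eG(2)[OF w] pW(3)[OF w] cW(2)[OF w] _ _ M(2)]) (use \<beta> in auto)
      then have "\<bar>g w\<bar> \<le> M * S * (1 - w\<^sup>2)\<^sup>2" unfolding g_def by simp
      moreover have "\<bar>G' w\<bar> \<le> M * S * (w * (1 - w\<^sup>2))" unfolding G'_def
        by (rule combine'[OF r1_bd[OF w] r2_bd(2)[OF w]]) (use Gb that w one_minus_sq[OF w] in auto)
      moreover have "(g has_real_derivative bcoeff (-\<epsilon>) (-K) W w * g w + G' w) (at w)" unfolding g_def G'_def
        by (rule derivative_eq_intros eG(3)[OF w] pW(4)[OF w] RW(2)[OF w] refl)+
          (simp add: \<rho>_def k_def algebra_simps)
      ultimately show ?thesis by blast
    qed
    have MS: "0 \<le> M * S" using M S by simp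
    have up: "x \<le> C * S * y" if "x \<le> C' * (M * S) * y" "C' * M \<le> C" "0 \<le> y" for x y C'
    proof -
      have "C' * M * (S * y) \<le> C * (S * y)" using that S by (intro mult_right_mono) auto
      then show ?thesis using that(1) by (simp add: mult_ac)
    qed
    have "\<forall>w\<in>{0<..<1}. \<bar>e w\<bar> \<le> C3 * (M * S) * (w * (1 - w\<^sup>2))\<^sup>2"
      by (rule vV[OF e0 MS ballI[OF e_all]])
    then have e_fin: "\<forall>w\<in>{0<..<1}. \<bar>e w\<bar> \<le> C * S * (w * (1 - w\<^sup>2))\<^sup>2"
      using up[OF _ C(1)] by simp
    have "\<forall>w\<in>{0<..<1}. \<bar>g w\<bar> \<le> C4 * (M * S) * (w * (1 - w\<^sup>2))\<^sup>2"
      by (rule vW[OF g0 MS ballI[OF g_all]])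
    then have g_fin: "\<forall>w\<in>{0<..<1}. \<bar>g w\<bar> \<le> C * S * (w * (1 - w\<^sup>2))\<^sup>2"
      using up[OF _ C(2)] by simp
    have "\<bar>\<rho>\<bar> \<le> C * S" "\<bar>k\<bar> \<le> C * S"
      using \<rho> k mult_right_mono[OF C(3) S] mult_right_mono[OF C(4) S] by linarith+
    moreover have "(e has_real_derivative bcoeff \<epsilon> K V w * e w + F' w) (at w)"
      "(g has_real_derivative bcoeff (-\<epsilon>) (-K) W w * g w + G' w) (at w)" if "w \<in> {0<..<1}" for w
      using e_all[OF that] g_all[OF that] by blast+
    ultimately show ?thesis using e_fin g_fin unfolding F'_def G'_def
      by (intro exI[of _ e] exI[of _ g] exI[of _ \<rho>] exI[of _ k] conjI ballI) simp_all
  qed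
  show thesis by (rule that[OF C(5)], rule main)
qed

section \<open>Power series continuation of loops\<close>

lemma sum_inverse_squares_le: "(\<Sum>i\<in>{1..<n}. 1 / (real i)\<^sup>2) \<le> 2"
proof -
  have "(\<Sum>i\<in>{1..<Suc (Suc n)}. 1 / (real i)\<^sup>2) \<le> 2 - 1 / real (Suc n)" for n
  proof (induction n)
    case (Suc n)
    have "(\<Sum>i\<in>{1..<Suc (Suc (Suc n))}. 1 / (real i)\<^sup>2) \<le> 2 - 1 / real (Suc n) + 1 / (real (Suc (Suc n)))\<^sup>2"
      using Suc by simp
    also have "1 / (real (Suc (Suc n)))\<^sup>2 \<le> 1 / (real (Suc n) * real (Suc (Suc n)))"
      by (intro divide_left_mono) (auto simp: power2_eq_square)
    also have "1 / (real (Suc n) * real (Suc (Suc n))) = 1 / real (Suc n) - 1 / real (Suc (Suc n))"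
      by (simp add: field_simps)
    finally show ?case by simp
  qed simp
  from this[of n] have "(\<Sum>i\<in>{1..<Suc (Suc n)}. 1 / (real i)\<^sup>2) \<le> 2" using order_trans by force
  moreover have "(\<Sum>i\<in>{1..<n}. 1 / (real i)\<^sup>2) \<le> (\<Sum>i\<in>{1..<Suc (Suc n)}. 1 / (real i)\<^sup>2)"
    by (intro sum_mono2) auto
  ultimately show ?thesis by linarith
qed

text \<open>Squaring \<open>1 / (a * b) = (1 / a + 1 / b) / (a + b)\<close> with
  \<open>a + b = j\<close> pulls out the factor \<open>1 / j^2\<close> and leaves two bounded sums
  of inverse squares.\<close>

lemma convolution_inverse_squares_le:
  "(\<Sum>i\<in>{1..<j}. 1 / ((real i)\<^sup>2 * (real (j - i))\<^sup>2)) \<le> 8 / (real j)\<^sup>2"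
proof (cases "j = 0")
  case False
  then have j: "0 < real j" by simp
  have "(\<Sum>i\<in>{1..<j}. 1 / ((real i)\<^sup>2 * (real (j - i))\<^sup>2)) \<le>
      (\<Sum>i\<in>{1..<j}. 2 / (real j)\<^sup>2 * (1 / (real i)\<^sup>2 + 1 / (real (j - i))\<^sup>2))"
  proof (intro sum_mono)
    fix i assume i: "i \<in> {1..<j}"
    define a b where "a = real i" and "b = real (j - i)"
    have ab: "0 < a" "0 < b" "real j = a + b" using i unfolding a_def b_def by auto
    have "(1 / a + 1 / b)\<^sup>2 \<le> 2 * (1 / a\<^sup>2 + 1 / b\<^sup>2)"
      using sum_squares_bound[of "1/a" "1/b"] by (simp add: power2_sum power_divide)
    moreover have "1 / (a\<^sup>2 * b\<^sup>2) = (1 / a + 1 / b)\<^sup>2 / (a + b)\<^sup>2"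
      using ab by (simp add: divide_simps add_pos_pos)
    ultimately show "1 / ((real i)\<^sup>2 * (real (j - i))\<^sup>2) \<le> 2 / (real j)\<^sup>2 * (1 / (real i)\<^sup>2 + 1 / (real (j - i))\<^sup>2)"
      unfolding ab(3) a_def[symmetric] b_def[symmetric] by (simp add: divide_right_mono)
  qed
  also have "\<dots> = 2 / (real j)\<^sup>2 * ((\<Sum>i\<in>{1..<j}. 1 / (real i)\<^sup>2) + (\<Sum>i\<in>{1..<j}. 1 / (real (j - i))\<^sup>2))"
    by (simp only: sum.distrib flip: sum_distrib_left)
  also have "(\<Sum>i\<in>{1..<j}. 1 / (real (j - i))\<^sup>2) = (\<Sum>i\<in>{1..<j}. 1 / (real i)\<^sup>2)"
    by (rule sum.reindex_bij_witness[of _ "\<lambda>i. j - i" "\<lambda>i. j - i"]) auto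
  also have "2 / (real j)\<^sup>2 * ((\<Sum>i\<in>{1..<j}. 1 / (real i)\<^sup>2) + (\<Sum>i\<in>{1..<j}. 1 / (real i)\<^sup>2)) \<le> 2 / (real j)\<^sup>2 * (2 + 2)"
    using sum_inverse_squares_le[of j] by (intro mult_left_mono add_mono) auto
  finally show ?thesis by simp
qed simp

text \<open>The factor \<open>1 / j^2\<close> makes these majorants stable under Cauchy products.\<close>
definition majorant :: "real \<Rightarrow> real \<Rightarrow> nat \<Rightarrow> real" where
  "majorant A r j = A * r ^ j / (real j)\<^sup>2"

lemma majorant_nonneg: "0 \<le> A \<Longrightarrow> 0 \<le> r \<Longrightarrow> 0 \<le> majorant A r j"
  unfolding majorant_def by auto

lemma majorant_le: "0 \<le> A \<Longrightarrow> 0 \<le> r \<Longrightarrow> 0 < j \<Longrightarrow> majorant A r j \<le> A * r ^ j"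
proof -
  assume "0 \<le> A" "0 \<le> r" and j: "0 < j"
  then have "0 \<le> A * r ^ j" "1 \<le> (real j)\<^sup>2" by (auto simp: one_le_power)
  then show ?thesis unfolding majorant_def using mult_left_mono[of 1 "(real j)\<^sup>2" "A * r ^ j"] j by (simp add: divide_le_eq)
qed

text \<open>The left side is the scalar form of the recursion for the coefficients: products of two
  earlier ones, because the equation is quadratic, and the previous one, because \<epsilon> is
  shifted by the expansion variable.\<close>

lemma majorant_step:
  assumes "0 < C" "0 < d"
  shows "\<exists>A>0. \<exists>r>0. \<forall>j>0.
     C * ((\<Sum>i\<in>{1..<j}. majorant A r i * majorant A r (j - i)) + (if j = 1 then 1 / d else majorant A r (j - 1))) \<le> majorant A r j"
proof -
  \<comment> \<open>The convolution constant 8 gives \<open>C * 8 * A = 1 / 2\<close>. With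
    \<open>8 * C \<le> r\<close> the shifted term takes at most the other half, and
    \<open>16 * C^2 / d \<le> r\<close> settles the start \<open>j = 1\<close>.\<close>
  define A where "A = 1 / (16 * C)"
  define r where "r = 8 * C + 16 * C\<^sup>2 / d"
  have A: "0 < A" unfolding A_def using assms by simp
  have r: "0 < r" "8 * C \<le> r" "16 * C\<^sup>2 / d \<le> r" unfolding r_def using assms by (simp_all add: add_pos_pos)
  have "C * ((\<Sum>i\<in>{1..<j}. majorant A r i * majorant A r (j - i)) + (if j = 1 then 1 / d else majorant A r (j - 1))) \<le> majorant A r j"
    if j: "0 < j" for j
  proof (cases "j = 1")
    case True
    have "C / d = A * (16 * C\<^sup>2 / d)" unfolding A_def using assms by (simp add: power2_eq_square)
    also have "\<dots> \<le> A * r" using r A by (intro mult_left_mono) auto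
    finally show ?thesis using True by (simp add: majorant_def)
  next
    case False
    then have j2: "2 \<le> j" using j by simp
    have conv: "(\<Sum>i\<in>{1..<j}. majorant A r i * majorant A r (j - i)) \<le> 8 * A * majorant A r j"
    proof -
      have "(\<Sum>i\<in>{1..<j}. majorant A r i * majorant A r (j - i)) =
        (\<Sum>i\<in>{1..<j}. A\<^sup>2 * r ^ j * (1 / ((real i)\<^sup>2 * (real (j - i))\<^sup>2)))"
      proof (intro sum.cong refl)
        fix i assume "i \<in> {1..<j}"
        then have "r ^ j = r ^ i * r ^ (j - i)" by (simp flip: power_add)
        then show "majorant A r i * majorant A r (j - i) = A\<^sup>2 * r ^ j * (1 / ((real i)\<^sup>2 * (real (j - i))\<^sup>2))"
          unfolding majorant_def by (simp add: power2_eq_square)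
      qed
      also have "\<dots> = A\<^sup>2 * r ^ j * (\<Sum>i\<in>{1..<j}. 1 / ((real i)\<^sup>2 * (real (j - i))\<^sup>2))"
        by (simp add: sum_distrib_left)
      also have "\<dots> \<le> A\<^sup>2 * r ^ j * (8 / (real j)\<^sup>2)"
        using convolution_inverse_squares_le A r by (intro mult_left_mono) auto
      also have "\<dots> = 8 * A * majorant A r j" unfolding majorant_def by (simp add: power2_eq_square)
      finally show ?thesis .
    qed
    have prev: "majorant A r (j - 1) \<le> 4 / r * majorant A r j"
    proof -
      have "real j \<le> 2 * real (j - 1)" using j2 by simp
      then have "(real j)\<^sup>2 \<le> (2 * real (j - 1))\<^sup>2" by (intro power_mono) auto
      then have "1 / (real (j - 1))\<^sup>2 \<le> 4 / (real j)\<^sup>2"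
        using j2 by (simp only: power_mult_distrib) (simp add: divide_simps)
      then have "A * r ^ (j - 1) * (1 / (real (j - 1))\<^sup>2) \<le> A * r ^ (j - 1) * (4 / (real j)\<^sup>2)"
        using A r by (intro mult_left_mono) auto
      moreover have "r ^ j = r * r ^ (j - 1)" using j by (simp flip: power_Suc)
      ultimately show ?thesis unfolding majorant_def using r by (simp add: mult_ac)
    qed
    have "C * ((\<Sum>i\<in>{1..<j}. majorant A r i * majorant A r (j - i)) + majorant A r (j - 1))
       \<le> C * (8 * A * majorant A r j + 4 / r * majorant A r j)"
      using conv prev assms by (intro mult_left_mono add_mono) auto
    also have "\<dots> = (1/2 + 4 * C / r) * majorant A r j" unfolding A_def using assms by (simp add: field_simps)
    also have "\<dots> \<le> 1 * majorant A r j"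
      using r assms A by (intro mult_right_mono majorant_nonneg) (auto simp: field_simps)
    finally show ?thesis using False by simp
  qed
  then show ?thesis using A r(1) by blast
qed

text \<open>
  Inserting \<open>V + \<Sum>j. x^j v j\<close>, \<open>R + \<Sum>j. x^j \<rho> j\<close> and \<open>K + \<Sum>j. x^j k j\<close> for the parameter \<open>\<epsilon> + x\<close> into
  the equation for \<open>V^2 / 2\<close>, these are the contributions to the coefficient of \<open>x^j\<close> that do not
  contain \<open>v j\<close>, \<open>\<rho> j\<close>, \<open>k j\<close>. The sign \<open>s\<close> distinguishes the two halves of the loop.
\<close>
definition hcoeff :: "(nat \<Rightarrow> real \<Rightarrow> real) \<Rightarrow> nat \<Rightarrow> real \<Rightarrow> real" where
  "hcoeff v j t = (\<Sum>i\<in>{1..<j}. v i t * v (j - i) t) / 2"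

text \<open>The last summand comes from multiplying the shift of \<epsilon> with the solution. At
  order 1 it meets \<open>V\<close> itself, because the coefficient of index 0 is kept at zero and
  does not carry \<open>V\<close>.\<close>

definition fcoeff :: "real \<Rightarrow> (real \<Rightarrow> real) \<Rightarrow> (nat \<Rightarrow> real \<Rightarrow> real) \<Rightarrow> (nat \<Rightarrow> real) \<Rightarrow> (nat \<Rightarrow> real) \<Rightarrow> nat \<Rightarrow> real \<Rightarrow> real" where
  "fcoeff s V v \<rho> k j t = - 4 * t * (1 - t\<^sup>2) * (\<Sum>i\<in>{1..<j}. \<rho> i * \<rho> (j - i)) + 2 * t * s * (\<Sum>i\<in>{1..<j}. k i * v (j - i) t)
     - 2 * t * (1 - t\<^sup>2) * s * (if j = 1 then V t else v (j - 1) t)"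

text \<open>The weight is the one that bounds \<open>V\<close> from both sides, so a perturbation
  with small \<open>M\<close> leaves a branch positive and does not change its behaviour at the
  ends.\<close>

definition small_coeff :: "real \<Rightarrow> (real \<Rightarrow> real) \<Rightarrow> bool" where
  "small_coeff M v \<longleftrightarrow> continuous_on {0<..<1} v \<and> (\<forall>t\<in>{0<..<1}. \<bar>v t\<bar> \<le> M * (t * (1 - t\<^sup>2)))"

lemma abs_scale: "0 \<le> c \<Longrightarrow> \<bar>s\<bar> = 1 \<Longrightarrow> \<bar>x\<bar> \<le> b \<Longrightarrow> \<bar>c * s * x\<bar> \<le> c * b" for b c s x :: real
  by (simp add: abs_mult mult_left_mono)

text \<open>The unknown of the linear problem is \<open>e = V * v + hcoeff\<close>, whose forcing
  contains \<open>fcoeff - bcoeff * hcoeff\<close>. All contributions are measured by the scalar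
  recursion \<open>Q\<close>; the possible pole of \<open>bcoeff\<close> at the saddle is absorbed
  by the double zero of \<open>hcoeff\<close>.\<close>

lemma forcing_bound:
  fixes v :: "nat \<Rightarrow> real \<Rightarrow> real" and m \<rho> k :: "nat \<Rightarrow> real"
  assumes V: "wbranch d \<epsilon> R K V" and s: "\<bar>s\<bar> = 1"
    and v: "\<And>i. i \<in> {1..<j} \<Longrightarrow> small_coeff (m i) (v i)"
    and r: "\<And>i. i \<in> {1..<j} \<Longrightarrow> \<bar>\<rho> i\<bar> \<le> m i \<and> \<bar>k i\<bar> \<le> m i"
    and "0 < j"
    and Q_def: "Q = (\<Sum>i\<in>{1..<j}. m i * m (j - i)) + (if j = 1 then 1 / d else m (j - 1))"
  shows "continuous_on {0<..<1} (hcoeff v j)" "continuous_on {0<..<1} (fcoeff s V v \<rho> k j)" "0 \<le> Q"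
    "\<And>t. 0 < t \<Longrightarrow> t < 1 \<Longrightarrow> \<bar>hcoeff v j t\<bar> \<le> Q / 2 * (t * (1 - t\<^sup>2))\<^sup>2"
    "\<And>t. 0 < t \<Longrightarrow> t < 1 \<Longrightarrow> \<bar>fcoeff s V v \<rho> k j t - bcoeff \<epsilon> K V t * hcoeff v j t\<bar> \<le> (6 + (\<bar>K\<bar> + \<bar>\<epsilon>\<bar>) / d) * Q * (t * (1 - t\<^sup>2))"
proof -
  note VD = wbranchD[OF V]
  have m: "0 \<le> m i" if "i \<in> {1..<j}" for i using r[OF that] by linarith
  have vc: "continuous_on {0<..<1} (v i)" if "i \<in> {1..<j}" for i using v[OF that] unfolding small_coeff_def by auto
  have ji: "j - i \<in> {1..<j}" if "i \<in> {1..<j}" for i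
    using that by auto
  have vcj: "continuous_on {0<..<1} (v (j - i))" if "i \<in> {1..<j}" for i using vc[OF ji[OF that]] .
  have mj: "0 \<le> m (j - i)" if "i \<in> {1..<j}" for i using m[OF ji[OF that]] .
  have rj: "\<bar>\<rho> (j - i)\<bar> \<le> m (j - i)" if "i \<in> {1..<j}" for i using r[OF ji[OF that]] by blast
  have j1: "j - 1 \<in> {1..<j}" if "j \<noteq> 1"
    using that \<open>0 < j\<close> by auto
  show "continuous_on {0<..<1} (hcoeff v j)" unfolding hcoeff_def
    by (intro continuous_intros continuous_on_sum vc vcj ji) simp_all
  have "continuous_on {0<..<1} (\<lambda>t. if j = 1 then V t else v (j - 1) t)"
    using VD(7) vc j1 by (cases "j = 1") auto
  then show "continuous_on {0<..<1} (fcoeff s V v \<rho> k j)" unfolding fcoeff_def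
    by (intro continuous_intros continuous_on_sum vcj)
  define Q1 where "Q1 = (\<Sum>i\<in>{1..<j}. m i * m (j - i))"
  define T where "T = (if j = 1 then 1 / d else m (j - 1))"
  have Q1: "0 \<le> Q1" unfolding Q1_def by (intro sum_nonneg mult_nonneg_nonneg m mj)
  have T: "0 \<le> T" unfolding T_def using m j1 VD(1) by auto
  have Q: "Q = Q1 + T" unfolding Q_def Q1_def T_def by simp
  show Q0: "0 \<le> Q" using Q Q1 T by simp
  fix t :: real assume t: "0 < t" "t < 1"
  define U where "U = 1 - t\<^sup>2"
  have U: "0 < U" "U \<le> 1" using one_minus_sq[OF t] unfolding U_def by auto
  define y where "y = t * U"
  have y: "0 < y" "y \<le> t" "y \<le> U" "y \<le> 1" unfolding y_def using t U by (auto simp: mult_le_cancel_left1 mult_le_one mult_le_cancel_right1)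
  have vb: "\<bar>v i t\<bar> \<le> m i * y" if "i \<in> {1..<j}" for i
    using v[OF that] t unfolding small_coeff_def y_def U_def by auto
  have vbj: "\<bar>v (j - i) t\<bar> \<le> m (j - i) * y" if "i \<in> {1..<j}" for i using vb[OF ji[OF that]] .
  have "\<bar>\<Sum>i\<in>{1..<j}. v i t * v (j - i) t\<bar> \<le> (\<Sum>i\<in>{1..<j}. \<bar>v i t * v (j - i) t\<bar>)" by (rule sum_abs)
  also have "\<dots> \<le> (\<Sum>i\<in>{1..<j}. (m i * y) * (m (j - i) * y))"
    unfolding abs_mult using y by (intro sum_mono mult_mono mult_nonneg_nonneg vb vbj m mj abs_ge_zero) auto
  also have "\<dots> = Q1 * y\<^sup>2" unfolding Q1_def sum_distrib_right by (intro sum.cong refl) (simp add: power2_eq_square)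
  finally have "\<bar>\<Sum>i\<in>{1..<j}. v i t * v (j - i) t\<bar> \<le> Q1 * y\<^sup>2" .
  also have "\<dots> \<le> Q * y\<^sup>2" using Q T by (intro mult_right_mono) auto
  finally have hb: "\<bar>hcoeff v j t\<bar> \<le> Q / 2 * y\<^sup>2" unfolding hcoeff_def by simp
  then show "\<bar>hcoeff v j t\<bar> \<le> Q / 2 * (t * (1 - t\<^sup>2))\<^sup>2" unfolding y_def U_def .
  have "\<bar>\<Sum>i\<in>{1..<j}. \<rho> i * \<rho> (j - i)\<bar> \<le> (\<Sum>i\<in>{1..<j}. \<bar>\<rho> i * \<rho> (j - i)\<bar>)" by (rule sum_abs)
  also have "\<dots> \<le> Q1" unfolding Q1_def abs_mult
    by (intro sum_mono mult_mono rj m r[THEN conjunct1] abs_ge_zero)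
  finally have s1: "\<bar>\<Sum>i\<in>{1..<j}. \<rho> i * \<rho> (j - i)\<bar> \<le> Q1" .
  have b1: "\<bar>- 4 * t * U * (\<Sum>i\<in>{1..<j}. \<rho> i * \<rho> (j - i))\<bar> \<le> 4 * y * Q1"
  proof -
    have "\<bar>- 4 * t * U * x\<bar> = 4 * y * \<bar>x\<bar>" for x unfolding y_def using t U by (simp add: abs_mult)
    then show ?thesis using s1 y by (simp add: mult_left_mono)
  qed
  have "\<bar>\<Sum>i\<in>{1..<j}. k i * v (j - i) t\<bar> \<le> (\<Sum>i\<in>{1..<j}. \<bar>k i * v (j - i) t\<bar>)" by (rule sum_abs)
  also have "\<dots> \<le> (\<Sum>i\<in>{1..<j}. m i * (m (j - i) * y))"
    unfolding abs_mult using y by (intro sum_mono mult_mono mult_nonneg_nonneg vbj m mj r[THEN conjunct2] abs_ge_zero) auto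
  also have "\<dots> = Q1 * y" unfolding Q1_def sum_distrib_right by (intro sum.cong refl) simp
  finally have s2: "\<bar>\<Sum>i\<in>{1..<j}. k i * v (j - i) t\<bar> \<le> Q1 * y" .
  have "\<bar>2 * t * s * (\<Sum>i\<in>{1..<j}. k i * v (j - i) t)\<bar> \<le> 2 * t * (Q1 * y)"
    using t by (intro abs_scale[OF _ s s2]) simp
  also have "\<dots> \<le> 2 * 1 * (Q1 * y)" using t Q1 y by (intro mult_right_mono mult_left_mono) simp_all
  finally have b2: "\<bar>2 * t * s * (\<Sum>i\<in>{1..<j}. k i * v (j - i) t)\<bar> \<le> 2 * y * Q1"
    by (simp only: mult_1_right mult.commute[of Q1 y] mult.assoc)
  have "\<bar>if j = 1 then V t else v (j - 1) t\<bar> \<le> T * y"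
    using VD(4,5)[OF t] vb[of "j - 1"] j1 unfolding T_def y_def U_def by auto
  also have "\<dots> \<le> T * 1" using T y by (intro mult_left_mono) auto
  finally have s3: "\<bar>if j = 1 then V t else v (j - 1) t\<bar> \<le> T" by (simp only: mult_1_right)
  have "\<bar>2 * t * U * s * (if j = 1 then V t else v (j - 1) t)\<bar> \<le> 2 * t * U * T"
    using t U by (intro abs_scale[OF _ s s3]) simp
  then have b3: "\<bar>2 * t * U * s * (if j = 1 then V t else v (j - 1) t)\<bar> \<le> 2 * y * T"
    unfolding y_def by (simp only: mult.assoc)
  have "\<bar>bcoeff \<epsilon> K V t * hcoeff v j t\<bar> \<le> (2 * (\<bar>K\<bar> + \<bar>\<epsilon>\<bar>) / (d * U)) * (Q / 2 * y\<^sup>2)"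
    unfolding abs_mult using bcoeff_bound[OF V t] hb VD(1) U unfolding U_def[symmetric] by (intro mult_mono) auto
  also have "\<dots> = (\<bar>K\<bar> + \<bar>\<epsilon>\<bar>) / d * Q * y * t" unfolding y_def using U VD(1) by (simp add: field_simps power2_eq_square)
  also have "\<dots> \<le> (\<bar>K\<bar> + \<bar>\<epsilon>\<bar>) / d * Q * y * 1" using t y Q0 VD(1) by (intro mult_left_mono) auto
  finally have b4: "\<bar>bcoeff \<epsilon> K V t * hcoeff v j t\<bar> \<le> (\<bar>K\<bar> + \<bar>\<epsilon>\<bar>) / d * Q * y" by simp
  have "\<bar>fcoeff s V v \<rho> k j t\<bar> \<le> 4 * y * Q1 + 2 * y * Q1 + 2 * y * T"
  proof -
    define x1 where "x1 = - 4 * t * U * (\<Sum>i\<in>{1..<j}. \<rho> i * \<rho> (j - i))"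
    define x2 where "x2 = 2 * t * s * (\<Sum>i\<in>{1..<j}. k i * v (j - i) t)"
    define x3 where "x3 = 2 * t * U * s * (if j = 1 then V t else v (j - 1) t)"
    have "fcoeff s V v \<rho> k j t = x1 + x2 - x3" unfolding fcoeff_def x1_def x2_def x3_def U_def ..
    then have "\<bar>fcoeff s V v \<rho> k j t\<bar> \<le> \<bar>x1\<bar> + \<bar>x2\<bar> + \<bar>x3\<bar>" by simp
    then show ?thesis using b1 b2 b3 unfolding x1_def[symmetric] x2_def[symmetric] x3_def[symmetric] by linarith
  qed
  also have "\<dots> \<le> 6 * Q * y" using y T Q by (simp add: algebra_simps)
  finally have fb: "\<bar>fcoeff s V v \<rho> k j t\<bar> \<le> 6 * Q * y" .
  define B where "B = bcoeff \<epsilon> K V t * hcoeff v j t"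
  define c where "c = (\<bar>K\<bar> + \<bar>\<epsilon>\<bar>) / d"
  have "\<bar>fcoeff s V v \<rho> k j t - B\<bar> \<le> \<bar>fcoeff s V v \<rho> k j t\<bar> + \<bar>B\<bar>" by (rule abs_triangle_ineq4)
  also have "\<dots> \<le> 6 * Q * y + c * Q * y" using fb b4 unfolding B_def c_def by (rule add_mono)
  also have "\<dots> = (6 + c) * Q * y" by (simp only: distrib_right)
  finally show "\<bar>fcoeff s V v \<rho> k j t - bcoeff \<epsilon> K V t * hcoeff v j t\<bar> \<le> (6 + (\<bar>K\<bar> + \<bar>\<epsilon>\<bar>) / d) * Q * (t * (1 - t\<^sup>2))"
    unfolding B_def c_def y_def U_def .
qed
lemma small_coeff_step:
  assumes V: "wbranch d \<epsilon> R K V" and e: "\<forall>t\<in>{0<..<1}. \<bar>e t\<bar> \<le> M * (t * (1 - t\<^sup>2))\<^sup>2" "continuous_on {0<..<1} e"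
    and h: "continuous_on {0<..<1} h" "\<And>t. 0 < t \<Longrightarrow> t < 1 \<Longrightarrow> \<bar>h t\<bar> \<le> N * (t * (1 - t\<^sup>2))\<^sup>2"
  shows "small_coeff ((M + N) / d) (\<lambda>t. (e t - h t) / V t)"
  unfolding small_coeff_def
proof (intro conjI ballI)
  note VD = wbranchD[OF V]
  have "V t \<noteq> 0" if "t \<in> {0<..<1}" for t using VD(5)[of t] that by auto
  then show "continuous_on {0<..<1} (\<lambda>t. (e t - h t) / V t)"
    by (intro continuous_intros e h VD(7)) auto
  fix t :: real assume "t \<in> {0<..<1}"
  then have t: "0 < t" "t < 1" by auto
  define y where "y = t * (1 - t\<^sup>2)"
  have y: "0 < y" using one_minus_sq[OF t] t unfolding y_def by simp
  have V0: "0 < d * y" "d * y \<le> V t" using VD(3)[OF t] VD(1) y unfolding y_def by simp_all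
  have eh: "\<bar>e t\<bar> \<le> M * y\<^sup>2" "\<bar>h t\<bar> \<le> N * y\<^sup>2" using e(1) h(2)[OF t] t unfolding y_def by auto
  have "\<bar>e t - h t\<bar> \<le> (M + N) * y\<^sup>2" using eh by (simp add: distrib_right)
  then have "\<bar>e t - h t\<bar> / V t \<le> ((M + N) * y\<^sup>2) / (d * y)" using V0 by (intro frac_le) auto
  also have "\<dots> = (M + N) / d * y" using y by (simp add: power2_eq_square)
  finally show "\<bar>(e t - h t) / V t\<bar> \<le> (M + N) / d * (t * (1 - t\<^sup>2))"
    using V0 unfolding y_def by simp
qed

lemma small_coeff_mono:
  assumes v: "small_coeff M v" and "M \<le> M'"
  shows "small_coeff M' v"
proof -
  have "\<bar>v t\<bar> \<le> M' * (t * (1 - t\<^sup>2))" if "t \<in> {0<..<1}" for t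
  proof -
    have "M * (t * (1 - t\<^sup>2)) \<le> M' * (t * (1 - t\<^sup>2))"
      using that one_minus_sq[of t] \<open>M \<le> M'\<close> by (intro mult_right_mono) auto
    then show ?thesis using v that unfolding small_coeff_def by (metis order_trans)
  qed
  then show ?thesis using v unfolding small_coeff_def by blast
qed

definition branch_eq :: "real \<Rightarrow> real \<Rightarrow> real \<Rightarrow> real \<Rightarrow> (real \<Rightarrow> real) \<Rightarrow> (nat \<Rightarrow> real \<Rightarrow> real) \<Rightarrow> (nat \<Rightarrow> real) \<Rightarrow> (nat \<Rightarrow> real)
    \<Rightarrow> nat \<Rightarrow> (real \<Rightarrow> real) \<Rightarrow> real \<Rightarrow> real \<Rightarrow> bool" where
  "branch_eq s \<epsilon> R K V v \<rho> k j x a b \<longleftrightarrow> (\<forall>t\<in>{0<..<1}. ((\<lambda>t. V t * x t + hcoeff v j t) has_real_derivative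
      2 * t * (K - \<epsilon> * (1 - t\<^sup>2)) * x t + a * (- 2 * t * (1 - t\<^sup>2) * (4 * R - (1 - t\<^sup>2))) + s * b * (2 * t * V t)
        + fcoeff s V v \<rho> k j t) (at t))"

text \<open>Translates a solution of the linear problem back: on the open interval
  \<open>V * ((e - hcoeff) / V) + hcoeff\<close> is just \<open>e\<close>.\<close>

lemma branch_eqI:
  assumes V: "wbranch d \<epsilon> R K V"
    and e: "\<forall>t\<in>{0<..<1}. (e has_real_derivative bcoeff \<epsilon> K V t * e t +
         (a * (- 2 * t * (1 - t\<^sup>2) * (4 * R - (1 - t\<^sup>2))) + (s * b) * (2 * t * V t) + (fcoeff s V v \<rho> k j t - bcoeff \<epsilon> K V t * hcoeff v j t))) (at t)"
  shows "branch_eq s \<epsilon> R K V v \<rho> k j (\<lambda>t. (e t - hcoeff v j t) / V t) a b"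
  unfolding branch_eq_def
proof
  fix t :: real assume t: "t \<in> {0<..<1}"
  have V0: "V t \<noteq> 0" if "t \<in> {0<..<1}" for t using wbranchD(5)[OF V, of t] that by auto
  have gen: "A + (p + q + (r - B)) = X + p + q + r" if "A - B = X" for A B X p q r :: real
    using that by simp
  have ee: "(e has_real_derivative bcoeff \<epsilon> K V t * e t +
         (a * (- 2 * t * (1 - t\<^sup>2) * (4 * R - (1 - t\<^sup>2))) + (s * b) * (2 * t * V t) + (fcoeff s V v \<rho> k j t - bcoeff \<epsilon> K V t * hcoeff v j t))) (at t)"
    using e t by blast
  have "((\<lambda>t. V t * ((e t - hcoeff v j t) / V t) + hcoeff v j t) has_real_derivative bcoeff \<epsilon> K V t * e t +
         (a * (- 2 * t * (1 - t\<^sup>2) * (4 * R - (1 - t\<^sup>2))) + (s * b) * (2 * t * V t) + (fcoeff s V v \<rho> k j t - bcoeff \<epsilon> K V t * hcoeff v j t))) (at t)"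
    by (rule has_field_derivative_transform_within_open[OF ee, of "{0<..<1}"]) (use t V0 in auto)
  moreover have "bcoeff \<epsilon> K V t * e t - bcoeff \<epsilon> K V t * hcoeff v j t = 2 * t * (K - \<epsilon> * (1 - t\<^sup>2)) * ((e t - hcoeff v j t) / V t)"
  proof -
    define c where "c = 2 * t * (K - \<epsilon> * (1 - t\<^sup>2))"
    show ?thesis unfolding bcoeff_def c_def[symmetric] by (simp add: right_diff_distrib diff_divide_distrib)
  qed
  then have "bcoeff \<epsilon> K V t * e t + (a * (- 2 * t * (1 - t\<^sup>2) * (4 * R - (1 - t\<^sup>2))) + (s * b) * (2 * t * V t) + (fcoeff s V v \<rho> k j t - bcoeff \<epsilon> K V t * hcoeff v j t))
    = 2 * t * (K - \<epsilon> * (1 - t\<^sup>2)) * ((e t - hcoeff v j t) / V t) + a * (- 2 * t * (1 - t\<^sup>2) * (4 * R - (1 - t\<^sup>2))) + s * b * (2 * t * V t)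
        + fcoeff s V v \<rho> k j t" by (rule gen)
  ultimately show "((\<lambda>t. V t * ((e t - hcoeff v j t) / V t) + hcoeff v j t) has_real_derivative
      2 * t * (K - \<epsilon> * (1 - t\<^sup>2)) * ((e t - hcoeff v j t) / V t) + a * (- 2 * t * (1 - t\<^sup>2) * (4 * R - (1 - t\<^sup>2))) + s * b * (2 * t * V t)
        + fcoeff s V v \<rho> k j t) (at t)" by (simp only:)
qed

text \<open>One order of the expansion: the linear problem is solved for \<open>e\<close>, then
  \<open>hcoeff\<close> is removed and the result divided by \<open>V\<close>. The constant
  \<open>C\<close> depends on the given loop only, so one majorant serves all orders.\<close>

lemma loop_series_step:
  assumes V: "wbranch d \<epsilon> R K V" and W: "wbranch d (-\<epsilon>) R (-K) W"
  obtains C where "0 < C" "\<And>v w \<rho> k m j. (\<forall>i\<in>{1..<j}. small_coeff (m i) (v i) \<and> small_coeff (m i) (w i) \<and> \<bar>\<rho> i\<bar> \<le> m i \<and> \<bar>k i\<bar> \<le> m i) \<Longrightarrow>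
     0 < j \<Longrightarrow> C * ((\<Sum>i\<in>{1..<j}. m i * m (j - i)) + (if j = 1 then 1 / d else m (j - 1))) \<le> m j \<Longrightarrow>
     \<exists>x y a b. small_coeff (m j) x \<and> small_coeff (m j) y \<and> \<bar>a\<bar> \<le> m j \<and> \<bar>b\<bar> \<le> m j \<and>
       branch_eq 1 \<epsilon> R K V v \<rho> k j x a b \<and> branch_eq (-1) (-\<epsilon>) R (-K) W w \<rho> k j y a b"
proof -
  show thesis
  proof (rule loop_solve[OF V W])
  fix C :: real assume C: "0 < C" and sol: "\<And>F G S. continuous_on {0<..<1} F \<Longrightarrow> continuous_on {0<..<1} G \<Longrightarrow> 0 \<le> S \<Longrightarrow>
      (\<forall>w\<in>{0<..<1}. \<bar>F w\<bar> \<le> S * (w * (1 - w\<^sup>2))) \<Longrightarrow> (\<forall>w\<in>{0<..<1}. \<bar>G w\<bar> \<le> S * (w * (1 - w\<^sup>2))) \<Longrightarrow>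
    (\<exists>e g \<rho> k. \<bar>\<rho>\<bar> \<le> C * S \<and> \<bar>k\<bar> \<le> C * S \<and>
      (\<forall>w\<in>{0<..<1}. \<bar>e w\<bar> \<le> C * S * (w * (1 - w\<^sup>2))\<^sup>2 \<and> \<bar>g w\<bar> \<le> C * S * (w * (1 - w\<^sup>2))\<^sup>2 \<and>
         (e has_real_derivative bcoeff \<epsilon> K V w * e w + (\<rho> * (- 2 * w * (1 - w\<^sup>2) * (4 * R - (1 - w\<^sup>2))) + k * (2 * w * V w) + F w)) (at w) \<and>
         (g has_real_derivative bcoeff (-\<epsilon>) (-K) W w * g w + (\<rho> * (- 2 * w * (1 - w\<^sup>2) * (4 * R - (1 - w\<^sup>2))) + (-k) * (2 * w * W w) + G w)) (at w)))"
  note VD = wbranchD[OF V]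
  define c where "c = 6 + (\<bar>K\<bar> + \<bar>\<epsilon>\<bar>) / d"
  have c: "0 < c" unfolding c_def using VD(1) by (intro add_pos_nonneg) auto
  \<comment> \<open>The first summand bounds the two numbers, the second the quotient by
    \<open>V\<close>; there the \<open>1 / 2\<close> is the constant from the bound on
    \<open>hcoeff\<close>.\<close>
  define C' where "C' = C * c + (C * c + 1 / 2) / d"
  have C': "0 < C'" "C * c \<le> C'" "(C * c + 1 / 2) / d \<le> C'"
  proof -
    have "0 < C * c" using C c by simp
    moreover from this have "0 < (C * c + 1 / 2) / d" using VD(1) by simp
    ultimately show "0 < C'" "C * c \<le> C'" "(C * c + 1 / 2) / d \<le> C'" unfolding C'_def by simp_all
  qed
  show thesis
  proof (rule that[OF C'(1)])
    fix v w :: "nat \<Rightarrow> real \<Rightarrow> real" and \<rho> k m :: "nat \<Rightarrow> real" and j :: nat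
    assume prev: "\<forall>i\<in>{1..<j}. small_coeff (m i) (v i) \<and> small_coeff (m i) (w i) \<and> \<bar>\<rho> i\<bar> \<le> m i \<and> \<bar>k i\<bar> \<le> m i"
      and j: "0 < j" and mj: "C' * ((\<Sum>i\<in>{1..<j}. m i * m (j - i)) + (if j = 1 then 1 / d else m (j - 1))) \<le> m j"
    define Q where "Q = (\<Sum>i\<in>{1..<j}. m i * m (j - i)) + (if j = 1 then 1 / d else m (j - 1))"
    have p1: "small_coeff (m i) (v i)" and p2: "small_coeff (m i) (w i)" and p3: "\<bar>\<rho> i\<bar> \<le> m i \<and> \<bar>k i\<bar> \<le> m i" if "i \<in> {1..<j}" for i
      using prev that by blast+
    have s: "\<bar>1\<bar> = (1::real)" "\<bar>- 1\<bar> = (1::real)" by simp_all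
    note fV = forcing_bound[OF V s(1) p1 p3 j Q_def] and fW = forcing_bound[OF W s(2) p2 p3 j Q_def]
    have cc: "6 + (\<bar>- K\<bar> + \<bar>- \<epsilon>\<bar>) / d = c" unfolding c_def by simp
    have Q0: "0 \<le> c * Q" using fV(3) c by simp
    have ac: "continuous_on {0<..<1} (bcoeff \<epsilon> K V)" "continuous_on {0<..<1} (bcoeff (-\<epsilon>) (-K) W)"
      using bcoeff_continuous[OF V] bcoeff_continuous[OF W] by blast+
    have F1: "continuous_on {0<..<1} (\<lambda>t. fcoeff 1 V v \<rho> k j t - bcoeff \<epsilon> K V t * hcoeff v j t)"
      by (intro continuous_intros fV ac)
    have G1: "continuous_on {0<..<1} (\<lambda>t. fcoeff (-1) W w \<rho> k j t - bcoeff (-\<epsilon>) (-K) W t * hcoeff w j t)"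
      by (intro continuous_intros fW ac)
    have F2: "\<forall>t\<in>{0<..<1}. \<bar>fcoeff 1 V v \<rho> k j t - bcoeff \<epsilon> K V t * hcoeff v j t\<bar> \<le> (c * Q) * (t * (1 - t\<^sup>2))"
      using fV(5) unfolding c_def by auto
    have G2: "\<forall>t\<in>{0<..<1}. \<bar>fcoeff (-1) W w \<rho> k j t - bcoeff (-\<epsilon>) (-K) W t * hcoeff w j t\<bar> \<le> (c * Q) * (t * (1 - t\<^sup>2))"
      using fW(5) unfolding cc by auto
    from sol[OF F1 G1 Q0 F2 G2] obtain e g a b where ab: "\<bar>a\<bar> \<le> C * (c * Q)" "\<bar>b\<bar> \<le> C * (c * Q)"
      and eg: "\<forall>t\<in>{0<..<1}. \<bar>e t\<bar> \<le> C * (c * Q) * (t * (1 - t\<^sup>2))\<^sup>2" "\<forall>t\<in>{0<..<1}. \<bar>g t\<bar> \<le> C * (c * Q) * (t * (1 - t\<^sup>2))\<^sup>2"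
      and e: "\<forall>t\<in>{0<..<1}. (e has_real_derivative bcoeff \<epsilon> K V t * e t +
         (a * (- 2 * t * (1 - t\<^sup>2) * (4 * R - (1 - t\<^sup>2))) + b * (2 * t * V t) + (fcoeff 1 V v \<rho> k j t - bcoeff \<epsilon> K V t * hcoeff v j t))) (at t)"
      and g: "\<forall>t\<in>{0<..<1}. (g has_real_derivative bcoeff (-\<epsilon>) (-K) W t * g t +
         (a * (- 2 * t * (1 - t\<^sup>2) * (4 * R - (1 - t\<^sup>2))) + (-b) * (2 * t * W t) + (fcoeff (-1) W w \<rho> k j t - bcoeff (-\<epsilon>) (-K) W t * hcoeff w j t))) (at t)"
      by blast
    define x where "x = (\<lambda>t. (e t - hcoeff v j t) / V t)"
    define y where "y = (\<lambda>t. (g t - hcoeff w j t) / W t)"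
    have "C * c * Q \<le> C' * Q" using C' fV(3) by (intro mult_right_mono) auto
    then have le1: "C * (c * Q) \<le> m j" using mj unfolding Q_def[symmetric] by simp
    have "(C * c + 1 / 2) / d * Q \<le> C' * Q" using C' fV(3) by (intro mult_right_mono) auto
    moreover have "(C * (c * Q) + Q / 2) / d = (C * c + 1 / 2) / d * Q" by (simp add: algebra_simps)
    ultimately have le2: "(C * (c * Q) + Q / 2) / d \<le> m j" using mj unfolding Q_def[symmetric] by (simp only: order_trans)
    have ec: "continuous_on {0<..<1} e" "continuous_on {0<..<1} g"
      using e g by (intro continuous_at_imp_continuous_on ballI, blast intro: DERIV_isCont)+
    have "small_coeff (m j) x" unfolding x_def
      by (rule small_coeff_mono[OF small_coeff_step[OF V eg(1) ec(1) fV(1,4)] le2])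
    moreover have "small_coeff (m j) y" unfolding y_def
      by (rule small_coeff_mono[OF small_coeff_step[OF W eg(2) ec(2) fW(1,4)] le2])
    moreover have "branch_eq 1 \<epsilon> R K V v \<rho> k j x a b" unfolding x_def by (rule branch_eqI[OF V]) (use e in simp)
    moreover have "branch_eq (-1) (-\<epsilon>) R (-K) W w \<rho> k j y a b" unfolding y_def by (rule branch_eqI[OF W]) (use g in simp)
    ultimately show "\<exists>x y a b. small_coeff (m j) x \<and> small_coeff (m j) y \<and> \<bar>a\<bar> \<le> m j \<and> \<bar>b\<bar> \<le> m j \<and>
       branch_eq 1 \<epsilon> R K V v \<rho> k j x a b \<and> branch_eq (-1) (-\<epsilon>) R (-K) W w \<rho> k j y a b"
      using order_trans[OF ab(1) le1] order_trans[OF ab(2) le1] by blast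
  qed
  qed
qed

text \<open>The equation of order \<open>j\<close> involves only data of smaller positive order,
  which is what well-founded recursion over \<open>j\<close> requires.\<close>

lemma branch_eq_cong:
  assumes "\<And>i. i \<in> {1..<j} \<Longrightarrow> v i = v' i \<and> \<rho> i = \<rho>' i \<and> k i = k' i" and "0 < j"
  shows "branch_eq s \<epsilon> R K V v \<rho> k j x a b = branch_eq s \<epsilon> R K V v' \<rho>' k' j x a b"
proof -
  have ji: "v (j - i) = v' (j - i)" "\<rho> (j - i) = \<rho>' (j - i)" if "i \<in> {1..<j}" for i
    using assms(1)[of "j - i"] that by auto
  have "hcoeff v j = hcoeff v' j" unfolding hcoeff_def
    by (intro ext arg_cong2[where f = "(/)"] sum.cong refl) (simp add: assms(1) ji)
  moreover have "fcoeff s V v \<rho> k j t = fcoeff s V v' \<rho>' k' j t" for t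
  proof -
    have 1: "(\<Sum>i\<in>{1..<j}. \<rho> i * \<rho> (j - i)) = (\<Sum>i\<in>{1..<j}. \<rho>' i * \<rho>' (j - i))"
      by (intro sum.cong refl) (simp add: assms(1) ji)
    have 2: "(\<Sum>i\<in>{1..<j}. k i * v (j - i) t) = (\<Sum>i\<in>{1..<j}. k' i * v' (j - i) t)"
      by (intro sum.cong refl) (simp add: assms(1) ji)
    have 3: "(if j = 1 then V t else v (j - 1) t) = (if j = 1 then V t else v' (j - 1) t)"
      using assms(1)[of "j - 1"] \<open>0 < j\<close> by auto
    show ?thesis unfolding fcoeff_def 1 2 3 ..
  qed
  ultimately show ?thesis unfolding branch_eq_def by simp
qed
definition dcoeff :: "real \<Rightarrow> real \<Rightarrow> real \<Rightarrow> real \<Rightarrow> (real \<Rightarrow> real) \<Rightarrow> (nat \<Rightarrow> real \<Rightarrow> real) \<Rightarrow> (nat \<Rightarrow> real) \<Rightarrow> (nat \<Rightarrow> real)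
    \<Rightarrow> nat \<Rightarrow> real \<Rightarrow> real" where
  "dcoeff s \<epsilon> R K V v \<rho> k j t = 2 * t * (K - \<epsilon> * (1 - t\<^sup>2)) * v j t + \<rho> j * (- 2 * t * (1 - t\<^sup>2) * (4 * R - (1 - t\<^sup>2))) + s * k j * (2 * t * V t)
        + fcoeff s V v \<rho> k j t"

text \<open>The derivatives of \<open>V * v j + hcoeff v j\<close> obey the same majorant up to a
  factor, uniformly in \<open>t\<close>; this permits termwise differentiation of the
  series.\<close>

lemma dcoeff_bound:
  fixes v :: "nat \<Rightarrow> real \<Rightarrow> real" and m \<rho> k :: "nat \<Rightarrow> real"
  assumes V: "wbranch d \<epsilon> R K V" and s: "\<bar>s\<bar> = 1"
    and v: "\<And>i. 0 < i \<Longrightarrow> small_coeff (m i) (v i)"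
    and r: "\<And>i. 0 < i \<Longrightarrow> \<bar>\<rho> i\<bar> \<le> m i \<and> \<bar>k i\<bar> \<le> m i"
    and j: "0 < j" and C: "0 < C" "C * ((\<Sum>i\<in>{1..<j}. m i * m (j - i)) + (if j = 1 then 1 / d else m (j - 1))) \<le> m j"
    and t: "0 < t" "t < 1"
  shows "\<bar>dcoeff s \<epsilon> R K V v \<rho> k j t\<bar> \<le> (2 * (\<bar>K\<bar> + \<bar>\<epsilon>\<bar>) + 2 * (4 * R + 1) + 2 / d + 2 * (6 + (\<bar>K\<bar> + \<bar>\<epsilon>\<bar>) / d) / C) * m j"
proof -
  note VD = wbranchD[OF V]
  define Q where "Q = (\<Sum>i\<in>{1..<j}. m i * m (j - i)) + (if j = 1 then 1 / d else m (j - 1))"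
  have p1: "small_coeff (m i) (v i)" and p3: "\<bar>\<rho> i\<bar> \<le> m i \<and> \<bar>k i\<bar> \<le> m i" if "i \<in> {1..<j}" for i
    using v[of i] r[of i] that by auto
  note f = forcing_bound[OF V s p1 p3 j Q_def]
  have mj: "0 \<le> m j" using r[OF j] by linarith
  have Q: "0 \<le> Q" "Q \<le> m j / C" using f(3) C unfolding Q_def[symmetric] by (auto simp: field_simps)
  define U where "U = 1 - t\<^sup>2"
  have U: "0 < U" "U \<le> 1" using one_minus_sq[OF t] unfolding U_def by auto
  define y where "y = t * U"
  have y: "0 < y" "y \<le> t" "y \<le> U" "y \<le> 1" unfolding y_def using t U by (auto simp: mult_le_cancel_left1 mult_le_one mult_le_cancel_right1)
  define c where "c = \<bar>K\<bar> + \<bar>\<epsilon>\<bar>"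
  have c: "0 \<le> c" unfolding c_def by simp
  have vj: "\<bar>v j t\<bar> \<le> m j"
  proof -
    have "m j * y \<le> m j * 1" using mj y by (intro mult_left_mono) auto
    then show ?thesis using v[OF j] t unfolding small_coeff_def y_def U_def by force
  qed
  have "\<bar>2 * t * (K - \<epsilon> * U) * v j t\<bar> = (2 * t) * (\<bar>K - \<epsilon> * U\<bar> * \<bar>v j t\<bar>)" using t by (simp add: abs_mult)
  also have "\<dots> \<le> 2 * (c * m j)" using t c mj vj damping_bound[OF t, of K \<epsilon>] unfolding c_def U_def
    by (intro mult_mono) auto
  finally have b1: "\<bar>2 * t * (K - \<epsilon> * U) * v j t\<bar> \<le> 2 * c * m j" by simp
  have "\<bar>\<rho> j * (- 2 * t * U * (4 * R - U))\<bar> = \<bar>\<rho> j\<bar> * ((2 * y) * \<bar>4 * R - U\<bar>)" unfolding y_def using t U by (simp add: abs_mult)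
  also have "\<dots> \<le> m j * ((2 * 1) * (4 * R + 1))"
    using r[OF j] y U VD(2) mj by (intro mult_mono mult_nonneg_nonneg) auto
  finally have b2: "\<bar>\<rho> j * (- 2 * t * U * (4 * R - U))\<bar> \<le> 2 * (4 * R + 1) * m j" by (simp only: mult_ac mult_1_right)
  have Vt: "0 < V t" "V t \<le> 1 / d"
  proof -
    show "0 < V t" using VD(5)[OF t] .
    have "y / d \<le> 1 / d" using y VD(1) by (intro divide_right_mono) auto
    then show "V t \<le> 1 / d" using VD(4)[OF t] unfolding y_def U_def by linarith
  qed
  have "\<bar>s * k j * (2 * t * V t)\<bar> = \<bar>k j\<bar> * ((2 * t) * V t)" using t s Vt by (simp add: abs_mult)
  also have "\<dots> \<le> m j * ((2 * 1) * (1 / d))" using r[OF j] t Vt mj by (intro mult_mono mult_nonneg_nonneg) auto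
  finally have b3: "\<bar>s * k j * (2 * t * V t)\<bar> \<le> 2 / d * m j" by (simp add: mult.commute)
  have "\<bar>bcoeff \<epsilon> K V t * hcoeff v j t\<bar> \<le> (2 * c / (d * U)) * (Q / 2 * y\<^sup>2)"
    unfolding abs_mult using bcoeff_bound[OF V t] f(4)[OF _ _ t] VD(1) U c unfolding U_def[symmetric] y_def c_def by (intro mult_mono) auto
  also have "\<dots> = c / d * Q * (y * t)" unfolding y_def using U VD(1) by (simp add: field_simps power2_eq_square)
  also have "\<dots> \<le> c / d * Q * (1 * 1)" using t y Q c VD(1) by (intro mult_left_mono mult_mono) auto
  finally have h1: "\<bar>bcoeff \<epsilon> K V t * hcoeff v j t\<bar> \<le> c / d * Q" by simp
  have "\<bar>fcoeff s V v \<rho> k j t - bcoeff \<epsilon> K V t * hcoeff v j t\<bar> \<le> (6 + c / d) * Q * y"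
    using f(5)[OF _ _ t] unfolding y_def U_def c_def by blast
  also have "\<dots> \<le> (6 + c / d) * Q * 1" using y Q c VD(1) by (intro mult_left_mono) auto
  finally have h2: "\<bar>fcoeff s V v \<rho> k j t - bcoeff \<epsilon> K V t * hcoeff v j t\<bar> \<le> (6 + c / d) * Q" by simp
  have "c / d * Q \<le> (6 + c / d) * Q" using Q by (intro mult_right_mono) auto
  then have "\<bar>fcoeff s V v \<rho> k j t\<bar> \<le> 2 * (6 + c / d) * Q" using h1 h2 by linarith
  also have "\<dots> \<le> 2 * (6 + c / d) * (m j / C)" using Q c VD(1) by (intro mult_left_mono) auto
  finally have b4: "\<bar>fcoeff s V v \<rho> k j t\<bar> \<le> 2 * (6 + c / d) / C * m j" by simp
  have "\<bar>dcoeff s \<epsilon> R K V v \<rho> k j t\<bar> \<le> 2 * c * m j + 2 * (4 * R + 1) * m j + 2 / d * m j + 2 * (6 + c / d) / C * m j"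
    unfolding dcoeff_def U_def[symmetric]
    by (intro order_trans[OF abs_triangle_ineq] add_mono b1 b2 b3 b4)
  also have "\<dots> = (2 * c + 2 * (4 * R + 1) + 2 / d + 2 * (6 + c / d) / C) * m j" by (simp only: distrib_right)
  finally show ?thesis unfolding c_def .
qed

lemma loop_series:
  assumes V: "wbranch d \<epsilon> R K V" and W: "wbranch d (-\<epsilon>) R (-K) W"
  obtains N r v w \<rho> k where "0 < N" "0 < r" "v 0 = (\<lambda>_. 0)" "w 0 = (\<lambda>_. 0)" "\<rho> 0 = 0" "k 0 = 0"
    "\<And>j. small_coeff (N * r ^ j) (v j)" "\<And>j. small_coeff (N * r ^ j) (w j)" "\<And>j. \<bar>\<rho> j\<bar> \<le> N * r ^ j" "\<And>j. \<bar>k j\<bar> \<le> N * r ^ j"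
    "\<And>j t. 0 < t \<Longrightarrow> t < 1 \<Longrightarrow> ((\<lambda>t. V t * v j t + hcoeff v j t) has_real_derivative dcoeff 1 \<epsilon> R K V v \<rho> k j t) (at t)"
    "\<And>j t. 0 < t \<Longrightarrow> t < 1 \<Longrightarrow> ((\<lambda>t. W t * w j t + hcoeff w j t) has_real_derivative dcoeff (-1) (-\<epsilon>) R (-K) W w \<rho> k j t) (at t)"
    "\<And>j t. 0 < t \<Longrightarrow> t < 1 \<Longrightarrow> \<bar>dcoeff 1 \<epsilon> R K V v \<rho> k j t\<bar> \<le> N * r ^ j"
    "\<And>j t. 0 < t \<Longrightarrow> t < 1 \<Longrightarrow> \<bar>dcoeff (-1) (-\<epsilon>) R (-K) W w \<rho> k j t\<bar> \<le> N * r ^ j"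
proof (rule loop_series_step[OF V W])
  fix C :: real
  assume C: "0 < C" and step: "\<And>v w \<rho> k m j. (\<forall>i\<in>{1..<j}. small_coeff (m i) (v i) \<and> small_coeff (m i) (w i) \<and> \<bar>\<rho> i\<bar> \<le> m i \<and> \<bar>k i\<bar> \<le> m i) \<Longrightarrow>
     0 < j \<Longrightarrow> C * ((\<Sum>i\<in>{1..<j}. m i * m (j - i)) + (if j = 1 then 1 / d else m (j - 1))) \<le> m j \<Longrightarrow>
     \<exists>x y a b. small_coeff (m j) x \<and> small_coeff (m j) y \<and> \<bar>a\<bar> \<le> m j \<and> \<bar>b\<bar> \<le> m j \<and>
       branch_eq 1 \<epsilon> R K V v \<rho> k j x a b \<and> branch_eq (-1) (-\<epsilon>) R (-K) W w \<rho> k j y a b"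
  note VD = wbranchD[OF V]
  obtain A r where A: "0 < A" and r: "0 < r" and maj: "\<And>j. 0 < j \<Longrightarrow>
     C * ((\<Sum>i\<in>{1..<j}. majorant A r i * majorant A r (j - i)) + (if j = 1 then 1 / d else majorant A r (j - 1))) \<le> majorant A r j"
    using majorant_step[OF C VD(1)] by blast
  define m where "m = majorant A r"
  \<comment> \<open>The state at \<open>j\<close> is the tuple of the two function coefficients
    followed by those of \<open>R\<close> and \<open>K\<close>. At index 0 nothing is required; the
    entries there are replaced by zero afterwards.\<close>
  define P where "P = (\<lambda>f (j::nat) s. (\<lambda>(x, y, a, b). 0 < j \<longrightarrow> small_coeff (m j) x \<and> small_coeff (m j) y \<and> \<bar>a\<bar> \<le> m j \<and> \<bar>b\<bar> \<le> m j \<and>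
       branch_eq 1 \<epsilon> R K V (\<lambda>i. fst (f i)) (\<lambda>i. fst (snd (snd (f i)))) (\<lambda>i. snd (snd (snd (f i)))) j x a b \<and>
       branch_eq (-1) (-\<epsilon>) R (-K) W (\<lambda>i. fst (snd (f i))) (\<lambda>i. fst (snd (snd (f i)))) (\<lambda>i. snd (snd (snd (f i)))) j y a b) s)"
  have "\<exists>f. \<forall>j. P f j (f j)"
  proof (rule dependent_wf_choice[of less_than P])
    show "wf less_than" by simp
    show "P f j s = P g j s" if "\<And>z. (z, j) \<in> less_than \<Longrightarrow> f z = g z" for f g j s
    proof (cases "0 < j")
      case True
      then show ?thesis unfolding P_def split_beta
        by (intro arg_cong2[where f = "(\<longrightarrow>)"] arg_cong2[where f = "(\<and>)"] refl branch_eq_cong) (use that in auto)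
    qed (simp add: P_def split_beta)
    show "\<exists>s. P f j s" if *: "\<And>i. (i, j) \<in> less_than \<Longrightarrow> P f i (f i)" for j f
    proof (cases "0 < j")
      case True
      have "\<forall>i\<in>{1..<j}. small_coeff (m i) (fst (f i)) \<and> small_coeff (m i) (fst (snd (f i))) \<and> \<bar>fst (snd (snd (f i)))\<bar> \<le> m i \<and> \<bar>snd (snd (snd (f i)))\<bar> \<le> m i"
        using * unfolding P_def split_beta by auto
      from step[OF this True maj[OF True, folded m_def]] show ?thesis unfolding P_def by auto
    qed (auto simp: P_def)
  qed
  then obtain f where f: "\<And>j. P f j (f j)" by blast
  define v where "v = (\<lambda>j. if j = 0 then (\<lambda>_. 0) else fst (f j))"
  define w where "w = (\<lambda>j. if j = 0 then (\<lambda>_. 0) else fst (snd (f j)))"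
  define \<rho> where "\<rho> = (\<lambda>j. if j = 0 then 0 else fst (snd (snd (f j))))"
  define k where "k = (\<lambda>j. if j = 0 then 0 else snd (snd (snd (f j))))"
  have all: "small_coeff (m j) (v j)" "small_coeff (m j) (w j)" "\<bar>\<rho> j\<bar> \<le> m j" "\<bar>k j\<bar> \<le> m j"
       "branch_eq 1 \<epsilon> R K V v \<rho> k j (v j) (\<rho> j) (k j)" "branch_eq (-1) (-\<epsilon>) R (-K) W w \<rho> k j (w j) (\<rho> j) (k j)" if "0 < j" for j
  proof -
    note Pj = f[of j, unfolded P_def split_beta, rule_format, OF that]
    show "small_coeff (m j) (v j)" "small_coeff (m j) (w j)" "\<bar>\<rho> j\<bar> \<le> m j" "\<bar>k j\<bar> \<le> m j"
      using Pj that unfolding v_def w_def \<rho>_def k_def by auto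
    have "branch_eq 1 \<epsilon> R K V v \<rho> k j (v j) (\<rho> j) (k j) = branch_eq 1 \<epsilon> R K V (\<lambda>i. fst (f i)) (\<lambda>i. fst (snd (snd (f i)))) (\<lambda>i. snd (snd (snd (f i)))) j (v j) (\<rho> j) (k j)"
      by (rule branch_eq_cong[OF _ that]) (auto simp: v_def w_def \<rho>_def k_def)
    then show "branch_eq 1 \<epsilon> R K V v \<rho> k j (v j) (\<rho> j) (k j)" using Pj that unfolding v_def w_def \<rho>_def k_def by simp
    have "branch_eq (-1) (-\<epsilon>) R (-K) W w \<rho> k j (w j) (\<rho> j) (k j) = branch_eq (-1) (-\<epsilon>) R (-K) W (\<lambda>i. fst (snd (f i))) (\<lambda>i. fst (snd (snd (f i)))) (\<lambda>i. snd (snd (snd (f i)))) j (w j) (\<rho> j) (k j)"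
      by (rule branch_eq_cong[OF _ that]) (auto simp: v_def w_def \<rho>_def k_def)
    then show "branch_eq (-1) (-\<epsilon>) R (-K) W w \<rho> k j (w j) (\<rho> j) (k j)" using Pj that unfolding v_def w_def \<rho>_def k_def by simp
  qed
  \<comment> \<open>The summand 1 ensures \<open>1 \<le> L\<close>, so that \<open>N\<close> bounds
    the coefficients as well as the derivatives.\<close>
  define L where "L = 2 * (\<bar>K\<bar> + \<bar>\<epsilon>\<bar>) + 2 * (4 * R + 1) + 2 / d + 2 * (6 + (\<bar>K\<bar> + \<bar>\<epsilon>\<bar>) / d) / C + 1"
  have L: "1 \<le> L" unfolding L_def using C VD(1,2) by (simp add: add_nonneg_nonneg)
  define N where "N = L * A"
  have mN: "m j \<le> N * r ^ j" "L * m j \<le> N * r ^ j" "0 \<le> m j" if "0 < j" for j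
  proof -
    have mj: "m j \<le> A * r ^ j" "0 \<le> m j" unfolding m_def using majorant_le[OF _ _ that] majorant_nonneg A r by auto
    then show "0 \<le> m j" by simp
    have "L * m j \<le> L * (A * r ^ j)" using mj L by (intro mult_left_mono) auto
    then show 1: "L * m j \<le> N * r ^ j" unfolding N_def by simp
    have "1 * m j \<le> L * m j" using L mj by (intro mult_right_mono) auto
    then show "m j \<le> N * r ^ j" using 1 by simp
  qed
  have N: "0 < N" unfolding N_def using L A by simp
  have Nr: "0 \<le> N * r ^ j" for j using N r by simp
  have v0: "v 0 = (\<lambda>_. 0)" "w 0 = (\<lambda>_. 0)" "\<rho> 0 = 0" "k 0 = 0" unfolding v_def w_def \<rho>_def k_def by auto
  have sc0: "small_coeff (N * r ^ 0) (\<lambda>_. 0)" unfolding small_coeff_def using N one_minus_sq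
    by (auto intro!: mult_nonneg_nonneg less_imp_le)
  have h0: "hcoeff v 0 = (\<lambda>_. 0)" "hcoeff w 0 = (\<lambda>_. 0)" by (auto simp: hcoeff_def fun_eq_iff)
  have d0: "dcoeff 1 \<epsilon> R K V v \<rho> k 0 t = 0" "dcoeff (-1) (-\<epsilon>) R (-K) W w \<rho> k 0 t = 0" for t
    unfolding dcoeff_def fcoeff_def by (auto simp: v0)
  show thesis
  proof (rule that[where v = v and w = w and \<rho> = \<rho> and k = k and N = N and r = r, OF N r v0])
    fix j
    show "small_coeff (N * r ^ j) (v j)" "small_coeff (N * r ^ j) (w j)" "\<bar>\<rho> j\<bar> \<le> N * r ^ j" "\<bar>k j\<bar> \<le> N * r ^ j"
    proof -
      have "small_coeff (N * r ^ j) (v j) \<and> small_coeff (N * r ^ j) (w j) \<and> \<bar>\<rho> j\<bar> \<le> N * r ^ j \<and> \<bar>k j\<bar> \<le> N * r ^ j"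
      proof (cases "j = 0")
        case True
        then show ?thesis using sc0 Nr[of 0] by (simp add: v0)
      next
        case False
        then have j: "0 < j" by simp
        show ?thesis using small_coeff_mono[OF all(1)[OF j] mN(1)[OF j]] small_coeff_mono[OF all(2)[OF j] mN(1)[OF j]]
            order_trans[OF all(3)[OF j] mN(1)[OF j]] order_trans[OF all(4)[OF j] mN(1)[OF j]] by blast
      qed
      then show "small_coeff (N * r ^ j) (v j)" "small_coeff (N * r ^ j) (w j)" "\<bar>\<rho> j\<bar> \<le> N * r ^ j" "\<bar>k j\<bar> \<le> N * r ^ j"
        by blast+
    qed
    fix t :: real assume t: "0 < t" "t < 1"
    show "((\<lambda>t. V t * v j t + hcoeff v j t) has_real_derivative dcoeff 1 \<epsilon> R K V v \<rho> k j t) (at t)"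
    proof (cases "j = 0")
      case True then show ?thesis by (simp add: d0 h0 v0)
    next
      case False then show ?thesis using all(5)[of j] t unfolding branch_eq_def dcoeff_def by auto
    qed
    show "((\<lambda>t. W t * w j t + hcoeff w j t) has_real_derivative dcoeff (-1) (-\<epsilon>) R (-K) W w \<rho> k j t) (at t)"
    proof (cases "j = 0")
      case True then show ?thesis by (simp add: d0 h0 v0)
    next
      case False then show ?thesis using all(6)[of j] t unfolding branch_eq_def dcoeff_def by auto
    qed
    have s: "\<bar>1\<bar> = (1::real)" "\<bar>- 1\<bar> = (1::real)" by simp_all
    have rr: "\<bar>\<rho> i\<bar> \<le> m i \<and> \<bar>k i\<bar> \<le> m i" if "0 < i" for i using all[OF that] by blast
    have Lm: "(L - 1) * m j \<le> N * r ^ j" if "0 < j" using mN[OF that] by (simp add: algebra_simps)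
    have Leq: "2 * (\<bar>K\<bar> + \<bar>\<epsilon>\<bar>) + 2 * (4 * R + 1) + 2 / d + 2 * (6 + (\<bar>K\<bar> + \<bar>\<epsilon>\<bar>) / d) / C = L - 1"
      "2 * (\<bar>-K\<bar> + \<bar>-\<epsilon>\<bar>) + 2 * (4 * R + 1) + 2 / d + 2 * (6 + (\<bar>-K\<bar> + \<bar>-\<epsilon>\<bar>) / d) / C = L - 1"
      unfolding L_def by simp_all
    show "\<bar>dcoeff 1 \<epsilon> R K V v \<rho> k j t\<bar> \<le> N * r ^ j"
    proof (cases "j = 0")
      case True then show ?thesis using d0 Nr[of 0] by simp
    next
      case False then show ?thesis
        using dcoeff_bound[OF V s(1) all(1) rr _ C maj[folded m_def] t, of j, unfolded Leq] Lm by linarith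
    qed
    show "\<bar>dcoeff (-1) (-\<epsilon>) R (-K) W w \<rho> k j t\<bar> \<le> N * r ^ j"
    proof (cases "j = 0")
      case True then show ?thesis using d0 Nr[of 0] by simp
    next
      case False then show ?thesis
        using dcoeff_bound[OF W s(2) all(2) rr _ C maj[folded m_def] t, of j, unfolded Leq] Lm by linarith
    qed
  qed
qed

section \<open>Summation of the series\<close>

lemma power_series_bound:
  fixes a :: "nat \<Rightarrow> real"
  assumes a: "\<And>j. \<bar>a j\<bar> \<le> N * r ^ j" and "0 \<le> r" and x: "\<bar>x\<bar> * r < 1"
  shows "summable (\<lambda>j. norm (x ^ j * a j))" "summable (\<lambda>j. x ^ j * a j)"
proof -
  have g: "summable (\<lambda>j. N * (\<bar>x\<bar> * r) ^ j)"
    using x \<open>0 \<le> r\<close> by (intro summable_mult summable_geometric) (auto simp: abs_mult)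
  have "norm (x ^ j * a j) \<le> N * (\<bar>x\<bar> * r) ^ j" for j
  proof -
    have "norm (x ^ j * a j) = \<bar>x\<bar> ^ j * \<bar>a j\<bar>" by (simp add: abs_mult power_abs)
    also have "\<dots> \<le> \<bar>x\<bar> ^ j * (N * r ^ j)" using a by (intro mult_left_mono) auto
    finally show ?thesis by (simp add: power_mult_distrib mult_ac)
  qed
  then show "summable (\<lambda>j. norm (x ^ j * a j))" by (intro summable_comparison_test'[OF g, of 0]) auto
  then show "summable (\<lambda>j. x ^ j * a j)" by (rule summable_norm_cancel)
qed

lemma power_series_tail_bound:
  fixes a :: "nat \<Rightarrow> real"
  assumes a: "\<And>j. \<bar>a j\<bar> \<le> N * r ^ j" "a 0 = 0" and "0 \<le> r" and x: "\<bar>x\<bar> * r \<le> 1 / 2"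
  shows "\<bar>\<Sum>j. x ^ j * a j\<bar> \<le> 2 * N * (\<bar>x\<bar> * r)"
proof -
  have x1: "\<bar>x\<bar> * r < 1" using x by linarith
  note s = power_series_bound[OF a(1) \<open>0 \<le> r\<close> x1]
  have "(\<Sum>j. x ^ j * a j) = (\<Sum>j. x ^ Suc j * a (Suc j))"
    using suminf_split_head[OF s(2)] a(2) by simp
  also have "norm \<dots> \<le> (\<Sum>j. norm (x ^ Suc j * a (Suc j)))"
    using s(1) summable_Suc_iff[of "\<lambda>j. norm (x ^ j * a j)"] by (intro summable_norm) simp
  also have "\<dots> \<le> (\<Sum>j. N * (\<bar>x\<bar> * r) * (\<bar>x\<bar> * r) ^ j)"
  proof (rule suminf_le)
    fix j
    have "norm (x ^ Suc j * a (Suc j)) = \<bar>x\<bar> ^ Suc j * \<bar>a (Suc j)\<bar>" by (simp add: abs_mult power_abs)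
    also have "\<dots> \<le> \<bar>x\<bar> ^ Suc j * (N * r ^ Suc j)" using a(1)[of "Suc j"] by (intro mult_left_mono) auto
    finally show "norm (x ^ Suc j * a (Suc j)) \<le> N * (\<bar>x\<bar> * r) * (\<bar>x\<bar> * r) ^ j" by (simp add: power_mult_distrib mult_ac)
  next
    show "summable (\<lambda>j. norm (x ^ Suc j * a (Suc j)))"
      using s(1) summable_Suc_iff[of "\<lambda>j. norm (x ^ j * a j)"] by simp
    show "summable (\<lambda>j. N * (\<bar>x\<bar> * r) * (\<bar>x\<bar> * r) ^ j)"
      using x1 \<open>0 \<le> r\<close> by (intro summable_mult summable_geometric) (auto simp: abs_mult)
  qed
  also have "\<dots> = N * (\<bar>x\<bar> * r) * (1 / (1 - \<bar>x\<bar> * r))"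
    using x1 \<open>0 \<le> r\<close> by (subst suminf_mult) (auto intro!: summable_geometric simp: suminf_geometric abs_mult)
  also have "\<dots> \<le> N * (\<bar>x\<bar> * r) * 2"
  proof (intro mult_left_mono)
    show "1 / (1 - \<bar>x\<bar> * r) \<le> 2" using x by (simp add: divide_le_eq)
    have "0 \<le> N" using a(1)[of 0] by simp
    then show "0 \<le> N * (\<bar>x\<bar> * r)" using \<open>0 \<le> r\<close> by simp
  qed
  finally show ?thesis by (simp add: mult_ac)
qed

text \<open>Both series start at order 1, so the end terms of the Cauchy product vanish; this gives
  the index range used in \<open>hcoeff\<close> and \<open>fcoeff\<close>.\<close>

lemma power_series_convolution:
  fixes a b :: "nat \<Rightarrow> real"
  assumes a: "\<And>j. \<bar>a j\<bar> \<le> N * r ^ j" "a 0 = 0" and b: "\<And>j. \<bar>b j\<bar> \<le> M * r ^ j" "b 0 = 0"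
    and "0 \<le> r" and x: "\<bar>x\<bar> * r < 1"
  shows "(\<lambda>j. x ^ j * (\<Sum>i\<in>{1..<j}. a i * b (j - i))) sums ((\<Sum>j. x ^ j * a j) * (\<Sum>j. x ^ j * b j))"
proof -
  have "(\<lambda>j. \<Sum>i\<le>j. (x ^ i * a i) * (x ^ (j - i) * b (j - i))) sums ((\<Sum>j. x ^ j * a j) * (\<Sum>j. x ^ j * b j))"
    by (intro Cauchy_product_sums power_series_bound[OF a(1) \<open>0 \<le> r\<close> x] power_series_bound[OF b(1) \<open>0 \<le> r\<close> x])
  moreover have "(\<Sum>i\<le>j. (x ^ i * a i) * (x ^ (j - i) * b (j - i))) = x ^ j * (\<Sum>i\<in>{1..<j}. a i * b (j - i))" for j
  proof -
    have "(\<Sum>i\<le>j. (x ^ i * a i) * (x ^ (j - i) * b (j - i))) = (\<Sum>i\<in>{1..<j}. (x ^ i * a i) * (x ^ (j - i) * b (j - i)))"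
    proof (rule sum.mono_neutral_right)
      show "\<forall>i\<in>{..j} - {1..<j}. (x ^ i * a i) * (x ^ (j - i) * b (j - i)) = 0"
      proof
        fix i assume "i \<in> {..j} - {1..<j}"
        then have "i = 0 \<or> i = j" by auto
        then show "(x ^ i * a i) * (x ^ (j - i) * b (j - i)) = 0" using a b by auto
      qed
    qed auto
    also have "\<dots> = (\<Sum>i\<in>{1..<j}. x ^ j * (a i * b (j - i)))"
    proof (intro sum.cong refl)
      fix i assume "i \<in> {1..<j}"
      then have "x ^ j = x ^ i * x ^ (j - i)" by (simp flip: power_add)
      then show "(x ^ i * a i) * (x ^ (j - i) * b (j - i)) = x ^ j * (a i * b (j - i))" by simp
    qed
    finally show ?thesis by (simp add: sum_distrib_left)
  qed
  ultimately show ?thesis by simp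
qed

text \<open>The series is shown to satisfy the polynomial equation for the half square. Positivity
  allows one to take the square root and return to the equation for the function itself.\<close>

lemma DERIV_of_half_square:
  fixes f :: "real \<Rightarrow> real"
  assumes der: "((\<lambda>t. (f t)\<^sup>2 / 2) has_real_derivative D) (at t)" and S: "open S" "t \<in> S" and pos: "\<And>t. t \<in> S \<Longrightarrow> 0 < f t"
  shows "(f has_real_derivative D / f t) (at t)"
proof -
  define q where "q = (\<lambda>t. (f t)\<^sup>2 / 2)"
  have q: "(q has_real_derivative D) (at t)" using der unfolding q_def .
  have f_eq: "sqrt (2 * q u) = f u" if "u \<in> S" for u using pos[OF that] unfolding q_def by simp
  have "0 < 2 * q t" using pos[OF S(2)] unfolding q_def by simp
  then have "((\<lambda>u. sqrt (2 * q u)) has_real_derivative (2 * D) * (inverse (sqrt (2 * q t)) / 2)) (at t)"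
    by (auto intro!: derivative_eq_intros q)
  then have *: "((\<lambda>u. sqrt (2 * q u)) has_real_derivative D / f t) (at t)"
  proof -
    assume "((\<lambda>u. sqrt (2 * q u)) has_real_derivative (2 * D) * (inverse (sqrt (2 * q t)) / 2)) (at t)"
    moreover have "(2 * D) * (inverse z / 2) = D / z" for z by (cases "z = 0") (simp_all add: field_simps)
    ultimately show ?thesis unfolding f_eq[OF S(2)] by (simp only:)
  qed
  show ?thesis by (rule has_field_derivative_transform_within_open[OF * S]) (rule f_eq)
qed

text \<open>As the equation for \<open>V^2 / 2\<close> is polynomial, the coefficient equations add
  up to it exactly, without remainder. The smallness conditions on \<open>x\<close> keep the sum
  above half of the old lower weight and keep the new \<open>R\<close> positive.\<close>

lemma branch_series_sum:
  fixes v :: "nat \<Rightarrow> real \<Rightarrow> real" and \<rho> k :: "nat \<Rightarrow> real"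
  assumes V: "wbranch d \<epsilon> R K V" and s: "\<bar>s\<bar> = 1"
    and v: "v 0 = (\<lambda>_. 0)" "\<And>j. small_coeff (N * r ^ j) (v j)"
    and \<rho>: "\<rho> 0 = 0" "\<And>j. \<bar>\<rho> j\<bar> \<le> N * r ^ j" and k: "k 0 = 0" "\<And>j. \<bar>k j\<bar> \<le> N * r ^ j"
    and der: "\<And>j t. 0 < t \<Longrightarrow> t < 1 \<Longrightarrow> ((\<lambda>t. V t * v j t + hcoeff v j t) has_real_derivative dcoeff s \<epsilon> R K V v \<rho> k j t) (at t)"
    and bd: "\<And>j t. 0 < t \<Longrightarrow> t < 1 \<Longrightarrow> \<bar>dcoeff s \<epsilon> R K V v \<rho> k j t\<bar> \<le> N * r ^ j"
    and N: "0 < N" and r: "0 < r" and x1: "\<bar>x\<bar> * r \<le> 1 / 2" and x2: "2 * N * (\<bar>x\<bar> * r) \<le> d / 2" and x3: "2 * N * (\<bar>x\<bar> * r) \<le> R / 2"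
    and d': "0 < d'" "d' \<le> d / 2" "d' * (1 / d + d / 2) \<le> 1"
  defines "v' \<equiv> \<lambda>t. \<Sum>j. x ^ j * v j t" and "\<rho>' \<equiv> \<Sum>j. x ^ j * \<rho> j" and "k' \<equiv> \<Sum>j. x ^ j * k j"
  shows "wbranch d' (\<epsilon> + s * x) (R + \<rho>') (K + s * k') (\<lambda>t. V t + v' t)"
proof -
  note VD = wbranchD[OF V]
  have r0: "0 \<le> r" and xr: "\<bar>x\<bar> * r < 1" using r x1 by auto
  have vb: "\<bar>v j t\<bar> \<le> (N * (t * (1 - t\<^sup>2))) * r ^ j" if "0 < t" "t < 1" for j t
    using v(2)[of j] that unfolding small_coeff_def by (auto simp: mult_ac)
  have v0: "v 0 t = 0" for t by (simp add: v)
  have v'_le: "\<bar>v' t\<bar> \<le> d / 2 * (t * (1 - t\<^sup>2))" if t: "0 < t" "t < 1" for t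
  proof -
    have "\<bar>v' t\<bar> \<le> 2 * (N * (t * (1 - t\<^sup>2))) * (\<bar>x\<bar> * r)"
      unfolding v'_def by (rule power_series_tail_bound[OF vb[OF t] v0 r0 x1])
    also have "\<dots> = 2 * N * (\<bar>x\<bar> * r) * (t * (1 - t\<^sup>2))" by (simp add: mult_ac)
    also have "\<dots> \<le> d / 2 * (t * (1 - t\<^sup>2))" using x2 t one_minus_sq[OF t] by (intro mult_right_mono) auto
    finally show ?thesis .
  qed
  define V' where "V' = (\<lambda>t. V t + v' t)"
  have lower: "d / 2 * (t * (1 - t\<^sup>2)) \<le> V' t" if t: "0 < t" "t < 1" for t
  proof -
    have "d / 2 * (t * (1 - t\<^sup>2)) = d * (t * (1 - t\<^sup>2)) - d / 2 * (t * (1 - t\<^sup>2))" by simp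
    then show ?thesis using v'_le[OF t] VD(3)[OF t] unfolding V'_def by linarith
  qed
  have pos: "0 < V' t" if t: "0 < t" "t < 1" for t
  proof -
    have "0 < d / 2 * (t * (1 - t\<^sup>2))" using t one_minus_sq[OF t] VD(1) by simp
    then show ?thesis using lower[OF t] by linarith
  qed
  have "\<bar>\<rho>'\<bar> \<le> 2 * N * (\<bar>x\<bar> * r)" unfolding \<rho>'_def by (rule power_series_tail_bound[OF \<rho>(2,1) r0 x1])
  then have R': "0 < R + \<rho>'" using x3 VD(2) by linarith
  define r1 where "r1 = (\<lambda>t. - 2 * t * (1 - t\<^sup>2) * (4 * R - (1 - t\<^sup>2)))"
  \<comment> \<open>The expected derivative of the summed variation: each convolution has become a
    product of sums, and the shift by one index a factor \<open>x\<close>.\<close>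
  define Df where "Df = (\<lambda>t. 2 * t * (K - \<epsilon> * (1 - t\<^sup>2)) * v' t + \<rho>' * r1 t + s * k' * (2 * t * V t)
     + (- 4 * t * (1 - t\<^sup>2) * (\<rho>' * \<rho>') + 2 * t * s * (k' * v' t) - 2 * t * (1 - t\<^sup>2) * s * (x * v' t + x * V t)))"
  have e_sums: "(\<lambda>j. x ^ j * (V t * v j t + hcoeff v j t)) sums (V t * v' t + v' t * v' t / 2)" if t: "0 < t" "t < 1" for t
  proof -
    have "(\<lambda>j. x ^ j * v j t) sums v' t" unfolding v'_def
      using power_series_bound(2)[OF vb[OF t] r0 xr] by (rule summable_sums)
    then have 1: "(\<lambda>j. V t * (x ^ j * v j t)) sums (V t * v' t)" by (rule sums_mult)
    have "(\<lambda>j. x ^ j * (\<Sum>i\<in>{1..<j}. v i t * v (j - i) t)) sums (v' t * v' t)"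
      unfolding v'_def by (rule power_series_convolution[OF vb[OF t] v0 vb[OF t] v0 r0 xr])
    then have "(\<lambda>j. x ^ j * (\<Sum>i\<in>{1..<j}. v i t * v (j - i) t) / 2) sums (v' t * v' t / 2)" by (rule sums_divide)
    from sums_add[OF 1 this] show ?thesis
      unfolding hcoeff_def by (simp add: distrib_left mult_ac)
  qed
  have d_sums: "(\<lambda>j. x ^ j * dcoeff s \<epsilon> R K V v \<rho> k j t) sums Df t" if t: "0 < t" "t < 1" for t
  proof -
    have vs: "(\<lambda>j. x ^ j * v j t) sums v' t" unfolding v'_def
      using power_series_bound(2)[OF vb[OF t] r0 xr] by (rule summable_sums)
    have \<rho>s: "(\<lambda>j. x ^ j * \<rho> j) sums \<rho>'" unfolding \<rho>'_def
      using power_series_bound(2)[OF \<rho>(2) r0 xr] by (rule summable_sums)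
    have ks: "(\<lambda>j. x ^ j * k j) sums k'" unfolding k'_def
      using power_series_bound(2)[OF k(2) r0 xr] by (rule summable_sums)
    have \<rho>\<rho>: "(\<lambda>j. x ^ j * (\<Sum>i\<in>{1..<j}. \<rho> i * \<rho> (j - i))) sums (\<rho>' * \<rho>')"
      unfolding \<rho>'_def by (rule power_series_convolution[OF \<rho>(2,1) \<rho>(2,1) r0 xr])
    have kv: "(\<lambda>j. x ^ j * (\<Sum>i\<in>{1..<j}. k i * v (j - i) t)) sums (k' * v' t)"
      unfolding k'_def v'_def by (rule power_series_convolution[OF k(2,1) vb[OF t] v0 r0 xr])
    define z where "z = (\<lambda>j. if j = 1 then V t else v (j - 1) t)"
    have "(\<lambda>j. x ^ Suc j * z (Suc j)) sums (x * v' t + x * V t)"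
    proof -
      have "(\<lambda>j. x * (x ^ j * v j t) + (if j = 0 then x * V t else 0)) sums (x * v' t + x * V t)"
        by (intro sums_add sums_mult vs sums_single)
      moreover have "x ^ Suc j * z (Suc j) = x * (x ^ j * v j t) + (if j = 0 then x * V t else 0)" for j
        unfolding z_def using v0 by simp
      ultimately show ?thesis by simp
    qed
    moreover have "z 0 = 0" unfolding z_def using v0 by simp
    ultimately have zs: "(\<lambda>j. x ^ j * z j) sums (x * v' t + x * V t)"
      using sums_Suc[of "\<lambda>j. x ^ j * z j" "x * v' t + x * V t"] by simp
    have "(\<lambda>j. 2 * t * (K - \<epsilon> * (1 - t\<^sup>2)) * (x ^ j * v j t) + (x ^ j * \<rho> j) * r1 t + s * (x ^ j * k j) * (2 * t * V t)
      + (- 4 * t * (1 - t\<^sup>2) * (x ^ j * (\<Sum>i\<in>{1..<j}. \<rho> i * \<rho> (j - i))) + 2 * t * s * (x ^ j * (\<Sum>i\<in>{1..<j}. k i * v (j - i) t))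
        - 2 * t * (1 - t\<^sup>2) * s * (x ^ j * z j))) sums Df t"
      unfolding Df_def by (intro sums_add sums_diff sums_mult sums_mult2 vs \<rho>s ks \<rho>\<rho> kv zs)
    moreover have "x ^ j * dcoeff s \<epsilon> R K V v \<rho> k j t = 2 * t * (K - \<epsilon> * (1 - t\<^sup>2)) * (x ^ j * v j t) + (x ^ j * \<rho> j) * r1 t + s * (x ^ j * k j) * (2 * t * V t)
      + (- 4 * t * (1 - t\<^sup>2) * (x ^ j * (\<Sum>i\<in>{1..<j}. \<rho> i * \<rho> (j - i))) + 2 * t * s * (x ^ j * (\<Sum>i\<in>{1..<j}. k i * v (j - i) t))
        - 2 * t * (1 - t\<^sup>2) * s * (x ^ j * z j))" for j
      unfolding dcoeff_def fcoeff_def r1_def z_def by (simp only: distrib_left right_diff_distrib mult_ac)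
    ultimately show ?thesis by simp
  qed
  have e_der: "((\<lambda>t. V t * v' t + v' t * v' t / 2) has_real_derivative Df t) (at t)" if t: "0 < t" "t < 1" for t
  proof -
    have "uniformly_convergent_on {0<..<1} (\<lambda>n t. \<Sum>j<n. x ^ j * dcoeff s \<epsilon> R K V v \<rho> k j t)"
    proof (rule Weierstrass_m_test'[where M = "\<lambda>j. N * (\<bar>x\<bar> * r) ^ j"])
      fix j and t :: real assume "t \<in> {0<..<1}"
      then have "norm (x ^ j * dcoeff s \<epsilon> R K V v \<rho> k j t) \<le> \<bar>x\<bar> ^ j * (N * r ^ j)"
        using bd[of t j] by (auto simp: abs_mult power_abs intro!: mult_left_mono)
      then show "norm (x ^ j * dcoeff s \<epsilon> R K V v \<rho> k j t) \<le> N * (\<bar>x\<bar> * r) ^ j"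
        by (simp add: power_mult_distrib mult_ac)
    next
      show "summable (\<lambda>j. N * (\<bar>x\<bar> * r) ^ j)"
        using xr r0 by (intro summable_mult summable_geometric) (auto simp: abs_mult)
    qed
    then have "((\<lambda>t. \<Sum>j. x ^ j * (V t * v j t + hcoeff v j t)) has_real_derivative (\<Sum>j. x ^ j * dcoeff s \<epsilon> R K V v \<rho> k j t)) (at t)"
    proof (rule has_field_derivative_series'(2)[rotated 2])
      show "summable (\<lambda>j. x ^ j * (V t * v j t + hcoeff v j t))" by (rule sums_summable[OF e_sums[OF t]])
      show "((\<lambda>t. x ^ j * (V t * v j t + hcoeff v j t)) has_real_derivative x ^ j * dcoeff s \<epsilon> R K V v \<rho> k j u) (at u within {0<..<1})"
        if "u \<in> {0<..<1}" for j u
        by (rule has_field_derivative_at_within, rule DERIV_cmult, rule der) (use that in auto)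
    qed (use t in \<open>auto simp: interior_open\<close>)
    then have "((\<lambda>t. \<Sum>j. x ^ j * (V t * v j t + hcoeff v j t)) has_real_derivative Df t) (at t)"
      using sums_unique[OF d_sums[OF t]] by simp
    then show ?thesis
      by (rule has_field_derivative_transform_within_open[of _ _ _ "{0<..<1}"])
        (use t sums_unique[OF e_sums] in auto)
  qed
  have "((\<lambda>t. (V' t)\<^sup>2 / 2) has_real_derivative
      - 2 * t * (1 - t\<^sup>2) * (2 * (R + \<rho>')\<^sup>2 - (R + \<rho>') * (1 - t\<^sup>2)) + 2 * t * ((K + s * k') - (\<epsilon> + s * x) * (1 - t\<^sup>2)) * V' t) (at t)"
    if t: "0 < t" "t < 1" for t
  proof -
    define DV where "DV = - 2 * t * (1 - t\<^sup>2) * (2 * R\<^sup>2 - R * (1 - t\<^sup>2)) / V t + 2 * t * (K - \<epsilon> * (1 - t\<^sup>2))"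
    have VDV: "V t * DV = - 2 * t * (1 - t\<^sup>2) * (2 * R\<^sup>2 - R * (1 - t\<^sup>2)) + 2 * t * (K - \<epsilon> * (1 - t\<^sup>2)) * V t"
    proof -
      have "a * (p / a + q) = p + q * a" if "0 < a" for a p q :: real using that by (simp add: distrib_left)
      from this[OF VD(5)[OF t]] show ?thesis unfolding DV_def .
    qed
    have "(V has_real_derivative DV) (at t)" using VD(6)[OF t] unfolding DV_def .
    then have "((\<lambda>t. (V t)\<^sup>2 / 2) has_real_derivative V t * DV) (at t)"
      by (auto intro!: derivative_eq_intros)
    from DERIV_add[OF this e_der[OF t]]
    have *: "((\<lambda>t. (V t)\<^sup>2 / 2 + (V t * v' t + v' t * v' t / 2)) has_real_derivative V t * DV + Df t) (at t)" .
    have 1: "(\<lambda>t. (V t)\<^sup>2 / 2 + (V t * v' t + v' t * v' t / 2)) = (\<lambda>t. (V' t)\<^sup>2 / 2)"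
      unfolding V'_def by (auto simp: fun_eq_iff power2_eq_square algebra_simps)
    have 2: "V t * DV + Df t = - 2 * t * (1 - t\<^sup>2) * (2 * (R + \<rho>')\<^sup>2 - (R + \<rho>') * (1 - t\<^sup>2)) + 2 * t * ((K + s * k') - (\<epsilon> + s * x) * (1 - t\<^sup>2)) * V' t"
      unfolding VDV Df_def V'_def r1_def by algebra
    show ?thesis using * unfolding 1 2 .
  qed
  note half = this
  show ?thesis unfolding V'_def[symmetric] wbranch_def
  proof (intro conjI ballI d' R')
    fix t :: real assume "t \<in> {0<..<1}"
    then have t: "0 < t" "t < 1" by auto
    define y where "y = t * (1 - t\<^sup>2)"
    have y: "0 < y" using t one_minus_sq[OF t] unfolding y_def by simp
    have "d' * y \<le> d / 2 * y" using d' y by (intro mult_right_mono) auto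
    then show "d' * (t * (1 - t\<^sup>2)) \<le> V' t" using lower[OF t] unfolding y_def by linarith
    have "V' t \<le> y / d + d / 2 * y" using VD(4)[OF t] v'_le[OF t] unfolding V'_def y_def by linarith
    also have "\<dots> = (1 / d + d / 2) * y" by (simp add: algebra_simps)
    also have "\<dots> \<le> (1 / d') * y" using d' y by (intro mult_right_mono) (auto simp: field_simps)
    finally show "V' t \<le> t * (1 - t\<^sup>2) / d'" unfolding y_def by simp
    have *: "(V' has_real_derivative (- 2 * t * (1 - t\<^sup>2) * (2 * (R + \<rho>')\<^sup>2 - (R + \<rho>') * (1 - t\<^sup>2)) + 2 * t * ((K + s * k') - (\<epsilon> + s * x) * (1 - t\<^sup>2)) * V' t) / V' t) (at t)"
      by (rule DERIV_of_half_square[OF half[OF t], of "{0<..<1}"]) (use t pos in auto)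
    show "(V' has_real_derivative - 2 * t * (1 - t\<^sup>2) * (2 * (R + \<rho>')\<^sup>2 - (R + \<rho>') * (1 - t\<^sup>2)) / V' t + 2 * t * ((K + s * k') - (\<epsilon> + s * x) * (1 - t\<^sup>2))) (at t)"
    proof -
      have "(p + q * a) / a = p / a + q" if "0 < a" for a p q :: real using that by (simp add: add_divide_distrib)
      from this[OF pos[OF t]] show ?thesis using * by (simp only:)
    qed
  qed
qed

text \<open>Using one \<open>R\<close> for both halves expresses that they meet at the same turning
  point.\<close>

definition wloop :: "real \<Rightarrow> real \<Rightarrow> real \<Rightarrow> real \<Rightarrow> bool" where
  "wloop d \<epsilon> R K \<longleftrightarrow> (\<exists>V W. wbranch d \<epsilon> R K V \<and> wbranch d (-\<epsilon>) R (-K) W)"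

text \<open>An analytic implicit function theorem around an arbitrary loop. The coefficients are
  exposed together with geometric bounds, because these also give convergence on a complex
  disc.\<close>

theorem wloop_continuation:
  assumes "wloop d \<epsilon> R K"
  obtains \<delta> r N d' \<rho> k where "0 < \<delta>" "0 < r" "\<delta> * r \<le> 1 / 2" "\<rho> 0 = R" "k 0 = K"
    "\<And>j. \<bar>\<rho> j\<bar> \<le> N * r ^ j" "\<And>j. \<bar>k j\<bar> \<le> N * r ^ j"
    "\<And>x. \<bar>x\<bar> \<le> \<delta> \<Longrightarrow> wloop d' (\<epsilon> + x) (\<Sum>j. x ^ j * \<rho> j) (\<Sum>j. x ^ j * k j)"
proof -
  obtain V W where V: "wbranch d \<epsilon> R K V" and W: "wbranch d (-\<epsilon>) R (-K) W" using assms unfolding wloop_def by auto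
  note VD = wbranchD[OF V]
  show thesis
  proof (rule loop_series[OF V W])
    fix N r :: real and v w :: "nat \<Rightarrow> real \<Rightarrow> real" and \<rho> k :: "nat \<Rightarrow> real"
    assume N: "0 < N" and r: "0 < r" and v0: "v 0 = (\<lambda>_. 0)" and w0: "w 0 = (\<lambda>_. 0)" and \<rho>0: "\<rho> 0 = 0" and k0: "k 0 = 0"
      and v: "\<And>j. small_coeff (N * r ^ j) (v j)" and w: "\<And>j. small_coeff (N * r ^ j) (w j)"
      and \<rho>: "\<And>j. \<bar>\<rho> j\<bar> \<le> N * r ^ j" and k: "\<And>j. \<bar>k j\<bar> \<le> N * r ^ j"
      and vd: "\<And>j t. 0 < t \<Longrightarrow> t < 1 \<Longrightarrow> ((\<lambda>t. V t * v j t + hcoeff v j t) has_real_derivative dcoeff 1 \<epsilon> R K V v \<rho> k j t) (at t)"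
      and wd: "\<And>j t. 0 < t \<Longrightarrow> t < 1 \<Longrightarrow> ((\<lambda>t. W t * w j t + hcoeff w j t) has_real_derivative dcoeff (-1) (-\<epsilon>) R (-K) W w \<rho> k j t) (at t)"
      and vb: "\<And>j t. 0 < t \<Longrightarrow> t < 1 \<Longrightarrow> \<bar>dcoeff 1 \<epsilon> R K V v \<rho> k j t\<bar> \<le> N * r ^ j"
      and wb: "\<And>j t. 0 < t \<Longrightarrow> t < 1 \<Longrightarrow> \<bar>dcoeff (-1) (-\<epsilon>) R (-K) W w \<rho> k j t\<bar> \<le> N * r ^ j"
    \<comment> \<open>At most half of \<open>1 / r\<close>, and small enough that \<open>V\<close>
      and \<open>R\<close> change by at most half of their lower bounds.\<close>
    define \<delta> where "\<delta> = min (1 / 2) (min (d / 2) (R / 2) / (2 * N)) / r"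
    have \<delta>: "0 < \<delta>" "\<delta> * r \<le> 1 / 2" "2 * N * (\<delta> * r) \<le> d / 2" "2 * N * (\<delta> * r) \<le> R / 2"
    proof -
      have \<delta>r: "\<delta> * r = min (1 / 2) (min (d / 2) (R / 2) / (2 * N))" unfolding \<delta>_def using r by simp
      show "0 < \<delta>" unfolding \<delta>_def using r N VD(1,2) by simp
      show "\<delta> * r \<le> 1 / 2" unfolding \<delta>r by simp
      have "\<delta> * r \<le> min (d / 2) (R / 2) / (2 * N)" unfolding \<delta>r by simp
      then have "2 * N * (\<delta> * r) \<le> min (d / 2) (R / 2)" using N by (simp add: field_simps)
      then show "2 * N * (\<delta> * r) \<le> d / 2" "2 * N * (\<delta> * r) \<le> R / 2" by simp_all
    qed
    define d' where "d' = min (d / 2) (1 / (1 / d + d / 2))"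
    have dd: "0 < 1 / d + d / 2" using VD(1) by (intro add_pos_pos) auto
    have d': "0 < d'" "d' \<le> d / 2" "d' * (1 / d + d / 2) \<le> 1"
    proof -
      show "0 < d'" "d' \<le> d / 2" unfolding d'_def using VD(1) dd by auto
      have "d' \<le> 1 / (1 / d + d / 2)" unfolding d'_def by simp
      then show "d' * (1 / d + d / 2) \<le> 1" using dd by (simp add: pos_le_divide_eq)
    qed
    define \<rho>' where "\<rho>' = (\<lambda>j. if j = 0 then R else \<rho> j)"
    define k' where "k' = (\<lambda>j. if j = 0 then K else k j)"
    define N' where "N' = N + \<bar>R\<bar> + \<bar>K\<bar>"
    show thesis
    proof (rule that[of \<delta> r \<rho>' k' N' d'])
      show "0 < \<delta>" "0 < r" "\<delta> * r \<le> 1 / 2" "\<rho>' 0 = R" "k' 0 = K" using \<delta> r unfolding \<rho>'_def k'_def by auto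
      fix j
      have NN: "N * r ^ j \<le> N' * r ^ j" unfolding N'_def using r by (intro mult_right_mono) auto
      show "\<bar>\<rho>' j\<bar> \<le> N' * r ^ j" using order_trans[OF \<rho>[of j] NN] N unfolding \<rho>'_def N'_def by (cases "j = 0") auto
      show "\<bar>k' j\<bar> \<le> N' * r ^ j" using order_trans[OF k[of j] NN] N unfolding k'_def N'_def by (cases "j = 0") auto
    next
      fix x :: real assume x: "\<bar>x\<bar> \<le> \<delta>"
      have xr: "\<bar>x\<bar> * r \<le> \<delta> * r" using x r by (intro mult_right_mono) auto
      have x1: "\<bar>x\<bar> * r \<le> 1 / 2" using xr \<delta> by linarith
      have "2 * N * (\<bar>x\<bar> * r) \<le> 2 * N * (\<delta> * r)" using xr N by (intro mult_left_mono) auto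
      then have x2: "2 * N * (\<bar>x\<bar> * r) \<le> d / 2" "2 * N * (\<bar>x\<bar> * r) \<le> R / 2" using \<delta> by linarith+
      have xr1: "\<bar>x\<bar> * r < 1" using x1 by linarith
      have sum': "(\<Sum>j. x ^ j * (if j = 0 then a0 else a j)) = a0 + (\<Sum>j. x ^ j * a j)" if a: "\<And>j. \<bar>a j\<bar> \<le> N * r ^ j" "a 0 = 0" for a a0
      proof -
        have "summable (\<lambda>j. x ^ j * a j)" using power_series_bound(2)[OF a(1) _ xr1] r by simp
        then have "(\<lambda>j. (if j = 0 then a0 else 0) + x ^ j * a j) sums (a0 + (\<Sum>j. x ^ j * a j))"
          by (intro sums_add sums_single summable_sums)
        moreover have "(if j = 0 then a0 else 0) + x ^ j * a j = x ^ j * (if j = 0 then a0 else a j)" for j using a(2) by simp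
        ultimately show ?thesis by (simp add: sums_iff)
      qed
      have s: "\<bar>1\<bar> = (1::real)" "\<bar>- 1\<bar> = (1::real)" by simp_all
      note V' = branch_series_sum[OF V s(1) v0 v \<rho>0 \<rho> k0 k vd vb N r x1 x2 d']
      note W' = branch_series_sum[OF W s(2) w0 w \<rho>0 \<rho> k0 k wd wb N r x1 x2 d']
      have e: "\<epsilon> + 1 * x = \<epsilon> + x" "- \<epsilon> + - 1 * x = - (\<epsilon> + x)"
        "K + 1 * (\<Sum>j. x ^ j * k j) = (\<Sum>j. x ^ j * k' j)" "- K + - 1 * (\<Sum>j. x ^ j * k j) = - (\<Sum>j. x ^ j * k' j)"
        "R + (\<Sum>j. x ^ j * \<rho> j) = (\<Sum>j. x ^ j * \<rho>' j)"
        unfolding k'_def \<rho>'_def by (simp_all add: sum'[OF k k0] sum'[OF \<rho> \<rho>0])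
      show "wloop d' (\<epsilon> + x) (\<Sum>j. x ^ j * \<rho>' j) (\<Sum>j. x ^ j * k' j)"
        unfolding wloop_def using V'[unfolded e] W'[unfolded e] by blast
    qed
  qed
qed

section \<open>A priori bounds and limits of loops\<close>

text \<open>The minimum over \<open>[u, v]\<close> has a nonpositive value, so \<open>D\<close> has
  a negative derivative there; hence the minimum can only lie at the right end.\<close>

lemma DERIV_le_imp_less_right:
  fixes D :: "real \<Rightarrow> real"
  assumes der: "\<And>u. a < u \<Longrightarrow> u < b \<Longrightarrow> (D has_real_derivative D' u) (at u)"
    and neg: "\<And>u. a < u \<Longrightarrow> u < b \<Longrightarrow> D u \<le> 0 \<Longrightarrow> D' u < 0"
    and uv: "a < u" "u < v" "v < b" and Du: "D u \<le> 0"
  shows "D v < D u"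
proof -
  have "continuous_on {u..v} D"
    using der uv by (intro continuous_at_imp_continuous_on ballI) (meson DERIV_isCont atLeastAtMost_iff less_le_trans le_less_trans)
  then obtain m where m: "m \<in> {u..v}" "\<And>y. y \<in> {u..v} \<Longrightarrow> D m \<le> D y"
    using continuous_attains_inf[of "{u..v}" D] uv by auto
  have "D m \<le> D u" using m(2)[of u] uv by auto
  then have "D m \<le> 0" using Du by linarith
  then have "D' m < 0" using m(1) uv by (intro neg) auto
  have "m = v"
  proof (rule ccontr)
    assume "m \<noteq> v"
    then have mv: "m < v" using m by auto
    have "(D has_real_derivative D' m) (at m)" using der m uv mv by auto
    from DERIV_neg_dec_right[OF this \<open>D' m < 0\<close>] obtain e where e: "0 < e" "\<And>h. 0 < h \<Longrightarrow> h < e \<Longrightarrow> D (m + h) < D m" by blast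
    define h where "h = min (e / 2) (v - m)"
    have h: "0 < h" "h < e" "h \<le> v - m" using e mv unfolding h_def by (auto simp: min_def)
    have "m + h \<in> {u..v}" using h m(1) by auto
    then show False using e(2)[OF h(1,2)] m(2)[of "m + h"] by linarith
  qed
  moreover have "m \<noteq> u"
    using \<open>m = v\<close> uv by auto
  moreover have "D m < D u"
  proof -
    have "(D has_real_derivative D' u) (at u)" "D' u < 0" using der neg uv Du by auto
    from DERIV_neg_dec_right[OF this] obtain e where e: "0 < e" "\<And>h. 0 < h \<Longrightarrow> h < e \<Longrightarrow> D (u + h) < D u" by blast
    define h where "h = min (e / 2) (v - u)"
    have h: "0 < h" "h < e" "h \<le> v - u" using e uv unfolding h_def by (auto simp: min_def)
    have "u + h \<in> {u..v}" using h uv by auto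
    then show ?thesis using e(2)[OF h(1,2)] m(2)[of "u + h"] by linarith
  qed
  ultimately show ?thesis by simp
qed

lemma positive_towards_zero_limit:
  fixes D :: "real \<Rightarrow> real"
  assumes der: "\<And>u. a < u \<Longrightarrow> u < b \<Longrightarrow> (D has_real_derivative D' u) (at u)"
    and neg: "\<And>u. a < u \<Longrightarrow> u < b \<Longrightarrow> D u \<le> 0 \<Longrightarrow> D' u < 0"
    and lim: "(D \<longlongrightarrow> 0) (at_left b)" and u: "a < u" "u < b"
  shows "0 < D u"
proof (rule ccontr)
  assume "\<not> 0 < D u"
  then have Du: "D u \<le> 0" by simp
  define m where "m = (u + b) / 2"
  have m: "u < m" "m < b" using u unfolding m_def by auto
  have Dm: "D m < 0" using DERIV_le_imp_less_right[OF der neg u(1) m Du] Du by simp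
  have "D v \<le> D m" if "v \<in> {m<..<b}" for v
  proof -
    have "D v < D m" by (rule DERIV_le_imp_less_right[OF der neg, of a b]) (use that m u Dm in auto)
    then show ?thesis by simp
  qed
  then have "eventually (\<lambda>v. D v \<le> D m) (at_left b)"
    using m by (intro eventually_at_leftI[of m]) auto
  then have "0 \<le> D m" using lim tendsto_upperbound trivial_limit_at_left_real by blast
  then show False using Dm by simp
qed

lemma wbranch_half_loop:
  assumes V: "wbranch d \<epsilon> R K V"
  shows "half_loop \<epsilon> (K / R) (1 / R) (\<lambda>u. V (sqrt (1 - R * u)) / R\<^sup>2)"
  unfolding half_loop_def
proof (intro conjI ballI)
  note VD = wbranchD[OF V]
  show "2 < 1 / R" using wbranch_R_less[OF V] VD(2) by (simp add: field_simps)
  have w: "0 < sqrt (1 - R * u)" "sqrt (1 - R * u) < 1" "(sqrt (1 - R * u))\<^sup>2 = 1 - R * u" if "u \<in> {0<..<1/R}" for u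
    using that VD(2) by (auto simp: field_simps)
  fix u assume u: "u \<in> {0<..<1/R}"
  define w where "w = sqrt (1 - R * u)"
  have ww: "0 < w" "w < 1" "w\<^sup>2 = 1 - R * u" using w[OF u] unfolding w_def by auto
  have Vw: "0 < V w" using VD(5) ww by blast
  show "0 < V (sqrt (1 - R * u)) / R\<^sup>2" using Vw VD(2) unfolding w_def by simp
  define D where "D = - 2 * w * (1 - w\<^sup>2) * (2 * R\<^sup>2 - R * (1 - w\<^sup>2)) / V w + 2 * w * (K - \<epsilon> * (1 - w\<^sup>2))"
  have "((\<lambda>u. sqrt (1 - R * u)) has_real_derivative - R / (2 * w)) (at u)"
    using ww(1) unfolding w_def by (auto intro!: derivative_eq_intros simp: field_simps)
  moreover have "(V has_real_derivative D) (at (sqrt (1 - R * u)))"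
    using VD(6)[OF ww(1,2)] unfolding D_def w_def .
  ultimately have "((\<lambda>u. V (sqrt (1 - R * u))) has_real_derivative D * (- R / (2 * w))) (at u)"
    by (rule DERIV_chain2[rotated])
  then have "((\<lambda>u. V (sqrt (1 - R * u)) / R\<^sup>2) has_real_derivative D * (- R / (2 * w)) / R\<^sup>2) (at u)"
    by (rule DERIV_cdivide)
  moreover have "D * (- R / (2 * w)) / R\<^sup>2 = u * (2 - u) / (V w / R\<^sup>2) - (K / R - \<epsilon> * u)"
    unfolding D_def ww(3) using ww(1) Vw VD(2) by (simp add: field_simps power2_eq_square)
  ultimately show "((\<lambda>u. V (sqrt (1 - R * u)) / R\<^sup>2) has_real_derivative
      u * (2 - u) / (V (sqrt (1 - R * u)) / R\<^sup>2) - (K / R - \<epsilon> * u)) (at u)"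
    unfolding w_def by simp
next
  note VD = wbranchD[OF V]
  have bd: "0 \<le> V (sqrt (1 - R * u)) / R\<^sup>2" "V (sqrt (1 - R * u)) / R\<^sup>2 \<le> sqrt (1 - R * u) * (R * u) / d / R\<^sup>2" if "u \<in> {0<..<1/R}" for u
  proof -
    have w: "0 < sqrt (1 - R * u)" "sqrt (1 - R * u) < 1" "(sqrt (1 - R * u))\<^sup>2 = 1 - R * u"
      using that VD(2) by (auto simp: field_simps)
    show "0 \<le> V (sqrt (1 - R * u)) / R\<^sup>2" using VD(5)[OF w(1,2)] by simp
    have "V (sqrt (1 - R * u)) \<le> sqrt (1 - R * u) * (R * u) / d"
      using VD(4)[OF w(1,2)] unfolding w(3) by simp
    then show "V (sqrt (1 - R * u)) / R\<^sup>2 \<le> sqrt (1 - R * u) * (R * u) / d / R\<^sup>2" by (intro divide_right_mono) auto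
  qed
  have R: "0 < 1 / R" using VD(2) by simp
  have c: "isCont (\<lambda>u. sqrt (1 - R * u) * (R * u) / d / R\<^sup>2) u" for u
    using VD(1,2) by (intro continuous_intros) auto
  have l: "((\<lambda>u. sqrt (1 - R * u) * (R * u) / d / R\<^sup>2) \<longlongrightarrow> 0) (at_right 0)"
    "((\<lambda>u. sqrt (1 - R * u) * (R * u) / d / R\<^sup>2) \<longlongrightarrow> 0) (at_left (1/R))"
    using c[of 0] c[of "1/R"] VD(2) unfolding isCont_def by (simp_all add: filterlim_at_split)
  show "((\<lambda>u. V (sqrt (1 - R * u)) / R\<^sup>2) \<longlongrightarrow> 0) (at_right 0)"
    by (rule tendsto_sandwich[OF _ _ tendsto_const l(1)]; rule eventually_at_rightI[of 0 "1/R"]) (use bd R in auto)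
  show "((\<lambda>u. V (sqrt (1 - R * u)) / R\<^sup>2) \<longlongrightarrow> 0) (at_left (1/R))"
    by (rule tendsto_sandwich[OF _ _ tendsto_const l(2)]; rule eventually_at_leftI[of 0 "1/R"]) (use bd R in auto)
qed

section \<open>Energy estimates for loops\<close>

text \<open>The energy of the Hamiltonian part, written in terms of \<open>u = 1 - x\<close>.\<close>
definition energy :: "(real \<Rightarrow> real) \<Rightarrow> real \<Rightarrow> real" where
  "energy f u = (f u)\<^sup>2 / 2 - u\<^sup>2 + u^3 / 3"

lemma energy_deriv:
  assumes f: "half_loop \<epsilon> k B f" and u: "0 < u" "u < B"
  shows "(energy f has_real_derivative - (k - \<epsilon> * u) * f u) (at u)"
proof -
  have "0 < f u" using half_loopD(2)[OF f u] .
  then show ?thesis unfolding energy_def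
    by (auto intro!: derivative_eq_intros half_loopD(3)[OF f u] simp: field_simps power2_eq_square)
qed

lemma energy_limits:
  assumes f: "half_loop \<epsilon> k B f"
  shows "(energy f \<longlongrightarrow> 0) (at_right 0)" "(energy f \<longlongrightarrow> - B\<^sup>2 + B^3 / 3) (at_left B)"
proof -
  have "(energy f \<longlongrightarrow> 0\<^sup>2 / 2 - 0\<^sup>2 + 0^3 / 3) (at_right 0)"
    unfolding energy_def by (intro tendsto_intros half_loopD(4)[OF f])  auto
  then show "(energy f \<longlongrightarrow> 0) (at_right 0)" by simp
  have "(energy f \<longlongrightarrow> 0\<^sup>2 / 2 - B\<^sup>2 + B^3 / 3) (at_left B)"
    unfolding energy_def by (intro tendsto_intros half_loopD(5)[OF f]) auto
  then show "(energy f \<longlongrightarrow> - B\<^sup>2 + B^3 / 3) (at_left B)" by simp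
qed

lemma mono_limits:
  fixes F :: "real \<Rightarrow> real"
  assumes "a < b" and der: "\<And>u. a < u \<Longrightarrow> u < b \<Longrightarrow> (F has_real_derivative F' u) (at u)"
    and pos: "\<And>u. a < u \<Longrightarrow> u < b \<Longrightarrow> 0 < F' u"
  shows "\<And>u l. a < u \<Longrightarrow> u < b \<Longrightarrow> (F \<longlongrightarrow> l) (at_right a) \<Longrightarrow> l < F u"
    "\<And>u l. a < u \<Longrightarrow> u < b \<Longrightarrow> (F \<longlongrightarrow> l) (at_left b) \<Longrightarrow> F u < l"
proof -
  have inc: "F x < F y" if "a < x" "x < y" "y < b" for x y
    by (rule DERIV_pos_imp_increasing[OF \<open>x < y\<close>]) (use that der pos in \<open>meson less_le_trans le_less_trans\<close>)
  fix u l assume u: "a < u" "u < b"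
  { assume l: "(F \<longlongrightarrow> l) (at_right a)"
    define m where "m = (a + u) / 2"
    have m: "a < m" "m < u" using u unfolding m_def by auto
    have "eventually (\<lambda>x. F x \<le> F m) (at_right a)"
      using inc m u by (intro eventually_at_rightI[of a m]) (auto intro: less_imp_le)
    then have "l \<le> F m" using l tendsto_upperbound trivial_limit_at_right_real by blast
    then show "l < F u" using inc[of m u] m u by simp }
  { assume l: "(F \<longlongrightarrow> l) (at_left b)"
    define m where "m = (u + b) / 2"
    have m: "u < m" "m < b" using u unfolding m_def by auto
    have "eventually (\<lambda>x. F m \<le> F x) (at_left b)"
      using inc m u by (intro eventually_at_leftI[of m b]) (auto intro: less_imp_le)
    then have "F m \<le> l" using l tendsto_lowerbound trivial_limit_at_left_real by blast
    then show "F u < l" using inc[of u m] m u by simp }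
qed

text \<open>The damping changes sign at \<open>z = k / \<epsilon>\<close>. From the saddle to
  \<open>z\<close> the energy falls along \<open>f\<close> and rises along \<open>g\<close>; beyond
  \<open>z\<close> the roles are exchanged. Both energies start at 0 and end with the same value at
  \<open>B\<close>. If \<open>z\<close> were not inside, the common end value would have two signs;
  since it is inside, the energies and hence the heights are ordered everywhere.\<close>

lemma loop_energy:
  assumes lg: "loop_graph \<epsilon> k B f g" and "0 < \<epsilon>"
  shows "k / \<epsilon> < B" "\<And>u. 0 < u \<Longrightarrow> u < B \<Longrightarrow> f u \<le> g u"
proof -
  have f: "half_loop \<epsilon> k B f" and g: "half_loop (-\<epsilon>) (-k) B g" using lg unfolding loop_graph_def by auto
  define z where "z = k / \<epsilon>"
  have z: "0 < z" unfolding z_def using loop_graph_k_bounds[OF lg \<open>0 < \<epsilon>\<close>] \<open>0 < \<epsilon>\<close> by simp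
  have sgn: "0 < k - \<epsilon> * u \<longleftrightarrow> u < z" "k - \<epsilon> * u < 0 \<longleftrightarrow> z < u" for u
    unfolding z_def using \<open>0 < \<epsilon>\<close> by (auto simp: field_simps)
  define Lf where "Lf = - B\<^sup>2 + B^3 / 3"
  have B: "2 < B" using half_loopD(1)[OF f] .
  have nf: "((\<lambda>u. - energy f u) has_real_derivative (k - \<epsilon> * u) * f u) (at u)" if "0 < u" "u < B" for u
    by (rule DERIV_cong[OF DERIV_minus[OF energy_deriv[OF f that]]]) (simp add: algebra_simps)
  have pg: "(energy g has_real_derivative (k - \<epsilon> * u) * g u) (at u)" if "0 < u" "u < B" for u
    using energy_deriv[OF g that] by (simp add: algebra_simps)
  have fpos: "0 < f u" "0 < g u" if "0 < u" "u < B" for u using half_loopD(2)[OF f that] half_loopD(2)[OF g that] by auto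
  have limf: "((\<lambda>u. - energy f u) \<longlongrightarrow> 0) (at_right 0)" "((\<lambda>u. - energy f u) \<longlongrightarrow> - Lf) (at_left B)"
    using tendsto_minus[OF energy_limits(1)[OF f]] tendsto_minus[OF energy_limits(2)[OF f]] unfolding Lf_def by auto
  have limg: "(energy g \<longlongrightarrow> 0) (at_right 0)" "(energy g \<longlongrightarrow> Lf) (at_left B)"
    using energy_limits[OF g] unfolding Lf_def by auto
  have below: "energy f u \<le> 0" "0 \<le> energy g u" if u: "0 < u" "u < B" "u \<le> z" for u
  proof -
    have "0 < min B z" using B z by auto
    have m1: "0 < - energy f v" "0 < energy g v" if "0 < v" "v < min B z" for v
      using mono_limits(1)[of 0 "min B z" "\<lambda>u. - energy f u" "\<lambda>u. (k - \<epsilon> * u) * f u" v 0]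
        mono_limits(1)[of 0 "min B z" "energy g" "\<lambda>u. (k - \<epsilon> * u) * g u" v 0]
        that nf pg fpos sgn limf limg by auto
    have "isCont (energy f) u" "isCont (energy g) u"
      using DERIV_isCont[OF energy_deriv[OF f u(1,2)]] DERIV_isCont[OF energy_deriv[OF g u(1,2)]] by auto
    then have ll: "(energy f \<longlongrightarrow> energy f u) (at_left u)" "(energy g \<longlongrightarrow> energy g u) (at_left u)"
      unfolding isCont_def by (auto simp: filterlim_at_split)
    have "eventually (\<lambda>v. energy f v \<le> 0 \<and> 0 \<le> energy g v) (at_left u)"
    proof (rule eventually_at_leftI[of 0])
      fix v assume "v \<in> {0<..<u}"
      then show "energy f v \<le> 0 \<and> 0 \<le> energy g v" using m1[of v] u by auto
    qed (use u in auto)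
    then have "eventually (\<lambda>v. energy f v \<le> 0) (at_left u)" "eventually (\<lambda>v. 0 \<le> energy g v) (at_left u)"
      by (auto elim: eventually_mono)
    then show "energy f u \<le> 0" "0 \<le> energy g u"
      using ll tendsto_upperbound tendsto_lowerbound trivial_limit_at_left_real by blast+
  qed
  show zB: "k / \<epsilon> < B" unfolding z_def[symmetric]
  proof (rule ccontr)
    assume "\<not> z < B"
    then have p: "0 < (k - \<epsilon> * v) * f v" "0 < (k - \<epsilon> * v) * g v" if "0 < v" "v < B" for v
      using that fpos[OF that] sgn(1)[of v] by (auto intro!: mult_pos_pos)
    have "0 < B" "0 < (1::real)" "1 < B" using B by auto
    note m = mono_limits[OF this(1) nf p(1) this(2,3)] mono_limits[OF this(1) pg p(2) this(2,3)]
    have "0 < - energy f 1" by (rule m(1)) (use limf(1) in simp_all)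
    moreover have "- energy f 1 < - Lf" by (rule m(2)) (use limf(2) in simp_all)
    moreover have "0 < energy g 1" by (rule m(3)) (use limg(1) in simp_all)
    moreover have "energy g 1 < Lf" by (rule m(4)) (use limg(2) in simp_all)
    ultimately show False by linarith
  qed
  have above: "energy f u \<le> Lf" "Lf \<le> energy g u" if u: "z < u" "u < B" for u
  proof -
    have n1: "(energy f has_real_derivative - (k - \<epsilon> * u) * f u) (at u)" if "z < u" "u < B" for u
      using energy_deriv[OF f, of u] that z by auto
    have n2: "((\<lambda>u. - energy g u) has_real_derivative - (k - \<epsilon> * u) * g u) (at u)" if "z < u" "u < B" for u
      by (rule DERIV_cong[OF DERIV_minus[OF pg]]) (use that z in \<open>auto simp: algebra_simps\<close>)
    have p: "0 < - (k - \<epsilon> * v) * f v" "0 < - (k - \<epsilon> * v) * g v" if "z < v" "v < B" for v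
      using fpos[of v] sgn(2)[of v] that z by (auto intro!: mult_neg_pos simp: mult_less_0_iff)
    have "energy f u < Lf"
      by (rule mono_limits(2)[of z B "energy f" "\<lambda>u. - (k - \<epsilon> * u) * f u"])
        (use u n1 p energy_limits(2)[OF f] in \<open>auto simp: Lf_def\<close>)
    moreover have "- energy g u < - Lf"
      by (rule mono_limits(2)[of z B "\<lambda>u. - energy g u" "\<lambda>u. - (k - \<epsilon> * u) * g u"])
        (use u n2 p tendsto_minus[OF limg(2)] in auto)
    ultimately show "energy f u \<le> Lf" "Lf \<le> energy g u" by auto
  qed
  show "f u \<le> g u" if u: "0 < u" "u < B" for u
  proof -
    have "energy f u \<le> energy g u"
    proof (cases "u \<le> z")
      case True
      then show ?thesis using below[OF u True] by linarith
    next
      case False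
      then show ?thesis using above[of u] u by linarith
    qed
    then have "(f u)\<^sup>2 \<le> (g u)\<^sup>2" unfolding energy_def by simp
    then show ?thesis using fpos(2)[OF u] by (rule power2_le_imp_le[OF _ less_imp_le])
  qed
qed
text \<open>The line of slope \<open>l = 3 * \<epsilon> + 2\<close> stays above \<open>g\<close>
  because \<open>k < 3 * \<epsilon>\<close> and \<open>2 / l < 1\<close>. Past \<open>u = 3\<close>
  the damping term makes the energy of \<open>g\<close> decrease, so the end value
  \<open>- B^2 + B^3 / 3\<close> is bounded by the energy at 3, and this bounds
  \<open>B\<close>.\<close>

lemma loop_upper_bounds:
  assumes lg: "loop_graph \<epsilon> k B f g" and "0 < \<epsilon>"
  shows "\<And>u. 0 < u \<Longrightarrow> u < B \<Longrightarrow> g u < (3 * \<epsilon> + 2) * u" "B \<le> 4 * (3 * \<epsilon> + 2)"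
proof -
  have f: "half_loop \<epsilon> k B f" and g: "half_loop (-\<epsilon>) (-k) B g" using lg unfolding loop_graph_def by auto
  note k = loop_graph_k_bounds[OF lg \<open>0 < \<epsilon>\<close>]
  define l where "l = 3 * \<epsilon> + 2"
  have l: "2 < l" unfolding l_def using \<open>0 < \<epsilon>\<close> by simp
  have B: "2 < B" using half_loopD(1)[OF f] .
  show gl: "g u < (3 * \<epsilon> + 2) * u" if u: "0 < u" "u < B" for u
    unfolding l_def[symmetric]
  proof (rule half_loop_barrier_greater(1)[OF g, of B "\<lambda>u. l * u" "\<lambda>_. l"])
    show "0 < l * u \<and> ((\<lambda>u. l * u) has_real_derivative l) (at u) \<and> u * (2 - u) / (l * u) - (- k - - \<epsilon> * u) < l" if "u \<in> {0<..<B}" for u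
    proof (intro conjI)
      show "0 < l * u" using l that by simp
      show "((\<lambda>u. l * u) has_real_derivative l) (at u)" by (auto intro!: derivative_eq_intros)
      have "u * (2 - u) / (l * u) = (2 - u) / l" using that by simp
      also have "\<dots> < 2 / l" using that l by (intro divide_strict_right_mono) auto
      also have "\<dots> < 1" using l by simp
      finally have "u * (2 - u) / (l * u) < 1" .
      moreover have "0 < \<epsilon> * u" using that \<open>0 < \<epsilon>\<close> by simp
      ultimately show "u * (2 - u) / (l * u) - (- k - - \<epsilon> * u) < l" unfolding l_def using k \<open>0 < \<epsilon>\<close> by linarith
    qed
    show "((\<lambda>u. l * u) \<longlongrightarrow> 0) (at_right 0)" by (auto intro!: tendsto_eq_intros)
  qed (use u B in auto)
  show "B \<le> 4 * (3 * \<epsilon> + 2)"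
  proof (cases "B \<le> 4")
    case True
    then show ?thesis using \<open>0 < \<epsilon>\<close> by simp
  next
    case False
    have k3: "k - \<epsilon> * u < 0" if "3 < u" for u
    proof -
      have "\<epsilon> * 3 < \<epsilon> * u" using that \<open>0 < \<epsilon>\<close> by simp
      then show ?thesis using k by linarith
    qed
    have pg: "((\<lambda>u. - energy g u) has_real_derivative - (k - \<epsilon> * u) * g u) (at u)" if "3 < u" "u < B" for u
      by (rule DERIV_cong[OF DERIV_minus[OF energy_deriv[OF g]]]) (use that in \<open>auto simp: algebra_simps\<close>)
    have pp: "0 < - (k - \<epsilon> * u) * g u" if "3 < u" "u < B" for u
      using k3[OF that(1)] half_loopD(2)[OF g, of u] that by (intro mult_pos_pos) auto
    have "isCont (energy g) 3" using DERIV_isCont[OF energy_deriv[OF g, of 3]] False by auto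
    then have lim3: "((\<lambda>u. - energy g u) \<longlongrightarrow> - energy g 3) (at_right 3)"
      unfolding isCont_def by (intro tendsto_minus) (auto simp: filterlim_at_split)
    define m where "m = (3 + B) / 2"
    have m: "3 < m" "m < B" "3 < B" using False unfolding m_def by auto
    have "- energy g 3 < - energy g m"
      by (rule mono_limits(1)[OF m(3) pg pp m(1,2) lim3]) simp_all
    moreover have "- energy g m < - (- B\<^sup>2 + B^3 / 3)"
      by (rule mono_limits(2)[OF m(3) pg pp m(1,2) tendsto_minus[OF energy_limits(2)[OF g]]]) simp_all
    ultimately have "- B\<^sup>2 + B^3 / 3 < energy g 3" by linarith
    also have "energy g 3 = (g 3)\<^sup>2 / 2" unfolding energy_def by (simp add: power2_eq_square power3_eq_cube)
    also have "\<dots> \<le> (l * 3)\<^sup>2 / 2"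
      using gl[of 3] half_loopD(2)[OF g, of 3] m unfolding l_def by (intro divide_right_mono power_mono) auto
    finally have "- B\<^sup>2 + B^3 / 3 < 9 * l\<^sup>2 / 2" by (simp add: power_mult_distrib)
    \<comment> \<open>The threshold 4 makes the cubic term dominate: the end energy is then at least
      \<open>B^2 / 3\<close>.\<close>
    moreover have "B\<^sup>2 * (B - 4) \<ge> 0" using False by simp
    then have "B\<^sup>2 / 3 \<le> - B\<^sup>2 + B^3 / 3" by (simp add: algebra_simps power2_eq_square power3_eq_cube)
    ultimately have "B\<^sup>2 < 16 * l\<^sup>2" using zero_le_power2[of l] by linarith
    then have "B\<^sup>2 < (4 * l)\<^sup>2" by (simp add: power_mult_distrib)
    then have "B < 4 * l" using l by (intro power2_less_imp_less[of B "4 * l"]) auto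
    then show ?thesis unfolding l_def by simp
  qed
qed

text \<open>At \<open>u = 2\<close> the graph could come close to the second equilibrium. If the
  damping there is at most \<open>a / 2\<close>, the subsolution \<open>a * (u * (3 - u))\<close>
  stays positive up to 2. If it is larger, the sign change \<open>z\<close> of the damping lies well
  beyond 2, the energy does not increase between 2 and \<open>z\<close>, and the potential that has
  to be overcome up to \<open>z\<close> forces \<open>f 2\<close> to be at least
  \<open>z - 2\<close>.\<close>

lemma loop_lower_at_2:
  assumes lg: "loop_graph \<epsilon> k B f g" and \<epsilon>: "0 < \<epsilon>" "\<epsilon> \<le> E"
  defines "a \<equiv> 1 / (3 * E + 6)"
  shows "min (2 * a) (a / (2 * E)) \<le> f 2" "\<And>u. 0 < u \<Longrightarrow> u \<le> 2 \<Longrightarrow> a * (u * (2 - u)) < f u \<or> u = 2"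
proof -
  have f: "half_loop \<epsilon> k B f" and g: "half_loop (-\<epsilon>) (-k) B g" using lg unfolding loop_graph_def by auto
  note k = loop_graph_k_bounds[OF lg \<epsilon>(1)]
  have B: "2 < B" using half_loopD(1)[OF f] .
  have E: "0 < E" using \<epsilon> by linarith
  \<comment> \<open>\<open>1 / a = 3 * E + 6\<close> exceeds every admissible damping, which is
    below \<open>3 * E\<close>, and leaves room for the slopes of the two parabolas used as
    subsolutions.\<close>
  have a: "0 < a" "a * (3 * E + 6) = 1" "a \<le> 1 / 6" unfolding a_def using E by (auto simp: field_simps)
  have ae: "a * \<epsilon> \<le> a * E" "0 < a * \<epsilon>" using a \<epsilon> by auto
  have aE: "3 * (a * E) + 6 * a = 1" using a(2) by (simp add: algebra_simps)
  have aa: "a * a \<le> a * (1 / 6)" using a by (intro mult_left_mono) auto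
  have 1: "a * (u * (2 - u)) < f u" if u: "u \<in> {0<..<2}" for u
  proof (rule half_loop_barrier_less(1)[OF f, of 2 "\<lambda>u. a * (u * (2 - u))" "\<lambda>u. a * (2 - 2 * u)"])
    fix u :: real assume u: "u \<in> {0<..<2}"
    have u2: "0 < u" "0 < 2 - u" using u by auto
    show "0 < a * (u * (2 - u)) \<and> ((\<lambda>u. a * (u * (2 - u))) has_real_derivative a * (2 - 2 * u)) (at u) \<and>
        a * (2 - 2 * u) < u * (2 - u) / (a * (u * (2 - u))) - (k - \<epsilon> * u)"
    proof (intro conjI)
      show "0 < a * (u * (2 - u))" using a u2 by simp
      show "((\<lambda>u. a * (u * (2 - u))) has_real_derivative a * (2 - 2 * u)) (at u)"
        by (auto intro!: derivative_eq_intros simp: algebra_simps)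
      have "u * (2 - u) / (a * (u * (2 - u))) = 3 * E + 6" unfolding a_def using u2 by simp
      moreover have "a * (2 - 2 * u) \<le> a * 2" using a u2 by (intro mult_left_mono) auto
      moreover have "0 < \<epsilon> * u" using u2 \<epsilon> by simp
      ultimately show "a * (2 - 2 * u) < u * (2 - u) / (a * (u * (2 - u))) - (k - \<epsilon> * u)"
        using k a \<epsilon> by linarith
    qed
  next
    show "((\<lambda>u. a * (u * (2 - u))) \<longlongrightarrow> 0) (at_right 0)" by (auto intro!: tendsto_eq_intros)
  qed (use u B in auto)
  show "a * (u * (2 - u)) < f u \<or> u = 2" if "0 < u" "u \<le> 2" for u using 1[of u] that by force
  show "min (2 * a) (a / (2 * E)) \<le> f 2"
  proof (cases "k - 2 * \<epsilon> \<le> a / 2")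
    case True
    have "a * (u * (3 - u)) < f u" if u: "u \<in> {0<..<2}" for u
    proof (rule half_loop_barrier_less(1)[OF f, of 2 "\<lambda>u. a * (u * (3 - u))" "\<lambda>u. a * (3 - 2 * u)"])
      fix u :: real assume u: "u \<in> {0<..<2}"
      define v where "v = 2 - u"
      have v: "0 < v" "v < 2" "u = 2 - v" using u unfolding v_def by auto
      show "0 < a * (u * (3 - u)) \<and> ((\<lambda>u. a * (u * (3 - u))) has_real_derivative a * (3 - 2 * u)) (at u) \<and>
          a * (3 - 2 * u) < u * (2 - u) / (a * (u * (3 - u))) - (k - \<epsilon> * u)"
      proof (intro conjI)
        show "0 < a * (u * (3 - u))" using a u by simp
        show "((\<lambda>u. a * (u * (3 - u))) has_real_derivative a * (3 - 2 * u)) (at u)"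
          by (auto intro!: derivative_eq_intros simp: algebra_simps)
        have eq: "u * (2 - u) / (a * (u * (3 - u))) = v / (a * (1 + v))" unfolding v(3) using v a by simp
        have "(a * (3 - 2 * u) + (k - \<epsilon> * u)) * (a * (1 + v)) = a * a * (2 * v - 1) * (1 + v) + (k - 2 * \<epsilon>) * (a * (1 + v)) + a * \<epsilon> * v * (1 + v)"
          unfolding v(3) by (simp add: algebra_simps)
        also have "(k - 2 * \<epsilon>) * (a * (1 + v)) \<le> (a / 2) * (a * (1 + v))"
          using True a v by (intro mult_right_mono) auto
        also have "a * a * (2 * v - 1) * (1 + v) + (a / 2) * (a * (1 + v)) + a * \<epsilon> * v * (1 + v) < v"
        proof -
          have t1: "a * a * (2 * v) * (1 + v) \<le> a * (1 / 6) * (2 * v) * 3"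
            using aa a v by (intro mult_mono) auto
          have t2: "a * \<epsilon> * v * (1 + v) \<le> a * E * v * 3" using ae a v E \<epsilon> by (intro mult_mono mult_nonneg_nonneg) auto
          have t3: "0 < a * a * (1 + v)" using a v by simp
          have t4: "a * v + 3 * (a * E * v) \<le> v"
          proof -
            have "(a + 3 * (a * E)) * v \<le> 1 * v" using aE a v by (intro mult_right_mono) auto
            then show ?thesis by (simp add: algebra_simps)
          qed
          have "a * a * (2 * v - 1) * (1 + v) + (a / 2) * (a * (1 + v)) = a * a * (2 * v) * (1 + v) - a * a * (1 + v) / 2"
            by (simp add: algebra_simps)
          then show ?thesis using t1 t2 t3 t4 by linarith
        qed
        finally have "(a * (3 - 2 * u) + (k - \<epsilon> * u)) * (a * (1 + v)) < v" by simp
        then have "a * (3 - 2 * u) + (k - \<epsilon> * u) < v / (a * (1 + v))" using a v by (simp add: pos_less_divide_eq)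
        then show "a * (3 - 2 * u) < u * (2 - u) / (a * (u * (3 - u))) - (k - \<epsilon> * u)" unfolding eq by linarith
      qed
    next
      show "((\<lambda>u. a * (u * (3 - u))) \<longlongrightarrow> 0) (at_right 0)" by (auto intro!: tendsto_eq_intros)
    qed (use u B in auto)
    then have "eventually (\<lambda>u. a * (u * (3 - u)) \<le> f u) (at_left 2)"
      by (intro eventually_at_leftI[of 0]) (auto intro: less_imp_le)
    moreover have "isCont f 2" using half_loopD(3)[OF f, of 2] B by (auto intro: DERIV_isCont)
    then have "(f \<longlongrightarrow> f 2) (at_left 2)" unfolding isCont_def by (auto simp: filterlim_at_split)
    moreover have "((\<lambda>u. a * (u * (3 - u))) \<longlongrightarrow> a * (2 * (3 - 2))) (at_left 2)" by (intro tendsto_intros)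
    ultimately have "a * (2 * (3 - 2)) \<le> f 2" using tendsto_le trivial_limit_at_left_real by blast
    then show ?thesis by simp
  next
    case False
    define z where "z = k / \<epsilon>"
    have kz: "k = \<epsilon> * z" unfolding z_def using \<epsilon> by simp
    have "a / (2 * \<epsilon>) < z - 2"
      using False \<epsilon> unfolding z_def by (simp add: field_simps)
    moreover have "a / (2 * E) \<le> a / (2 * \<epsilon>)" using \<epsilon> a E by (intro divide_left_mono) auto
    moreover have "0 < a / (2 * E)" using a E by simp
    ultimately have z2: "a / (2 * E) \<le> z - 2" "2 < z" by linarith+
    have zB: "z < B" using loop_energy(1)[OF lg \<epsilon>(1)] unfolding z_def .
    have nf: "\<exists>y. (energy f has_real_derivative y) (at u) \<and> y \<le> 0" if "2 \<le> u" "u \<le> z" for u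
    proof (intro exI conjI)
      show "(energy f has_real_derivative - (k - \<epsilon> * u) * f u) (at u)" using energy_deriv[OF f, of u] that zB by auto
      have "0 \<le> \<epsilon> * (z - u)" using that \<epsilon> by simp
      then have "0 \<le> k - \<epsilon> * u" unfolding kz by (simp add: algebra_simps)
      then show "- (k - \<epsilon> * u) * f u \<le> 0" using half_loopD(2)[OF f, of u] that zB by (intro mult_nonpos_nonneg) auto
    qed
    have "energy f z \<le> energy f 2" by (rule DERIV_nonpos_imp_nonincreasing) (use nf z2 in auto)
    moreover have "- z\<^sup>2 + z^3 / 3 \<le> energy f z" unfolding energy_def by simp
    \<comment> \<open>The potential \<open>- u^2 + u^3 / 3\<close> has the local minimum
      \<open>- 4 / 3\<close> at 2; its excess at \<open>z\<close> is
      \<open>(z - 2)^2 * (z + 1) / 3\<close>.\<close>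
    moreover have "(z - 2)\<^sup>2 \<le> - z\<^sup>2 + z^3 / 3 + 4 / 3"
    proof -
      have "- z\<^sup>2 + z^3 / 3 + 4 / 3 - (z - 2)\<^sup>2 = (z - 2)\<^sup>2 * (z - 2) / 3" by (simp add: algebra_simps power2_eq_square power3_eq_cube)
      moreover have "0 \<le> (z - 2)\<^sup>2 * (z - 2) / 3" using z2 by simp
      ultimately show ?thesis by linarith
    qed
    moreover have "energy f 2 = (f 2)\<^sup>2 / 2 - 4 / 3" unfolding energy_def by simp
    ultimately have "(z - 2)\<^sup>2 \<le> (f 2)\<^sup>2 / 2" by linarith
    then have "(z - 2)\<^sup>2 \<le> (f 2)\<^sup>2" using zero_le_power2[of "f 2"] by linarith
    then have "z - 2 \<le> f 2" using half_loopD(2)[OF f, of 2] B by (intro power2_le_imp_le[of "z - 2" "f 2"]) auto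
    then show ?thesis using z2 by linarith
  qed
qed
text \<open>The square has a bounded derivative although \<open>f\<close> may have a vertical
  tangent at \<open>B\<close>. Letting the right point tend to \<open>B\<close> gives the square
  root behaviour there.\<close>

lemma half_loop_square_lipschitz:
  assumes f: "half_loop \<epsilon> k B f" and "\<bar>\<epsilon>\<bar> \<le> E" "\<bar>k\<bar> \<le> 3 * E" "B \<le> M" and le: "\<And>u. 0 < u \<Longrightarrow> u < B \<Longrightarrow> f u \<le> F * u"
  defines "L \<equiv> M\<^sup>2 + 2 * M + (3 * E + E * M) * (F * M)"
  shows "\<And>x y. 0 < x \<Longrightarrow> x \<le> y \<Longrightarrow> y < B \<Longrightarrow> \<bar>(f y)\<^sup>2 - (f x)\<^sup>2\<bar> \<le> 2 * L * (y - x)"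
    "\<And>x. 0 < x \<Longrightarrow> x < B \<Longrightarrow> (f x)\<^sup>2 \<le> 2 * L * (B - x)"
proof -
  note fD = half_loopD[OF f]
  have F: "0 \<le> F" using le[of 1] fD(1) fD(2)[of 1] by auto
  have E: "0 \<le> E" using assms(2) by linarith
  have der: "((\<lambda>u. (f u)\<^sup>2) has_real_derivative 2 * (u * (2 - u) - (k - \<epsilon> * u) * f u)) (at u)" if "0 < u" "u < B" for u
    using fD(2)[OF that] by (auto intro!: derivative_eq_intros fD(3)[OF that] simp: field_simps power2_eq_square)
  have bd: "\<bar>2 * (u * (2 - u) - (k - \<epsilon> * u) * f u)\<bar> \<le> 2 * L" if u: "0 < u" "u < B" for u
  proof -
    have uM: "u \<le> M" using u \<open>B \<le> M\<close> by simp
    have "\<bar>u * (2 - u)\<bar> \<le> u * (2 + u)" using u unfolding abs_mult by (intro mult_mono) auto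
    also have "\<dots> \<le> M * (2 + M)" using u uM by (intro mult_mono) auto
    finally have 1: "\<bar>u * (2 - u)\<bar> \<le> M\<^sup>2 + 2 * M" by (simp add: algebra_simps power2_eq_square)
    have "\<bar>\<epsilon> * u\<bar> \<le> E * M" unfolding abs_mult using assms(2) u uM E by (intro mult_mono) auto
    then have 2: "\<bar>k - \<epsilon> * u\<bar> \<le> 3 * E + E * M" using assms(3) by linarith
    have "f u \<le> F * M" using order_trans[OF le[OF u] mult_left_mono[OF uM F]] .
    then have 3: "\<bar>(k - \<epsilon> * u) * f u\<bar> \<le> (3 * E + E * M) * (F * M)"
      unfolding abs_mult using 2 fD(2)[OF u] by (intro mult_mono) auto
    have "\<bar>2 * (p - q)\<bar> \<le> 2 * (x + y)" if "\<bar>p\<bar> \<le> x" "\<bar>q\<bar> \<le> y" for p q x y :: real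
      using that unfolding abs_le_iff by (auto simp: algebra_simps)
    from this[OF 1 3] show ?thesis unfolding L_def .
  qed
  show lip: "\<bar>(f y)\<^sup>2 - (f x)\<^sup>2\<bar> \<le> 2 * L * (y - x)" if "0 < x" "x \<le> y" "y < B" for x y
    by (rule bounded_derivative_diff[where f = "\<lambda>u. (f u)\<^sup>2", OF that(2) der bd]) (use that in auto)
  fix x assume x: "0 < x" "x < B"
  have "eventually (\<lambda>y. (f x)\<^sup>2 - (f y)\<^sup>2 \<le> 2 * L * (y - x)) (at_left B)"
    using x lip by (intro eventually_at_leftI[of x]) (auto simp: abs_le_iff)
  moreover have "((\<lambda>y. (f x)\<^sup>2 - (f y)\<^sup>2) \<longlongrightarrow> (f x)\<^sup>2 - 0\<^sup>2) (at_left B)" by (intro tendsto_intros fD(5))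
  moreover have "((\<lambda>y. 2 * L * (y - x)) \<longlongrightarrow> 2 * L * (B - x)) (at_left B)" by (intro tendsto_intros)
  ultimately have "(f x)\<^sup>2 - 0\<^sup>2 \<le> 2 * L * (B - x)" using tendsto_le trivial_limit_at_left_real by blast
  then show "(f x)\<^sup>2 \<le> 2 * L * (B - x)" by simp
qed

text \<open>\<open>sqrt (1 - u / B)\<close> is the variable \<open>w\<close>, so this is the
  two-sided weight of \<open>wbranch\<close> in unscaled form.\<close>

definition graph_bound :: "real \<Rightarrow> real \<Rightarrow> (real \<Rightarrow> real) \<Rightarrow> bool" where
  "graph_bound d B f \<longleftrightarrow> (\<forall>u\<in>{0<..<B}. d * (u * sqrt (1 - u / B)) \<le> f u \<and> f u \<le> u * sqrt (1 - u / B) / d)"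

lemma half_loop_upper:
  assumes f: "half_loop \<epsilon> k B f" and "\<bar>\<epsilon>\<bar> \<le> E" "\<bar>k\<bar> \<le> 3 * E" "B \<le> M" and le: "\<And>u. 0 < u \<Longrightarrow> u < B \<Longrightarrow> f u \<le> F * u"
    and L: "L = M\<^sup>2 + 2 * M + (3 * E + E * M) * (F * M)" and u: "0 < u" "u < B"
  shows "f u \<le> (2 * F + sqrt (2 * L * M)) * (u * sqrt (1 - u / B))"
proof -
  note fD = half_loopD[OF f]
  have F: "0 \<le> F" using le[of 1] fD(1) fD(2)[of 1] by auto
  have E: "0 \<le> E" using assms(2) by linarith
  have M: "2 < M" using fD(1) \<open>B \<le> M\<close> by simp
  have L0: "0 \<le> L" unfolding L using E M F by (intro add_nonneg_nonneg mult_nonneg_nonneg) auto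
  define s where "s = sqrt (1 - u / B)"
  have s: "0 \<le> s" "0 < 1 - u / B" unfolding s_def using u by auto
  show ?thesis unfolding s_def[symmetric]
  proof (cases "u \<le> 1")
    case True
    have "(1 / 2)\<^sup>2 \<le> 1 - u / B" using True u fD(1) by (simp add: field_simps power2_eq_square)
    then have "1 / 2 \<le> s" unfolding s_def by (rule real_le_rsqrt)
    then have "u * 1 \<le> u * (2 * s)" using u by (intro mult_left_mono) auto
    then have "F * u \<le> F * (u * (2 * s))" using F by (intro mult_left_mono) auto
    also have "\<dots> = 2 * F * (u * s)" by simp
    also have "\<dots> \<le> (2 * F + sqrt (2 * L * M)) * (u * s)" using u s L0 M by (intro mult_right_mono) auto
    finally show "f u \<le> (2 * F + sqrt (2 * L * M)) * (u * s)" using le[OF u] by linarith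
  next
    case False
    have "(f u)\<^sup>2 \<le> 2 * L * (B - u)"
      using half_loop_square_lipschitz(2)[OF f assms(2-4) le u] unfolding L .
    also have "\<dots> = 2 * L * B * (1 - u / B)" using u by (simp add: field_simps)
    also have "\<dots> \<le> 2 * L * M * (1 - u / B)" using \<open>B \<le> M\<close> L0 s by (intro mult_right_mono mult_left_mono) auto
    finally have "f u \<le> sqrt (2 * L * M * (1 - u / B))" by (rule real_le_rsqrt)
    also have "\<dots> = sqrt (2 * L * M) * s" unfolding s_def by (simp add: real_sqrt_mult)
    also have "\<dots> \<le> (2 * F + sqrt (2 * L * M)) * s" using F s by (intro mult_right_mono) auto
    also have "\<dots> \<le> (2 * F + sqrt (2 * L * M)) * (u * s)"
      using False s F L0 M by (intro mult_left_mono) (auto simp: mult_le_cancel_right1)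
    finally show "f u \<le> (2 * F + sqrt (2 * L * M)) * (u * s)" .
  qed
qed

text \<open>The constant depends only on the bound \<open>E\<close> for \<epsilon>. Linear upper
  bounds are shown for \<open>g\<close> and pass to \<open>f\<close>, lower bounds are shown for
  \<open>f\<close> and pass to \<open>g\<close>, by the ordering of the two graphs. The lower bound
  is split at distance \<open>\<eta>\<close> from the second equilibrium: a parabola on the left,
  Lipschitz continuity of \<open>f^2\<close> around it, and a comparison with
  \<open>c * sqrt (B - u)\<close> on the right.\<close>

lemma loop_uniform_bounds:
  assumes E: "0 < E"
  shows "\<exists>d>0. \<forall>\<epsilon> k B f g. 0 < \<epsilon> \<longrightarrow> \<epsilon> \<le> E \<longrightarrow> loop_graph \<epsilon> k B f g \<longrightarrow>
    graph_bound d B f \<and> graph_bound d B g \<and> B \<le> 1 / d"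
proof -
  define M where "M = 4 * (3 * E + 2)"
  define F where "F = 3 * E + 2 + E * M"
  define L where "L = M\<^sup>2 + 2 * M + (3 * E + E * M) * (F * M)"
  define a where "a = 1 / (3 * E + 6)"
  define \<delta> where "\<delta> = min (2 * a) (a / (2 * E))"
  \<comment> \<open>Within this distance of 2 the Lipschitz bound changes \<open>f^2\<close> by at
    most half of its lower bound \<open>\<delta>^2\<close> at 2.\<close>
  define \<eta> where "\<eta> = \<delta>\<^sup>2 / (4 * L)"
  \<comment> \<open>So small that, where \<open>f^2 \<le> c^2 * (B - u)\<close>, the damping cannot
    make up for the conservative term \<open>u * (2 - u)\<close>, which is at most
    \<open>- 2 * \<eta>\<close> to the right of \<open>2 + \<eta>\<close>.\<close>
  define c where "c = min 1 (\<eta> / (2 * E * M * sqrt M + 1))"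
  define d1 where "d1 = min (a * \<eta>) (min (\<delta> / (2 * M)) (c / M))"
  define d where "d = min d1 (1 / (2 * F + sqrt (2 * L * M) + M))"
  have M: "8 < M" unfolding M_def using E by simp
  have F: "2 < F" unfolding F_def using E M by (simp add: add_pos_pos)
  have L: "0 < L" unfolding L_def using E M F by (intro add_pos_nonneg mult_nonneg_nonneg add_nonneg_nonneg) auto
  have a: "0 < a" unfolding a_def using E by simp
  have \<delta>: "0 < \<delta>" unfolding \<delta>_def using a E by simp
  have \<eta>: "0 < \<eta>" unfolding \<eta>_def using \<delta> L by simp
  have den: "0 < 2 * E * M * sqrt M + 1" using E M by (intro add_nonneg_pos) auto
  have c: "0 < c" "c \<le> 1" "c * (2 * E * M * sqrt M + 1) \<le> \<eta>"
  proof -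
    show "0 < c" "c \<le> 1" unfolding c_def using \<eta> den by auto
    have "c \<le> \<eta> / (2 * E * M * sqrt M + 1)" unfolding c_def by simp
    then show "c * (2 * E * M * sqrt M + 1) \<le> \<eta>" using den by (simp add: pos_le_divide_eq)
  qed
  have d1: "0 < d1" "d1 \<le> a * \<eta>" "d1 \<le> \<delta> / (2 * M)" "d1 \<le> c / M" unfolding d1_def using a \<eta> \<delta> M c by auto
  have LM: "0 \<le> sqrt (2 * L * M)" using L M by simp
  have dd: "0 < d" "d \<le> d1" "2 * F + sqrt (2 * L * M) + M \<le> 1 / d"
  proof -
    have p: "0 < 2 * F + sqrt (2 * L * M) + M" using F LM M by linarith
    show "0 < d" "d \<le> d1" unfolding d_def using d1 p by auto
    then have "d \<le> 1 / (2 * F + sqrt (2 * L * M) + M)" unfolding d_def by simp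
    then show "2 * F + sqrt (2 * L * M) + M \<le> 1 / d" using p \<open>0 < d\<close> by (simp add: field_simps)
  qed
  have "graph_bound d B f \<and> graph_bound d B g \<and> B \<le> 1 / d" if \<epsilon>: "0 < \<epsilon>" "\<epsilon> \<le> E" and lg: "loop_graph \<epsilon> k B f g" for \<epsilon> k B f g
  proof -
    have f: "half_loop \<epsilon> k B f" and g: "half_loop (-\<epsilon>) (-k) B g" using lg unfolding loop_graph_def by auto
    note fD = half_loopD[OF f]
    have k: "0 < k" "k < 3 * \<epsilon>" using loop_graph_k_bounds[OF lg \<epsilon>(1)] by auto
    have kE: "\<bar>\<epsilon>\<bar> \<le> E" "\<bar>k\<bar> \<le> 3 * E" "\<bar>-\<epsilon>\<bar> \<le> E" "\<bar>-k\<bar> \<le> 3 * E" using k \<epsilon> by auto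
    have BM: "B \<le> M" using loop_upper_bounds(2)[OF lg \<epsilon>(1)] \<epsilon> unfolding M_def by simp
    have gF: "g u \<le> F * u" if u: "0 < u" "u < B" for u
    proof -
      have "(3 * \<epsilon> + 2) * u \<le> F * u" unfolding F_def using \<epsilon> u E M by (intro mult_right_mono) (auto intro: add_increasing2)
      then show ?thesis using loop_upper_bounds(1)[OF lg \<epsilon>(1) u] by linarith
    qed
    have fF: "f u \<le> F * u" if u: "0 < u" "u < B" for u
      using order_trans[OF loop_energy(2)[OF lg \<epsilon>(1) u] gF[OF u]] .
    have upper: "y \<le> u * sqrt (1 - u / B) / d" if "y \<le> (2 * F + sqrt (2 * L * M)) * (u * sqrt (1 - u / B))" "0 < u" "u < B" for y u
    proof -
      have "(2 * F + sqrt (2 * L * M)) * (u * sqrt (1 - u / B)) \<le> (1 / d) * (u * sqrt (1 - u / B))"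
        using dd M that by (intro mult_right_mono) auto
      then show ?thesis using that by simp
    qed
    have fu: "f u \<le> u * sqrt (1 - u / B) / d" if u: "0 < u" "u < B" for u
      by (rule upper[OF half_loop_upper[OF f kE(1,2) BM fF L_def u] u])
    have gu: "g u \<le> u * sqrt (1 - u / B) / d" if u: "0 < u" "u < B" for u
      by (rule upper[OF half_loop_upper[OF g kE(3,4) BM gF L_def u] u])
    have at2: "\<delta> \<le> f 2" using loop_lower_at_2(1)[OF lg \<epsilon>] unfolding \<delta>_def a_def .
    have lip: "\<bar>(f y)\<^sup>2 - (f x)\<^sup>2\<bar> \<le> 2 * L * (y - x)" if "0 < x" "x \<le> y" "y < B" for x y
      using half_loop_square_lipschitz(1)[OF f kE(1,2) BM fF that] unfolding L_def .
    have mid: "\<delta> / 2 \<le> f u" if u: "0 < u" "u < B" "\<bar>u - 2\<bar> \<le> \<eta>" for u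
    proof -
      have "\<bar>(f 2)\<^sup>2 - (f u)\<^sup>2\<bar> \<le> 2 * L * \<bar>u - 2\<bar>"
        using lip[of u 2] lip[of 2 u] u fD(1) by (cases "u \<le> 2") (auto simp: abs_minus_commute)
      also have "\<dots> \<le> 2 * L * \<eta>" using u L by (intro mult_left_mono) auto
      also have "\<dots> = \<delta>\<^sup>2 / 2" unfolding \<eta>_def using L by simp
      finally have "(f 2)\<^sup>2 - \<delta>\<^sup>2 / 2 \<le> (f u)\<^sup>2" by linarith
      moreover have "\<delta>\<^sup>2 \<le> (f 2)\<^sup>2" using at2 \<delta> by (intro power_mono) auto
      ultimately have "(\<delta> / 2)\<^sup>2 \<le> (f u)\<^sup>2"
      proof -
        have "(\<delta> / 2)\<^sup>2 = \<delta>\<^sup>2 / 4" by (simp add: power_divide)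
        moreover have "0 \<le> \<delta>\<^sup>2" by simp
        ultimately show ?thesis if "(f 2)\<^sup>2 - \<delta>\<^sup>2 / 2 \<le> (f u)\<^sup>2" "\<delta>\<^sup>2 \<le> (f 2)\<^sup>2" using that by linarith
      qed
      then show ?thesis using fD(2)[OF u(1,2)] by (intro power2_le_imp_le[of "\<delta> / 2" "f u"]) auto
    qed
    have right: "c * sqrt (B - u) \<le> f u" if u: "2 + \<eta> < u" "u < B" for u
    proof -
      have "0 < (f u)\<^sup>2 - c\<^sup>2 * (B - u)"
      proof (rule positive_towards_zero_limit[of "2 + \<eta>" B "\<lambda>u. (f u)\<^sup>2 - c\<^sup>2 * (B - u)" "\<lambda>u. 2 * (u * (2 - u) - (k - \<epsilon> * u) * f u) + c\<^sup>2"])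
        fix u assume u: "2 + \<eta> < u" "u < B"
        then have u0: "0 < u" "2 < u" using \<eta> by auto
        have fp: "0 < f u" using fD(2) u0 u by auto
        show "((\<lambda>u. (f u)\<^sup>2 - c\<^sup>2 * (B - u)) has_real_derivative 2 * (u * (2 - u) - (k - \<epsilon> * u) * f u) + c\<^sup>2) (at u)"
          using fp by (auto intro!: derivative_eq_intros fD(3)[OF u0(1) u(2)] simp: field_simps power2_eq_square)
        assume "(f u)\<^sup>2 - c\<^sup>2 * (B - u) \<le> 0"
        moreover have "c\<^sup>2 * (B - u) \<le> c\<^sup>2 * M" using BM u0 by (intro mult_left_mono) auto
        ultimately have "(f u)\<^sup>2 \<le> (c * sqrt M)\<^sup>2" using M by (simp add: power_mult_distrib)
        then have fc: "f u \<le> c * sqrt M" using c M by (intro power2_le_imp_le[of "f u" "c * sqrt M"]) auto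
        have "(k - \<epsilon> * u) * f u \<ge> - (E * M * (c * sqrt M))"
        proof -
          have "\<epsilon> * u * f u \<le> E * M * (c * sqrt M)" using fc fp \<epsilon> u u0 BM E M by (intro mult_mono) auto
          moreover have "0 \<le> k * f u" using k fp by simp
          ultimately show ?thesis by (simp add: algebra_simps)
        qed
        moreover have "u * (2 - u) \<le> - (2 * \<eta>)"
        proof -
          have "2 * \<eta> \<le> u * (u - 2)" using u u0 \<eta> by (intro mult_mono) auto
          then show ?thesis by (simp add: algebra_simps)
        qed
        moreover have "c\<^sup>2 \<le> c" using c by (simp add: power2_eq_square mult_le_cancel_left1)
        moreover have "2 * (E * M * (c * sqrt M)) + c \<le> \<eta>" using c(3) by (simp add: algebra_simps)
        moreover have "2 * (p - q) + z < 0" if "- x \<le> q" "p \<le> - (2 * \<eta>)" "z \<le> c" "2 * x + c \<le> \<eta>" for p q x z :: real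
        proof -
          have "2 * p \<le> - (4 * \<eta>)" "- (2 * q) \<le> 2 * x" using that by simp_all
          then show ?thesis using that \<eta> by simp
        qed
        ultimately show "2 * (u * (2 - u) - (k - \<epsilon> * u) * f u) + c\<^sup>2 < 0" by blast
      next
        have "((\<lambda>u. (f u)\<^sup>2 - c\<^sup>2 * (B - u)) \<longlongrightarrow> 0\<^sup>2 - c\<^sup>2 * (B - B)) (at_left B)" by (intro tendsto_intros fD(5))
        then show "((\<lambda>u. (f u)\<^sup>2 - c\<^sup>2 * (B - u)) \<longlongrightarrow> 0) (at_left B)" by simp
      qed (use u in auto)
      moreover have "(c * sqrt (B - u))\<^sup>2 = c\<^sup>2 * (B - u)" using u by (simp add: power_mult_distrib)
      ultimately have "(c * sqrt (B - u))\<^sup>2 \<le> (f u)\<^sup>2" by simp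
      moreover have "0 \<le> f u" using fD(2)[of u] u \<eta> by auto
      ultimately show ?thesis by (rule power2_le_imp_le)
    qed
    have fl: "d * (u * sqrt (1 - u / B)) \<le> f u" if u: "0 < u" "u < B" for u
    proof -
      define s where "s = sqrt (1 - u / B)"
      have s: "0 \<le> s" "s \<le> 1" unfolding s_def using u by auto
      have us: "0 \<le> u * s" "u * s \<le> u" using u s by (auto simp: mult_le_cancel_left1)
      have "d1 * (u * s) \<le> f u"
      proof -
        consider "u \<le> 2 - \<eta>" | "\<bar>u - 2\<bar> \<le> \<eta>" | "2 + \<eta> < u" by linarith
        then show ?thesis
        proof cases
          case 1
          have "d1 * (u * s) \<le> (a * \<eta>) * u" using d1 us a \<eta> by (intro mult_mono) auto
          also have "\<dots> = a * (u * \<eta>)" by simp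
          also have "\<dots> \<le> a * (u * (2 - u))" using 1 a u by (intro mult_left_mono) auto
          also have "\<dots> \<le> f u" using loop_lower_at_2(2)[OF lg \<epsilon> u(1)] 1 \<eta> unfolding a_def by force
          finally show ?thesis .
        next
          case 2
          have "u * s \<le> M" using us u BM by linarith
          then have "d1 * (u * s) \<le> (\<delta> / (2 * M)) * M" using d1 us \<delta> M by (intro mult_mono) auto
          also have "\<dots> = \<delta> / 2" using M by simp
          also have "\<dots> \<le> f u" using mid u 2 by blast
          finally show ?thesis .
        next
          case 3
          have "B - u = B * (1 - u / B)" using u by (simp add: field_simps)
          then have sq: "sqrt (B - u) = sqrt B * s" unfolding s_def by (simp add: real_sqrt_mult)
          have "1 \<le> sqrt B" using fD(1) by simp
          have "d1 * (u * s) \<le> (c / M) * (M * s)" using d1 us u BM s c M by (intro mult_mono mult_right_mono) auto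
          also have "\<dots> = c * (1 * s)" using M by simp
          also have "\<dots> \<le> c * (sqrt B * s)" using c s \<open>1 \<le> sqrt B\<close> by (intro mult_left_mono mult_right_mono) auto
          also have "\<dots> \<le> f u" using right[OF 3 u(2)] unfolding sq .
          finally show ?thesis .
        qed
      qed
      moreover have "d * (u * s) \<le> d1 * (u * s)" using dd us by (intro mult_right_mono) auto
      ultimately show ?thesis unfolding s_def by linarith
    qed
    have gl: "d * (u * sqrt (1 - u / B)) \<le> g u" if u: "0 < u" "u < B" for u
      using order_trans[OF fl[OF u] loop_energy(2)[OF lg \<epsilon>(1) u]] .
    have "B \<le> 1 / d" using BM dd(3) F LM by linarith
    then show ?thesis unfolding graph_bound_def using fu gu fl gl by auto
  qed
  then show ?thesis using dd(1) by blast
qed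

section \<open>Compactness of the set of loops\<close>

lemma wbranch_d_mono:
  assumes "wbranch d \<epsilon> R K V" and d': "0 < d'" "\<And>w. 0 < w \<Longrightarrow> w < 1 \<Longrightarrow> d' * (w * (1 - w\<^sup>2)) \<le> V w \<and> V w \<le> w * (1 - w\<^sup>2) / d'"
  shows "wbranch d' \<epsilon> R K V"
  using assms unfolding wbranch_def by auto

lemma wbranch_of_graph_bound:
  assumes V: "wbranch d \<epsilon> R K V" and b: "graph_bound c (1 / R) (\<lambda>u. V (sqrt (1 - R * u)) / R\<^sup>2)"
    and c: "0 < c" "c \<le> 1" "1 / R \<le> 1 / c"
  shows "wbranch (c\<^sup>2) \<epsilon> R K V"
proof (rule wbranch_d_mono[OF V])
  note VD = wbranchD[OF V]
  show "0 < c\<^sup>2" using c by simp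
  have cR: "c \<le> R" "R < 1" using c VD(2) wbranch_R_less[OF V] by (auto simp: field_simps)
  fix w :: real assume w: "0 < w" "w < 1"
  have U: "0 < 1 - w\<^sup>2" "1 - w\<^sup>2 < 1" using one_minus_sq[OF w] w by auto
  have u: "(1 - w\<^sup>2) / R \<in> {0<..<1/R}" using U VD(2) by (simp add: divide_strict_right_mono)
  have eqs: "R * ((1 - w\<^sup>2) / R) = 1 - w\<^sup>2" "(1 - w\<^sup>2) / R / (1 / R) = 1 - w\<^sup>2" using VD(2) by auto
  define y where "y = w * (1 - w\<^sup>2)"
  have y: "0 < y" unfolding y_def using w U by simp
  have b1: "c * ((1 - w\<^sup>2) / R * w) \<le> V w / R\<^sup>2" "V w / R\<^sup>2 \<le> (1 - w\<^sup>2) / R * w / c"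
    using b[unfolded graph_bound_def, rule_format, OF u] w unfolding eqs by simp_all
  have "c * ((1 - w\<^sup>2) / R * w) = c * R * y / R\<^sup>2" "(1 - w\<^sup>2) / R * w / c = R * y / c / R\<^sup>2"
    using VD(2) unfolding y_def by (simp_all add: power2_eq_square mult_ac)
  then have 1: "c * R * y \<le> V w" and 2: "V w \<le> R * y / c"
    using b1 VD(2) by (simp_all only: divide_le_cancel) auto
  have "c\<^sup>2 * y \<le> c * R * y" using cR c y unfolding power2_eq_square by (intro mult_right_mono mult_left_mono) auto
  then show "c\<^sup>2 * (w * (1 - w\<^sup>2)) \<le> V w \<and> V w \<le> w * (1 - w\<^sup>2) / c\<^sup>2"
  proof (intro conjI)
    assume "c\<^sup>2 * y \<le> c * R * y"
    then show "c\<^sup>2 * (w * (1 - w\<^sup>2)) \<le> V w" using 1 unfolding y_def by linarith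
    have "R * y / c \<le> 1 * y / c" using cR y c by (intro divide_right_mono mult_right_mono) auto
    also have "\<dots> \<le> y / c\<^sup>2"
    proof -
      have "c\<^sup>2 \<le> c" using c by (simp add: power2_eq_square mult_le_cancel_left1)
      then show ?thesis using y c by (simp add: frac_le)
    qed
    finally show "V w \<le> w * (1 - w\<^sup>2) / c\<^sup>2" using 2 unfolding y_def by linarith
  qed
qed

lemma wbranch_loop_graph:
  assumes "wbranch d \<epsilon> R K V" "wbranch d (-\<epsilon>) R (-K) W"
  shows "loop_graph \<epsilon> (K / R) (1 / R) (\<lambda>u. V (sqrt (1 - R * u)) / R\<^sup>2) (\<lambda>u. W (sqrt (1 - R * u)) / R\<^sup>2)"
  using wbranch_half_loop[OF assms(1)] wbranch_half_loop[OF assms(2)] unfolding loop_graph_def by simp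

text \<open>Replaces an arbitrary weight constant \<open>d0\<close> by one that depends on
  \<open>E\<close> only, so that loops along a sequence of parameters cannot degenerate.\<close>

lemma wloop_uniform:
  assumes E: "0 < E"
  shows "\<exists>d>0. \<forall>d0 \<epsilon> R K. 0 < \<epsilon> \<longrightarrow> \<epsilon> \<le> E \<longrightarrow> wloop d0 \<epsilon> R K \<longrightarrow> wloop d \<epsilon> R K \<and> d \<le> R \<and> R \<le> 1 \<and> \<bar>K\<bar> \<le> 3 * E"
proof -
  obtain c where c: "0 < c" and b: "\<And>\<epsilon> k B f g. 0 < \<epsilon> \<Longrightarrow> \<epsilon> \<le> E \<Longrightarrow> loop_graph \<epsilon> k B f g \<Longrightarrow>
    graph_bound c B f \<and> graph_bound c B g \<and> B \<le> 1 / c"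
    using loop_uniform_bounds[OF E] by blast
  have "wloop (c\<^sup>2) \<epsilon> R K \<and> c\<^sup>2 \<le> R \<and> R \<le> 1 \<and> \<bar>K\<bar> \<le> 3 * E" if \<epsilon>: "0 < \<epsilon>" "\<epsilon> \<le> E" and w: "wloop d0 \<epsilon> R K" for d0 \<epsilon> R K
  proof -
    obtain V W where V: "wbranch d0 \<epsilon> R K V" and W: "wbranch d0 (-\<epsilon>) R (-K) W" using w unfolding wloop_def by auto
    note lg = wbranch_loop_graph[OF V W]
    note bb = b[OF \<epsilon> lg]
    have R: "0 < R" "R < 1 / 2" using wbranchD(2)[OF V] wbranch_R_less[OF V] by auto
    have cR: "c \<le> R" using bb R c by (auto simp: field_simps)
    then have c1: "c \<le> 1" using R by simp
    have "wbranch (c\<^sup>2) \<epsilon> R K V" using wbranch_of_graph_bound[OF V _ c c1] bb by blast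
    moreover have "wbranch (c\<^sup>2) (-\<epsilon>) R (-K) W" using wbranch_of_graph_bound[OF W _ c c1] bb by blast
    moreover have "c\<^sup>2 \<le> R" using c c1 cR by (simp add: power2_eq_square) (meson mult_left_le mult_left_mono order_trans less_imp_le mult_le_cancel_left1)
    moreover have "\<bar>K\<bar> \<le> 3 * E"
    proof -
      have k: "0 < K / R" "K / R < 3 * \<epsilon>" using loop_graph_k_bounds[OF lg \<epsilon>(1)] by auto
      then have "0 < K" using R by (simp add: zero_less_divide_iff)
      moreover have "K < 3 * \<epsilon> * R" using k(2) R by (simp add: divide_less_eq)
      moreover have "3 * \<epsilon> * R \<le> 3 * E * 1" using \<epsilon> R by (intro mult_mono) auto
      ultimately show ?thesis by simp
    qed
    ultimately show ?thesis unfolding wloop_def using R by auto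
  qed
  then show ?thesis using c by (intro exI[of _ "c\<^sup>2"]) auto
qed

lemma wbranch_lipschitz:
  assumes V: "wbranch d \<epsilon> R K V" and "R \<le> 1" "\<bar>K\<bar> \<le> M" "\<bar>\<epsilon>\<bar> \<le> M" "0 < x" "x \<le> y" "y < 1"
  shows "\<bar>V y - V x\<bar> \<le> (6 / d + 4 * M) * (y - x)"
proof (rule bounded_derivative_diff[OF \<open>x \<le> y\<close>])
  note VD = wbranchD[OF V]
  fix t assume "x \<le> t" "t \<le> y"
  then have t: "0 < t" "t < 1" using assms by auto
  show "(V has_real_derivative - 2 * t * (1 - t\<^sup>2) * (2 * R\<^sup>2 - R * (1 - t\<^sup>2)) / V t + 2 * t * (K - \<epsilon> * (1 - t\<^sup>2))) (at t)"
    using VD(6)[OF t] .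
  define y where "y = t * (1 - t\<^sup>2)"
  have y: "0 < y" using t one_minus_sq[OF t] unfolding y_def by simp
  have "\<bar>2 * R\<^sup>2 - R * (1 - t\<^sup>2)\<bar> \<le> 3"
  proof -
    have "R * (1 - t\<^sup>2) \<le> 1 * 1" using VD(2) \<open>R \<le> 1\<close> one_minus_sq[OF t] by (intro mult_mono) auto
    moreover have "R\<^sup>2 \<le> 1" using VD(2) \<open>R \<le> 1\<close> by (simp add: power_le_one)
    moreover have "0 \<le> R * (1 - t\<^sup>2)" using VD(2) one_minus_sq[OF t] by simp
    ultimately show ?thesis using zero_le_power2[of R] by linarith
  qed
  then have "2 * y * \<bar>2 * R\<^sup>2 - R * (1 - t\<^sup>2)\<bar> \<le> 2 * y * 3" using y by (intro mult_left_mono) auto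
  then have "2 * y * \<bar>2 * R\<^sup>2 - R * (1 - t\<^sup>2)\<bar> / V t \<le> (2 * y * 3) / (d * y)"
    using VD(3,5)[OF t] VD(1) y unfolding y_def[symmetric] by (intro frac_le) auto
  also have "\<dots> = 6 / d" using y by simp
  finally have "\<bar>- 2 * t * (1 - t\<^sup>2) * (2 * R\<^sup>2 - R * (1 - t\<^sup>2)) / V t\<bar> \<le> 6 / d"
    using VD(5)[OF t] t one_minus_sq[OF t] unfolding y_def by (simp add: abs_mult)
  moreover have "\<bar>2 * t * (K - \<epsilon> * (1 - t\<^sup>2))\<bar> \<le> 4 * M"
  proof -
    have "\<bar>2 * t * (K - \<epsilon> * (1 - t\<^sup>2))\<bar> = 2 * t * \<bar>K - \<epsilon> * (1 - t\<^sup>2)\<bar>" using t by (simp add: abs_mult)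
    also have "\<dots> \<le> 2 * 1 * (M + M)" using t damping_bound[OF t, of K \<epsilon>] assms by (intro mult_mono) auto
    finally show ?thesis by simp
  qed
  ultimately show "\<bar>- 2 * t * (1 - t\<^sup>2) * (2 * R\<^sup>2 - R * (1 - t\<^sup>2)) / V t + 2 * t * (K - \<epsilon> * (1 - t\<^sup>2))\<bar> \<le> 6 / d + 4 * M"
    by (meson abs_triangle_ineq add_mono order_trans)
qed

text \<open>The limit is taken in the equation for the half squares, where nothing is divided by
  \<open>V\<close>. Their derivatives converge uniformly, and the common \<open>d\<close> keeps the
  limit positive, so the square root can be undone.\<close>

lemma wbranch_limit:
  fixes V :: "nat \<Rightarrow> real \<Rightarrow> real"
  assumes V: "\<And>n. wbranch d (e n) (r n) (k n) (V n)" and R: "0 < R"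
    and lim: "e \<longlonglongrightarrow> \<epsilon>" "r \<longlonglongrightarrow> R" "k \<longlonglongrightarrow> K" and ul: "uniform_limit {0<..<1} V v sequentially"
  shows "wbranch d \<epsilon> R K v"
  unfolding wbranch_def
proof (intro conjI ballI)
  have pw: "(\<lambda>n. V n w) \<longlonglongrightarrow> v w" if "w \<in> {0<..<1}" for w using tendsto_uniform_limitI[OF ul that] .
  show "0 < d" "0 < R" using wbranchD(1)[OF V[of 0]] R by auto
  fix w :: real assume w: "w \<in> {0<..<1}"
  then have ww: "0 < w" "w < 1" by auto
  show 1: "d * (w * (1 - w\<^sup>2)) \<le> v w" using wbranchD(3)[OF V ww] by (intro LIMSEQ_le_const[OF pw[OF w]]) auto
  show "v w \<le> w * (1 - w\<^sup>2) / d" using wbranchD(4)[OF V ww] by (intro LIMSEQ_le_const2[OF pw[OF w]]) auto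
  have lower: "d * (w * (1 - w\<^sup>2)) \<le> v w" if "w \<in> {0<..<1}" for w
    using wbranchD(3)[OF V] that by (intro LIMSEQ_le_const[OF pw[OF that]]) auto
  have pos: "0 < v w" if "w \<in> {0<..<1}" for w
  proof -
    have "0 < d * (w * (1 - w\<^sup>2))" using that one_minus_sq[of w] wbranchD(1)[OF V[of 0]] by auto
    then show ?thesis using lower[OF that] by linarith
  qed
  define Df where "Df = (\<lambda>n t. - 2 * t * (1 - t\<^sup>2) * (2 * (r n)\<^sup>2 - r n * (1 - t\<^sup>2)) + 2 * t * (k n - e n * (1 - t\<^sup>2)) * V n t)"
  define D where "D = (\<lambda>t. - 2 * t * (1 - t\<^sup>2) * (2 * R\<^sup>2 - R * (1 - t\<^sup>2)) + 2 * t * (K - \<epsilon> * (1 - t\<^sup>2)) * v t)"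
  have der: "((\<lambda>t. (V n t)\<^sup>2 / 2) has_real_derivative Df n t) (at t)" if "t \<in> {0<..<1}" for n t
  proof -
    have t: "0 < t" "t < 1" using that by auto
    note Vp = wbranchD(5)[OF V t, of n]
    have "V n t * (p / V n t + q) = p + q * V n t" for p q using Vp by (simp add: distrib_left)
    note eq = this[of "- 2 * t * (1 - t\<^sup>2) * (2 * (r n)\<^sup>2 - r n * (1 - t\<^sup>2))" "2 * t * (k n - e n * (1 - t\<^sup>2))"]
    have "((\<lambda>t. (V n t)\<^sup>2 / 2) has_real_derivative V n t * (- 2 * t * (1 - t\<^sup>2) * (2 * (r n)\<^sup>2 - r n * (1 - t\<^sup>2)) / V n t + 2 * t * (k n - e n * (1 - t\<^sup>2)))) (at t)"
    proof -
      have "((\<lambda>t. (V n t)\<^sup>2 / 2) has_real_derivative V n t * z) (at t)" if "(V n has_real_derivative z) (at t)" for z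
        using that by (auto intro!: derivative_eq_intros)
      from this[OF wbranchD(6)[OF V t]] show ?thesis .
    qed
    then show ?thesis unfolding eq Df_def .
  qed
  have bdd: "bounded (v ` {0<..<1})"
  proof -
    have "\<bar>v t\<bar> \<le> 1 / d" if "t \<in> {0<..<1}" for t
    proof -
      have t: "0 < t" "t < 1" using that by auto
      have "v t \<le> t * (1 - t\<^sup>2) / d" using wbranchD(4)[OF V t] by (intro LIMSEQ_le_const2[OF pw[OF that]]) auto
      also have "\<dots> \<le> 1 * 1 / d" using t one_minus_sq[OF t] wbranchD(1)[OF V[of 0]] by (intro divide_right_mono mult_mono) auto
      finally show ?thesis using pos[OF that] by simp
    qed
    then show ?thesis unfolding bounded_iff by (intro exI[of _ "1 / d"]) auto
  qed
  have c: "uniform_limit {0<..<1} (\<lambda>n (t::real). z n) (\<lambda>_. a) sequentially" if "z \<longlonglongrightarrow> a" for z and a :: real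
    using that unfolding uniform_limit_iff tendsto_iff by auto
  have b1: "bounded ((\<lambda>t. q t) ` {0<..<1})" if "continuous_on {0..1} q" for q :: "real \<Rightarrow> real"
    by (rule bounded_subset[OF compact_imp_bounded[OF compact_continuous_image[OF that compact_Icc]]]) auto
  have cst: "uniform_limit {0<..<1} (\<lambda>n. q) q sequentially" for q :: "real \<Rightarrow> real" by (rule uniform_limit_const)
  have ulD: "uniform_limit {0<..<1} Df D sequentially"
  proof -
    have A: "uniform_limit {0<..<1} (\<lambda>n t. 2 * (r n)\<^sup>2 - r n * (1 - t\<^sup>2)) (\<lambda>t. 2 * R\<^sup>2 - R * (1 - t\<^sup>2)) sequentially"
      by (intro uniform_limit_minus c uniform_lim_mult[where f = "\<lambda>n t. r n" and l = "\<lambda>_. R"] cst tendsto_intros lim b1 continuous_intros)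
    have B: "uniform_limit {0<..<1} (\<lambda>n t. k n - e n * (1 - t\<^sup>2)) (\<lambda>t. K - \<epsilon> * (1 - t\<^sup>2)) sequentially"
      by (intro uniform_limit_minus c uniform_lim_mult[where f = "\<lambda>n t. e n" and l = "\<lambda>_. \<epsilon>"] cst tendsto_intros lim b1 continuous_intros)
    have A2: "uniform_limit {0<..<1} (\<lambda>n t. (- 2 * t * (1 - t\<^sup>2)) * (2 * (r n)\<^sup>2 - r n * (1 - t\<^sup>2))) (\<lambda>t. (- 2 * t * (1 - t\<^sup>2)) * (2 * R\<^sup>2 - R * (1 - t\<^sup>2))) sequentially"
      by (rule uniform_lim_mult[OF cst A]) (intro b1 continuous_intros)+
    have B2: "uniform_limit {0<..<1} (\<lambda>n t. (2 * t) * (k n - e n * (1 - t\<^sup>2))) (\<lambda>t. (2 * t) * (K - \<epsilon> * (1 - t\<^sup>2))) sequentially"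
      by (rule uniform_lim_mult[OF cst B]) (intro b1 continuous_intros)+
    have "uniform_limit {0<..<1} (\<lambda>n t. (2 * t) * (k n - e n * (1 - t\<^sup>2)) * V n t) (\<lambda>t. (2 * t) * (K - \<epsilon> * (1 - t\<^sup>2)) * v t) sequentially"
      by (rule uniform_lim_mult[OF B2 ul _ bdd]) (intro b1 continuous_intros)
    from uniform_limit_add[OF A2 this] show ?thesis unfolding Df_def D_def .
  qed
  obtain g where g: "\<And>t. t \<in> {0<..<1} \<Longrightarrow> (\<lambda>n. (V n t)\<^sup>2 / 2) \<longlonglongrightarrow> g t" "\<And>t. t \<in> {0<..<1} \<Longrightarrow> (g has_real_derivative D t) (at t)"
  proof -
    have "\<exists>g. \<forall>t\<in>{0<..<1}. (\<lambda>n. (V n t)\<^sup>2 / 2) \<longlonglongrightarrow> g t \<and> (g has_derivative (\<lambda>h. D t * h)) (at t within {0<..<1})"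
    proof (rule has_derivative_sequence[where f = "\<lambda>n t. (V n t)\<^sup>2 / 2" and f' = "\<lambda>n t h. Df n t * h"])
      show "((\<lambda>t. (V n t)\<^sup>2 / 2) has_derivative (\<lambda>h. Df n t * h)) (at t within {0<..<1})" if "t \<in> {0<..<1}" for n t
        using der[OF that] by (auto simp: has_field_derivative_def intro: has_derivative_at_withinI)
      show "\<forall>\<^sub>F n in sequentially. \<forall>t\<in>{0<..<1}. \<forall>h. norm (Df n t * h - D t * h) \<le> \<epsilon> * norm h" if "0 < \<epsilon>" for \<epsilon>
      proof -
        have "\<forall>\<^sub>F n in sequentially. \<forall>t\<in>{0<..<1}. dist (Df n t) (D t) < \<epsilon>" using ulD that unfolding uniform_limit_iff by blast
        then show ?thesis
        proof eventually_elim
          case (elim n)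
          have "norm (Df n t * h - D t * h) \<le> \<epsilon> * norm h" if "t \<in> {0<..<1}" for t h
          proof -
            have "norm (Df n t * h - D t * h) = dist (Df n t) (D t) * norm h" by (simp add: dist_real_def abs_mult left_diff_distrib[symmetric])
            also have "\<dots> \<le> \<epsilon> * norm h" using elim that by (intro mult_right_mono) (auto intro: less_imp_le)
            finally show ?thesis .
          qed
          then show ?case by blast
        qed
      qed
      show "(\<lambda>n. (V n w)\<^sup>2 / 2) \<longlonglongrightarrow> (v w)\<^sup>2 / 2" by (intro tendsto_intros pw w) simp
    qed (use w in auto)
    then obtain g where "\<And>t. t \<in> {0<..<1} \<Longrightarrow> (\<lambda>n. (V n t)\<^sup>2 / 2) \<longlonglongrightarrow> g t \<and> (g has_derivative (\<lambda>h. D t * h)) (at t within {0<..<1})" by blast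
    then show ?thesis using that[of g] by (simp add: has_field_derivative_def at_within_open[OF _ open_greaterThanLessThan])
  qed
  have geq: "g t = (v t)\<^sup>2 / 2" if "t \<in> {0<..<1}" for t
  proof (rule LIMSEQ_unique[OF g(1)[OF that]])
    show "(\<lambda>n. (V n t)\<^sup>2 / 2) \<longlonglongrightarrow> (v t)\<^sup>2 / 2" by (intro tendsto_intros pw that) simp
  qed
  have "((\<lambda>t. (v t)\<^sup>2 / 2) has_real_derivative D w) (at w)"
    by (rule has_field_derivative_transform_within_open[OF g(2)[OF w] open_greaterThanLessThan w geq])
  from DERIV_of_half_square[OF this open_greaterThanLessThan w pos]
  have "(v has_real_derivative D w / v w) (at w)" .
  moreover have "D w / v w = - 2 * w * (1 - w\<^sup>2) * (2 * R\<^sup>2 - R * (1 - w\<^sup>2)) / v w + 2 * w * (K - \<epsilon> * (1 - w\<^sup>2))"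
  proof -
    have "(p + q * a) / a = p / a + q" if "0 < a" for a p q :: real using that by (simp add: add_divide_distrib)
    from this[OF pos[OF w]] show ?thesis unfolding D_def by blast
  qed
  ultimately show "(v has_real_derivative - 2 * w * (1 - w\<^sup>2) * (2 * R\<^sup>2 - R * (1 - w\<^sup>2)) / v w + 2 * w * (K - \<epsilon> * (1 - w\<^sup>2))) (at w)"
    by (simp only:)
qed
text \<open>Extension by zero preserves the Lipschitz bound because the weight vanishes linearly at
  both ends. This provides equicontinuity on a compact interval.\<close>

lemma wbranch_clamped_lipschitz:
  assumes V: "wbranch d \<epsilon> R K V" and "R \<le> 1" "\<bar>K\<bar> \<le> M" "\<bar>\<epsilon>\<bar> \<le> M" and xy: "x \<in> {0..1}" "y \<in> {0..1}"
  defines "f \<equiv> \<lambda>w. if w \<in> {0<..<1} then V w else 0"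
  shows "\<bar>f y - f x\<bar> \<le> (6 / d + 4 * M) * \<bar>y - x\<bar>" "\<bar>f x\<bar> \<le> 1 / d"
proof -
  note VD = wbranchD[OF V]
  have M: "0 \<le> M" using assms by linarith
  have c: "2 / d \<le> 6 / d + 4 * M" "1 / d \<le> 6 / d + 4 * M" using VD(1) M by (auto simp: field_simps)
  have end0: "\<bar>f w\<bar> \<le> (6 / d + 4 * M) * w" "\<bar>f w\<bar> \<le> (6 / d + 4 * M) * (1 - w)" if w: "w \<in> {0..1}" for w
  proof -
    have "\<bar>f w\<bar> \<le> (6 / d + 4 * M) * w \<and> \<bar>f w\<bar> \<le> (6 / d + 4 * M) * (1 - w)"
    proof (cases "w \<in> {0<..<1}")
      case True
      then have ww: "0 < w" "w < 1" by auto
      have "1 - w\<^sup>2 = (1 + w) * (1 - w)" by (simp add: algebra_simps power2_eq_square)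
      also have "\<dots> \<le> 2 * (1 - w)" using ww by (intro mult_right_mono) auto
      finally have U2: "1 - w\<^sup>2 \<le> 2 * (1 - w)" .
      have "w * (1 - w\<^sup>2) / d \<le> w * 1 / d" using ww one_minus_sq[OF ww] VD(1) by (intro divide_right_mono mult_left_mono) auto
      also have "\<dots> = 1 / d * w" by simp
      also have "\<dots> \<le> (6 / d + 4 * M) * w" using c ww by (intro mult_right_mono) auto
      finally have 1: "V w \<le> (6 / d + 4 * M) * w" using VD(4)[OF ww] by linarith
      have "w * (1 - w\<^sup>2) / d \<le> 1 * (2 * (1 - w)) / d" using ww one_minus_sq[OF ww] U2 VD(1) by (intro divide_right_mono mult_mono) auto
      also have "\<dots> = 2 / d * (1 - w)" by simp
      also have "\<dots> \<le> (6 / d + 4 * M) * (1 - w)" using c ww by (intro mult_right_mono) auto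
      finally have 2: "V w \<le> (6 / d + 4 * M) * (1 - w)" using VD(4)[OF ww] by linarith
      show ?thesis using 1 2 VD(5)[OF ww] True unfolding f_def by auto
    next
      case False
      then show ?thesis using w M VD(1) unfolding f_def by auto
    qed
    then show "\<bar>f w\<bar> \<le> (6 / d + 4 * M) * w" "\<bar>f w\<bar> \<le> (6 / d + 4 * M) * (1 - w)" by auto
  qed
  have *: "\<bar>f y - f x\<bar> \<le> (6 / d + 4 * M) * (y - x)" if "x \<le> y" "x \<in> {0..1}" "y \<in> {0..1}" for x y
  proof -
    have "x = 0 \<or> y = 1 \<or> (x \<in> {0<..<1} \<and> y \<in> {0<..<1})" using that by auto
    then consider "x = 0" | "y = 1" | "x \<in> {0<..<1}" "y \<in> {0<..<1}" by blast
    then show ?thesis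
    proof cases
      case 1
      then have "f x = 0" unfolding f_def by simp
      then show ?thesis using end0(1)[OF that(3)] 1 by simp
    next
      case 2
      then have "f y = 0" unfolding f_def by simp
      then show ?thesis using end0(2)[OF that(2)] 2 by simp
    next
      case 3
      then show ?thesis using wbranch_lipschitz[OF V assms(2-4), of x y] that unfolding f_def by auto
    qed
  qed
  show "\<bar>f y - f x\<bar> \<le> (6 / d + 4 * M) * \<bar>y - x\<bar>"
  proof (cases "x \<le> y")
    case True
    then show ?thesis using *[OF True xy] by simp
  next
    case False
    then show ?thesis using *[OF _ xy(2,1)] by (simp add: abs_minus_commute)
  qed
  show "\<bar>f x\<bar> \<le> 1 / d"
  proof (cases "x \<in> {0<..<1}")
    case True
    then have "V x \<le> x * (1 - x\<^sup>2) / d" "0 < V x" using VD(4,5) by auto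
    moreover have "x * (1 - x\<^sup>2) / d \<le> 1 * 1 / d" using True one_minus_sq[of x] VD(1) by (intro divide_right_mono mult_mono) auto
    ultimately show ?thesis using True unfolding f_def by auto
  next
    case False
    then show ?thesis unfolding f_def using VD(1) by auto
  qed
qed

text \<open>A subsequence makes \<open>R\<close> and \<open>K\<close> converge, and Arzela-Ascoli
  provides a further one for the two halves. The halves are paired into one map to the plane in
  order to obtain a common subsequence.\<close>

lemma wloop_limit:
  assumes w: "\<And>n. wloop d (e n) (r n) (k n)" and rk: "\<And>n. d \<le> r n" "\<And>n. r n \<le> 1" "\<And>n. \<bar>k n\<bar> \<le> M" "\<And>n. \<bar>e n\<bar> \<le> M"
    and e: "e \<longlonglongrightarrow> \<epsilon>"
  shows "\<exists>R K. wloop d \<epsilon> R K"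
proof -
  obtain V W where V: "\<And>n. wbranch d (e n) (r n) (k n) (V n)" and W: "\<And>n. wbranch d (- e n) (r n) (- k n) (W n)"
    using w unfolding wloop_def by metis
  have d: "0 < d" using wbranchD(1)[OF V[of 0]] .
  have cpt: "compact ({d..1} \<times> {-M..M})" by (intro compact_Times compact_Icc)
  have mem: "\<forall>n. (r n, k n) \<in> {d..1} \<times> {-M..M}" using rk by (auto simp: abs_le_iff minus_le_iff)
  obtain l s where s: "l \<in> {d..1} \<times> {-M..M}" "strict_mono s" "((\<lambda>n. (r n, k n)) \<circ> s) \<longlonglongrightarrow> l"
    using cpt mem unfolding compact_def by (elim allE[where x = "\<lambda>n. (r n, k n)"]) blast
  define R where "R = fst l"
  define K where "K = snd l"
  have rs: "(\<lambda>n. r (s n)) \<longlonglongrightarrow> R" using tendsto_fst[OF s(3)] unfolding R_def by (simp add: o_def)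
  have ks: "(\<lambda>n. k (s n)) \<longlonglongrightarrow> K" using tendsto_snd[OF s(3)] unfolding K_def by (simp add: o_def)
  have R: "0 < R" using s(1) d unfolding R_def by auto
  define cl where "cl = (\<lambda>(f::real\<Rightarrow>real) w. if w \<in> {0<..<1} then f w else 0)"
  define L where "L = 6 / d + 4 * M"
  have M: "0 \<le> M" using rk(3)[of 0] by linarith
  have L: "0 < L" unfolding L_def using d M by (intro add_pos_nonneg) auto
  have Ve: "\<bar>- e n\<bar> \<le> M" "\<bar>- k n\<bar> \<le> M" for n using rk by simp_all
  have lipV: "\<bar>cl (V n) y - cl (V n) x\<bar> \<le> L * \<bar>y - x\<bar>" "\<bar>cl (V n) x\<bar> \<le> 1 / d"
    and lipW: "\<bar>cl (W n) y - cl (W n) x\<bar> \<le> L * \<bar>y - x\<bar>" "\<bar>cl (W n) x\<bar> \<le> 1 / d" if "x \<in> {0..1}" "y \<in> {0..1}" for n x y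
    using wbranch_clamped_lipschitz[OF V rk(2-4) that] wbranch_clamped_lipschitz[OF W rk(2) Ve(2,1) that]
    unfolding cl_def L_def by blast+
  define F where "F = (\<lambda>n w. (cl (V (s n)) w, cl (W (s n)) w))"
  have nF: "norm (F n w) \<le> \<bar>cl (V (s n)) w\<bar> + \<bar>cl (W (s n)) w\<bar>" for n w
    unfolding F_def using norm_Pair_le[of "cl (V (s n)) w" "cl (W (s n)) w"] by simp
  have dF: "norm (F n x - F n y) \<le> 2 * L * \<bar>x - y\<bar>" if "x \<in> {0..1}" "y \<in> {0..1}" for n x y
  proof -
    have "norm (F n x - F n y) \<le> \<bar>cl (V (s n)) x - cl (V (s n)) y\<bar> + \<bar>cl (W (s n)) x - cl (W (s n)) y\<bar>"
      unfolding F_def using norm_Pair_le[of "cl (V (s n)) x - cl (V (s n)) y" "cl (W (s n)) x - cl (W (s n)) y"] by simp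
    then show ?thesis using lipV(1)[OF that(2,1), of "s n"] lipW(1)[OF that(2,1), of "s n"] by linarith
  qed
  obtain g q where q: "strict_mono (q :: nat \<Rightarrow> nat)"
    and g: "\<And>\<epsilon>. 0 < \<epsilon> \<Longrightarrow> \<exists>N. \<forall>n x. n \<ge> N \<and> x \<in> {0..1} \<longrightarrow> norm (F (q n) x - g x) < \<epsilon>"
  proof (rule Arzela_Ascoli[of "{0..1::real}" F "2 / d"])
    show "norm (F n x) \<le> 2 / d" if "x \<in> {0..1}" for n x
      using nF[of n x] lipV(2)[OF that that, of "s n"] lipW(2)[OF that that, of "s n"] by simp
    show "\<exists>\<delta>>0. \<forall>n y. y \<in> {0..1} \<and> norm (x - y) < \<delta> \<longrightarrow> norm (F n x - F n y) < \<eta>" if x: "x \<in> {0..1}" and "0 < \<eta>" for x \<eta>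
    proof (intro exI[of _ "\<eta> / (2 * L)"] conjI allI impI)
      show "0 < \<eta> / (2 * L)" using L \<open>0 < \<eta>\<close> by simp
      fix n y assume y: "y \<in> {0..1} \<and> norm (x - y) < \<eta> / (2 * L)"
      then have "2 * L * \<bar>x - y\<bar> < \<eta>" using L by (simp add: field_simps)
      then show "norm (F n x - F n y) < \<eta>" using dF[OF x, of y n] y by simp
    qed
  qed (auto intro: that)
  define z where "z = (\<lambda>n. s (q n))"
  have uV: "uniform_limit {0<..<1} (\<lambda>n. V (z n)) (\<lambda>x. fst (g x)) sequentially"
    and uW: "uniform_limit {0<..<1} (\<lambda>n. W (z n)) (\<lambda>x. snd (g x)) sequentially"
  proof -
    have *: "\<forall>\<^sub>F n in sequentially. \<forall>x\<in>{0<..<1}. dist (V (z n) x) (fst (g x)) < \<eta> \<and> dist (W (z n) x) (snd (g x)) < \<eta>" if "0 < \<eta>" for \<eta>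
    proof -
      obtain N where N: "\<And>n x. n \<ge> N \<Longrightarrow> x \<in> {0..1} \<Longrightarrow> norm (F (q n) x - g x) < \<eta>" using g[OF \<open>0 < \<eta>\<close>] by blast
      have "dist (V (z n) x) (fst (g x)) < \<eta> \<and> dist (W (z n) x) (snd (g x)) < \<eta>" if "n \<ge> N" "x \<in> {0<..<1}" for n x
      proof -
        have n: "norm (F (q n) x - g x) < \<eta>" using N[OF that(1), of x] that by auto
        have "dist (V (z n) x) (fst (g x)) \<le> norm (F (q n) x - g x)"
          using dist_fst_le[of "F (q n) x" "g x"] that unfolding F_def z_def cl_def by (simp add: dist_norm)
        moreover have "dist (W (z n) x) (snd (g x)) \<le> norm (F (q n) x - g x)"
          using dist_snd_le[of "F (q n) x" "g x"] that unfolding F_def z_def cl_def by (simp add: dist_norm)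
        ultimately show ?thesis using n by linarith
      qed
      then show ?thesis unfolding eventually_sequentially by blast
    qed
    show "uniform_limit {0<..<1} (\<lambda>n. V (z n)) (\<lambda>x. fst (g x)) sequentially"
      unfolding uniform_limit_iff by (intro allI impI eventually_mono[OF *]) auto
    show "uniform_limit {0<..<1} (\<lambda>n. W (z n)) (\<lambda>x. snd (g x)) sequentially"
      unfolding uniform_limit_iff by (intro allI impI eventually_mono[OF *]) auto
  qed
  have ez: "(\<lambda>n. e (z n)) \<longlonglongrightarrow> \<epsilon>" unfolding z_def
    using LIMSEQ_subseq_LIMSEQ[OF LIMSEQ_subseq_LIMSEQ[OF e s(2)] q] by (simp add: o_def)
  have rz: "(\<lambda>n. r (z n)) \<longlonglongrightarrow> R" unfolding z_def using LIMSEQ_subseq_LIMSEQ[OF rs q] by (simp add: o_def)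
  have kz: "(\<lambda>n. k (z n)) \<longlonglongrightarrow> K" unfolding z_def using LIMSEQ_subseq_LIMSEQ[OF ks q] by (simp add: o_def)
  have "wbranch d \<epsilon> R K (\<lambda>x. fst (g x))" by (rule wbranch_limit[OF V R ez rz kz uV])
  moreover have "wbranch d (-\<epsilon>) R (-K) (\<lambda>x. snd (g x))"
    by (rule wbranch_limit[OF W R tendsto_minus[OF ez] rz tendsto_minus[OF kz] uW])
  ultimately show ?thesis unfolding wloop_def by blast
qed

section \<open>Homoclinic orbits and loop graphs\<close>

definition saddle_orbit :: "real \<Rightarrow> real \<Rightarrow> (real \<Rightarrow> real) \<Rightarrow> (real \<Rightarrow> real) \<Rightarrow> bool" where
  "saddle_orbit \<epsilon> \<kappa> X Y \<longleftrightarrow>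
     (\<forall>t. (X has_real_derivative Y t) (at t)) \<and>
     (\<forall>t. (Y has_real_derivative (X t)\<^sup>2 - 1 + (\<kappa> + \<epsilon> * X t) * Y t) (at t)) \<and>
     (X \<longlongrightarrow> 1) at_top \<and> (Y \<longlongrightarrow> 0) at_top \<and> (X \<longlongrightarrow> 1) at_bot \<and> (Y \<longlongrightarrow> 0) at_bot \<and>
     (\<exists>t. \<not> (X t = 1 \<and> Y t = 0))"

lemma saddle_orbitD:
  assumes "saddle_orbit \<epsilon> \<kappa> X Y"
  shows "\<And>t. (X has_real_derivative Y t) (at t)"
    "\<And>t. (Y has_real_derivative (X t)\<^sup>2 - 1 + (\<kappa> + \<epsilon> * X t) * Y t) (at t)"
    "(X \<longlongrightarrow> 1) at_top" "(Y \<longlongrightarrow> 0) at_top" "(X \<longlongrightarrow> 1) at_bot" "(Y \<longlongrightarrow> 0) at_bot"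
    "\<And>t. isCont X t" "\<And>t. isCont Y t"
proof -
  show "\<And>t. (X has_real_derivative Y t) (at t)"
    "\<And>t. (Y has_real_derivative (X t)\<^sup>2 - 1 + (\<kappa> + \<epsilon> * X t) * Y t) (at t)"
    "(X \<longlongrightarrow> 1) at_top" "(Y \<longlongrightarrow> 0) at_top" "(X \<longlongrightarrow> 1) at_bot" "(Y \<longlongrightarrow> 0) at_bot"
    using assms unfolding saddle_orbit_def by auto
  then show "\<And>t. isCont X t" "\<And>t. isCont Y t" by (blast intro: DERIV_isCont)+
qed

lemma gronwall_zero:
  fixes N :: "real \<Rightarrow> real"
  assumes der: "\<And>t. (N has_real_derivative N' t) (at t)" and le: "\<And>t. \<bar>N' t\<bar> \<le> C * N t" and nn: "\<And>t. 0 \<le> N t"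
    and N0: "N t0 = 0"
  shows "N t = 0"
proof -
  have "((\<lambda>t. N t * exp (- C * t)) has_real_derivative (N' t - C * N t) * exp (- C * t)) (at t)" for t
    by (auto intro!: derivative_eq_intros der simp: algebra_simps)
  moreover have "(N' t - C * N t) * exp (- C * t) \<le> 0" for t
    using le[of t] by (intro mult_nonpos_nonneg) (auto simp: abs_le_iff)
  ultimately have dec: "N y * exp (- C * y) \<le> N x * exp (- C * x)" if "x \<le> y" for x y
    by (intro DERIV_nonpos_imp_nonincreasing[OF that, where f = "\<lambda>t. N t * exp (- C * t)"]) blast
  have "((\<lambda>t. N t * exp (C * t)) has_real_derivative (N' t + C * N t) * exp (C * t)) (at t)" for t
    by (auto intro!: derivative_eq_intros der simp: algebra_simps)
  moreover have "0 \<le> (N' t + C * N t) * exp (C * t)" for t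
    using le[of t] by (intro mult_nonneg_nonneg) (auto simp: abs_le_iff)
  ultimately have inc: "N x * exp (C * x) \<le> N y * exp (C * y)" if "x \<le> y" for x y
    by (intro DERIV_nonneg_imp_nondecreasing[OF that, where f = "\<lambda>t. N t * exp (C * t)"]) blast
  have "N t \<le> 0"
  proof (cases "t0 \<le> t")
    case True
    then show ?thesis using dec[OF True] N0 by (simp add: mult_le_0_iff)
  next
    case False
    then show ?thesis using inc[of t t0] N0 by (simp add: mult_le_0_iff)
  qed
  then show ?thesis using nn[of t] by simp
qed

text \<open>Gronwall's inequality for the squared distance of two solutions. The field is only
  locally Lipschitz, hence the bounds; orbits that converge at both ends satisfy them.\<close>

lemma ode_unique:
  assumes X: "\<And>t. (X has_real_derivative Y t) (at t)"
    and Y: "\<And>t. (Y has_real_derivative (X t)\<^sup>2 - 1 + (\<kappa> + \<epsilon> * X t) * Y t) (at t)"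
    and P: "\<And>t. (P has_real_derivative Q t) (at t)"
    and Q: "\<And>t. (Q has_real_derivative (P t)\<^sup>2 - 1 + (\<kappa> + \<epsilon> * P t) * Q t) (at t)"
    and bd: "\<And>t. \<bar>X t\<bar> \<le> M" "\<And>t. \<bar>P t\<bar> \<le> M" "\<And>t. \<bar>Q t\<bar> \<le> M"
    and init: "X t0 = P t0" "Y t0 = Q t0"
  shows "X t = P t" "Y t = Q t"
proof -
  define N where "N = (\<lambda>t. (X t - P t)\<^sup>2 + (Y t - Q t)\<^sup>2)"
  define N' where "N' = (\<lambda>t. 2 * (X t - P t) * (Y t - Q t) + 2 * (Y t - Q t) * ((X t + P t) * (X t - P t) + \<kappa> * (Y t - Q t) + \<epsilon> * (X t * (Y t - Q t) + Q t * (X t - P t))))"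
  define c where "c = 1 + 2 * M + \<bar>\<epsilon>\<bar> * M"
  define C where "C = c + 2 * (\<bar>\<kappa>\<bar> + \<bar>\<epsilon>\<bar> * M)"
  have M: "0 \<le> M" using bd(1)[of 0] by linarith
  have N_der: "(N has_real_derivative N' t) (at t)" for t
  proof -
    have "(N has_real_derivative 2 * (X t - P t) * (Y t - Q t) + 2 * (Y t - Q t) * (((X t)\<^sup>2 - 1 + (\<kappa> + \<epsilon> * X t) * Y t) - ((P t)\<^sup>2 - 1 + (\<kappa> + \<epsilon> * P t) * Q t))) (at t)"
      unfolding N_def by (auto intro!: derivative_eq_intros X Y P Q simp: algebra_simps)
    moreover have "((X t)\<^sup>2 - 1 + (\<kappa> + \<epsilon> * X t) * Y t) - ((P t)\<^sup>2 - 1 + (\<kappa> + \<epsilon> * P t) * Q t) = (X t + P t) * (X t - P t) + \<kappa> * (Y t - Q t) + \<epsilon> * (X t * (Y t - Q t) + Q t * (X t - P t))"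
      by (simp add: algebra_simps power2_eq_square)
    ultimately show ?thesis unfolding N'_def by simp
  qed
  have N_le: "\<bar>N' t\<bar> \<le> C * N t" for t
  proof -
    define a b where "a = X t - P t" and "b = Y t - Q t"
    have e: "N' t = 2 * (a * b) * (1 + (X t + P t) + \<epsilon> * Q t) + 2 * b\<^sup>2 * (\<kappa> + \<epsilon> * X t)"
      unfolding N'_def a_def[symmetric] b_def[symmetric] by (simp add: algebra_simps power2_eq_square)
    have 1: "\<bar>1 + (X t + P t) + \<epsilon> * Q t\<bar> \<le> c"
    proof -
      have "\<bar>\<epsilon> * Q t\<bar> \<le> \<bar>\<epsilon>\<bar> * M" unfolding abs_mult using bd(3) by (intro mult_left_mono) auto
      then show ?thesis unfolding c_def using bd(1,2)[of t] by linarith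
    qed
    have 2: "\<bar>\<kappa> + \<epsilon> * X t\<bar> \<le> \<bar>\<kappa>\<bar> + \<bar>\<epsilon>\<bar> * M"
    proof -
      have "\<bar>\<epsilon> * X t\<bar> \<le> \<bar>\<epsilon>\<bar> * M" unfolding abs_mult using bd(1) by (intro mult_left_mono) auto
      then show ?thesis by linarith
    qed
    have ab: "\<bar>2 * (a * b)\<bar> \<le> a\<^sup>2 + b\<^sup>2"
    proof -
      have "0 \<le> (a + b)\<^sup>2" "0 \<le> (a - b)\<^sup>2" by auto
      then show ?thesis by (auto simp: abs_le_iff power2_eq_square algebra_simps)
    qed
    have p1: "\<bar>2 * (a * b) * (1 + (X t + P t) + \<epsilon> * Q t)\<bar> \<le> (a\<^sup>2 + b\<^sup>2) * c"
      unfolding abs_mult[of "2 * (a * b)"] using ab 1 by (intro mult_mono) auto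
    have "\<bar>2 * b\<^sup>2 * (\<kappa> + \<epsilon> * X t)\<bar> = 2 * b\<^sup>2 * \<bar>\<kappa> + \<epsilon> * X t\<bar>" by (simp add: abs_mult)
    also have "\<dots> \<le> 2 * (a\<^sup>2 + b\<^sup>2) * (\<bar>\<kappa>\<bar> + \<bar>\<epsilon>\<bar> * M)" using 2 by (intro mult_mono) auto
    finally have p2: "\<bar>2 * b\<^sup>2 * (\<kappa> + \<epsilon> * X t)\<bar> \<le> 2 * (a\<^sup>2 + b\<^sup>2) * (\<bar>\<kappa>\<bar> + \<bar>\<epsilon>\<bar> * M)" .
    have "\<bar>N' t\<bar> \<le> (a\<^sup>2 + b\<^sup>2) * c + 2 * (a\<^sup>2 + b\<^sup>2) * (\<bar>\<kappa>\<bar> + \<bar>\<epsilon>\<bar> * M)"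
      unfolding e by (intro order_trans[OF abs_triangle_ineq] add_mono p1 p2)
    also have "\<dots> = C * N t" unfolding C_def N_def a_def b_def by (simp add: algebra_simps)
    finally show ?thesis .
  qed
  have nn: "0 \<le> N t" for t unfolding N_def by simp
  have N0: "N t0 = 0" unfolding N_def init by simp
  have "N t = 0" by (rule gronwall_zero[OF N_der N_le nn N0])
  then show "X t = P t" "Y t = Q t" unfolding N_def by (auto simp: sum_power2_eq_zero_iff)
qed

lemma bounded_if_limits:
  fixes X :: "real \<Rightarrow> real"
  assumes c: "\<And>t. isCont X t" and "(X \<longlongrightarrow> a) at_top" "(X \<longlongrightarrow> b) at_bot"
  shows "\<exists>M. \<forall>t. \<bar>X t\<bar> \<le> M"
proof -
  obtain T where T: "\<And>t. T \<le> t \<Longrightarrow> \<bar>X t - a\<bar> < 1"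
    using tendstoD[OF assms(2), of 1] unfolding eventually_at_top_linorder dist_real_def by auto
  obtain S where S: "\<And>t. t \<le> S \<Longrightarrow> \<bar>X t - b\<bar> < 1"
    using tendstoD[OF assms(3), of 1] unfolding eventually_at_bot_linorder dist_real_def by auto
  have "bounded (X ` {S..T})"
    using c by (intro compact_imp_bounded compact_continuous_image continuous_at_imp_continuous_on) auto
  then obtain K where "\<forall>x\<in>X ` {S..T}. norm x \<le> K" unfolding bounded_iff by blast
  then have K: "\<bar>X t\<bar> \<le> K" if "t \<in> {S..T}" for t using that by simp
  have "\<bar>X t\<bar> \<le> max K (max (\<bar>a\<bar> + 1) (\<bar>b\<bar> + 1))" for t
    using T[of t] S[of t] K[of t] by (cases "T \<le> t"; cases "t \<le> S") (auto simp: max_def)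
  then show ?thesis by blast
qed

context
  fixes \<epsilon> \<kappa> :: real and X Y :: "real \<Rightarrow> real"
  assumes orb: "saddle_orbit \<epsilon> \<kappa> X Y"
begin

lemmas oD = saddle_orbitD[OF orb]

lemma orbit_bounded: "\<exists>M\<ge>1. \<forall>t. \<bar>X t\<bar> \<le> M \<and> \<bar>Y t\<bar> \<le> M"
proof -
  obtain M1 where M1: "\<And>t. \<bar>X t\<bar> \<le> M1" using bounded_if_limits[OF oD(7,3,5)] by blast
  obtain M2 where M2: "\<And>t. \<bar>Y t\<bar> \<le> M2" using bounded_if_limits[OF oD(8,4,6)] by blast
  show ?thesis
    by (intro exI[of _ "max 1 (max M1 M2)"]) (use M1 M2 in \<open>auto simp: le_max_iff_disj\<close>)
qed

lemma orbit_not_equilibrium: "\<not> (Y t = 0 \<and> (X t)\<^sup>2 = 1)"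
proof
  assume a: "Y t = 0 \<and> (X t)\<^sup>2 = 1"
  obtain M where M: "1 \<le> M" "\<And>t. \<bar>X t\<bar> \<le> M" "\<And>t. \<bar>Y t\<bar> \<le> M" using orbit_bounded by blast
  define c where "c = X t"
  have c: "c\<^sup>2 = 1" using a unfolding c_def by simp
  then have "\<bar>c\<bar> = 1" by (metis abs_1 power2_eq_iff_nonneg abs_ge_zero power2_abs power_one zero_le_one)
  then have cM: "\<bar>c\<bar> \<le> M" "\<bar>0::real\<bar> \<le> M" using M(1) by auto
  have cst: "((\<lambda>_. c) has_real_derivative 0) (at u)" "((\<lambda>_. 0) has_real_derivative c\<^sup>2 - 1 + (\<kappa> + \<epsilon> * c) * 0) (at u)" for u
    using c by auto
  have init: "X t = c" "Y t = 0" using a unfolding c_def by auto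
  have all: "X s = c" "Y s = 0" for s
    using ode_unique[OF oD(1,2) cst M(2) cM init] by blast+
  have "X = (\<lambda>_. c)" using all by auto
  then have "((\<lambda>_. c) \<longlongrightarrow> 1) (at_top :: real filter)" using oD(3) by metis
  then have "c = 1" using tendsto_unique[OF _ tendsto_const, of "at_top :: real filter" c 1] by auto
  then show False using orb all unfolding saddle_orbit_def by auto
qed

text \<open>A return would make the orbit periodic, and a periodic curve that converges is
  constant.\<close>

lemma orbit_injective:
  assumes "s < t"
  shows "\<not> (X s = X t \<and> Y s = Y t)"
proof
  assume eq: "X s = X t \<and> Y s = Y t"
  define p where "p = t - s"
  have p: "0 < p" unfolding p_def using assms by simp
  obtain M where M: "1 \<le> M" "\<And>t. \<bar>X t\<bar> \<le> M" "\<And>t. \<bar>Y t\<bar> \<le> M" using orbit_bounded by blast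
  have shift: "((\<lambda>u. f (u + p)) has_real_derivative f' (u + p)) (at u)" if "\<And>u. (f has_real_derivative f' u) (at u)" for f f' :: "real \<Rightarrow> real" and u
    using DERIV_shift[of f "f' (u + p)" u p] that by auto
  have sX: "((\<lambda>u. X (u + p)) has_real_derivative Y (u + p)) (at u)" for u using shift[OF oD(1)] .
  have sY: "((\<lambda>u. Y (u + p)) has_real_derivative (X (u + p))\<^sup>2 - 1 + (\<kappa> + \<epsilon> * X (u + p)) * Y (u + p)) (at u)" for u
    using shift[OF oD(2)] .
  have init: "X (s + p) = X s" "Y (s + p) = Y s" using eq by (auto simp: p_def)
  have per: "X (u + p) = X u" "Y (u + p) = Y u" for u
    using ode_unique[OF sX sY oD(1,2) M(2) M(2,3) init] by blast+
  have pern: "X (u + real n * p) = X u \<and> Y (u + real n * p) = Y u" for u n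
  proof (induction n)
    case (Suc n)
    have "u + real (Suc n) * p = (u + real n * p) + p" by (simp add: algebra_simps)
    then show ?case using Suc per by metis
  qed simp
  have "filterlim (\<lambda>n. u + real n * p) at_top sequentially" for u
    using p by (intro filterlim_tendsto_add_at_top[OF tendsto_const] filterlim_at_top_mult_tendsto_pos[OF tendsto_const p] filterlim_real_sequentially)
  then have "(\<lambda>n. X (u + real n * p)) \<longlonglongrightarrow> 1" "(\<lambda>n. Y (u + real n * p)) \<longlonglongrightarrow> 0" for u
    using filterlim_compose[OF oD(3)] filterlim_compose[OF oD(4)] by blast+
  moreover have "(\<lambda>n. X (u + real n * p)) = (\<lambda>_. X u)" "(\<lambda>n. Y (u + real n * p)) = (\<lambda>_. Y u)" for u using pern by auto
  ultimately have "X u = 1" "Y u = 0" for u by (metis LIMSEQ_const_iff)+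
  then show False using orb unfolding saddle_orbit_def by auto
qed

lemma second_deriv_sign:
  assumes "Y t = 0" "0 < (X t)\<^sup>2 - 1"
  shows "\<exists>d>0. \<forall>h. 0 < h \<and> h < d \<longrightarrow> 0 < Y (t + h) \<and> X t < X (t + h)"
proof -
  have "(Y has_real_derivative (X t)\<^sup>2 - 1) (at t)" using oD(2)[of t] assms by simp
  from DERIV_pos_inc_right[OF this assms(2)] obtain d where d: "0 < d" "\<And>h. 0 < h \<Longrightarrow> h < d \<Longrightarrow> 0 < Y (t + h)"
    using assms(1) by auto
  have "X t < X (t + h)" if h: "0 < h" "h < d" for h
  proof -
    have "t < t + h" using h by simp
    then obtain z where z: "t < z" "z < t + h" "X (t + h) - X t = (t + h - t) * Y z"
      using MVT2[of t "t + h" X Y] oD(1) by blast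
    have "0 < Y z" using d(2)[of "z - t"] z h by auto
    then have "0 < (t + h - t) * Y z" using h by simp
    then show ?thesis using z by linarith
  qed
  then show ?thesis using d by blast
qed

lemma second_deriv_sign_neg:
  assumes "Y t = 0" "(X t)\<^sup>2 - 1 < 0"
  shows "\<exists>d>0. \<forall>h. 0 < h \<and> h < d \<longrightarrow> Y (t + h) < 0 \<and> X (t + h) < X t"
proof -
  have "(Y has_real_derivative (X t)\<^sup>2 - 1) (at t)" using oD(2)[of t] assms by simp
  from DERIV_neg_dec_right[OF this assms(2)] obtain d where d: "0 < d" "\<And>h. 0 < h \<Longrightarrow> h < d \<Longrightarrow> Y (t + h) < 0"
    using assms(1) by auto
  have "X (t + h) < X t" if h: "0 < h" "h < d" for h
  proof -
    have "t < t + h" using h by simp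
    then obtain z where z: "t < z" "z < t + h" "X (t + h) - X t = (t + h - t) * Y z"
      using MVT2[of t "t + h" X Y] oD(1) by blast
    have "Y z < 0" using d(2)[of "z - t"] z h by auto
    then have "(t + h - t) * Y z < 0" using h by (simp add: mult_pos_neg)
    then show ?thesis using z by linarith
  qed
  then show ?thesis using d by blast
qed

text \<open>As \<open>X\<close> tends to 1 in both time directions, values at least as far from 1 as
  \<open>X s\<close> occur only in a compact time interval.\<close>

lemma orbit_X_extremum:
  assumes "X s \<noteq> 1"
  shows "\<exists>m. \<bar>X s - 1\<bar> \<le> \<bar>X m - 1\<bar> \<and> (if X s < 1 then \<forall>t. X m \<le> X t else \<forall>t. X t \<le> X m)"
proof -
  define r where "r = \<bar>X s - 1\<bar>"
  have r: "0 < r" unfolding r_def using assms by simp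
  obtain T where T: "\<And>t. T \<le> t \<Longrightarrow> \<bar>X t - 1\<bar> < r"
    using tendstoD[OF oD(3) r] unfolding eventually_at_top_linorder dist_real_def by auto
  obtain S where S: "\<And>t. t \<le> S \<Longrightarrow> \<bar>X t - 1\<bar> < r"
    using tendstoD[OF oD(5) r] unfolding eventually_at_bot_linorder dist_real_def by auto
  have s: "s \<in> {S..T}" using T[of s] S[of s] unfolding r_def by (cases "T \<le> s"; cases "s \<le> S") auto
  have cont: "continuous_on {S..T} X" using oD(7) by (intro continuous_at_imp_continuous_on) auto
  show ?thesis
  proof (cases "X s < 1")
    case True
    obtain m where m: "m \<in> {S..T}" "\<And>t. t \<in> {S..T} \<Longrightarrow> X m \<le> X t"
      using continuous_attains_inf[OF compact_Icc _ cont] s by blast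
    have "X m \<le> X t" for t
    proof (cases "t \<in> {S..T}")
      case False
      then have "\<bar>X t - 1\<bar> < r" using T[of t] S[of t] by auto
      then have "X s < X t" unfolding r_def using True by auto
      then show ?thesis using m(2)[OF s] by simp
    qed (use m in auto)
    moreover have "\<bar>X s - 1\<bar> \<le> \<bar>X m - 1\<bar>" using True m(2)[OF s] by linarith
    ultimately show ?thesis using True by auto
  next
    case False
    obtain m where m: "m \<in> {S..T}" "\<And>t. t \<in> {S..T} \<Longrightarrow> X t \<le> X m"
      using continuous_attains_sup[OF compact_Icc _ cont] s by blast
    have "X t \<le> X m" for t
    proof (cases "t \<in> {S..T}")
      case False
      then have "\<bar>X t - 1\<bar> < r" using T[of t] S[of t] by auto
      then have "X t < X s" unfolding r_def using \<open>\<not> X s < 1\<close> by auto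
      then show ?thesis using m(2)[OF s] by simp
    qed (use m in auto)
    moreover have "\<bar>X s - 1\<bar> \<le> \<bar>X m - 1\<bar>" using False m(2)[OF s] by linarith
    ultimately show ?thesis using False by auto
  qed
qed

text \<open>At a maximum above 1 one has \<open>Y = 0\<close> and \<open>Y' = X^2 - 1 > 0\<close>,
  so \<open>X\<close> would still increase. If the maximum equals 1, then \<open>Y = 0\<close> there
  and the orbit would sit at the saddle.\<close>

lemma orbit_X_less_1: "X t < 1"
proof -
  have le: "X t \<le> 1" for t
  proof (rule ccontr)
    assume "\<not> X t \<le> 1"
    then obtain m where m: "\<bar>X t - 1\<bar> \<le> \<bar>X m - 1\<bar>" "\<And>s. X s \<le> X m" using orbit_X_extremum[of t] by auto
    have "1 < X m" using m(2)[of t] \<open>\<not> X t \<le> 1\<close> by simp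
    have "Y m = 0" using DERIV_local_max[OF oD(1)[of m], of 1] m(2) by auto
    moreover have "0 < (X m)\<^sup>2 - 1" using \<open>1 < X m\<close> by simp
    ultimately obtain d where "0 < d" "\<And>h. 0 < h \<and> h < d \<Longrightarrow> X m < X (m + h)" using second_deriv_sign by blast
    then have "X m < X (m + d / 2)" by auto
    then show False using m(2)[of "m + d / 2"] by simp
  qed
  have "X t \<noteq> 1"
  proof
    assume "X t = 1"
    then have "Y t = 0" using DERIV_local_max[OF oD(1)[of t], of 1] le by auto
    then show False using orbit_not_equilibrium[of t] \<open>X t = 1\<close> by simp
  qed
  then show ?thesis using le[of t] by simp
qed

text \<open>By the second derivative a minimum needs \<open>X^2 - 1 \<ge> 0\<close>, equality would
  be an equilibrium, and \<open>X < 1\<close> leaves only the side left of the second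
  equilibrium.\<close>

lemma orbit_minimum: obtains t0 where "\<And>t. X t0 \<le> X t" "Y t0 = 0" "X t0 < -1"
proof -
  obtain m where m: "\<And>s. X m \<le> X s" using orbit_X_extremum[of 0] orbit_X_less_1[of 0] by auto
  have Ym: "Y m = 0" using DERIV_local_min[OF oD(1)[of m], of 1] m by auto
  have "\<not> (X m)\<^sup>2 - 1 < 0"
  proof
    assume "(X m)\<^sup>2 - 1 < 0"
    then obtain d where "0 < d" "\<And>h. 0 < h \<and> h < d \<Longrightarrow> X (m + h) < X m" using second_deriv_sign_neg[OF Ym] by blast
    then have "X (m + d / 2) < X m" by auto
    then show False using m[of "m + d / 2"] by simp
  qed
  moreover have "(X m)\<^sup>2 \<noteq> 1" using orbit_not_equilibrium[of m] Ym by blast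
  ultimately have "1 < (X m)\<^sup>2" by simp
  then have "1 < \<bar>X m\<bar>" using abs_square_le_1[of "X m"] by (simp add: not_le[symmetric])
  then have "X m < -1" using orbit_X_less_1[of m] by auto
  then show thesis using that m Ym by blast
qed

lemma last_zero_step:
  assumes z: "Y z = 0" "-1 < X z"
  shows "\<exists>d>0. \<forall>h. 0 < h \<and> h < d \<longrightarrow> Y (z + h) < 0"
proof -
  have "(X z)\<^sup>2 < 1" using z orbit_X_less_1[of z] by (simp add: abs_square_less_1)
  then show ?thesis using second_deriv_sign_neg[OF z(1)] by fastforce
qed

lemma first_zero:
  fixes f :: "real \<Rightarrow> real"
  assumes "\<And>t. isCont f t" "a < b" "f b \<ge> 0" "\<And>h. 0 < h \<Longrightarrow> h < d \<Longrightarrow> f (a + h) < 0" "0 < d"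
  obtains z where "a < z" "z \<le> b" "f z = 0" "\<And>t. a < t \<Longrightarrow> t < z \<Longrightarrow> f t < 0"
proof -
  define S where "S = {t \<in> {a + min (d / 2) ((b - a) / 2)..b}. 0 \<le> f t}"
  define c where "c = a + min (d / 2) ((b - a) / 2)"
  have c: "a < c" "c < b" "c < a + d" unfolding c_def using assms by (auto simp: min_def field_simps)
  have "continuous_on {c..b} f" using assms(1) by (intro continuous_at_imp_continuous_on) auto
  then have "closed {t \<in> {c..b}. 0 \<le> f t}"
    using continuous_closed_preimage[of "{c..b}" f "{0..}"] by (simp add: vimage_def Int_def conj_commute)
  moreover have "bounded {t \<in> {c..b}. 0 \<le> f t}" by (rule bounded_subset[OF bounded_closed_interval[of c b]]) auto
  ultimately have "compact S" unfolding S_def c_def[symmetric] compact_eq_bounded_closed by blast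
  moreover have "b \<in> S" unfolding S_def c_def[symmetric] using c assms by auto
  ultimately obtain z where z: "z \<in> S" "\<And>t. t \<in> S \<Longrightarrow> z \<le> t" using compact_attains_inf[of S] by blast
  have neg: "f t < 0" if "a < t" "t < z" for t
  proof (cases "t < c")
    case True
    then show ?thesis using assms(4)[of "t - a"] that c by auto
  next
    case False
    then show ?thesis using z(2)[of t] that z(1) unfolding S_def c_def[symmetric] by force
  qed
  have az: "a < z" "z \<le> b" using z(1) c unfolding S_def c_def[symmetric] by auto
  have "(f \<longlongrightarrow> f z) (at_left z)" using assms(1)[of z] unfolding isCont_def by (simp add: filterlim_at_split)
  moreover have "eventually (\<lambda>t. f t \<le> 0) (at_left z)"
    using neg az by (intro eventually_at_leftI[of a]) (auto intro: less_imp_le)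
  ultimately have "f z \<le> 0" using tendsto_upperbound trivial_limit_at_left_real by blast
  then have "f z = 0" using z(1) unfolding S_def by simp
  then show thesis using that az neg by blast
qed

text \<open>Once \<open>X > -1\<close>, the axis \<open>Y = 0\<close> can be crossed only downwards,
  because \<open>Y' = X^2 - 1 < 0\<close> there. A nonpositive \<open>Y\<close> at a late time would
  be followed by negative values for ever, and \<open>X\<close> could not tend to 1.\<close>

lemma eventually_Y_pos: "\<exists>T. \<forall>t\<ge>T. 0 < Y t"
proof -
  obtain T where T: "\<And>t. T \<le> t \<Longrightarrow> \<bar>X t - 1\<bar> < 1"
    using tendstoD[OF oD(3), of 1] unfolding eventually_at_top_linorder dist_real_def by auto
  have Xp: "-1 < X t" if "T \<le> t" for t using T[OF that] by auto
  have no_neg: False if "T \<le> z" "Y z \<le> 0" "\<And>t. z < t \<Longrightarrow> Y t < 0" for z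
  proof -
    have "X t \<le> X z" if "z \<le> t" for t
    proof (rule DERIV_nonpos_imp_nonincreasing[OF that])
      fix x assume "z \<le> x" "x \<le> t"
      then have "Y x \<le> 0" using \<open>Y z \<le> 0\<close> \<open>\<And>t. z < t \<Longrightarrow> Y t < 0\<close>[of x] by (cases "x = z") auto
      then show "\<exists>y. (X has_real_derivative y) (at x) \<and> y \<le> 0" using oD(1)[of x] by blast
    qed
    then have "eventually (\<lambda>t. X t \<le> X z) at_top" unfolding eventually_at_top_linorder by blast
    then have "1 \<le> X z" using oD(3) tendsto_upperbound trivial_limit_at_top_linorder by blast
    then show False using orbit_X_less_1[of z] by simp
  qed
  have after: "Y t < 0" if z: "T \<le> z" "\<exists>d>0. \<forall>h. 0 < h \<and> h < d \<longrightarrow> Y (z + h) < 0" and "z < t" for z t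
  proof (rule ccontr)
    assume "\<not> Y t < 0"
    obtain d where d: "0 < d" "\<And>h. 0 < h \<Longrightarrow> h < d \<Longrightarrow> Y (z + h) < 0" using z by blast
    obtain w where w: "z < w" "w \<le> t" "Y w = 0" "\<And>s. z < s \<Longrightarrow> s < w \<Longrightarrow> Y s < 0"
      using first_zero[of Y z t d] oD(8) \<open>z < t\<close> \<open>\<not> Y t < 0\<close> d by (metis not_less)
    have "(X w)\<^sup>2 - 1 < 0" using Xp[of w] orbit_X_less_1[of w] w z by (simp add: abs_square_less_1)
    moreover have "(Y has_real_derivative (X w)\<^sup>2 - 1) (at w)" using oD(2)[of w] w by simp
    ultimately obtain e where e: "0 < e" "\<And>h. 0 < h \<Longrightarrow> h < e \<Longrightarrow> Y w < Y (w - h)" using DERIV_neg_dec_left by blast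
    define h where "h = min (e / 2) ((w - z) / 2)"
    have "0 < h" "h < e" "h < w - z" unfolding h_def using e w by (auto simp: min_def field_simps)
    then show False using e(2)[of h] w(3) w(4)[of "w - h"] by auto
  qed
  have "0 < Y t" if "T \<le> t" for t
  proof (rule ccontr)
    assume "\<not> 0 < Y t"
    then have "\<exists>d>0. \<forall>h. 0 < h \<and> h < d \<longrightarrow> Y (t + h) < 0"
    proof (cases "Y t = 0")
      case True
      then show ?thesis using last_zero_step Xp[OF that] by blast
    next
      case False
      then have "Y t < 0" using \<open>\<not> 0 < Y t\<close> by simp
      then have "eventually (\<lambda>s. Y s < 0) (at t)" using oD(8)[of t] unfolding isCont_def by (rule order_tendstoD[rotated])
      then obtain d where "0 < d" "\<And>s. s \<noteq> t \<Longrightarrow> dist s t < d \<Longrightarrow> Y s < 0" unfolding eventually_at by auto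
      then show ?thesis by (intro exI[of _ d]) (auto simp: dist_real_def)
    qed
    then show False using no_neg[OF that] after[OF that] \<open>\<not> 0 < Y t\<close> by force
  qed
  then show ?thesis by blast
qed

text \<open>If the orbit turned around again after the point where \<open>X\<close> is minimal, then its last arc would
  have to cross the arc after the minimum, which makes the orbit periodic.\<close>
lemma orbit_Y_pos_after_minimum:
  assumes t0: "\<And>t. X t0 \<le> X t" "Y t0 = 0" "X t0 < -1" and "t0 < t"
  shows "0 < Y t"
proof (rule ccontr)
  assume "\<not> 0 < Y t"
  have "0 < (X t0)\<^sup>2 - 1" using t0(3) abs_square_le_1[of "X t0"] by (simp add: not_le[symmetric])
  then obtain d where d: "0 < d" "\<And>h. 0 < h \<Longrightarrow> h < d \<Longrightarrow> 0 < Y (t0 + h)" using second_deriv_sign[OF t0(2)] by blast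
  obtain t1 where t1: "t0 < t1" "t1 \<le> t" "- Y t1 = 0" "\<And>s. t0 < s \<Longrightarrow> s < t1 \<Longrightarrow> - Y s < 0"
    using first_zero[of "\<lambda>t. - Y t" t0 t d] oD(8) \<open>t0 < t\<close> \<open>\<not> 0 < Y t\<close> d by (metis isCont_minus neg_0_le_iff_le neg_less_0_iff_less not_less)
  obtain T0 where T0: "\<And>t. T0 \<le> t \<Longrightarrow> 0 < Y t" using eventually_Y_pos by blast
  have sgn: "(X z)\<^sup>2 - 1 \<le> 0" if "Y z = 0" "a < z" "\<And>s. a < s \<Longrightarrow> s < z \<Longrightarrow> 0 < Y s" for z a
  proof (rule ccontr)
    assume "\<not> ?thesis"
    moreover have "(Y has_real_derivative (X z)\<^sup>2 - 1) (at z)" using oD(2)[of z] that by simp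
    ultimately obtain e where e: "0 < e" "\<And>h. 0 < h \<Longrightarrow> h < e \<Longrightarrow> Y (z - h) < Y z" using DERIV_pos_inc_left by (metis not_le)
    define h where "h = min (e / 2) ((z - a) / 2)"
    have "0 < h" "h < e" "h < z - a" unfolding h_def using e that by (auto simp: min_def field_simps)
    then show False using e(2)[of h] that(1) that(3)[of "z - h"] by auto
  qed
  have "(X t1)\<^sup>2 < 1" using sgn[of t1 t0] t1 orbit_not_equilibrium[of t1] by force
  then have Xt1: "-1 < X t1" by (simp add: abs_square_less_1)
  \<comment> \<open>Its largest element \<open>T\<close> is the last time at which the orbit is on
    or below the axis; afterwards the final arc rises to the saddle.\<close>
  define S where "S = {s \<in> {t1..max t1 T0}. Y s \<le> 0}"
  have "continuous_on {t1..max t1 T0} Y" using oD(8) by (intro continuous_at_imp_continuous_on) auto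
  then have "closed S" unfolding S_def
    using continuous_closed_preimage[of "{t1..max t1 T0}" Y "{..0}"] by (simp add: vimage_def Int_def conj_commute)
  moreover have "bounded S" unfolding S_def by (rule bounded_subset[OF bounded_closed_interval[of t1 "max t1 T0"]]) auto
  ultimately have "compact S" unfolding compact_eq_bounded_closed by blast
  moreover have "t1 \<in> S" unfolding S_def using t1 by auto
  ultimately obtain T where T: "T \<in> S" "\<And>s. s \<in> S \<Longrightarrow> s \<le> T" using compact_attains_sup[of S] by blast
  have Tp: "0 < Y s" if "T < s" for s
  proof (cases "s \<le> max t1 T0")
    case True
    then show ?thesis using T(2)[of s] T(1) that unfolding S_def by force
  next
    case False
    then show ?thesis using T0[of s] by simp
  qed
  have Tt1: "t1 \<le> T" using T(2)[OF \<open>t1 \<in> S\<close>] .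
  have "(Y \<longlongrightarrow> Y T) (at_right T)" using oD(8)[of T] unfolding isCont_def by (simp add: filterlim_at_split)
  moreover have "eventually (\<lambda>s. 0 \<le> Y s) (at_right T)"
    using Tp by (intro eventually_at_rightI[of T "T + 1"]) (auto intro: less_imp_le)
  ultimately have "0 \<le> Y T" using tendsto_lowerbound trivial_limit_at_right_real by blast
  then have YT: "Y T = 0" using T(1) unfolding S_def by simp
  \<comment> \<open>The axis is left upwards at \<open>T\<close>, which is impossible for
    \<open>X > -1\<close>; so the final arc starts left of the second equilibrium, like the first
    one.\<close>
  have XT: "X T < -1"
  proof -
    have "\<not> -1 < X T"
    proof
      assume "-1 < X T"
      then obtain d where "0 < d" "\<And>h. 0 < h \<and> h < d \<Longrightarrow> Y (T + h) < 0" using last_zero_step[OF YT] by blast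
      then have "Y (T + d / 2) < 0" by auto
      then show False using Tp[of "T + d / 2"] \<open>0 < d\<close> by simp
    qed
    moreover have "X T \<noteq> -1" using orbit_not_equilibrium[of T] YT by auto
    ultimately show ?thesis by simp
  qed
  have "X t0 \<noteq> X T" using orbit_injective[of t0 T] t1 Tt1 t0(2) YT by auto
  then have X0T: "X t0 < X T" using t0(1)[of T] by simp
  have inc0: "X a < X b" if "t0 \<le> a" "a < b" "b \<le> t1" for a b
  proof (rule DERIV_pos_imp_increasing_open[OF \<open>a < b\<close>])
    show "\<exists>y. (X has_real_derivative y) (at x) \<and> 0 < y" if "a < x" "x < b" for x
      using oD(1)[of x] t1(4)[of x] that \<open>t0 \<le> a\<close> \<open>b \<le> t1\<close> by (intro exI[of _ "Y x"]) auto
  qed (use oD(7) in \<open>auto intro!: continuous_at_imp_continuous_on\<close>)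
  have "eventually (\<lambda>s. X t1 < X s) at_top" using order_tendstoD(1)[OF oD(3) orbit_X_less_1[of t1]] .
  then obtain T2 where T2: "\<And>s. T2 \<le> s \<Longrightarrow> X t1 < X s" unfolding eventually_at_top_linorder by auto
  have "\<exists>T'. T \<le> T' \<and> T' \<le> max T T2 \<and> X T' = X t1"
    using XT Xt1 T2[of "max T T2"] oD(7) by (intro IVT') (auto intro!: continuous_at_imp_continuous_on less_imp_le)
  then obtain T' where T': "T \<le> T'" "X T' = X t1" by blast
  have TT': "T < T'" using T' XT Xt1 by (cases "T = T'") auto
  have incT: "X a < X b" if "T \<le> a" "a < b" for a b
  proof (rule DERIV_pos_imp_increasing_open[OF \<open>a < b\<close>])
    show "\<exists>y. (X has_real_derivative y) (at x) \<and> 0 < y" if "a < x" "x < b" for x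
      using oD(1)[of x] Tp[of x] that \<open>T \<le> a\<close> by (intro exI[of _ "Y x"]) auto
  qed (use oD(7) in \<open>auto intro!: continuous_at_imp_continuous_on\<close>)
  have c01: "continuous_on {t0..t1} X" using oD(7) by (intro continuous_at_imp_continuous_on) auto
  have inj: "inj_on X {t0..t1}"
    by (rule linorder_inj_onI') (use inc0 in force)
  \<comment> \<open>The inverse of \<open>X\<close> on the first arc \<open>[t0, t1]\<close>, so
    that both arcs can be compared as graphs over the same range of \<open>X\<close>.\<close>
  define \<tau> where "\<tau> = the_inv_into {t0..t1} X"
  have \<tau>: "\<tau> (X s) = s" if "s \<in> {t0..t1}" for s unfolding \<tau>_def using the_inv_into_f_f[OF inj that] .
  have img: "X ` {t0..t1} = {X t0..X t1}"
  proof (intro set_eqI iffI)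
    fix x assume "x \<in> X ` {t0..t1}"
    then show "x \<in> {X t0..X t1}" using inc0 by (force simp: le_less)
  next
    fix x assume "x \<in> {X t0..X t1}"
    then have "\<exists>s. t0 \<le> s \<and> s \<le> t1 \<and> X s = x" using t1(1) c01 by (intro IVT') auto
    then show "x \<in> X ` {t0..t1}" by force
  qed
  have \<tau>c: "continuous_on {X t0..X t1} \<tau>"
    unfolding \<tau>_def img[symmetric] by (rule continuous_on_inv_into[OF c01 compact_Icc inj])
  have X\<tau>: "X (\<tau> x) = x" "\<tau> x \<in> {t0..t1}" if "x \<in> {X t0..X t1}" for x
    using that unfolding img[symmetric] by (auto simp: \<tau>)
  have mapsto: "X s \<in> {X t0..X t1}" if "s \<in> {T..T'}" for s
    using t0(1)[of s] incT[of s T'] that T' by (cases "s = T'") auto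
  \<comment> \<open>At \<open>T\<close> the final arc is on the axis and the first arc above it; at
    \<open>T'\<close> the first arc has come back to the axis and the final arc is above it. The
    zero in between is a common point of the two arcs.\<close>
  define h where "h = (\<lambda>s. Y s - Y (\<tau> (X s)))"
  have "continuous_on {T..T'} h" unfolding h_def
  proof (intro continuous_intros)
    show "continuous_on {T..T'} Y" using oD(8) by (intro continuous_at_imp_continuous_on) auto
    have "continuous_on {T..T'} (\<lambda>s. \<tau> (X s))"
      using oD(7) mapsto by (intro continuous_on_compose2[OF \<tau>c]) (auto intro!: continuous_at_imp_continuous_on)
    moreover have "continuous_on UNIV Y" using oD(8) by (intro continuous_at_imp_continuous_on) auto
    ultimately show "continuous_on {T..T'} (\<lambda>s. Y (\<tau> (X s)))"
      using continuous_on_compose2[of UNIV Y "{T..T'}" "\<lambda>s. \<tau> (X s)"] by blast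
  qed
  moreover have "h T \<le> 0"
  proof -
    have r: "X T \<in> {X t0..X t1}" using X0T XT Xt1 by auto
    have "\<tau> (X T) \<noteq> t0" "\<tau> (X T) \<noteq> t1" using X\<tau>[OF r] X0T XT Xt1 by auto
    then have "0 < Y (\<tau> (X T))" using X\<tau>(2)[OF r] t1(4)[of "\<tau> (X T)"] by auto
    then show ?thesis unfolding h_def YT by simp
  qed
  moreover have "0 \<le> h T'"
    unfolding h_def T'(2) using \<tau>[of t1] t1 Tp[OF TT'] by simp
  ultimately obtain z where z: "T \<le> z" "z \<le> T'" "h z = 0"
    using IVT'[of h T 0 T'] T'(1) by blast
  have r: "X z \<in> {X t0..X t1}" using mapsto z by auto
  have "\<tau> (X z) < z"
  proof -
    have "\<tau> (X z) \<le> t1" using X\<tau>(2)[OF r] by simp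
    then have "\<tau> (X z) \<le> z" using Tt1 z by simp
    moreover have "\<tau> (X z) \<noteq> z"
    proof
      assume "\<tau> (X z) = z"
      then have "z = t1" "t1 = T" using \<open>\<tau> (X z) \<le> t1\<close> Tt1 z by auto
      then show False using XT Xt1 by simp
    qed
    ultimately show ?thesis by simp
  qed
  moreover have "X (\<tau> (X z)) = X z" "Y (\<tau> (X z)) = Y z" using X\<tau>(1)[OF r] z(3) unfolding h_def by auto
  ultimately show False using orbit_injective by blast
qed

text \<open>After \<open>t0\<close> the coordinate \<open>X\<close> increases strictly and can serve
  as parameter. The damping \<open>\<kappa> + \<epsilon> * X\<close> is rewritten in
  \<open>u = 1 - X\<close>, which is where \<open>\<kappa> + \<epsilon>\<close> comes from.\<close>

lemma orbit_half_loop: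
  assumes t0: "Y t0 = 0" "X t0 < -1" and pos: "\<And>t. t0 < t \<Longrightarrow> 0 < Y t"
  shows "\<exists>f. half_loop \<epsilon> (\<kappa> + \<epsilon>) (1 - X t0) f"
proof -
  have inc: "X a < X b" if "t0 \<le> a" "a < b" for a b
  proof (rule DERIV_pos_imp_increasing_open[OF \<open>a < b\<close>])
    show "\<exists>y. (X has_real_derivative y) (at x) \<and> 0 < y" if "a < x" "x < b" for x
      using oD(1)[of x] pos[of x] that \<open>t0 \<le> a\<close> by (intro exI[of _ "Y x"]) auto
  qed (use oD(7) in \<open>auto intro!: continuous_at_imp_continuous_on\<close>)
  have ex: "\<exists>s>t0. X s = x" if "x \<in> {X t0<..<1}" for x
  proof -
    have "eventually (\<lambda>s. x < X s) at_top" using order_tendstoD(1)[OF oD(3)] that by auto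
    then obtain T2 where T2: "\<And>s. T2 \<le> s \<Longrightarrow> x < X s" unfolding eventually_at_top_linorder by auto
    have "\<exists>s. t0 \<le> s \<and> s \<le> max t0 T2 \<and> X s = x"
      using that T2[of "max t0 T2"] oD(7) by (intro IVT') (auto intro!: continuous_at_imp_continuous_on less_imp_le)
    then show ?thesis using that by (metis greaterThanLessThan_iff le_less less_irrefl)
  qed
  define \<tau> where "\<tau> = (\<lambda>x. SOME s. t0 < s \<and> X s = x)"
  have \<tau>: "t0 < \<tau> x" "X (\<tau> x) = x" if "x \<in> {X t0<..<1}" for x
    using someI_ex[OF ex[OF that, unfolded Bex_def]] unfolding \<tau>_def by auto
  have \<tau>X: "\<tau> (X s) = s" if "t0 < s" for s
  proof -
    have r: "X s \<in> {X t0<..<1}" using inc[of t0 s] that orbit_X_less_1[of s] by auto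
    show ?thesis using \<tau>[OF r] inc[of "\<tau> (X s)" s] inc[of s "\<tau> (X s)"] that by (metis less_imp_le less_irrefl linorder_neqE_linordered_idom)
  qed
  have \<tau>_der: "(\<tau> has_real_derivative inverse (Y (\<tau> x))) (at x)" if x: "x \<in> {X t0<..<1}" for x
  proof (rule DERIV_inverse_function[where f = X and a = "X t0" and b = 1])
    show "(X has_real_derivative Y (\<tau> x)) (at (\<tau> x))" by (rule oD(1))
    show "Y (\<tau> x) \<noteq> 0" using pos[OF \<tau>(1)[OF x]] by simp
    have "isCont \<tau> (X (\<tau> x))"
    proof (rule isCont_inverse_function[where d = "(\<tau> x - t0) / 2" and f = X and x = "\<tau> x"])
      show "0 < (\<tau> x - t0) / 2" using \<tau>(1)[OF x] by simp
      show "\<tau> (X z) = z" if "\<bar>z - \<tau> x\<bar> \<le> (\<tau> x - t0) / 2" for z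
        using abs_le_D2[OF that] \<tau>(1)[OF x] by (intro \<tau>X) (simp add: field_simps)
      show "isCont X z" if "\<bar>z - \<tau> x\<bar> \<le> (\<tau> x - t0) / 2" for z by (rule oD(7))
    qed
    then show "isCont \<tau> x" using \<tau>(2)[OF x] by simp
  qed (use x \<tau> in auto)
  define f where "f = (\<lambda>u. Y (\<tau> (1 - u)))"
  define B where "B = 1 - X t0"
  have B: "2 < B" unfolding B_def using t0 by simp
  have xr: "1 - u \<in> {X t0<..<1}" if "u \<in> {0<..<B}" for u using that unfolding B_def by auto
  have fpos: "0 < f u" if "u \<in> {0<..<B}" for u unfolding f_def using pos[OF \<tau>(1)[OF xr[OF that]]] .
  have f_der: "(f has_real_derivative u * (2 - u) / f u - ((\<kappa> + \<epsilon>) - \<epsilon> * u)) (at u)" if u: "u \<in> {0<..<B}" for u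
  proof -
    define s where "s = \<tau> (1 - u)"
    have Xs: "X s = 1 - u" unfolding s_def using \<tau>(2)[OF xr[OF u]] .
    have Ys: "0 < Y s" "f u = Y s" unfolding s_def using fpos[OF u] by (auto simp: f_def)
    have l: "((\<lambda>u. 1 - u) has_real_derivative 0 - 1) (at u)" by (intro DERIV_diff DERIV_const DERIV_ident)
    have "((\<lambda>u. \<tau> (1 - u)) has_real_derivative inverse (Y s) * (0 - 1)) (at u)"
      unfolding s_def by (rule DERIV_chain2[where g = "\<lambda>u. 1 - u", OF \<tau>_der[OF xr[OF u]] l])
    then have "(f has_real_derivative ((X s)\<^sup>2 - 1 + (\<kappa> + \<epsilon> * X s) * Y s) * (inverse (Y s) * (0 - 1))) (at u)"
      unfolding f_def s_def by (rule DERIV_chain2[where f = Y and g = "\<lambda>u. \<tau> (1 - u)", OF oD(2)])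
    moreover have "((X s)\<^sup>2 - 1 + (\<kappa> + \<epsilon> * X s) * Y s) * (inverse (Y s) * (0 - 1)) = u * (2 - u) / f u - ((\<kappa> + \<epsilon>) - \<epsilon> * u)"
      unfolding Xs Ys(2) using Ys(1) by (simp add: field_simps power2_eq_square)
    ultimately show ?thesis by simp
  qed
  have lim0: "(f \<longlongrightarrow> 0) (at_right 0)"
  proof (rule tendstoI)
    fix e :: real assume "0 < e"
    then obtain T where T: "\<And>t. T \<le> t \<Longrightarrow> dist (Y t) 0 < e"
      using tendstoD[OF oD(4)] unfolding eventually_at_top_linorder by blast
    define T1 where "T1 = max T (t0 + 1)"
    have "X t0 < X T1" "X T1 < 1" using inc[of t0 T1] orbit_X_less_1 unfolding T1_def by auto
    show "\<forall>\<^sub>F u in at_right 0. dist (f u) 0 < e"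
    proof (rule eventually_at_rightI[of 0 "1 - X T1"])
      fix u assume u: "u \<in> {0<..<1 - X T1}"
      then have ub: "u \<in> {0<..<B}" unfolding B_def using \<open>X t0 < X T1\<close> by auto
      have "T1 \<le> \<tau> (1 - u)"
      proof (rule ccontr)
        assume "\<not> ?thesis"
        then have "X (\<tau> (1 - u)) < X T1" using inc[of "\<tau> (1 - u)" T1] \<tau>(1)[OF xr[OF ub]] by simp
        then show False using \<tau>(2)[OF xr[OF ub]] u by simp
      qed
      then show "dist (f u) 0 < e" unfolding f_def by (intro T) (simp add: T1_def)
    qed (use \<open>X T1 < 1\<close> in simp)
  qed
  have lim1: "(f \<longlongrightarrow> 0) (at_left B)"
  proof (rule tendstoI)
    fix e :: real assume "0 < e"
    then have "\<forall>\<^sub>F t in at t0. dist (Y t) (Y t0) < e" using tendstoD oD(8)[of t0] unfolding isCont_def by blast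
    then obtain d where d: "0 < d" "\<And>t. t \<noteq> t0 \<Longrightarrow> dist t t0 < d \<Longrightarrow> dist (Y t) 0 < e" unfolding eventually_at t0(1) by auto
    define T1 where "T1 = t0 + d"
    have XT: "X t0 < X T1" using inc[of t0 T1] d unfolding T1_def by auto
    show "\<forall>\<^sub>F u in at_left B. dist (f u) 0 < e"
    proof (rule eventually_at_leftI[of "1 - X T1"])
      fix u assume u: "u \<in> {1 - X T1<..<B}"
      then have ub: "u \<in> {0<..<B}" using orbit_X_less_1[of T1] by auto
      have "\<tau> (1 - u) < T1"
      proof (rule ccontr)
        assume "\<not> ?thesis"
        then have "X T1 \<le> X (\<tau> (1 - u))" using inc[of T1 "\<tau> (1 - u)"] d unfolding T1_def by (cases "T1 = \<tau> (1 - u)") (auto simp: T1_def)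
        then show False using \<tau>(2)[OF xr[OF ub]] u by simp
      qed
      then show "dist (f u) 0 < e" unfolding f_def using \<tau>(1)[OF xr[OF ub]]
        by (intro d(2)) (auto simp: T1_def dist_real_def)
    qed (use XT in \<open>simp add: B_def\<close>)
  qed
  show ?thesis using B fpos f_der lim0 lim1 unfolding half_loop_def B_def by (intro exI[of _ f]) blast
qed

end

lemma saddle_orbit_reverse:
  assumes "saddle_orbit \<epsilon> \<kappa> X Y"
  shows "saddle_orbit (-\<epsilon>) (-\<kappa>) (\<lambda>t. X (- t)) (\<lambda>t. - Y (- t))"
proof -
  note oD = saddle_orbitD[OF assms]
  have 1: "((\<lambda>t. X (- t)) has_real_derivative - Y (- t)) (at t)" for t
    using oD(1)[of "- t"] unfolding DERIV_mirror .
  have 2: "((\<lambda>t. - Y (- t)) has_real_derivative (X (- t))\<^sup>2 - 1 + (- \<kappa> + - \<epsilon> * X (- t)) * (- Y (- t))) (at t)" for t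
  proof -
    have "((\<lambda>t. Y (- t)) has_real_derivative ((X (- t))\<^sup>2 - 1 + (\<kappa> + \<epsilon> * X (- t)) * Y (- t)) * (-1)) (at t)"
      using oD(2)[of "- t"] unfolding DERIV_mirror by simp
    from DERIV_minus[OF this] show ?thesis by (simp add: algebra_simps)
  qed
  have 3: "((\<lambda>t. X (- t)) \<longlongrightarrow> 1) at_top" "((\<lambda>t. X (- t)) \<longlongrightarrow> 1) at_bot"
    by (rule oD(5)[unfolded filterlim_at_bot_mirror], rule oD(3)[unfolded filterlim_at_top_mirror])
  have 4: "((\<lambda>t. Y (- t)) \<longlongrightarrow> 0) at_top" "((\<lambda>t. Y (- t)) \<longlongrightarrow> 0) at_bot"
    by (rule oD(6)[unfolded filterlim_at_bot_mirror], rule oD(4)[unfolded filterlim_at_top_mirror])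
  have 5: "\<exists>t. \<not> (X (- t) = 1 \<and> - Y (- t) = 0)"
    using assms unfolding saddle_orbit_def by (metis minus_minus neg_equal_0_iff_equal)
  show ?thesis unfolding saddle_orbit_def using 1 2 3 tendsto_minus[OF 4(1)] tendsto_minus[OF 4(2)] 5 by auto
qed

text \<open>The arc before the minimum is the arc after the minimum of the reversed orbit. Since
  both use the same minimum, the two graphs end at the same point.\<close>

theorem saddle_orbit_loop_graph:
  assumes "saddle_orbit \<epsilon> \<kappa> X Y"
  shows "\<exists>B f g. loop_graph \<epsilon> (\<kappa> + \<epsilon>) B f g"
proof (rule orbit_minimum[OF assms])
  fix t0 assume t0: "\<And>t. X t0 \<le> X t" "Y t0 = 0" "X t0 < -1"
  note rev = saddle_orbit_reverse[OF assms]
  obtain f where f: "half_loop \<epsilon> (\<kappa> + \<epsilon>) (1 - X t0) f"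
    using orbit_half_loop[OF assms t0(2,3) orbit_Y_pos_after_minimum[OF assms t0]] by blast
  have "\<exists>g. half_loop (-\<epsilon>) (- \<kappa> + - \<epsilon>) (1 - X (- (- t0))) g"
    using t0 by (intro orbit_half_loop[OF rev] orbit_Y_pos_after_minimum[OF rev, of "- t0"]) auto
  then obtain g where g: "half_loop (-\<epsilon>) (- (\<kappa> + \<epsilon>)) (1 - X t0) g" by auto
  show ?thesis using f g unfolding loop_graph_def by blast
qed

section \<open>From graphs to homoclinic orbits\<close>

text \<open>Separation of variables: time as a function of position is an antiderivative of
  \<open>1 / p\<close>. Its slope is at least \<open>1 / C\<close>, so it maps the line onto itself
  and its inverse is a global solution.\<close>

lemma autonomous_solution:
  fixes p :: "real \<Rightarrow> real"
  assumes cont: "continuous_on UNIV p" and p: "\<And>x. 0 < p x" "\<And>x. p x \<le> C"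
  shows "\<exists>\<theta>. (\<forall>t. (\<theta> has_real_derivative p (\<theta> t)) (at t)) \<and> filterlim \<theta> at_top at_top \<and> filterlim \<theta> at_bot at_bot"
proof -
  have C: "0 < C" using p(1)[of 0] p(2)[of 0] by linarith
  have "continuous_on UNIV (\<lambda>x. 1 / p x)" using p(1) by (intro continuous_intros cont) (metis less_irrefl)
  have "\<exists>T. \<forall>x::real. (T has_vector_derivative 1 / p x) (at x)"
  proof -
    have "\<exists>F. \<forall>x::real. -\<infinity> < ereal x \<longrightarrow> ereal x < \<infinity> \<longrightarrow> (F has_vector_derivative 1 / p x) (at x)"
      using einterval_antiderivative[of "-\<infinity>" \<infinity> "\<lambda>x. 1 / p x"] \<open>continuous_on UNIV (\<lambda>x. 1 / p x)\<close>
      by (simp add: continuous_on_eq_continuous_at)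
    then show ?thesis by simp
  qed
  then obtain T where T: "\<And>x. (T has_real_derivative 1 / p x) (at x)"
    unfolding has_real_derivative_iff_has_vector_derivative by blast
  have Tc: "isCont T x" for x using T DERIV_isCont by blast
  have inc: "(y - x) / C \<le> T y - T x" if "x \<le> y" for x y
  proof -
    have "((\<lambda>x. T x - x / C) has_real_derivative 1 / p x - 1 / C) (at x)" for x
      by (intro DERIV_diff T DERIV_cdivide DERIV_ident)
    moreover have "0 \<le> 1 / p x - 1 / C" for x using p[of x] C by (simp add: frac_le)
    ultimately have "T x - x / C \<le> T y - y / C"
      by (intro DERIV_nonneg_imp_nondecreasing[OF that, where f = "\<lambda>x. T x - x / C"]) blast
    then show ?thesis by (simp add: diff_divide_distrib)
  qed
  have mono: "T x < T y" if "x < y" for x y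
  proof -
    have "0 < (y - x) / C" using that C by simp
    then show ?thesis using inc[of x y] that by linarith
  qed
  have surj: "\<exists>x. T x = t" for t
  proof -
    define a where "a = C * (\<bar>t\<bar> + \<bar>T 0\<bar>)"
    have a: "0 \<le> a" "a / C = \<bar>t\<bar> + \<bar>T 0\<bar>" unfolding a_def using C by auto
    have "(0 - (- a)) / C \<le> T 0 - T (- a)" "(a - 0) / C \<le> T a - T 0" using inc[of "-a" 0] inc[of 0 a] a(1) by auto
    then have "T (- a) \<le> t" "t \<le> T a" using a(2) by auto
    then have "\<exists>x. - a \<le> x \<and> x \<le> a \<and> T x = t" using a(1) Tc by (intro IVT) auto
    then show ?thesis by blast
  qed
  define \<theta> where "\<theta> = (\<lambda>t. SOME x. T x = t)"
  have \<theta>: "T (\<theta> t) = t" for t unfolding \<theta>_def using someI_ex[OF surj] .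
  have \<theta>T: "\<theta> (T x) = x" for x using \<theta>[of "T x"] mono[of "\<theta> (T x)" x] mono[of x "\<theta> (T x)"] by (metis less_irrefl linorder_neqE_linordered_idom)
  have \<theta>c: "isCont \<theta> t" for t
  proof -
    have "isCont \<theta> (T (\<theta> t))"
      by (rule isCont_inverse_function[where d = 1 and f = T and x = "\<theta> t"]) (auto simp: \<theta>T Tc)
    then show ?thesis by (simp add: \<theta>)
  qed
  have der: "(\<theta> has_real_derivative p (\<theta> t)) (at t)" for t
  proof -
    have "(\<theta> has_real_derivative inverse (1 / p (\<theta> t))) (at t)"
      by (rule DERIV_inverse_function[where f = T and a = "t - 1" and b = "t + 1"])
        (use T p(1)[of "\<theta> t"] \<theta> \<theta>c in auto)
    then show ?thesis by simp
  qed
  have m: "\<theta> s \<le> \<theta> t" if "s \<le> t" for s t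
    using mono[of "\<theta> t" "\<theta> s"] \<theta> that by (metis not_less)
  have top: "filterlim \<theta> at_top at_top"
    unfolding filterlim_at_top
  proof
    fix z show "\<forall>\<^sub>F t in at_top. z \<le> \<theta> t"
      using eventually_ge_at_top[of "T z"] by eventually_elim (use m[of "T z"] \<theta>T in auto)
  qed
  have bot: "filterlim \<theta> at_bot at_bot"
    unfolding filterlim_at_bot
  proof
    fix z show "\<forall>\<^sub>F t in at_bot. \<theta> t \<le> z"
      using eventually_le_at_bot[of "T z"] by eventually_elim (use m[of _ "T z"] \<theta>T in auto)
  qed
  show ?thesis using der top bot by blast
qed

text \<open>L'Hopital's rule for \<open>V^2 / w^2\<close>, where the factor \<open>V\<close> cancels
  in the derivative. The value depends on \<open>R\<close> alone, so both halves have the same slope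
  and fit together smoothly at the turning point.\<close>

lemma wbranch_slope:
  assumes V: "wbranch d \<epsilon> R K V"
  shows "((\<lambda>w. V w / w) \<longlongrightarrow> sqrt (2 * R * (1 - 2 * R))) (at_right 0)"
proof -
  note VD = wbranchD[OF V]
  have R: "0 < 2 * R * (1 - 2 * R)" using VD(2) wbranch_R_less[OF V] by simp
  have V0: "(V \<longlongrightarrow> 0) (at_right 0)" using wbranch_tendsto_0[OF V] by blast
  have ev: "eventually (\<lambda>w::real. 0 < w \<and> w < 1) (at_right 0)"
    by (rule eventually_at_rightI[of 0 1]) auto
  have "((\<lambda>w. (V w)\<^sup>2 / w\<^sup>2) \<longlongrightarrow> 2 * R * (1 - 2 * R)) (at_right 0)"
  proof (rule lhopital_right_0)
    show "((\<lambda>w. (V w)\<^sup>2) \<longlongrightarrow> 0) (at_right 0)" using tendsto_power[OF V0, of 2] by simp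
    show "((\<lambda>w::real. w\<^sup>2) \<longlongrightarrow> 0) (at_right 0)" by (intro tendsto_eq_intros) auto
    show "\<forall>\<^sub>F w::real in at_right 0. w\<^sup>2 \<noteq> 0" "\<forall>\<^sub>F w::real in at_right 0. 2 * w \<noteq> 0" using ev by (auto elim: eventually_mono)
    show "\<forall>\<^sub>F w in at_right 0. ((\<lambda>w. w\<^sup>2) has_real_derivative 2 * w) (at w)"
      by (auto intro!: always_eventually derivative_eq_intros)
    let ?D = "\<lambda>w. 2 * V w * (- 2 * w * (1 - w\<^sup>2) * (2 * R\<^sup>2 - R * (1 - w\<^sup>2)) / V w + 2 * w * (K - \<epsilon> * (1 - w\<^sup>2)))"
    show "\<forall>\<^sub>F w in at_right 0. ((\<lambda>w. (V w)\<^sup>2) has_real_derivative ?D w) (at w)"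
      using ev
    proof eventually_elim
      case (elim w)
      then show ?case using VD(6)[of w] by (auto intro!: derivative_eq_intros)
    qed
    have "((\<lambda>w. - 2 * (1 - w\<^sup>2) * (2 * R\<^sup>2 - R * (1 - w\<^sup>2)) + 2 * V w * (K - \<epsilon> * (1 - w\<^sup>2))) \<longlongrightarrow>
       - 2 * (1 - 0\<^sup>2) * (2 * R\<^sup>2 - R * (1 - 0\<^sup>2)) + 2 * 0 * (K - \<epsilon> * (1 - 0\<^sup>2))) (at_right 0)"
      by (intro tendsto_intros V0)
    then have l: "((\<lambda>w. - 2 * (1 - w\<^sup>2) * (2 * R\<^sup>2 - R * (1 - w\<^sup>2)) + 2 * V w * (K - \<epsilon> * (1 - w\<^sup>2))) \<longlongrightarrow> 2 * R * (1 - 2 * R)) (at_right 0)"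
      by (simp add: algebra_simps power2_eq_square)
    show "((\<lambda>w. ?D w / (2 * w)) \<longlongrightarrow> 2 * R * (1 - 2 * R)) (at_right 0)"
    proof (rule Lim_transform_eventually[OF l])
      show "\<forall>\<^sub>F w in at_right 0. - 2 * (1 - w\<^sup>2) * (2 * R\<^sup>2 - R * (1 - w\<^sup>2)) + 2 * V w * (K - \<epsilon> * (1 - w\<^sup>2)) = ?D w / (2 * w)"
        using ev
      proof eventually_elim
        case (elim w)
        have "0 < V w" using VD(5)[of w] elim by auto
        have e: "- 2 * u * y + 2 * v * z = 2 * v * (- 2 * w * u * y / v + 2 * w * z) / (2 * w)" if "v \<noteq> 0" "w \<noteq> 0" for u y z v :: real
          using that by (simp add: field_simps)
        show ?case by (rule e) (use \<open>0 < V w\<close> elim in auto)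
      qed
    qed
  qed
  from tendsto_real_sqrt[OF this]
  show ?thesis
  proof (rule Lim_transform_eventually)
    show "\<forall>\<^sub>F w in at_right 0. sqrt ((V w)\<^sup>2 / w\<^sup>2) = V w / w"
      using ev by eventually_elim (use VD(5) in \<open>auto simp: real_sqrt_divide less_imp_le\<close>)
  qed
qed

text \<open>The halves are glued to one function \<open>Z\<close> of \<open>w\<close> in
  \<open>(-1, 1)\<close>, with negative \<open>w\<close> for the part below the axis. The motion
  along the loop is \<open>w' = q / (2 * R)\<close>. It slows down linearly at both ends, so in the
  variable \<open>\<theta>\<close> with \<open>w = tanh \<theta>\<close> the speed is bounded and
  the orbit is defined for all times.\<close>

theorem wloop_saddle_orbit:
  assumes V: "wbranch d \<epsilon> R K V" and W: "wbranch d (-\<epsilon>) R (-K) W"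
  shows "\<exists>X Y. saddle_orbit \<epsilon> (K / R - \<epsilon>) X Y"
proof -
  note VD = wbranchD[OF V] and WD = wbranchD[OF W]
  have R: "0 < R" "0 < 2 * R * (1 - 2 * R)" using VD(2) wbranch_R_less[OF V] by auto
  define z where "z = sqrt (2 * R * (1 - 2 * R))"
  have z: "0 < z" "z\<^sup>2 = 2 * R * (1 - 2 * R)" unfolding z_def using R by auto
  define Z where "Z = (\<lambda>w. if 0 < w then V w else if w < 0 then - W (- w) else 0)"
  \<comment> \<open>The common slope \<open>z\<close> removes the singularity of
    \<open>Z / w\<close> at the turning point and makes \<open>q\<close> continuous and positive on
    the whole interval.\<close>
  define q where "q = (\<lambda>w. if w = 0 then z else Z w / w)"
  have qZ: "Z w = w * q w" for w unfolding q_def Z_def by auto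
  let ?D = "\<lambda>w. - 2 * (1 - w\<^sup>2) * (2 * R\<^sup>2 - R * (1 - w\<^sup>2)) / q w + 2 * w * (K - \<epsilon> * (1 - w\<^sup>2))"
  have bnd: "d * (1 - w\<^sup>2) \<le> q w \<and> q w \<le> (1 - w\<^sup>2) / d" if "w \<in> {-1<..<1} - {0}" for w
  proof (cases "0 < w")
    case True
    then have "d * (w * (1 - w\<^sup>2)) \<le> V w" "V w \<le> w * (1 - w\<^sup>2) / d" using VD(3,4)[of w] that by auto
    then show ?thesis unfolding q_def Z_def using True VD(1) by (auto simp: field_simps)
  next
    case False
    then have n: "0 < - w" "-w < 1" using that by auto
    then have "d * ((-w) * (1 - (-w)\<^sup>2)) \<le> W (-w)" "W (-w) \<le> (-w) * (1 - (-w)\<^sup>2) / d" using WD(3,4)[of "-w"] by auto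
    then show ?thesis unfolding q_def Z_def using n VD(1) by (auto simp: field_simps)
  qed
  have Z_der0: "(Z has_real_derivative ?D w) (at w)" if w: "w \<in> {-1<..<1} - {0}" for w
  proof (cases "0 < w")
    case True
    have 1: "(V has_real_derivative - 2 * w * (1 - w\<^sup>2) * (2 * R\<^sup>2 - R * (1 - w\<^sup>2)) / V w + 2 * w * (K - \<epsilon> * (1 - w\<^sup>2))) (at w)"
      using VD(6)[of w] True w by auto
    have 2: "(Z has_real_derivative - 2 * w * (1 - w\<^sup>2) * (2 * R\<^sup>2 - R * (1 - w\<^sup>2)) / V w + 2 * w * (K - \<epsilon> * (1 - w\<^sup>2))) (at w)"
      by (rule has_field_derivative_transform_within_open[OF 1, of "{0<..}"]) (use True in \<open>auto simp: Z_def\<close>)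
    have "0 < V w" using VD(5)[of w] True w by auto
    have e: "- 2 * w * a * b / v = - 2 * a * b / (v / w)" if "0 < v" for a b v :: real
      using that True by (simp add: field_simps)
    have "q w = V w / w" unfolding q_def Z_def using True by simp
    then show ?thesis using 2 unfolding e[OF \<open>0 < V w\<close>] by simp
  next
    case False
    then have n: "0 < - w" "- w < 1" using w by auto
    have 1: "(W has_real_derivative - 2 * (-w) * (1 - (-w)\<^sup>2) * (2 * R\<^sup>2 - R * (1 - (-w)\<^sup>2)) / W (-w) + 2 * (-w) * (- K - (-\<epsilon>) * (1 - (-w)\<^sup>2))) (at (-w))"
      (is "(W has_real_derivative ?E) _")
      using WD(6)[of "-w"] n by auto
    have "((\<lambda>w. W (- w)) has_real_derivative - ?E) (at w)" using 1 unfolding DERIV_mirror .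
    from DERIV_minus[OF this] have "((\<lambda>w. - W (- w)) has_real_derivative ?E) (at w)" by simp
    then have 2: "(Z has_real_derivative ?E) (at w)"
      by (rule has_field_derivative_transform_within_open[of _ _ _ "{..<0}"]) (use n in \<open>auto simp: Z_def\<close>)
    have Wp: "0 < W (-w)" using WD(5)[of "-w"] n by auto
    have e: "- 2 * (- w) * a * b / v = - 2 * a * b / (- v / w)" if "0 < v" for a b v :: real
      using that n by (simp add: field_simps)
    have qw: "q w = - W (-w) / w" unfolding q_def Z_def using n by simp
    have "?E = ?D w" unfolding e[OF Wp] qw by (simp add: algebra_simps)
    then show ?thesis using 2 by simp
  qed
  have q0: "q \<midarrow>0\<rightarrow> z"
    unfolding filterlim_at_split[of q "nhds z" "0::real"]
  proof
    have a: "((\<lambda>w. W w / w) \<longlongrightarrow> z) (at_right 0)" "((\<lambda>w. V w / w) \<longlongrightarrow> z) (at_right 0)"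
      using wbranch_slope[OF W] wbranch_slope[OF V] unfolding z_def by auto
    show "(q \<longlongrightarrow> z) (at_right 0)"
      by (rule Lim_transform_eventually[OF a(2)])
        (auto simp: q_def Z_def eventually_at_right_field intro!: exI[of _ 1])
    have "((\<lambda>w. W (- w) / (- w)) \<longlongrightarrow> z) (at_left 0)"
      using a(1) unfolding filterlim_at_left_to_right[of _ _ 0] by simp
    then show "(q \<longlongrightarrow> z) (at_left 0)"
      by (rule Lim_transform_eventually)
        (auto simp: q_def Z_def eventually_at_left_field intro!: exI[of _ "-1"])
  qed
  have Z_der: "(Z has_real_derivative ?D w) (at w)" if w: "w \<in> {-1<..<1}" for w
  proof (cases "w = 0")
    case False then show ?thesis using Z_der0 w by simp
  next
    case True
    have "(\<lambda>h. (Z (0 + h) - Z 0) / h) \<midarrow>0\<rightarrow> z"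
      by (rule Lim_transform_eventually[OF q0]) (auto simp: q_def Z_def eventually_at intro!: exI[of _ 1])
    then have "(Z has_real_derivative z) (at 0)" unfolding DERIV_def .
    moreover have "z = - 2 * (1 - 0\<^sup>2) * (2 * R\<^sup>2 - R * (1 - 0\<^sup>2)) / z + 2 * 0 * (K - \<epsilon> * (1 - 0\<^sup>2))"
      using z by (simp add: field_simps power2_eq_square)
    ultimately show ?thesis unfolding True by (simp add: q_def)
  qed
  have q_cont: "isCont q w" if w: "w \<in> {-1<..<1}" for w
  proof (cases "w = 0")
    case True then show ?thesis using q0 unfolding isCont_def by (simp add: q_def)
  next
    case False
    have "isCont Z w" using Z_der[OF w] DERIV_isCont by blast
    then have c: "isCont (\<lambda>w. Z w / w) w" using False by (intro continuous_intros) auto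
    have "\<forall>\<^sub>F x in nhds w. Z x / x = q x"
      using False by (auto simp: q_def eventually_nhds intro!: exI[of _ "- {0}"])
    then show ?thesis using isCont_cong[of "\<lambda>w. Z w / w" q w] c by blast
  qed
  have qb: "d * (1 - w\<^sup>2) \<le> q w \<and> q w \<le> (1 - w\<^sup>2) / d" if w: "w \<in> {-1<..<1}" for w
  proof (cases "w = 0")
    case False then show ?thesis using bnd w by simp
  next
    case True
    have ev: "\<forall>\<^sub>F w::real in at 0. w \<in> {-1<..<1} - {0}"
      by (auto simp: eventually_at dist_real_def intro!: exI[of _ 1])
    have "(\<lambda>w::real. d * (1 - w\<^sup>2)) \<midarrow>0\<rightarrow> d * (1 - 0\<^sup>2)" by (intro tendsto_intros)
    then have "d * (1 - 0\<^sup>2) \<le> z"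
      by (rule tendsto_le[OF at_neq_bot q0]) (intro eventually_mono[OF ev], use bnd in blast)
    moreover have "(\<lambda>w::real. (1 - w\<^sup>2) / d) \<midarrow>0\<rightarrow> (1 - 0\<^sup>2) / d" using VD(1) by (intro tendsto_intros) auto
    then have "z \<le> (1 - 0\<^sup>2) / d"
      by (rule tendsto_le[OF at_neq_bot _ q0]) (intro eventually_mono[OF ev], use bnd in blast)
    ultimately show ?thesis unfolding True by (simp add: q_def)
  qed
  have q_pos: "0 < q w" if w: "w \<in> {-1<..<1}" for w
  proof -
    have "0 < d * (1 - w\<^sup>2)" using VD(1) w by (simp add: power2_less_1_iff abs_less_iff)
    then show ?thesis using qb[OF w] by linarith
  qed
  define p where "p = (\<lambda>\<theta>. q (tanh \<theta>) / (2 * R * (1 - (tanh \<theta>)\<^sup>2)))"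
  have th: "tanh \<theta> \<in> {-1<..<1}" for \<theta> :: real using tanh_real_lt_1 tanh_real_gt_neg1 by simp
  have th2: "0 < 1 - (tanh \<theta>)\<^sup>2" for \<theta> :: real using th[of \<theta>] by (simp add: power2_less_1_iff abs_less_iff)
  have p_pos: "0 < p \<theta>" for \<theta> unfolding p_def using q_pos[OF th] R th2 by simp
  have p_le: "p \<theta> \<le> 1 / (2 * R * d)" for \<theta>
  proof -
    have "p \<theta> \<le> ((1 - (tanh \<theta>)\<^sup>2) / d) / (2 * R * (1 - (tanh \<theta>)\<^sup>2))"
      unfolding p_def using qb[OF th] R th2[of \<theta>] by (intro divide_right_mono) auto
    also have "\<dots> = 1 / (2 * R * d)"
      using less_imp_neq[OF th2[of \<theta>], symmetric] nonzero_mult_divide_mult_cancel_right[of "1 - (tanh \<theta>)\<^sup>2" 1 "2 * R * d"] by (simp add: mult.commute mult.left_commute)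
    finally show ?thesis .
  qed
  have p_cont: "continuous_on UNIV p"
    unfolding continuous_on_eq_continuous_at[OF open_UNIV]
  proof
    fix \<theta> :: real
    have t: "isCont tanh \<theta>" by (intro continuous_intros) auto
    show "isCont p \<theta>" unfolding p_def
      using th2[of \<theta>] R by (intro continuous_intros isCont_o2[OF t q_cont[OF th]] t) auto
  qed
  obtain \<theta> where \<theta>: "\<And>t. (\<theta> has_real_derivative p (\<theta> t)) (at t)" "filterlim \<theta> at_top at_top" "filterlim \<theta> at_bot at_bot"
    using autonomous_solution[OF p_cont p_pos p_le] by blast
  define w where "w = (\<lambda>t. tanh (\<theta> t))"
  have wr: "w t \<in> {-1<..<1}" for t unfolding w_def by (rule th)
  have w_der: "(w has_real_derivative q (w t) / (2 * R)) (at t)" for t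
  proof -
    have "(w has_real_derivative (1 - (tanh (\<theta> t))\<^sup>2) * p (\<theta> t)) (at t)"
      unfolding w_def by (rule has_field_derivative_tanh[OF _ \<theta>(1)]) (use cosh_real_pos[of "\<theta> t"] in simp)
    then show ?thesis unfolding p_def w_def using th2[of "\<theta> t"] R by simp
  qed
  define X where "X = (\<lambda>t. 1 - (1 - (w t)\<^sup>2) / R)"
  define Y where "Y = (\<lambda>t. Z (w t) / R\<^sup>2)"
  have X_der: "(X has_real_derivative Y t) (at t)" for t
  proof -
    have "(X has_real_derivative 2 * w t * (q (w t) / (2 * R)) / R) (at t)"
      unfolding X_def using R by (auto intro!: derivative_eq_intros w_der)
    then show ?thesis unfolding Y_def qZ by (simp add: power2_eq_square)
  qed
  have Y_der: "(Y has_real_derivative (X t)\<^sup>2 - 1 + (K / R - \<epsilon> + \<epsilon> * X t) * Y t) (at t)" for t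
  proof -
    from DERIV_chain2[where g = w and f = Z, OF Z_der[OF wr[of t]] w_der[of t]]
    have "(Y has_real_derivative (?D (w t) * (q (w t) / (2 * R))) / R\<^sup>2) (at t)"
      unfolding Y_def by (rule DERIV_cdivide)
    moreover have e: "((- 2 * u * (2 * R\<^sup>2 - R * u) / v + 2 * x * (K - \<epsilon> * u)) * (v / (2 * R))) / R\<^sup>2 =
       (1 - u / R)\<^sup>2 - 1 + (K / R - \<epsilon> + \<epsilon> * (1 - u / R)) * (x * v / R\<^sup>2)" if "0 < v" for u v x
      using that R(1) by (simp add: divide_simps) (simp add: algebra_simps power2_eq_square)
    ultimately show ?thesis unfolding e[OF q_pos[OF wr]] X_def Y_def qZ by simp
  qed
  have w_lim: "(w \<longlongrightarrow> 1) at_top" "(w \<longlongrightarrow> -1) at_bot"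
    unfolding w_def by (rule filterlim_compose[OF tanh_real_at_top \<theta>(2)], rule filterlim_compose[OF tanh_real_at_bot \<theta>(3)])
  have X_lim: "(X \<longlongrightarrow> 1) F" "(Y \<longlongrightarrow> 0) F" if "(w \<longlongrightarrow> c) F" "c\<^sup>2 = 1" for F c
  proof -
    have "(X \<longlongrightarrow> 1 - (1 - c\<^sup>2) / R) F" unfolding X_def using R by (intro tendsto_intros that) auto
    then show "(X \<longlongrightarrow> 1) F" using that(2) by simp
    have "((\<lambda>t. (1 - (w t)\<^sup>2) / d / R\<^sup>2) \<longlongrightarrow> (1 - c\<^sup>2) / d / R\<^sup>2) F" using R VD(1) by (intro tendsto_intros that) auto
    then have l: "((\<lambda>t. (1 - (w t)\<^sup>2) / d / R\<^sup>2) \<longlongrightarrow> 0) F" using that(2) by simp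
    have "\<bar>Y t\<bar> \<le> (1 - (w t)\<^sup>2) / d / R\<^sup>2" for t
    proof -
      have "\<bar>Z (w t)\<bar> \<le> 1 * q (w t)" unfolding qZ abs_mult using wr[of t] q_pos[OF wr[of t]] by (intro mult_mono) auto
      also have "\<dots> \<le> (1 - (w t)\<^sup>2) / d" using qb[OF wr[of t]] by simp
      finally have "\<bar>Z (w t)\<bar> / R\<^sup>2 \<le> (1 - (w t)\<^sup>2) / d / R\<^sup>2" by (rule divide_right_mono) simp
      then show ?thesis unfolding Y_def by simp
    qed
    then show "(Y \<longlongrightarrow> 0) F" by (intro Lim_null_comparison[OF _ l]) auto
  qed
  have "X 0 \<noteq> 1" unfolding X_def using wr[of 0] R by (auto simp: power2_eq_1_iff)
  then show ?thesis unfolding saddle_orbit_def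
    using X_der Y_der X_lim[OF w_lim(1)] X_lim[OF w_lim(2)] by (intro exI[of _ X] exI[of _ Y]) auto
qed

section \<open>Existence of loops and scaling\<close>

text \<open>If \<open>P\<close> is a limit point but the curve does not converge, it keeps coming
  close to \<open>P\<close> and leaving a ball around it. By continuity it meets the sphere at
  arbitrarily late times, and compactness of the sphere yields a second limit point.\<close>

lemma omega_limit_set_singleton_iff:
  fixes \<gamma> :: "real \<Rightarrow> 'a::heine_borel"
  assumes cont: "\<And>t. isCont \<gamma> t"
  shows "omega_limit_set \<gamma> = {P} \<longleftrightarrow> (\<gamma> \<longlongrightarrow> P) at_top"
proof
  assume lim: "(\<gamma> \<longlongrightarrow> P) at_top"
  have "(\<lambda>k. \<gamma> (real k)) \<longlonglongrightarrow> P" using filterlim_compose[OF lim filterlim_real_sequentially] .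
  then have "P \<in> omega_limit_set \<gamma>" unfolding omega_limit_set_def using filterlim_real_sequentially by blast
  moreover have "p = P" if p: "p \<in> omega_limit_set \<gamma>" for p
  proof -
    obtain t :: "nat \<Rightarrow> real" where t: "filterlim t at_top sequentially" "(\<lambda>k. \<gamma> (t k)) \<longlonglongrightarrow> p"
      using p unfolding omega_limit_set_def by blast
    show ?thesis using tendsto_unique[OF _ t(2) filterlim_compose[OF lim t(1)]] by simp
  qed
  ultimately show "omega_limit_set \<gamma> = {P}" by blast
next
  assume om: "omega_limit_set \<gamma> = {P}"
  show "(\<gamma> \<longlongrightarrow> P) at_top"
  proof (rule tendstoI, rule ccontr)
    fix e :: real assume e: "0 < e" and "\<not> (\<forall>\<^sub>F t in at_top. dist (\<gamma> t) P < e)"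
    then have far: "\<exists>t\<ge>T. e \<le> dist (\<gamma> t) P" for T unfolding eventually_at_top_linorder by (meson not_less)
    obtain \<tau> where \<tau>: "filterlim \<tau> at_top sequentially" "(\<lambda>k. \<gamma> (\<tau> k)) \<longlonglongrightarrow> P"
      using om unfolding omega_limit_set_def by blast
    have near: "\<exists>t\<ge>T. dist (\<gamma> t) P < e" for T
    proof -
      have "\<forall>\<^sub>F k in sequentially. T \<le> \<tau> k \<and> dist (\<gamma> (\<tau> k)) P < e"
        using filterlim_at_top[THEN iffD1, OF \<tau>(1)] tendstoD[OF \<tau>(2) e] by (intro eventually_conj) auto
      then show ?thesis using eventually_happens[of _ sequentially] by fastforce
    qed
    have "\<exists>t\<ge>T. dist (\<gamma> t) P = e" for T
    proof -
      obtain t1 where t1: "T \<le> t1" "dist (\<gamma> t1) P < e" using near by blast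
      obtain t2 where t2: "t1 \<le> t2" "e \<le> dist (\<gamma> t2) P" using far by blast
      have "\<exists>t. t1 \<le> t \<and> t \<le> t2 \<and> dist (\<gamma> t) P = e"
        using t1 t2 cont by (intro IVT) (auto intro!: continuous_intros)
      then obtain t where "t1 \<le> t" "dist (\<gamma> t) P = e" by blast
      then show ?thesis using t1(1) by (intro exI[of _ t]) simp
    qed
    then have "\<forall>n::nat. \<exists>t. real n \<le> t \<and> dist (\<gamma> t) P = e" by blast
    then obtain s where s: "\<And>n::nat. real n \<le> s n" "\<And>n. dist (\<gamma> (s n)) P = e" by (auto dest!: choice)
    have "seq_compact (sphere P e)" unfolding compact_eq_seq_compact_metric[symmetric] compact_eq_bounded_closed
    proof
      show "bounded (sphere P e)" by (rule bounded_subset[OF bounded_cball[of P e]]) auto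
      have "sphere P e = cball P e - ball P e" by auto
      then show "closed (sphere P e)" by (simp add: closed_Diff)
    qed
    moreover have "\<forall>n. \<gamma> (s n) \<in> sphere P e" using s(2) by (simp add: dist_commute)
    ultimately obtain l r where l: "l \<in> sphere P e" "strict_mono r" "((\<lambda>n. \<gamma> (s n)) \<circ> r) \<longlonglongrightarrow> l"
      using seq_compactE[of "sphere P e" "\<lambda>n. \<gamma> (s n)"] by blast
    have "filterlim s at_top sequentially"
      by (rule filterlim_at_top_mono[OF filterlim_real_sequentially]) (use s(1) in auto)
    then have "filterlim (\<lambda>n. s (r n)) at_top sequentially"
      using filterlim_compose filterlim_subseq[OF l(2)] by blast
    then have "l \<in> omega_limit_set \<gamma>" using l(3) unfolding omega_limit_set_def comp_def by blast
    then show False using om l(1) e by auto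
  qed
qed

lemma alpha_limit_set_mirror: "alpha_limit_set \<gamma> = omega_limit_set (\<lambda>t. \<gamma> (- t))"
proof -
  have "(\<exists>t :: nat \<Rightarrow> real. filterlim t at_bot sequentially \<and> (\<lambda>k. \<gamma> (t k)) \<longlonglongrightarrow> p) \<longleftrightarrow>
    (\<exists>t :: nat \<Rightarrow> real. filterlim t at_top sequentially \<and> (\<lambda>k. \<gamma> (- t k)) \<longlonglongrightarrow> p)" (is "?L \<longleftrightarrow> ?R") for p
  proof
    assume ?L
    then obtain t :: "nat \<Rightarrow> real" where "filterlim t at_bot sequentially" "(\<lambda>k. \<gamma> (t k)) \<longlonglongrightarrow> p" by blast
    then show ?R by (intro exI[of _ "\<lambda>k. - t k"]) (auto simp: filterlim_uminus_at_top)
  next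
    assume ?R
    then obtain t :: "nat \<Rightarrow> real" where "filterlim t at_top sequentially" "(\<lambda>k. \<gamma> (- t k)) \<longlonglongrightarrow> p" by blast
    then show ?L by (intro exI[of _ "\<lambda>k. - t k"]) (auto simp: filterlim_uminus_at_top)
  qed
  then show ?thesis unfolding alpha_limit_set_def omega_limit_set_def by blast
qed

lemma alpha_limit_set_singleton_iff:
  fixes \<gamma> :: "real \<Rightarrow> 'a::heine_borel"
  assumes cont: "\<And>t. isCont \<gamma> t"
  shows "alpha_limit_set \<gamma> = {P} \<longleftrightarrow> (\<gamma> \<longlongrightarrow> P) at_bot"
proof -
  have "isCont (\<lambda>t. \<gamma> (- t)) t" for t
    by (rule isCont_o2[OF isCont_minus[OF continuous_ident] cont])
  then show ?thesis unfolding alpha_limit_set_mirror filterlim_at_bot_mirror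
    by (rule omega_limit_set_singleton_iff)
qed

lemma bt_solution_iff:
  "bt_solution n b (\<lambda>t. (x t, y t)) \<longleftrightarrow>
     (\<forall>t. (x has_real_derivative y t) (at t)) \<and>
     (\<forall>t. (y has_real_derivative - n + b * y t + (x t)\<^sup>2 + x t * y t) (at t))"
proof -
  have "((\<lambda>t. (x t, y t)) has_vector_derivative (p, q)) (at t) \<longleftrightarrow> (x has_real_derivative p) (at t) \<and> (y has_real_derivative q) (at t)" for p q t
  proof
    assume h: "((\<lambda>t. (x t, y t)) has_vector_derivative (p, q)) (at t)"
    show "(x has_real_derivative p) (at t) \<and> (y has_real_derivative q) (at t)"
      using bounded_linear.has_vector_derivative[OF bounded_linear_fst h] bounded_linear.has_vector_derivative[OF bounded_linear_snd h]
      by (simp add: has_real_derivative_iff_has_vector_derivative)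
  next
    assume "(x has_real_derivative p) (at t) \<and> (y has_real_derivative q) (at t)"
    then show "((\<lambda>t. (x t, y t)) has_vector_derivative (p, q)) (at t)"
      unfolding has_real_derivative_iff_has_vector_derivative by (blast intro: has_vector_derivative_Pair)
  qed
  then show ?thesis unfolding bt_solution_def bt_field_def by auto
qed

lemma saddle_orbit_of_has_saddle_loop:
  assumes e: "0 < \<epsilon>" and "has_saddle_loop (\<epsilon> ^ 4) b"
  shows "\<exists>X Y. saddle_orbit \<epsilon> (b / \<epsilon>) X Y"
proof -
  have sq: "sqrt (\<epsilon> ^ 4) = \<epsilon>\<^sup>2" using e by (intro real_sqrt_unique) (auto simp: power_mult[symmetric])
  obtain \<gamma> where \<gamma>: "bt_solution (\<epsilon> ^ 4) b \<gamma>" "\<exists>t. \<gamma> t \<noteq> (\<epsilon>\<^sup>2, 0)"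
    "alpha_limit_set \<gamma> = {(\<epsilon>\<^sup>2, 0)}" "omega_limit_set \<gamma> = {(\<epsilon>\<^sup>2, 0)}"
    using assms(2) unfolding has_saddle_loop_def sq by blast
  define x y where "x = (\<lambda>t. fst (\<gamma> t))" and "y = (\<lambda>t. snd (\<gamma> t))"
  have \<gamma>_eq: "\<gamma> = (\<lambda>t. (x t, y t))" unfolding x_def y_def by simp
  have xy: "(x has_real_derivative y t) (at t)" "(y has_real_derivative - (\<epsilon> ^ 4) + b * y t + (x t)\<^sup>2 + x t * y t) (at t)" for t
    using \<gamma>(1) unfolding \<gamma>_eq bt_solution_iff by auto
  have cont: "isCont \<gamma> t" for t
    using xy[of t] unfolding \<gamma>_eq by (intro continuous_Pair) (blast intro: DERIV_isCont)+
  have lims: "(\<gamma> \<longlongrightarrow> (\<epsilon>\<^sup>2, 0)) at_bot" "(\<gamma> \<longlongrightarrow> (\<epsilon>\<^sup>2, 0)) at_top"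
    using \<gamma>(3,4) alpha_limit_set_singleton_iff[of \<gamma>, OF cont] omega_limit_set_singleton_iff[of \<gamma>, OF cont] by auto
  define X where "X = (\<lambda>s. x (s / \<epsilon>) / \<epsilon>\<^sup>2)"
  define Y where "Y = (\<lambda>s. y (s / \<epsilon>) / \<epsilon> ^ 3)"
  have l: "((\<lambda>s. s / \<epsilon>) has_real_derivative 1 / \<epsilon>) (at s)" for s by (intro DERIV_cdivide DERIV_ident)
  have X_der: "(X has_real_derivative Y s) (at s)" for s
  proof -
    have "(X has_real_derivative (y (s / \<epsilon>) * (1 / \<epsilon>)) / \<epsilon>\<^sup>2) (at s)"
      unfolding X_def by (intro DERIV_cdivide DERIV_chain2[where g = "\<lambda>s. s / \<epsilon>", OF xy(1) l])
    then show ?thesis unfolding Y_def by (simp add: power2_eq_square power3_eq_cube mult.assoc)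
  qed
  have Y_der: "(Y has_real_derivative (X s)\<^sup>2 - 1 + (b / \<epsilon> + \<epsilon> * X s) * Y s) (at s)" for s
  proof -
    define p q where "p = x (s / \<epsilon>)" and "q = y (s / \<epsilon>)"
    have "(Y has_real_derivative ((- (\<epsilon> ^ 4) + b * q + p\<^sup>2 + p * q) * (1 / \<epsilon>)) / \<epsilon> ^ 3) (at s)"
      unfolding Y_def p_def q_def by (intro DERIV_cdivide DERIV_chain2[where g = "\<lambda>s. s / \<epsilon>", OF xy(2) l])
    moreover have "((- (\<epsilon> ^ 4) + b * q + p\<^sup>2 + p * q) * (1 / \<epsilon>)) / \<epsilon> ^ 3 = (p / \<epsilon>\<^sup>2)\<^sup>2 - 1 + (b / \<epsilon> + \<epsilon> * (p / \<epsilon>\<^sup>2)) * (q / \<epsilon> ^ 3)"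
      using e by (simp add: field_simps power2_eq_square power3_eq_cube power4_eq_xxxx)
    ultimately show ?thesis unfolding X_def Y_def p_def q_def by simp
  qed
  have lim: "(X \<longlongrightarrow> 1) F \<and> (Y \<longlongrightarrow> 0) F" if "filterlim (\<lambda>s. s / \<epsilon>) G F" "(\<gamma> \<longlongrightarrow> (\<epsilon>\<^sup>2, 0)) G" for F G
  proof -
    have l: "((\<lambda>s. \<gamma> (s / \<epsilon>)) \<longlongrightarrow> (\<epsilon>\<^sup>2, 0)) F" using filterlim_compose[OF that(2,1)] .
    have "((\<lambda>s. x (s / \<epsilon>)) \<longlongrightarrow> \<epsilon>\<^sup>2) F" "((\<lambda>s. y (s / \<epsilon>)) \<longlongrightarrow> 0) F"
      using tendsto_fst[OF l] tendsto_snd[OF l] unfolding x_def y_def by auto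
    then have "(X \<longlongrightarrow> \<epsilon>\<^sup>2 / \<epsilon>\<^sup>2) F" "(Y \<longlongrightarrow> 0 / \<epsilon> ^ 3) F"
      unfolding X_def Y_def using e by (intro tendsto_divide tendsto_const; simp)+
    then show ?thesis using e by simp
  qed
  have top: "filterlim (\<lambda>s. s / \<epsilon>) at_top at_top" "filterlim (\<lambda>s. s / \<epsilon>) at_bot at_bot"
    using e by real_asymp+
  obtain t where t: "\<gamma> t \<noteq> (\<epsilon>\<^sup>2, 0)" using \<gamma>(2) by blast
  have "\<not> (X (\<epsilon> * t) = 1 \<and> Y (\<epsilon> * t) = 0)" using t e unfolding X_def Y_def \<gamma>_eq by auto
  then show ?thesis unfolding saddle_orbit_def
    using X_der Y_der lim[OF top(1) lims(2)] lim[OF top(2) lims(1)] by blast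
qed

lemma has_saddle_loop_of_saddle_orbit:
  assumes e: "0 < \<epsilon>" and orb: "saddle_orbit \<epsilon> (b / \<epsilon>) X Y"
  shows "has_saddle_loop (\<epsilon> ^ 4) b"
proof -
  have sq: "sqrt (\<epsilon> ^ 4) = \<epsilon>\<^sup>2" using e by (intro real_sqrt_unique) (auto simp: power_mult[symmetric])
  note o = orb[unfolded saddle_orbit_def]
  define x where "x = (\<lambda>t. \<epsilon>\<^sup>2 * X (\<epsilon> * t))"
  define y where "y = (\<lambda>t. \<epsilon> ^ 3 * Y (\<epsilon> * t))"
  have l: "((\<lambda>s. \<epsilon> * s) has_real_derivative \<epsilon>) (at s)" for s using DERIV_cmult_Id by blast
  have X: "(X has_real_derivative Y t) (at t)" and Y: "(Y has_real_derivative (X t)\<^sup>2 - 1 + (b / \<epsilon> + \<epsilon> * X t) * Y t) (at t)" for t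
    using o by auto
  have x_der: "(x has_real_derivative y s) (at s)" for s
  proof -
    have "(x has_real_derivative \<epsilon>\<^sup>2 * (Y (\<epsilon> * s) * \<epsilon>)) (at s)"
      unfolding x_def by (intro DERIV_cmult DERIV_chain2[where g = "\<lambda>s. \<epsilon> * s", OF X l])
    then show ?thesis unfolding y_def by (simp add: power2_eq_square power3_eq_cube mult_ac)
  qed
  have y_der: "(y has_real_derivative - (\<epsilon> ^ 4) + b * y s + (x s)\<^sup>2 + x s * y s) (at s)" for s
  proof -
    define p q where "p = X (\<epsilon> * s)" and "q = Y (\<epsilon> * s)"
    have "(y has_real_derivative \<epsilon> ^ 3 * ((p\<^sup>2 - 1 + (b / \<epsilon> + \<epsilon> * p) * q) * \<epsilon>)) (at s)"
      unfolding y_def p_def q_def by (intro DERIV_cmult DERIV_chain2[where g = "\<lambda>s. \<epsilon> * s", OF Y l])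
    moreover have "\<epsilon> ^ 3 * ((p\<^sup>2 - 1 + (b / \<epsilon> + \<epsilon> * p) * q) * \<epsilon>) = - (\<epsilon> ^ 4) + b * (\<epsilon> ^ 3 * q) + (\<epsilon>\<^sup>2 * p)\<^sup>2 + (\<epsilon>\<^sup>2 * p) * (\<epsilon> ^ 3 * q)"
      using e by (simp add: field_simps power2_eq_square power3_eq_cube power4_eq_xxxx)
    ultimately show ?thesis unfolding x_def y_def p_def q_def by simp
  qed
  define \<gamma> where "\<gamma> = (\<lambda>t. (x t, y t))"
  have sol: "bt_solution (\<epsilon> ^ 4) b \<gamma>" unfolding \<gamma>_def bt_solution_iff using x_der y_der by auto
  have cont: "isCont \<gamma> t" for t
    using x_der[of t] y_der[of t] unfolding \<gamma>_def by (intro continuous_Pair) (blast intro: DERIV_isCont)+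
  have lim: "(\<gamma> \<longlongrightarrow> (\<epsilon>\<^sup>2, 0)) F" if "filterlim (\<lambda>s. \<epsilon> * s) F F" "(X \<longlongrightarrow> 1) F" "(Y \<longlongrightarrow> 0) F" for F
  proof -
    have "((\<lambda>s. X (\<epsilon> * s)) \<longlongrightarrow> 1) F" "((\<lambda>s. Y (\<epsilon> * s)) \<longlongrightarrow> 0) F"
      using filterlim_compose[OF that(2,1)] filterlim_compose[OF that(3,1)] .
    from tendsto_mult_left[OF this(1), of "\<epsilon>\<^sup>2"] tendsto_mult_left[OF this(2), of "\<epsilon> ^ 3"]
    have "(x \<longlongrightarrow> \<epsilon>\<^sup>2 * 1) F" "(y \<longlongrightarrow> \<epsilon> ^ 3 * 0) F" unfolding x_def y_def .
    then show ?thesis unfolding \<gamma>_def using tendsto_Pair by fastforce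
  qed
  have top: "filterlim (\<lambda>s. \<epsilon> * s) at_top at_top" "filterlim (\<lambda>s. \<epsilon> * s) at_bot at_bot"
    using e by real_asymp+
  have lims: "(\<gamma> \<longlongrightarrow> (\<epsilon>\<^sup>2, 0)) at_top" "(\<gamma> \<longlongrightarrow> (\<epsilon>\<^sup>2, 0)) at_bot"
    using lim[OF top(1)] lim[OF top(2)] o by auto
  obtain t where t: "\<not> (X t = 1 \<and> Y t = 0)" using o by blast
  have "\<gamma> (t / \<epsilon>) \<noteq> (\<epsilon>\<^sup>2, 0)" using t e unfolding \<gamma>_def x_def y_def by auto
  then show ?thesis unfolding has_saddle_loop_def sq
    using sol lims alpha_limit_set_singleton_iff[of \<gamma>, OF cont] omega_limit_set_singleton_iff[of \<gamma>, OF cont] by blast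
qed

section \<open>Continuation from the Hamiltonian loop\<close>

text \<open>The Hamiltonian loop ends at \<open>B = 3\<close>; in the scaled variables its graph is
  exactly a multiple of the weight.\<close>

lemma wloop_0: "wloop (sqrt 2 / 3) 0 (1 / 3) 0"
proof -
  define c :: real where "c = sqrt 2 / 3"
  have c: "0 < c" "c * c = 2 / 9" "c \<le> 1" unfolding c_def by (auto simp: real_le_lsqrt field_simps)
  have "wbranch c 0 (1 / 3) 0 (\<lambda>w. c * (w * (1 - w\<^sup>2)))"
    unfolding wbranch_def
  proof (intro conjI ballI)
    fix w :: real assume w: "w \<in> {0<..<1}"
    have u: "0 < 1 - w\<^sup>2" using w one_minus_sq by auto
    then have p: "0 < w * (1 - w\<^sup>2)" using w by simp
    have "c * (w * (1 - w\<^sup>2)) \<le> 1 * (w * (1 - w\<^sup>2))" using c p by (intro mult_right_mono) auto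
    also have "\<dots> \<le> w * (1 - w\<^sup>2) / c" using c p by (simp add: pos_le_divide_eq mult_left_le)
    finally show "c * (w * (1 - w\<^sup>2)) \<le> w * (1 - w\<^sup>2) / c" .
    have "((\<lambda>w. c * (w * (1 - w\<^sup>2))) has_real_derivative c * (1 - 3 * w\<^sup>2)) (at w)"
      by (auto intro!: derivative_eq_intros simp: power2_eq_square algebra_simps)
    moreover have "- 2 * w * (1 - w\<^sup>2) * (2 * (1 / 3)\<^sup>2 - (1 / 3) * (1 - w\<^sup>2)) / (c * (w * (1 - w\<^sup>2))) = c * (1 - 3 * w\<^sup>2)"
    proof -
      have "c * (1 - 3 * w\<^sup>2) * (c * (w * (1 - w\<^sup>2))) = (c * c) * ((1 - 3 * w\<^sup>2) * (w * (1 - w\<^sup>2)))" by (simp add: mult_ac)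
      also have "\<dots> = - 2 * w * (1 - w\<^sup>2) * (2 * (1 / 3)\<^sup>2 - (1 / 3) * (1 - w\<^sup>2))"
        unfolding c(2) by (simp add: field_simps power2_eq_square)
      finally have e: "c * (1 - 3 * w\<^sup>2) * (c * (w * (1 - w\<^sup>2))) = - 2 * w * (1 - w\<^sup>2) * (2 * (1 / 3)\<^sup>2 - (1 / 3) * (1 - w\<^sup>2))" .
      have "c * (w * (1 - w\<^sup>2)) \<noteq> 0" using mult_pos_pos[OF c(1) p] by linarith
      then show ?thesis unfolding e[symmetric] by (rule nonzero_mult_div_cancel_right)
    qed
    ultimately show "((\<lambda>w. c * (w * (1 - w\<^sup>2))) has_real_derivative - 2 * w * (1 - w\<^sup>2) * (2 * (1 / 3)\<^sup>2 - (1 / 3) * (1 - w\<^sup>2)) / (c * (w * (1 - w\<^sup>2))) +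
      2 * w * (0 - 0 * (1 - w\<^sup>2))) (at w)" by simp
  qed (use c in auto)
  then show ?thesis unfolding wloop_def c_def by auto
qed

text \<open>The set of parameters with a loop is open in the nonnegative half line by power series
  continuation, and closed by the uniform bounds and compactness. The argument with the supremum of
  \<open>A\<close> is the connectedness of the half line.\<close>

theorem wloop_exists:
  assumes "0 \<le> \<epsilon>"
  shows "\<exists>d R K. wloop d \<epsilon> R K"
proof (rule ccontr)
  define S where "S = {\<epsilon>. 0 \<le> \<epsilon> \<and> (\<exists>d R K. wloop d \<epsilon> R K)}"
  define A where "A = {a. 0 \<le> a \<and> (\<forall>\<epsilon>. 0 \<le> \<epsilon> \<and> \<epsilon> \<le> a \<longrightarrow> \<epsilon> \<in> S)}"
  assume "\<not> ?thesis"
  then have "\<epsilon> \<notin> S" unfolding S_def by simp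
  then have bdd: "a < \<epsilon>" if "a \<in> A" for a using that assms unfolding A_def by (auto simp: not_less[symmetric])
  have open_S: "\<exists>\<delta>>0. \<forall>x. 0 \<le> x \<longrightarrow> \<bar>x - e\<bar> \<le> \<delta> \<longrightarrow> x \<in> S" if "e \<in> S" for e
  proof -
    obtain d R K where "wloop d e R K" using \<open>e \<in> S\<close> unfolding S_def by blast
    then obtain \<delta> d' \<rho> k where
      \<delta>: "0 < \<delta>" "\<And>x. \<bar>x\<bar> \<le> \<delta> \<Longrightarrow> wloop d' (e + x) (\<Sum>j. x ^ j * \<rho> j) (\<Sum>j. x ^ j * k j)"
      by (elim wloop_continuation) (erule that, assumption)
    show ?thesis
    proof (intro exI[of _ \<delta>] conjI allI impI \<delta>(1))
      fix x assume "0 \<le> x" "\<bar>x - e\<bar> \<le> \<delta>"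
      then show "x \<in> S" using \<delta>(2)[of "x - e"] unfolding S_def by auto
    qed
  qed
  have "0 \<in> S" unfolding S_def using wloop_0 by blast
  then have A0: "0 \<in> A" unfolding A_def by (auto dest: antisym)
  define m where "m = Sup A"
  have ub: "a \<le> m" if "a \<in> A" for a unfolding m_def using that bdd by (intro cSup_upper) (auto intro!: bdd_aboveI[of _ \<epsilon>] less_imp_le)
  have m0: "0 \<le> m" using ub[OF A0] .
  have below: "x \<in> S" if "0 \<le> x" "x < m" for x
  proof -
    have "A \<noteq> {}" using A0 by auto
    from less_cSupD[OF this that(2)[unfolded m_def]] obtain a where "a \<in> A" "x < a" by auto
    then show ?thesis using that(1) unfolding A_def by auto
  qed
  have mS: "m \<in> S"
  proof (cases "m = 0")
    case True then show ?thesis using \<open>0 \<in> S\<close> by simp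
  next
    case False
    then have mp: "0 < m" using m0 by simp
    obtain d where d: "0 < d" "\<And>d0 \<epsilon> R K. 0 < \<epsilon> \<Longrightarrow> \<epsilon> \<le> m \<Longrightarrow> wloop d0 \<epsilon> R K \<Longrightarrow> wloop d \<epsilon> R K \<and> d \<le> R \<and> R \<le> 1 \<and> \<bar>K\<bar> \<le> 3 * m"
      using wloop_uniform[OF mp] by blast
    \<comment> \<open>Parameters below \<open>m\<close> that converge to it; the shift by 2 makes
      already the first one positive, as the uniform bounds require.\<close>
    define e where "e = (\<lambda>n::nat. m * (1 - 1 / (real n + 2)))"
    have e: "0 < e n" "e n < m" for n unfolding e_def using mp by (auto simp: field_simps add_pos_nonneg)
    have "\<exists>R K. wloop d (e n) R K \<and> d \<le> R \<and> R \<le> 1 \<and> \<bar>K\<bar> \<le> 3 * m" for n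
    proof -
      have "e n \<in> S" using below[of "e n"] e[of n] by auto
      then obtain d0 R K where "wloop d0 (e n) R K" unfolding S_def by blast
      then show ?thesis using d(2)[of "e n"] e[of n] by (metis less_imp_le)
    qed
    then obtain r k where rk: "\<And>n. wloop d (e n) (r n) (k n)" "\<And>n. d \<le> r n" "\<And>n. r n \<le> 1" "\<And>n. \<bar>k n\<bar> \<le> 3 * m" by metis
    have el: "e \<longlonglongrightarrow> m" unfolding e_def by real_asymp
    have eb: "\<bar>e n\<bar> \<le> 3 * m" for n using e[of n] by simp
    show ?thesis using wloop_limit[OF rk eb el] m0 unfolding S_def by blast
  qed
  obtain \<delta> where \<delta>: "0 < \<delta>" "\<And>x. 0 \<le> x \<Longrightarrow> \<bar>x - m\<bar> \<le> \<delta> \<Longrightarrow> x \<in> S" using open_S[OF mS] by blast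
  have "m + \<delta> \<in> A"
    unfolding A_def
  proof (intro CollectI conjI allI impI)
    fix x assume x: "0 \<le> x \<and> x \<le> m + \<delta>"
    then show "x \<in> S" using below[of x] \<delta>(2)[of x] by (cases "x < m") auto
  qed (use m0 \<delta> in simp)
  then show False using ub \<delta> by fastforce
qed

text \<open>Both facts behind the definite description are supplied here: a loop for this \<epsilon>
  exists and yields an orbit, and every orbit yields a graph, whose \<open>k\<close> must agree with
  the given one.\<close>

theorem bstar_eq_loop_graph:
  assumes e: "0 < \<epsilon>" and lg: "loop_graph \<epsilon> k B f g"
  shows "bstar (\<epsilon> ^ 4) = \<epsilon> * (k - \<epsilon>)"
proof -
  have uniq: "b = \<epsilon> * (k - \<epsilon>)" if b: "has_saddle_loop (\<epsilon> ^ 4) b" for b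
  proof -
    obtain X Y where "saddle_orbit \<epsilon> (b / \<epsilon>) X Y" using saddle_orbit_of_has_saddle_loop[OF e b] by blast
    then have "b / \<epsilon> + \<epsilon> = k" using saddle_orbit_loop_graph loop_graph_unique lg by metis
    then show ?thesis using e by (auto simp: field_simps)
  qed
  obtain d R K where "wloop d \<epsilon> R K" using wloop_exists[of \<epsilon>] e by auto
  then obtain V W where V: "wbranch d \<epsilon> R K V" "wbranch d (-\<epsilon>) R (-K) W" unfolding wloop_def by blast
  obtain X Y where "saddle_orbit \<epsilon> (K / R - \<epsilon>) X Y" using wloop_saddle_orbit[OF V] by blast
  then have "saddle_orbit \<epsilon> (\<epsilon> * (K / R - \<epsilon>) / \<epsilon>) X Y" using e by simp
  then have "has_saddle_loop (\<epsilon> ^ 4) (\<epsilon> * (K / R - \<epsilon>))" by (rule has_saddle_loop_of_saddle_orbit[OF e])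
  then show ?thesis unfolding bstar_def using uniq by (metis the_equality)
qed

definition loop_k :: "real \<Rightarrow> real" where
  "loop_k \<epsilon> = (THE k. \<exists>d R K. wloop d \<epsilon> R K \<and> k = K / R)"

lemma loop_k_eq:
  assumes "wloop d \<epsilon> R K"
  shows "loop_k \<epsilon> = K / R"
proof -
  have lg: "\<exists>B f g. loop_graph \<epsilon> (K / R) B f g" if "wloop d \<epsilon> R K" for d R K
    using that wbranch_loop_graph unfolding wloop_def by blast
  have "k = K / R" if "\<exists>d R K. wloop d \<epsilon> R K \<and> k = K / R" for k
    using that lg[OF assms] lg loop_graph_unique by blast
  then show ?thesis unfolding loop_k_def using assms by (intro the_equality) blast+
qed

lemma loop_k_graph:
  assumes "0 \<le> \<epsilon>"
  shows "\<exists>B f g. loop_graph \<epsilon> (loop_k \<epsilon>) B f g"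
proof -
  obtain d R K where w: "wloop d \<epsilon> R K" using wloop_exists[OF assms] by blast
  then show ?thesis unfolding loop_k_eq[OF w] using wbranch_loop_graph unfolding wloop_def by blast
qed

lemma loop_k_minus:
  assumes "wloop d \<epsilon> R K"
  shows "loop_k (- \<epsilon>) = - loop_k \<epsilon>"
proof -
  have "wloop d (- \<epsilon>) R (- K)" using assms unfolding wloop_def by auto
  then show ?thesis using loop_k_eq assms by fastforce
qed

lemma bstar_eq_loop_k:
  assumes "0 < \<epsilon>"
  shows "bstar (\<epsilon> ^ 4) = \<epsilon> * (loop_k \<epsilon> - \<epsilon>)"
  using loop_k_graph[of \<epsilon>] bstar_eq_loop_graph[OF assms] assms by auto

section \<open>Analyticity\<close>

text \<open>Real analyticity is obtained through holomorphic extensions, which are stable under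
  quotients and composition; here the real parts of the coefficients are taken.\<close>

lemma real_expansion_of_analytic:
  assumes "f analytic_on {complex_of_real x}"
  shows "\<exists>F. (\<lambda>h. Re (f (complex_of_real (x + h)))) has_fps_expansion F"
proof -
  define G where "G = fps_expansion f (of_real x)"
  have G: "(\<lambda>h. f (of_real x + h)) has_fps_expansion G"
    unfolding G_def by (rule analytic_at_imp_has_fps_expansion[OF assms])
  then have c: "0 < fps_conv_radius G" and "\<forall>\<^sub>F z in nhds 0. eval_fps G z = f (of_real x + z)"
    unfolding has_fps_expansion_def by auto
  then have "\<forall>\<^sub>F z in nhds 0. ereal (norm z) < fps_conv_radius G \<and> eval_fps G z = f (of_real x + z)"
    using c eventually_nhds_in_open[of "eball 0 (fps_conv_radius G)" 0] by (auto simp: zero_ereal_def[symmetric] elim: eventually_elim2)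
  then obtain e where e: "0 < e" "\<And>z. dist z 0 < e \<Longrightarrow> ereal (norm z) < fps_conv_radius G \<and> eval_fps G z = f (of_real x + z)"
    unfolding eventually_nhds_metric by blast
  have "(\<lambda>h. Re (f (complex_of_real (x + h)))) has_fps_expansion Abs_fps (\<lambda>n. Re (fps_nth G n))"
  proof (rule has_fps_expansionI)
    have "(\<lambda>n. fps_nth (Abs_fps (\<lambda>n. Re (fps_nth G n))) n * h ^ n) sums Re (f (complex_of_real (x + h)))" if "dist h 0 < e" for h :: real
    proof -
      have "dist (complex_of_real h) 0 < e" using that by simp
      note e2 = e(2)[OF this]
      have "(\<lambda>n. fps_nth G n * of_real h ^ n) sums f (of_real x + of_real h)"
        using sums_eval_fps[of "of_real h" G] e2 by simp
      from sums_Re[OF this] show ?thesis by (simp flip: of_real_power)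
    qed
    then show "\<forall>\<^sub>F h in nhds 0. (\<lambda>n. fps_nth (Abs_fps (\<lambda>n. Re (fps_nth G n))) n * h ^ n) sums Re (f (complex_of_real (x + h)))"
      unfolding eventually_nhds_metric using e(1) by blast
  qed
  then show ?thesis by blast
qed

lemma complex_power_series:
  fixes a :: "nat \<Rightarrow> real"
  assumes "0 < \<delta>" "\<delta> * r \<le> 1 / 2" "0 < r" "\<And>j. \<bar>a j\<bar> \<le> N * r ^ j"
  defines "F \<equiv> eval_fps (Abs_fps (\<lambda>j. complex_of_real (a j)))"
  shows "F holomorphic_on ball 0 \<delta>" "\<And>x. \<bar>x\<bar> < \<delta> \<Longrightarrow> F (of_real x) = of_real (\<Sum>j. x ^ j * a j)" "F 0 = of_real (a 0)"
proof -
  have sm: "summable (\<lambda>j. norm (a j * x ^ j))" if "\<bar>x\<bar> \<le> \<delta>" for x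
  proof (rule summable_comparison_test')
    show "summable (\<lambda>j. N * (1 / 2) ^ j)" by (intro summable_mult summable_geometric) auto
    fix j :: nat
    have N: "0 \<le> N * r ^ j" using assms(4)[of j] by linarith
    have "\<bar>x\<bar> * r \<le> \<delta> * r" using that assms by (intro mult_right_mono) auto
    then have "\<bar>x\<bar> * r \<le> 1 / 2" using assms(2) by linarith
    then have "(\<bar>x\<bar> * r) ^ j \<le> (1 / 2) ^ j" using assms by (intro power_mono) auto
    moreover have "0 \<le> N" using assms(4)[of 0] by simp
    ultimately have "N * (\<bar>x\<bar> * r) ^ j \<le> N * (1 / 2) ^ j" by (rule mult_left_mono)
    moreover have "\<bar>a j\<bar> * \<bar>x\<bar> ^ j \<le> (N * r ^ j) * \<bar>x\<bar> ^ j" using assms(4) by (intro mult_right_mono) auto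
    ultimately show "norm (norm (a j * x ^ j)) \<le> N * (1 / 2) ^ j"
      by (simp add: abs_mult power_abs power_mult_distrib mult_ac)
  qed
  have "summable (\<lambda>j. complex_of_real (a j) * of_real \<delta> ^ j)"
    by (rule summable_norm_cancel) (use sm[of \<delta>] assms(1) in \<open>simp add: norm_mult norm_power abs_mult power_abs\<close>)
  from conv_radius_geI[OF this] have c: "ereal \<delta> \<le> fps_conv_radius (Abs_fps (\<lambda>j. complex_of_real (a j)))"
    using assms(1) unfolding fps_conv_radius_def by simp
  then have "ball 0 \<delta> \<subseteq> eball 0 (fps_conv_radius (Abs_fps (\<lambda>j. complex_of_real (a j))))"
    by (rule ball_eball_mono)
  then show "F holomorphic_on ball 0 \<delta>" unfolding F_def by (intro holomorphic_on_eval_fps)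
  show "F (of_real x) = of_real (\<Sum>j. x ^ j * a j)" if "\<bar>x\<bar> < \<delta>" for x
  proof -
    have "summable (\<lambda>j. x ^ j * a j)" using summable_norm_cancel[OF sm[of x]] that by (simp add: mult.commute)
    from sums_of_real[OF summable_sums[OF this], where 'a = complex]
    show ?thesis unfolding F_def eval_fps_def by (simp add: sums_iff mult.commute)
  qed
  show "F 0 = of_real (a 0)" unfolding F_def by (simp add: eval_fps_at_0)
qed

text \<open>\<open>k = K / R\<close> is a quotient of two series that converge on a complex disc. As
  \<open>R\<close> is nonzero at the centre, a smaller disc avoids zeros of the denominator.\<close>

lemma loop_k_holomorphic:
  assumes "wloop d \<epsilon> R K"
  shows "\<exists>\<delta> q. 0 < \<delta> \<and> q holomorphic_on ball 0 \<delta> \<and>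
    (\<forall>x. \<bar>x\<bar> < \<delta> \<longrightarrow> (\<exists>d R K. wloop d (\<epsilon> + x) R K) \<and> q (complex_of_real x) = of_real (loop_k (\<epsilon> + x)))"
proof (rule wloop_continuation[OF assms])
  fix \<delta> r N d' \<rho> k
  assume \<delta>: "0 < \<delta>" and r: "0 < r" and \<delta>r: "\<delta> * r \<le> 1 / 2" and 0: "\<rho> 0 = R" "k 0 = K"
    and b: "\<And>j. \<bar>\<rho> j\<bar> \<le> N * r ^ j" "\<And>j. \<bar>k j\<bar> \<le> N * r ^ j"
    and w: "\<And>x. \<bar>x\<bar> \<le> \<delta> \<Longrightarrow> wloop d' (\<epsilon> + x) (\<Sum>j. x ^ j * \<rho> j) (\<Sum>j. x ^ j * k j)"
  define P where "P = eval_fps (Abs_fps (\<lambda>j. complex_of_real (k j)))"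
  define Q where "Q = eval_fps (Abs_fps (\<lambda>j. complex_of_real (\<rho> j)))"
  note P = complex_power_series[OF \<delta> \<delta>r r b(2), folded P_def]
  note Q = complex_power_series[OF \<delta> \<delta>r r b(1), folded Q_def]
  have "0 < R" using assms wbranchD(2) unfolding wloop_def by blast
  then have Q0: "Q 0 \<noteq> 0" unfolding Q(3) 0 by simp
  have "isCont Q 0" using holomorphic_on_imp_continuous_on[OF Q(1)] \<delta> by (simp add: continuous_on_eq_continuous_at)
  from continuous_at_avoid[OF this Q0] obtain e where e: "0 < e" "\<And>z. dist 0 z < e \<Longrightarrow> Q z \<noteq> 0" by blast
  define \<delta>' where "\<delta>' = min \<delta> e"
  have \<delta>': "0 < \<delta>'" "\<delta>' \<le> \<delta>" "\<delta>' \<le> e" unfolding \<delta>'_def using \<delta> e by auto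
  show ?thesis
  proof (rule exI[of _ \<delta>'], rule exI[of _ "\<lambda>z. P z / Q z"], intro conjI allI impI)
    show "0 < \<delta>'" by (rule \<delta>')
    show "(\<lambda>z. P z / Q z) holomorphic_on ball 0 \<delta>'"
      using e(2) \<delta>' by (intro holomorphic_on_divide holomorphic_on_subset[OF P(1)] holomorphic_on_subset[OF Q(1)] subset_ball) auto
    fix x :: real assume x: "\<bar>x\<bar> < \<delta>'"
    then have x2: "\<bar>x\<bar> \<le> \<delta>" "\<bar>x\<bar> < \<delta>" using \<delta>' by auto
    show "\<exists>d R K. wloop d (\<epsilon> + x) R K" using w[OF x2(1)] by blast
    show "P (complex_of_real x) / Q (complex_of_real x) = of_real (loop_k (\<epsilon> + x))"
      unfolding loop_k_eq[OF w[OF x2(1)]] P(2)[OF x2(2)] Q(2)[OF x2(2)] by simp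
  qed
qed

text \<open>Averaging the power series at \<open>x\<close> and \<open>- x\<close> removes the odd
  terms and leaves a series in \<open>x^2\<close>.\<close>

lemma even_holomorphic_square:
  assumes hol: "\<phi> holomorphic_on ball 0 \<delta>" and \<delta>: "0 < \<delta>"
    and even: "\<And>x. \<bar>x\<bar> < \<delta> \<Longrightarrow> \<phi> (complex_of_real (- x)) = \<phi> (of_real x)"
  shows "\<exists>\<eta>>0. \<exists>G. G holomorphic_on ball 0 \<eta> \<and> (\<forall>s. 0 \<le> s \<longrightarrow> s < \<eta> \<longrightarrow> G (complex_of_real s) = \<phi> (of_real (sqrt s)))"
proof -
  define A where "A = (\<lambda>n. (deriv ^^ n) \<phi> 0 / fact n)"
  have A: "(\<lambda>n. A n * of_real x ^ n) sums \<phi> (of_real x)" if "\<bar>x\<bar> < \<delta>" for x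
    using holomorphic_power_series[OF hol, of "of_real x"] that unfolding A_def by simp
  have B: "(\<lambda>n. A (2 * n) * of_real (x\<^sup>2) ^ n) sums \<phi> (of_real x)" if x: "\<bar>x\<bar> < \<delta>" for x
  proof -
    have "\<bar>- x\<bar> < \<delta>" using x by simp
    from sums_add[OF A[OF x] A[OF this]]
    have "(\<lambda>n. A n * of_real x ^ n + A n * of_real (- x) ^ n) sums (\<phi> (of_real x) + \<phi> (of_real x))" unfolding even[OF x] .
    from sums_divide[OF this, of 2]
    have s: "(\<lambda>n. (A n * of_real x ^ n + A n * of_real (- x) ^ n) / 2) sums \<phi> (of_real x)" by simp
    have "(\<lambda>n. (A (2 * n) * of_real x ^ (2 * n) + A (2 * n) * of_real (- x) ^ (2 * n)) / 2) sums \<phi> (of_real x)"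
    proof (rule sums_mono_reindex[THEN iffD2, OF _ _ s])
      show "strict_mono (\<lambda>n::nat. 2 * n)" by (simp add: strict_mono_def)
      fix n :: nat assume "n \<notin> range (\<lambda>n. 2 * n)"
      then have "odd n" by (auto elim: evenE)
      then show "(A n * of_real x ^ n + A n * of_real (- x) ^ n) / 2 = 0" by (simp add: power_minus_odd)
    qed
    then show ?thesis by (simp add: power_mult)
  qed
  define \<eta> where "\<eta> = (\<delta> / 2)\<^sup>2"
  have \<eta>: "0 < \<eta>" unfolding \<eta>_def using \<delta> by simp
  define G where "G = eval_fps (Abs_fps (\<lambda>n. A (2 * n)))"
  have "summable (\<lambda>n. A (2 * n) * complex_of_real \<eta> ^ n)"
    using B[of "\<delta> / 2"] \<delta> unfolding \<eta>_def by (auto simp: sums_iff)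
  from conv_radius_geI[OF this] have c: "ereal \<eta> \<le> fps_conv_radius (Abs_fps (\<lambda>n. A (2 * n)))"
    using \<eta> unfolding fps_conv_radius_def by simp
  then have "ball 0 \<eta> \<subseteq> eball 0 (fps_conv_radius (Abs_fps (\<lambda>n. A (2 * n))))"
    by (rule ball_eball_mono)
  then have "G holomorphic_on ball 0 \<eta>" unfolding G_def by (intro holomorphic_on_eval_fps)
  moreover have "G (complex_of_real s) = \<phi> (of_real (sqrt s))" if s: "0 \<le> s" "s < \<eta>" for s
  proof -
    have "sqrt s < \<delta> / 2" using s \<delta> real_sqrt_less_mono[OF s(2)] unfolding \<eta>_def by simp
    then have "\<bar>sqrt s\<bar> < \<delta>" using s \<delta> by simp
    from B[OF this] show ?thesis unfolding G_def eval_fps_def using s by (simp add: sums_iff)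
  qed
  ultimately show ?thesis using \<eta> by blast
qed

text \<open>At positive arguments the function is a composition with an analytic square root. At 0
  the square root is singular, and analyticity is due to the parity of \<open>loop_k\<close>: the
  function \<open>x * loop_k x - x^2\<close> is even.\<close>

theorem loop_function_analytic:
  "analytic_restriction_on (\<lambda>s. sqrt s * loop_k (sqrt s) - s) {0..}"
proof -
  define H where "H = (\<lambda>s. sqrt s * loop_k (sqrt s) - s)"
  obtain d R K where "wloop d 0 R K" using wloop_exists[of 0] by auto
  from loop_k_holomorphic[OF this] obtain \<delta> q where \<delta>: "0 < \<delta>" and q: "q holomorphic_on ball 0 \<delta>"
    and qx: "\<And>x. \<bar>x\<bar> < \<delta> \<Longrightarrow> (\<exists>d R K. wloop d x R K) \<and> q (complex_of_real x) = of_real (loop_k x)" by auto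
  define \<phi> where "\<phi> = (\<lambda>z. z * q z - z\<^sup>2)"
  have \<phi>: "\<phi> holomorphic_on ball 0 \<delta>" unfolding \<phi>_def by (intro holomorphic_intros q)
  have "\<phi> (complex_of_real (- x)) = \<phi> (of_real x)" if x: "\<bar>x\<bar> < \<delta>" for x
  proof -
    have "loop_k (- x) = - loop_k x" using loop_k_minus qx[OF x] by blast
    moreover have "\<bar>- x\<bar> < \<delta>" using x by simp
    ultimately have "q (complex_of_real (- x)) = - q (of_real x)" using qx[OF x] qx[of "- x"] by (simp del: of_real_minus)
    then show ?thesis unfolding \<phi>_def by simp
  qed
  from even_holomorphic_square[OF \<phi> \<delta> this] obtain \<eta>' G where
    G': "0 < \<eta>'" "G holomorphic_on ball 0 \<eta>'" "\<And>s. 0 \<le> s \<Longrightarrow> s < \<eta>' \<Longrightarrow> G (complex_of_real s) = \<phi> (of_real (sqrt s))" by blast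
  define \<eta> where "\<eta> = min \<eta>' (\<delta>\<^sup>2)"
  have \<eta>: "0 < \<eta>" "\<eta> \<le> \<eta>'" "\<eta> \<le> \<delta>\<^sup>2" unfolding \<eta>_def using G' \<delta> by auto
  have GH: "Re (G (complex_of_real s)) = H s" if s: "0 \<le> s" "s < \<eta>" for s
  proof -
    have "sqrt s < \<delta>" using s \<eta> \<delta> by (intro real_less_lsqrt) auto
    then have "\<bar>sqrt s\<bar> < \<delta>" using s by simp
    from qx[OF this] have "q (complex_of_real (sqrt s)) = of_real (loop_k (sqrt s))" by simp
    moreover have "(complex_of_real (sqrt s))\<^sup>2 = of_real s" using s by (simp flip: of_real_power)
    ultimately show ?thesis using G'(3)[of s] s \<eta> unfolding H_def \<phi>_def by simp
  qed
  \<comment> \<open>Left of \<open>\<eta>\<close>, and in particular at negative arguments, the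
    values come from the holomorphic \<open>G\<close>; on \<open>[0, \<eta>)\<close> both formulas
    agree.\<close>
  define g where "g = (\<lambda>s. if s < \<eta> then Re (G (complex_of_real s)) else H s)"
  have g_eq: "g s = H s" if "0 \<le> s" for s unfolding g_def using GH that by auto
  have "real_analytic_on g {-\<eta><..}"
    unfolding real_analytic_on_def
  proof
    fix x assume x: "x \<in> {-\<eta><..}"
    show "\<exists>F. (\<lambda>h. g (x + h)) has_fps_expansion F"
    proof (cases "x < \<eta>")
      case True
      then have "complex_of_real x \<in> ball 0 \<eta>'" using x \<eta> by (simp add: abs_less_iff)
      then have "G analytic_on {complex_of_real x}"
        using G'(2) by (intro analytic_at[THEN iffD2] exI[of _ "ball 0 \<eta>'"]) auto
      from real_expansion_of_analytic[OF this] obtain F where F: "(\<lambda>h. Re (G (complex_of_real (x + h)))) has_fps_expansion F" by blast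
      have "\<forall>\<^sub>F h in nhds 0. Re (G (complex_of_real (x + h))) = g (x + h)"
        unfolding eventually_nhds_metric g_def by (rule exI[of _ "\<eta> - x"]) (use True in \<open>auto simp: dist_real_def\<close>)
      from has_fps_expansion_cong[OF this refl] show ?thesis using F by blast
    next
      case False
      define e where "e = sqrt x"
      have x0: "0 < x" using False \<eta> by simp
      then have e: "0 < e" "e\<^sup>2 = x" unfolding e_def by auto
      obtain d R K where "wloop d e R K" using wloop_exists[of e] e by auto
      from loop_k_holomorphic[OF this] obtain \<mu> p where \<mu>: "0 < \<mu>" and p: "p holomorphic_on ball 0 \<mu>"
        and px: "\<And>x. \<bar>x\<bar> < \<mu> \<Longrightarrow> p (complex_of_real x) = of_real (loop_k (e + x))" by blast
      \<comment> \<open>A complex extension near \<open>x > 0\<close>: \<open>csqrt\<close> is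
        analytic off the nonpositive real axis, and \<open>p\<close> continues \<open>loop_k\<close>
        around \<open>e = sqrt x\<close>.\<close>
      define f where "f = (\<lambda>z. csqrt z * p (csqrt z - of_real e) - z)"
      have cx: "csqrt (complex_of_real s) = of_real (sqrt s)" if "0 \<le> s" for s using that by simp
      have nn: "complex_of_real x \<notin> \<real>\<^sub>\<le>\<^sub>0" using x0 by (simp add: complex_nonpos_Reals_iff)
      have c: "csqrt analytic_on {complex_of_real x}" using analytic_on_subset[OF analytic_on_csqrt] nn by blast
      have "p analytic_on (\<lambda>z. csqrt z - of_real e) ` {complex_of_real x}"
        using p \<mu> x0 by (auto simp: cx e_def intro!: analytic_at[THEN iffD2] exI[of _ "ball 0 \<mu>"])
      then have "(p \<circ> (\<lambda>z. csqrt z - of_real e)) analytic_on {complex_of_real x}"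
        by (intro analytic_on_compose analytic_intros c)
      then have "f analytic_on {complex_of_real x}" unfolding f_def comp_def by (intro analytic_on_diff analytic_on_mult c analytic_on_ident)
      from real_expansion_of_analytic[OF this] obtain F where F: "(\<lambda>h. Re (f (complex_of_real (x + h)))) has_fps_expansion F" by blast
      have "((\<lambda>h. sqrt (x + h) - e) \<longlongrightarrow> sqrt (x + 0) - e) (nhds 0)"
        by (intro tendsto_intros filterlim_ident)
      then have "\<forall>\<^sub>F h in nhds 0. dist (sqrt (x + h) - e) (sqrt (x + 0) - e) < \<mu>" using \<mu> tendstoD by blast
      moreover have "\<forall>\<^sub>F h in nhds 0. 0 < x + h" using x0
        unfolding eventually_nhds_metric by (intro exI[of _ x]) (auto simp: dist_real_def)
      ultimately have "\<forall>\<^sub>F h in nhds 0. Re (f (complex_of_real (x + h))) = g (x + h)"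
      proof eventually_elim
        case (elim h)
        have "\<bar>sqrt (x + h) - e\<bar> < \<mu>" using elim(1) by (simp add: dist_real_def e_def)
        from px[OF this] have "p (complex_of_real (sqrt (x + h) - e)) = of_real (loop_k (sqrt (x + h)))" by simp
        moreover have "f (complex_of_real (x + h)) = of_real (sqrt (x + h)) * p (complex_of_real (sqrt (x + h) - e)) - of_real (x + h)"
          unfolding f_def cx[OF less_imp_le[OF elim(2)]] by simp
        ultimately show ?case using elim(2) g_eq[of "x + h"] unfolding H_def by simp
      qed
      from has_fps_expansion_cong[OF this refl] show ?thesis using F by blast
    qed
  qed
  then show ?thesis unfolding analytic_restriction_on_def H_def[symmetric]
    using g_eq \<eta>(1) by (intro exI[of _ "{-\<eta><..}"] exI[of _ g]) auto
qed

section \<open>Polynomial barriers\<close>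

text \<open>
  For the closed curve \<open>Y = sqrt 2 * w * (1 - w^2) * \<theta> w\<close>, \<open>u = B * (1 - w^2)\<close>, \<open>-1 < w < 1\<close>, with
  \<open>B = 2 + s^2\<close> and \<open>\<theta> w = B * s + w * p w\<close>, the sign of this polynomial decides in which direction
  the orbits for \<open>\<epsilon> = e / sqrt 2\<close> and the damping \<open>k / sqrt 2\<close> cross the curve. The value \<open>\<theta> 0 = B * s\<close> is
  forced by smoothness at the turning point; it allows one to divide by \<open>w\<close>.
\<close>
definition barrier_residual :: "real \<Rightarrow> real \<Rightarrow> real \<Rightarrow> real \<Rightarrow> real \<Rightarrow> real \<Rightarrow> real" where
  "barrier_residual s e k w p p' =
     p * (2 * ((2 + s\<^sup>2) * s) + w * p) - 3 * w * ((2 + s\<^sup>2) * s + w * p)\<^sup>2 + (1 - w\<^sup>2) * ((2 + s\<^sup>2) * s + w * p) * (p + w * p')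
       + (2 + s\<^sup>2) ^ 3 * w - (2 + s\<^sup>2) * (k - e * (2 + s\<^sup>2) * (1 - w\<^sup>2)) * ((2 + s\<^sup>2) * s + w * p)"

text \<open>Time reversal exchanges the two halves of the curve, that is \<open>w\<close> and
  \<open>- w\<close>, and reverses the direction of crossing.\<close>

lemma barrier_residual_uminus:
  "barrier_residual s (- e) (- k) (- w) (- p) p' = - barrier_residual s e k w p p'"
  unfolding barrier_residual_def by (simp add: algebra_simps)

text \<open>The residual is affine in the damping, with slope \<open>- B * \<theta> w\<close>. A
  small residual of either sign is therefore overcome by a small change of \<open>k\<close>, and
  this bounds the error of an approximate value.\<close>

lemma barrier_residual_shift:
  "barrier_residual s e (k + x) w p p' = barrier_residual s e k w p p' - (2 + s\<^sup>2) * x * ((2 + s\<^sup>2) * s + w * p)"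
  unfolding barrier_residual_def by (simp add: algebra_simps)

text \<open>The terms without a factor \<open>v\<close> cancel because of \<open>B = 2 + s^2\<close>
  and the value \<open>B * s\<close> at the turning point:
  \<open>B^2 * (2 - B * (1 - v^2)) = - (B * s)^2 + B^3 * v^2\<close>. After division by
  \<open>v\<close> the crossing condition is a polynomial over a positive factor when
  \<open>t > 0\<close>. The number \<open>r\<close> is \<open>sqrt 2\<close>.\<close>

lemma barrier_residual_eq:
  fixes r v s t B p p' k \<epsilon> :: real
  assumes "0 < r" "r * r = 2" "v \<noteq> 0" "1 - v\<^sup>2 \<noteq> 0" and B: "B = 2 + s\<^sup>2" and t: "t = B * s + v * p" "t \<noteq> 0"
  shows "r * ((1 - 3 * v\<^sup>2) * t + v * (1 - v\<^sup>2) * (p + v * p')) / (2 * B * v) + B * (1 - v\<^sup>2) * (2 - B * (1 - v\<^sup>2)) / (r * v * (1 - v\<^sup>2) * t) - (k - \<epsilon> * (B * (1 - v\<^sup>2)))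
    = barrier_residual s (r * \<epsilon>) (r * k) v p p' / (r * B * t)"
proof -
  have B0: "0 < B" unfolding B by (simp add: add_pos_nonneg)
  define U where "U = 1 - v\<^sup>2"
  have U0: "U \<noteq> 0" using assms(4) unfolding U_def by simp
  have 1: "r * ((1 - 3 * v\<^sup>2) * t + v * U * (p + v * p')) / (2 * B * v) = ((1 - 3 * v\<^sup>2) * t\<^sup>2 / v + U * t * (p + v * p')) / (r * B * t)"
  proof -
    have "r * (a * t + v * U * x) / ((r * r) * B * v) = (a * t\<^sup>2 / v + U * t * x) / (r * B * t)" for a x
      using assms(1,3) t(2) B0 by (simp add: field_simps power2_eq_square)
    then show ?thesis using assms(2) by simp
  qed
  have 2: "B * U * (2 - B * U) / (r * v * U * t) = B\<^sup>2 * (2 - B * U) / v / (r * B * t)"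
  proof -
    have "B * U * x / (r * v * U * t) = B\<^sup>2 * x / v / (r * B * t)" for x
      using assms(1,3) t(2) B0 U0 by (simp add: field_simps power2_eq_square)
    then show ?thesis by simp
  qed
  have 3: "k - \<epsilon> * (B * U) = r * B * t * (k - \<epsilon> * (B * U)) / (r * B * t)" using assms(1) t(2) B0 by simp
  have "(1 - 3 * v\<^sup>2) * t\<^sup>2 + B\<^sup>2 * (2 - B * U) = v * (p * (2 * (B * s) + v * p) - 3 * v * t\<^sup>2 + B ^ 3 * v)"
  proof -
    have "B\<^sup>2 * (2 - B * U) = - (B * s)\<^sup>2 + B ^ 3 * v\<^sup>2"
      unfolding U_def B by (simp add: algebra_simps power2_eq_square power3_eq_cube)
    then show ?thesis unfolding t by (simp add: algebra_simps power2_eq_square)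
  qed
  then have "((1 - 3 * v\<^sup>2) * t\<^sup>2 + B\<^sup>2 * (2 - B * U)) / v = p * (2 * (B * s) + v * p) - 3 * v * t\<^sup>2 + B ^ 3 * v"
    using assms(3) by simp
  then have 4: "(1 - 3 * v\<^sup>2) * t\<^sup>2 / v + U * t * (p + v * p') + B\<^sup>2 * (2 - B * U) / v - r * B * t * (k - \<epsilon> * (B * U)) =
    barrier_residual s (r * \<epsilon>) (r * k) v p p'"
    unfolding barrier_residual_def B[symmetric] t(1)[symmetric] U_def[symmetric] add_divide_distrib
    by (simp add: algebra_simps)
  show ?thesis unfolding U_def[symmetric] 1 2 4[symmetric]
    by (subst 3) (simp only: add_divide_distrib diff_divide_distrib)
qed

text \<open>If \<open>sqrt 2 * k \<le> \<kappa>\<close>, then the residual at the true damping is at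
  least as large and hence positive, and the two halves of the curve form a closed barrier, which no
  loop admits.\<close>

lemma loop_barrier:
  assumes lg: "loop_graph \<epsilon> k B0 f g" and s: "0 < s"
    and \<Phi>: "\<And>w. \<bar>w\<bar> \<le> 1 \<Longrightarrow> (\<Phi> has_real_derivative \<Phi>' w) (at w)"
    and \<theta>: "\<And>w. \<bar>w\<bar> < 1 \<Longrightarrow> 0 < (2 + s\<^sup>2) * s + w * \<Phi> w"
    and res: "\<And>w. w \<noteq> 0 \<Longrightarrow> \<bar>w\<bar> < 1 \<Longrightarrow> 0 < barrier_residual s (sqrt 2 * \<epsilon>) \<kappa> w (\<Phi> w) (\<Phi>' w)"
  shows "\<kappa> < sqrt 2 * k"
proof (rule ccontr)
  assume "\<not> ?thesis"
  then have k: "sqrt 2 * k \<le> \<kappa>" by simp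
  define B where "B = 2 + s\<^sup>2"
  have B: "0 < B" unfolding B_def by (simp add: add_pos_nonneg)
  define t where "t = (\<lambda>w. B * s + w * \<Phi> w)"
  define y where "y = (\<lambda>w. sqrt 2 * w * (1 - w\<^sup>2) * t w)"
  define y' where "y' = (\<lambda>w. sqrt 2 * ((1 - 3 * w\<^sup>2) * t w + w * (1 - w\<^sup>2) * (\<Phi> w + w * \<Phi>' w)))"
  define W where "W = (\<lambda>u. sqrt (1 - u / B))"
  have y_der: "(y has_real_derivative y' w) (at w)" if "\<bar>w\<bar> \<le> 1" for w
    unfolding y_def y'_def t_def using \<Phi>[OF that]
    by (auto intro!: derivative_eq_intros simp: algebra_simps power2_eq_square)
  have W: "0 < W u" "W u < 1" "(W u)\<^sup>2 = 1 - u / B" if "u \<in> {0<..<B}" for u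
    using that B unfolding W_def by (auto simp: field_simps)
  have W_der: "(W has_real_derivative - 1 / (2 * B * W u)) (at u)" if "u \<in> {0<..<B}" for u
    using W[OF that] B that unfolding W_def
    by (auto intro!: derivative_eq_intros simp: field_simps)
  \<comment> \<open>\<open>\<sigma> = 1\<close> gives the upper half of the curve and
    \<open>\<sigma> = -1\<close> the lower half reflected to positive values; a single inequality in
    \<open>\<sigma> * W u\<close> covers both.\<close>
  define h where "h = (\<lambda>\<sigma> u. \<sigma> * y (\<sigma> * W u))"
  define E where "E = (\<lambda>\<sigma> u. - (\<sigma> * (y' (\<sigma> * W u) / (2 * B * (\<sigma> * W u)))))"
  have h_pos: "0 < h \<sigma> u" and h_der: "(h \<sigma> has_real_derivative E \<sigma> u) (at u)"
    and h_less: "\<sigma> * E \<sigma> u < u * (2 - u) / (\<sigma> * h \<sigma> u) - (k - \<epsilon> * u)"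
    if u: "u \<in> {0<..<B}" and \<sigma>: "\<sigma> * \<sigma> = 1" for \<sigma> u
  proof -
    define v where "v = \<sigma> * W u"
    have \<sigma>1: "\<bar>\<sigma>\<bar> = 1" using \<sigma> by (metis abs_1 abs_mult_self_eq abs_mult mult_eq_1 power2_eq_1_iff power2_eq_square abs_square_eq_1)
    then have \<sigma>0: "\<sigma> \<noteq> 0" by auto
    have v2: "v\<^sup>2 = 1 - u / B" using W(3)[OF u] \<sigma> unfolding v_def by (simp add: power_mult_distrib power2_eq_square[of \<sigma>])
    have v: "v \<noteq> 0" "\<bar>v\<bar> < 1" "1 - v\<^sup>2 = u / B" "0 < 1 - v\<^sup>2"
      using W(1,2)[OF u] v2 \<sigma>1 \<sigma>0 u B unfolding v_def by (auto simp: abs_mult)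
    have \<sigma>v: "\<sigma> * v = W u" unfolding v_def using \<sigma> by (simp add: mult.assoc[symmetric])
    have t: "0 < t v" unfolding t_def B_def by (rule \<theta>[OF v(2)])
    have h: "h \<sigma> u = sqrt 2 * W u * (1 - v\<^sup>2) * t v"
      using \<sigma>v unfolding h_def y_def v_def[symmetric] by (metis mult.assoc mult.commute)
    show "0 < h \<sigma> u" unfolding h using W(1)[OF u] t v(4) by simp
    have "((\<lambda>u. \<sigma> * W u) has_real_derivative \<sigma> * (- 1 / (2 * B * W u))) (at u)" by (intro DERIV_cmult W_der[OF u])
    from DERIV_chain2[where g = "\<lambda>u. \<sigma> * W u" and f = y, OF y_der[of "\<sigma> * W u"] this]
    have "((\<lambda>u. y (\<sigma> * W u)) has_real_derivative y' v * (\<sigma> * (- 1 / (2 * B * W u)))) (at u)"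
      using v(2) unfolding v_def by simp
    from DERIV_cmult[OF this, of \<sigma>]
    have "(h \<sigma> has_real_derivative \<sigma> * (y' v * (\<sigma> * (- 1 / (2 * B * W u))))) (at u)" unfolding h_def .
    moreover have "\<sigma> * (y' v * (\<sigma> * (- 1 / (2 * B * W u)))) = E \<sigma> u"
    proof -
      have "\<sigma> * (z / (2 * B * (\<sigma> * W u))) = z / (2 * B * W u)" for z using \<sigma>0 by simp
      moreover have "\<sigma> * (z * (\<sigma> * x)) = z * x" for z x
        using \<sigma> by (metis mult.assoc mult.commute mult_1)
      ultimately show ?thesis unfolding E_def v_def[symmetric] by (simp add: v_def[symmetric])
    qed
    ultimately show "(h \<sigma> has_real_derivative E \<sigma> u) (at u)" by simp
    have uB: "B * (1 - v\<^sup>2) = u" using v(3) B by simp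
    have eq: "y' v / (2 * B * v) + u * (2 - u) / (sqrt 2 * v * (1 - v\<^sup>2) * t v) - (k - \<epsilon> * u) =
        barrier_residual s (sqrt 2 * \<epsilon>) (sqrt 2 * k) v (\<Phi> v) (\<Phi>' v) / (sqrt 2 * B * t v)"
      unfolding y'_def using v(4) less_imp_neq[OF t, symmetric]
      by (intro barrier_residual_eq[of "sqrt 2" v B s "t v" "\<Phi> v" "\<Phi>' v" k \<epsilon>, unfolded uB] v(1) B_def)
        (auto simp: t_def)
    have "0 < barrier_residual s (sqrt 2 * \<epsilon>) \<kappa> v (\<Phi> v) (\<Phi>' v)" using res v by blast
    also have "\<dots> \<le> barrier_residual s (sqrt 2 * \<epsilon>) (sqrt 2 * k) v (\<Phi> v) (\<Phi>' v)"
    proof -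
      have "0 \<le> (2 + s\<^sup>2) * (\<kappa> - sqrt 2 * k) * ((2 + s\<^sup>2) * s + v * \<Phi> v)"
        using k B t unfolding B_def[symmetric] t_def by simp
      then show ?thesis using barrier_residual_shift[of s "sqrt 2 * \<epsilon>" "sqrt 2 * k" "\<kappa> - sqrt 2 * k" v "\<Phi> v" "\<Phi>' v"] by simp
    qed
    finally have "0 < barrier_residual s (sqrt 2 * \<epsilon>) (sqrt 2 * k) v (\<Phi> v) (\<Phi>' v) / (sqrt 2 * B * t v)"
      using B t by simp
    then have "- (y' v / (2 * B * v)) < u * (2 - u) / (sqrt 2 * v * (1 - v\<^sup>2) * t v) - (k - \<epsilon> * u)"
      unfolding eq[symmetric] by linarith
    moreover have "\<sigma> * E \<sigma> u = - (y' v / (2 * B * v))"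
      unfolding E_def v_def[symmetric] using \<sigma> by (simp add: mult.assoc[symmetric])
    moreover have "\<sigma> * h \<sigma> u = sqrt 2 * v * (1 - v\<^sup>2) * t v"
      unfolding h v_def by (simp add: mult_ac)
    ultimately show "\<sigma> * E \<sigma> u < u * (2 - u) / (\<sigma> * h \<sigma> u) - (k - \<epsilon> * u)" by simp
  qed
  have Wc: "isCont W u" for u unfolding W_def by (intro continuous_intros) (use B in auto)
  have hc: "isCont (h \<sigma>) u" if "u \<in> {0, B}" "\<bar>\<sigma>\<bar> = 1" for \<sigma> u
  proof -
    have "\<bar>\<sigma> * W u\<bar> \<le> 1" using that B by (auto simp: W_def abs_mult)
    from DERIV_isCont[OF y_der[OF this]] have "isCont (\<lambda>u. y (\<sigma> * W u)) u"
      by (rule isCont_o2[rotated]) (intro continuous_intros Wc)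
    then show ?thesis unfolding h_def by (intro continuous_intros)
  qed
  have h0: "h \<sigma> 0 = 0" "h \<sigma> B = 0" if "\<bar>\<sigma>\<bar> = 1" for \<sigma>
    using that B unfolding h_def y_def W_def by (auto simp: power_mult_distrib abs_if split: if_splits)
  have lim: "(h \<sigma> \<longlongrightarrow> 0) (at_right 0)" "(h \<sigma> \<longlongrightarrow> 0) (at_left B)" if "\<bar>\<sigma>\<bar> = 1" for \<sigma>
    using hc[of 0 \<sigma>] hc[of B \<sigma>] h0[OF that] that unfolding isCont_def
    by (auto intro: filterlim_mono[OF _ order_refl at_le])
  have c1: "0 < h 1 u \<and> (h 1 has_real_derivative E 1 u) (at u) \<and> E 1 u < u * (2 - u) / h 1 u - (k - \<epsilon> * u)" if "u \<in> {0<..<B}" for u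
    using h_pos[OF that, of 1] h_der[OF that, of 1] h_less[OF that, of 1] by simp
  have c2: "0 < h (-1) u \<and> (h (-1) has_real_derivative E (-1) u) (at u) \<and> u * (2 - u) / h (-1) u + (k - \<epsilon> * u) < E (-1) u" if "u \<in> {0<..<B}" for u
    using h_pos[OF that, of "-1"] h_der[OF that, of "-1"] h_less[OF that, of "-1"] by simp
  show False
    by (rule no_loop_if_barrier[OF lg c1 lim c2 lim B]) auto
qed

text \<open>The same approximate curve yields both bounds: the damping is lowered by
  \<open>\<eta>\<close> for one of them and, after time reversal, raised by \<open>\<eta>\<close>
  for the other.\<close>

lemma loop_barrier_abs:
  assumes lg: "loop_graph \<epsilon> k B0 f g" and s: "0 < s"
    and \<Phi>: "\<And>w. \<bar>w\<bar> \<le> 1 \<Longrightarrow> (\<Phi> has_real_derivative \<Phi>' w) (at w)"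
    and \<theta>: "\<And>w. \<bar>w\<bar> < 1 \<Longrightarrow> 0 < (2 + s\<^sup>2) * s + w * \<Phi> w"
    and res: "\<And>w. w \<noteq> 0 \<Longrightarrow> \<bar>w\<bar> < 1 \<Longrightarrow> \<bar>barrier_residual s (sqrt 2 * \<epsilon>) \<kappa> w (\<Phi> w) (\<Phi>' w)\<bar> < \<eta> * ((2 + s\<^sup>2) * ((2 + s\<^sup>2) * s + w * \<Phi> w))"
  shows "\<bar>sqrt 2 * k - \<kappa>\<bar> < \<eta>"
proof -
  have "\<kappa> - \<eta> < sqrt 2 * k"
  proof (rule loop_barrier[OF lg s, where \<Phi> = \<Phi> and \<Phi>' = \<Phi>'])
    show "\<bar>w\<bar> \<le> 1 \<Longrightarrow> (\<Phi> has_real_derivative \<Phi>' w) (at w)" for w by (rule \<Phi>)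
    show "\<bar>w\<bar> < 1 \<Longrightarrow> 0 < (2 + s\<^sup>2) * s + w * \<Phi> w" for w by (rule \<theta>)
    fix w :: real assume "w \<noteq> 0" "\<bar>w\<bar> < 1"
    from res[OF this] show "0 < barrier_residual s (sqrt 2 * \<epsilon>) (\<kappa> - \<eta>) w (\<Phi> w) (\<Phi>' w)"
      using barrier_residual_shift[of s "sqrt 2 * \<epsilon>" \<kappa> "- \<eta>" w "\<Phi> w" "\<Phi>' w"] by (simp add: abs_less_iff mult_ac)
  qed
  moreover have "- (\<kappa> + \<eta>) < sqrt 2 * (- k)"
  proof (rule loop_barrier[OF loop_graph_swap[OF lg] s, where \<Phi> = "\<lambda>w. - \<Phi> (- w)" and \<Phi>' = "\<lambda>w. \<Phi>' (- w)"])
    fix w :: real assume "\<bar>w\<bar> \<le> 1"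
    then have "(\<Phi> has_real_derivative \<Phi>' (- w)) (at (- w))" using \<Phi>[of "- w"] by simp
    then have "((\<lambda>w. \<Phi> (- w)) has_real_derivative - \<Phi>' (- w)) (at w)" unfolding DERIV_mirror .
    from DERIV_minus[OF this] show "((\<lambda>w. - \<Phi> (- w)) has_real_derivative \<Phi>' (- w)) (at w)" by simp
  next
    fix w :: real assume "\<bar>w\<bar> < 1"
    then show "0 < (2 + s\<^sup>2) * s + w * - \<Phi> (- w)" using \<theta>[of "- w"] by simp
  next
    fix w :: real assume "w \<noteq> 0" "\<bar>w\<bar> < 1"
    then have r: "\<bar>barrier_residual s (sqrt 2 * \<epsilon>) \<kappa> (- w) (\<Phi> (- w)) (\<Phi>' (- w))\<bar> < \<eta> * ((2 + s\<^sup>2) * ((2 + s\<^sup>2) * s + (- w) * \<Phi> (- w)))"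
      using res[of "- w"] by simp
    have "barrier_residual s (- (sqrt 2 * \<epsilon>)) (- (\<kappa> + \<eta>)) (- (- w)) (- \<Phi> (- w)) (\<Phi>' (- w)) =
      - (barrier_residual s (sqrt 2 * \<epsilon>) \<kappa> (- w) (\<Phi> (- w)) (\<Phi>' (- w)) - (2 + s\<^sup>2) * \<eta> * ((2 + s\<^sup>2) * s + (- w) * \<Phi> (- w)))"
      unfolding barrier_residual_uminus barrier_residual_shift ..
    moreover have "\<dots> > 0" using r by (simp add: abs_less_iff mult_ac)
    ultimately show "0 < barrier_residual s (sqrt 2 * - \<epsilon>) (- (\<kappa> + \<eta>)) w (- \<Phi> (- w)) (\<Phi>' (- w))" by simp
  qed
  ultimately show ?thesis by (simp add: abs_less_iff)
qed

section \<open>The explicit error bound\<close>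

lemma abs_monomial_sum_le:
  fixes w e :: real and q :: "(real \<times> nat \<times> nat) list"
  assumes "\<bar>w\<bar> \<le> 1" "\<bar>e\<bar> \<le> 1"
  shows "\<bar>\<Sum>(c, i, j)\<leftarrow>q. c * w ^ i * e ^ j\<bar> \<le> (\<Sum>(c, i, j)\<leftarrow>q. \<bar>c\<bar>)"
proof (induction q)
  case (Cons x q)
  obtain c i j where x: "x = (c, i, j)" by (cases x) auto
  have "\<bar>w\<bar> ^ i * \<bar>e\<bar> ^ j \<le> 1 * 1" using assms by (intro mult_mono power_le_one) auto
  then have "\<bar>c\<bar> * (\<bar>w\<bar> ^ i * \<bar>e\<bar> ^ j) \<le> \<bar>c\<bar> * 1" by (intro mult_left_mono) auto
  then have "\<bar>c * w ^ i * e ^ j\<bar> \<le> \<bar>c\<bar>" by (simp add: abs_mult power_abs mult_ac)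
  then show ?case using Cons unfolding x by (simp add: order_trans[OF abs_triangle_ineq add_mono])
qed simp

text \<open>The entry \<open>(c, i, j)\<close> stands for the monomial \<open>c * w ^ i * e ^ j\<close>.\<close>
lemma cubic_residual:
  fixes e w :: real
  shows "barrier_residual (1 + 9 / 392 * e\<^sup>2) e (12 / 7 * e + 36 / 2401 * e ^ 3) w
      (- 9 / 7 * e + 81 / 392 * e\<^sup>2 * w + e ^ 3 * (- 243 / 4802 + 27 / 1372 * w\<^sup>2)) (81 / 392 * e\<^sup>2 + e ^ 3 * (27 / 686 * w))
    = e ^ 4 * (\<Sum>(c, i, j)\<leftarrow>[(- 37665 / 537824, 1, 0), (163053 / 1075648, 3, 0), (- 21141 / 153664, 5, 0), (41553 / 3764768, 0, 1),
     (- 30861 / 1882384, 2, 1), (85293 / 1882384, 4, 1), (- 24057 / 537824, 6, 1), (- 4987089 / 737894528, 1, 2),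
     (1798443 / 368947264, 3, 2), (40095 / 6588344, 5, 2), (- 2187 / 941192, 7, 2), (802629 / 1475789056, 0, 3),
     (427923 / 1475789056, 2, 3), (- 72171 / 52706752, 4, 3), (- 8614593 / 36156831872, 1, 4), (7879761 / 20661046784, 3, 4),
     (- 10935 / 105413504, 5, 4), (13076073 / 1157018619904, 0, 5), (- 4874823 / 1157018619904, 2, 5), (- 1003833 / 82644187136, 4, 5),
     (- 281604681 / 113387824750592, 1, 6), (29189889 / 8099130339328, 3, 6), (- 19683 / 20661046784, 5, 6), (63713871 / 453551299002368, 0, 7),
     (- 531441 / 4628074479616, 2, 7), (- 531441 / 9256148959232, 4, 7), (- 531441 / 37024595836928, 1, 8), (4428675 / 226775649501184, 3, 8),
     (- 177147 / 32396521357312, 5, 8), (165278151 / 177792109208928256, 0, 9), (- 531441 / 518344341716992, 2, 9), (4782969 / 1422336873671426048, 0, 11),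
     (- 4782969 / 1422336873671426048, 2, 11)]. c * w ^ i * e ^ j)"
  unfolding barrier_residual_def list.map prod.case sum_list.Cons sum_list.Nil by algebra

text \<open>The polynomials are the expansion of the loop up to order \<open>e^3\<close>, so the
  residual starts at \<open>e^4\<close>, and the absolute values of its coefficients add up to at
  most 1. The bound on \<open>e\<close> keeps the curve factor \<open>\<theta>\<close> at least
  2.\<close>

lemma loop_graph_k_cubic:
  assumes lg: "loop_graph \<epsilon> k B f g" and \<epsilon>: "0 < \<epsilon>" and e: "e = sqrt 2 * \<epsilon>" "e \<le> 9 / 16"
  shows "\<bar>sqrt 2 * k - (12 / 7 * e + 36 / 2401 * e ^ 3)\<bar> < 9 / 10 * e ^ 4"
proof -
  define s where "s = 1 + 9 / 392 * e\<^sup>2"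
  define \<Phi> where "\<Phi> = (\<lambda>w. - 9 / 7 * e + 81 / 392 * e\<^sup>2 * w + e ^ 3 * (- 243 / 4802 + 27 / 1372 * w\<^sup>2))"
  define \<Phi>' where "\<Phi>' = (\<lambda>w. 81 / 392 * e\<^sup>2 + e ^ 3 * (27 / 686 * w))"
  have e0: "0 < e" "e \<le> 1" using \<epsilon> e by auto
  have s: "1 \<le> s" unfolding s_def by simp
  have B: "3 \<le> 2 + s\<^sup>2" using s by (simp add: one_le_power)
  have \<Phi>b: "\<bar>\<Phi> w\<bar> \<le> 1" if "\<bar>w\<bar> \<le> 1" for w
  proof -
    have e2: "e\<^sup>2 \<le> 1 / 3" "e ^ 3 \<le> 1 / 5"
      using power_mono[OF e(2), of 2] power_mono[OF e(2), of 3] e0 by (auto simp: power_divide)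
    have "\<bar>81 / 392 * e\<^sup>2 * w\<bar> \<le> 81 / 392 * (1 / 3) * 1" unfolding abs_mult using e2 that by (intro mult_mono) auto
    moreover have "w\<^sup>2 \<le> 1" "0 \<le> w\<^sup>2" using that by (auto simp: abs_square_le_1)
    then have "\<bar>- 243 / 4802 + 27 / 1372 * w\<^sup>2\<bar> \<le> 1" by linarith
    then have "\<bar>e ^ 3 * (- 243 / 4802 + 27 / 1372 * w\<^sup>2)\<bar> \<le> 1 / 5 * 1" unfolding abs_mult using e2 e0 by (intro mult_mono) auto
    moreover have "\<bar>- 9 / 7 * e\<bar> \<le> 9 / 7 * (9 / 16)" using e(2) e0 by simp
    ultimately show ?thesis unfolding \<Phi>_def by linarith
  qed
  have \<theta>: "2 \<le> (2 + s\<^sup>2) * s + w * \<Phi> w" if "\<bar>w\<bar> \<le> 1" for w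
  proof -
    have "\<bar>w * \<Phi> w\<bar> \<le> 1 * 1" unfolding abs_mult using that \<Phi>b by (intro mult_mono) auto
    moreover have "3 * 1 \<le> (2 + s\<^sup>2) * s" using B s by (intro mult_mono) auto
    ultimately show ?thesis by (simp add: abs_le_iff)
  qed
  show ?thesis
  proof (rule loop_barrier_abs[OF lg, of s \<Phi> \<Phi>'])
    show "0 < s" using s by simp
    show "(\<Phi> has_real_derivative \<Phi>' w) (at w)" for w
      unfolding \<Phi>_def \<Phi>'_def by (auto intro!: derivative_eq_intros simp: algebra_simps)
    show "0 < (2 + s\<^sup>2) * s + w * \<Phi> w" if "\<bar>w\<bar> < 1" for w using \<theta>[of w] that by simp
    fix w :: real assume w: "w \<noteq> 0" "\<bar>w\<bar> < 1"
    have "\<bar>barrier_residual s e (12 / 7 * e + 36 / 2401 * e ^ 3) w (\<Phi> w) (\<Phi>' w)\<bar> \<le> e ^ 4 * 1"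
      unfolding s_def \<Phi>_def \<Phi>'_def cubic_residual abs_mult[of "e ^ 4"]
      using e0 w by (intro mult_mono order_trans[OF abs_monomial_sum_le]) auto
    also have "\<dots> < e ^ 4 * (9 / 10 * (3 * 2))" using e0 by simp
    also have "\<dots> \<le> e ^ 4 * (9 / 10 * ((2 + s\<^sup>2) * ((2 + s\<^sup>2) * s + w * \<Phi> w)))"
      using B \<theta>[of w] w by (intro mult_left_mono mult_mono) auto
    also have "\<dots> = 9 / 10 * e ^ 4 * ((2 + s\<^sup>2) * ((2 + s\<^sup>2) * s + w * \<Phi> w))" by (simp only: mult_ac)
    finally show "\<bar>barrier_residual s (sqrt 2 * \<epsilon>) (12 / 7 * e + 36 / 2401 * e ^ 3) w (\<Phi> w) (\<Phi>' w)\<bar>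
        < 9 / 10 * e ^ 4 * ((2 + s\<^sup>2) * ((2 + s\<^sup>2) * s + w * \<Phi> w))"
      unfolding e(1) .
  qed
qed

section \<open>Truncated expansions in \<open>e\<close>\<close>

text \<open>An expansion through order 8 whose remainder is uniform in \<open>w\<close>. An error
  \<open>e^9\<close> in the damping becomes \<open>e^10\<close> in \<open>b\<close>, which is of the
  order \<open>n^(5/2)\<close>. Working with truncations avoids expanding the residual completely,
  whose degree in \<open>e\<close> is large.\<close>

definition has_trunc :: "(real \<Rightarrow> real \<Rightarrow> real) \<Rightarrow> (nat \<Rightarrow> real \<Rightarrow> real) \<Rightarrow> bool" where
  "has_trunc f a \<longleftrightarrow> (\<exists>C\<ge>0. (\<forall>j<9. \<forall>w\<in>{-1..1}. \<bar>a j w\<bar> \<le> C) \<and>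
     (\<forall>w\<in>{-1..1}. \<forall>e\<in>{0..1}. \<bar>f w e - (\<Sum>j<9. a j w * e ^ j)\<bar> \<le> C * e ^ 9))"

lemma has_truncD:
  assumes "has_trunc f a"
  shows "\<exists>C\<ge>0. (\<forall>j w. j < 9 \<longrightarrow> \<bar>w\<bar> \<le> 1 \<longrightarrow> \<bar>a j w\<bar> \<le> C) \<and>
    (\<forall>w e. \<bar>w\<bar> \<le> 1 \<longrightarrow> 0 \<le> e \<longrightarrow> e \<le> 1 \<longrightarrow> \<bar>f w e - (\<Sum>j<9. a j w * e ^ j)\<bar> \<le> C * e ^ 9)"
proof -
  obtain C where C: "0 \<le> C" "\<forall>j<9. \<forall>w\<in>{-1..1}. \<bar>a j w\<bar> \<le> C"
    "\<forall>w\<in>{-1..1}. \<forall>e\<in>{0..1}. \<bar>f w e - (\<Sum>j<9. a j w * e ^ j)\<bar> \<le> C * e ^ 9"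
    using assms unfolding has_trunc_def by (elim exE conjE) (rule that)
  have m: "w \<in> {-1..1}" if "\<bar>w\<bar> \<le> 1" for w :: real using that by auto
  show ?thesis
  proof (intro exI[of _ C] conjI allI impI)
    show "0 \<le> C" by (rule C(1))
    show "\<bar>a j w\<bar> \<le> C" if "j < 9" "\<bar>w\<bar> \<le> 1" for j w using C(2) that(1) m[OF that(2)] by blast
    show "\<bar>f w e - (\<Sum>j<9. a j w * e ^ j)\<bar> \<le> C * e ^ 9" if "\<bar>w\<bar> \<le> 1" "0 \<le> e" "e \<le> 1" for w e
      using bspec[OF bspec[OF C(3) m[OF that(1)]], of e] that(2,3) by simp
  qed
qed

lemma has_truncI:
  assumes "\<And>j w. j < 9 \<Longrightarrow> \<bar>w\<bar> \<le> 1 \<Longrightarrow> \<bar>a j w\<bar> \<le> C"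
    "\<And>w e. \<bar>w\<bar> \<le> 1 \<Longrightarrow> 0 \<le> e \<Longrightarrow> e \<le> 1 \<Longrightarrow> \<bar>f w e - (\<Sum>j<9. a j w * e ^ j)\<bar> \<le> C * e ^ 9"
  shows "has_trunc f a"
proof -
  have "0 \<le> C" using assms(1)[of 0 0] by simp
  then show ?thesis using assms unfolding has_trunc_def by (intro exI[of _ C]) (auto simp: abs_le_iff)
qed

lemma has_trunc_polynomial:
  assumes "\<And>j. j < 9 \<Longrightarrow> continuous_on {-1..1} (a j)"
  shows "has_trunc (\<lambda>w e. \<Sum>j<9. a j w * e ^ j) a"
proof -
  have "\<exists>C. \<forall>w\<in>{-1..1}. \<bar>a j w\<bar> \<le> C" if "j < 9" for j
    using compact_imp_bounded[OF compact_continuous_image[OF assms[OF that] compact_Icc]] unfolding bounded_iff by auto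
  then obtain C where C: "\<And>j w. j < 9 \<Longrightarrow> w \<in> {-1..1} \<Longrightarrow> \<bar>a j w\<bar> \<le> C j" by metis
  show ?thesis
  proof (rule has_truncI[where C = "\<Sum>j<9. \<bar>C j\<bar>"])
    fix j :: nat and w :: real assume "j < 9" "\<bar>w\<bar> \<le> 1"
    then have "\<bar>a j w\<bar> \<le> \<bar>C j\<bar>" using C[of j w] by (simp add: abs_le_iff)
    also have "\<dots> \<le> (\<Sum>j<9. \<bar>C j\<bar>)" using \<open>j < 9\<close> by (intro member_le_sum) auto
    finally show "\<bar>a j w\<bar> \<le> (\<Sum>j<9. \<bar>C j\<bar>)" .
  qed (auto intro!: mult_nonneg_nonneg sum_nonneg)
qed

lemma has_trunc_cong:
  assumes "has_trunc f a" "\<And>w e. f w e = g w e" "\<And>j w. j < 9 \<Longrightarrow> a j w = b j w"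
  shows "has_trunc g b"
proof -
  obtain C where C: "\<And>j w. j < 9 \<Longrightarrow> \<bar>w\<bar> \<le> 1 \<Longrightarrow> \<bar>a j w\<bar> \<le> C"
    "\<And>w e. \<bar>w\<bar> \<le> 1 \<Longrightarrow> 0 \<le> e \<Longrightarrow> e \<le> 1 \<Longrightarrow> \<bar>f w e - (\<Sum>j<9. a j w * e ^ j)\<bar> \<le> C * e ^ 9"
    using has_truncD[OF assms(1)] by blast
  have "(\<Sum>j<9. a j w * e ^ j) = (\<Sum>j<9. b j w * e ^ j)" for w e using assms(3) by (intro sum.cong) auto
  moreover have "\<bar>b j w\<bar> \<le> C" if "j < 9" "\<bar>w\<bar> \<le> 1" for j w using C(1)[OF that] assms(3)[OF that(1)] by simp
  ultimately show ?thesis using C(2) unfolding assms(2) by (intro has_truncI[of b C]) simp_all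
qed

lemma has_trunc_add:
  assumes "has_trunc f a" "has_trunc g b"
  shows "has_trunc (\<lambda>w e. f w e + g w e) (\<lambda>j w. a j w + b j w)"
proof -
  obtain A where A: "\<And>j w. j < 9 \<Longrightarrow> \<bar>w\<bar> \<le> 1 \<Longrightarrow> \<bar>a j w\<bar> \<le> A"
    "\<And>w e. \<bar>w\<bar> \<le> 1 \<Longrightarrow> 0 \<le> e \<Longrightarrow> e \<le> 1 \<Longrightarrow> \<bar>f w e - (\<Sum>j<9. a j w * e ^ j)\<bar> \<le> A * e ^ 9"
    using has_truncD[OF assms(1)] by blast
  obtain B where B: "\<And>j w. j < 9 \<Longrightarrow> \<bar>w\<bar> \<le> 1 \<Longrightarrow> \<bar>b j w\<bar> \<le> B"
    "\<And>w e. \<bar>w\<bar> \<le> 1 \<Longrightarrow> 0 \<le> e \<Longrightarrow> e \<le> 1 \<Longrightarrow> \<bar>g w e - (\<Sum>j<9. b j w * e ^ j)\<bar> \<le> B * e ^ 9"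
    using has_truncD[OF assms(2)] by blast
  show ?thesis
  proof (rule has_truncI[where C = "A + B"])
    show "\<bar>a j w + b j w\<bar> \<le> A + B" if "j < 9" "\<bar>w\<bar> \<le> 1" for j w using A(1)[OF that] B(1)[OF that] by linarith
    fix w e :: real assume h: "\<bar>w\<bar> \<le> 1" "0 \<le> e" "e \<le> 1"
    have "(\<Sum>j<9. (a j w + b j w) * e ^ j) = (\<Sum>j<9. a j w * e ^ j) + (\<Sum>j<9. b j w * e ^ j)"
      unfolding distrib_right sum.distrib ..
    then have "f w e + g w e - (\<Sum>j<9. (a j w + b j w) * e ^ j) = (f w e - (\<Sum>j<9. a j w * e ^ j)) + (g w e - (\<Sum>j<9. b j w * e ^ j))" by simp
    also have "\<bar>\<dots>\<bar> \<le> A * e ^ 9 + B * e ^ 9"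
      by (rule order_trans[OF abs_triangle_ineq add_mono[OF A(2)[OF h] B(2)[OF h]]])
    finally show "\<bar>f w e + g w e - (\<Sum>j<9. (a j w + b j w) * e ^ j)\<bar> \<le> (A + B) * e ^ 9" by (simp add: distrib_right)
  qed
qed

text \<open>Products of coefficients with total order at least 9 go into the remainder; there are at
  most 81 of them.\<close>

lemma has_trunc_mult:
  assumes "has_trunc f a" "has_trunc g b"
  shows "has_trunc (\<lambda>w e. f w e * g w e) (\<lambda>j w. \<Sum>i\<le>j. a i w * b (j - i) w)"
proof -
  obtain A where A: "0 \<le> A" "\<And>j w. j < 9 \<Longrightarrow> \<bar>w\<bar> \<le> 1 \<Longrightarrow> \<bar>a j w\<bar> \<le> A"
    "\<And>w e. \<bar>w\<bar> \<le> 1 \<Longrightarrow> 0 \<le> e \<Longrightarrow> e \<le> 1 \<Longrightarrow> \<bar>f w e - (\<Sum>j<9. a j w * e ^ j)\<bar> \<le> A * e ^ 9"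
    using has_truncD[OF assms(1)] by blast
  obtain B where B: "0 \<le> B" "\<And>j w. j < 9 \<Longrightarrow> \<bar>w\<bar> \<le> 1 \<Longrightarrow> \<bar>b j w\<bar> \<le> B"
    "\<And>w e. \<bar>w\<bar> \<le> 1 \<Longrightarrow> 0 \<le> e \<Longrightarrow> e \<le> 1 \<Longrightarrow> \<bar>g w e - (\<Sum>j<9. b j w * e ^ j)\<bar> \<le> B * e ^ 9"
    using has_truncD[OF assms(2)] by blast
  have AB: "0 \<le> A * B" using A B by simp
  have coef: "\<bar>\<Sum>i\<le>j. a i w * b (j - i) w\<bar> \<le> 9 * (A * B)" if "j < 9" "\<bar>w\<bar> \<le> 1" for j w
  proof -
    have "\<bar>\<Sum>i\<le>j. a i w * b (j - i) w\<bar> \<le> (\<Sum>i\<le>j. A * B)"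
      using that A B by (intro order_trans[OF sum_abs] sum_mono) (auto simp: abs_mult intro!: mult_mono)
    also have "\<dots> = real (j + 1) * (A * B)" by simp
    also have "\<dots> \<le> 9 * (A * B)" using that AB by (intro mult_right_mono) auto
    finally show ?thesis .
  qed
  show ?thesis
  proof (rule has_truncI[where C = "9 * (A * B) + (81 * (A * B) + (10 * A * B + 9 * B * A))"])
    show "\<bar>\<Sum>i\<le>j. a i w * b (j - i) w\<bar> \<le> 9 * (A * B) + (81 * (A * B) + (10 * A * B + 9 * B * A))" if "j < 9" "\<bar>w\<bar> \<le> 1" for j w
      using coef[OF that] AB by (simp add: mult.commute)
  next
    fix w e :: real assume w: "\<bar>w\<bar> \<le> 1" and e: "0 \<le> e" "e \<le> 1"
    define p where "p = (\<Sum>j<9. a j w * e ^ j)"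
    define q where "q = (\<Sum>j<9. b j w * e ^ j)"
    have e9: "0 \<le> e ^ 9" "e ^ 9 \<le> 1" using e by (auto simp: power_le_one)
    have epow: "\<bar>c * e ^ j\<bar> \<le> \<bar>c\<bar>" for c j
      using e power_le_one[OF e, of j] by (simp add: abs_mult mult_left_le)
    have pb: "\<bar>p\<bar> \<le> 9 * A"
    proof -
      have "\<bar>p\<bar> \<le> (\<Sum>j<9::nat. A)" unfolding p_def
        using A(2) w by (intro order_trans[OF sum_abs] sum_mono order_trans[OF epow]) auto
      then show ?thesis by simp
    qed
    have qb: "\<bar>q\<bar> \<le> 9 * B"
    proof -
      have "\<bar>q\<bar> \<le> (\<Sum>j<9::nat. B)" unfolding q_def
        using B(2) w by (intro order_trans[OF sum_abs] sum_mono order_trans[OF epow]) auto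
      then show ?thesis by simp
    qed
    define S where "S = {..<9::nat} \<times> {..<9::nat}"
    define T where "T = {(i, j). i + j < (9::nat)}"
    have TS: "T \<subseteq> S" unfolding T_def S_def by auto
    have fS: "finite S" unfolding S_def by simp
    let ?t = "\<lambda>(i, j). (a i w * e ^ i) * (b j w * e ^ j)"
    have "p * q = sum ?t S" unfolding p_def q_def S_def sum_product sum.cartesian_product ..
    moreover have "(\<Sum>j<9. (\<Sum>i\<le>j. a i w * b (j - i) w) * e ^ j) = sum ?t T"
    proof -
      have "sum ?t T = (\<Sum>j<9. \<Sum>i\<le>j. (a i w * e ^ i) * (b (j - i) w * e ^ (j - i)))"
        unfolding T_def by (subst sum.triangle_reindex) simp
      also have "\<dots> = (\<Sum>j<9. (\<Sum>i\<le>j. a i w * b (j - i) w) * e ^ j)"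
        unfolding sum_distrib_right by (intro sum.cong refl) (auto simp: mult_ac simp flip: power_add)
      finally show ?thesis ..
    qed
    ultimately have "p * q - (\<Sum>j<9. (\<Sum>i\<le>j. a i w * b (j - i) w) * e ^ j) = sum ?t (S - T)"
      using sum.subset_diff[OF TS fS, of ?t] by simp
    moreover have "\<bar>sum ?t (S - T)\<bar> \<le> (\<Sum>x\<in>S - T. A * B * e ^ 9)"
    proof (intro order_trans[OF sum_abs] sum_mono)
      fix x assume "x \<in> S - T"
      then obtain i j where x: "x = (i, j)" "i < 9" "j < 9" "9 \<le> i + j" unfolding S_def T_def by auto
      have "\<bar>?t x\<bar> = \<bar>a i w\<bar> * \<bar>b j w\<bar> * e ^ (i + j)" using e unfolding x by (simp add: abs_mult power_add)
      also have "\<dots> \<le> A * B * e ^ 9"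
        using A(1) B(1) A(2)[OF x(2) w] B(2)[OF x(3) w] e x(4) by (intro mult_mono power_decreasing) auto
      finally show "\<bar>?t x\<bar> \<le> A * B * e ^ 9" .
    qed
    moreover have "(\<Sum>x\<in>S - T. A * B * e ^ 9) \<le> 81 * (A * B) * e ^ 9"
    proof -
      have "card (S - T) \<le> card S" using fS by (intro card_mono) auto
      then have "real (card (S - T)) \<le> 81" unfolding S_def by simp
      then have "real (card (S - T)) * (A * B * e ^ 9) \<le> 81 * (A * B * e ^ 9)" using AB e9 by (intro mult_right_mono) auto
      then show ?thesis by simp
    qed
    ultimately have 1: "\<bar>p * q - (\<Sum>j<9. (\<Sum>i\<le>j. a i w * b (j - i) w) * e ^ j)\<bar> \<le> 81 * (A * B) * e ^ 9" by linarith
    have fp: "\<bar>f w e - p\<bar> \<le> A * e ^ 9" "\<bar>g w e - q\<bar> \<le> B * e ^ 9"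
      using A(3)[OF w e] B(3)[OF w e] unfolding p_def q_def .
    have "A * e ^ 9 \<le> A * 1" using A(1) e9 by (intro mult_left_mono) auto
    then have fb: "\<bar>f w e\<bar> \<le> 10 * A" using fp(1) pb by linarith
    have "\<bar>f w e * (g w e - q)\<bar> \<le> 10 * A * (B * e ^ 9)" unfolding abs_mult using fb fp(2) A(1) by (intro mult_mono) auto
    moreover have "\<bar>q * (f w e - p)\<bar> \<le> 9 * B * (A * e ^ 9)" unfolding abs_mult using qb fp(1) B(1) by (intro mult_mono) auto
    moreover have "f w e * g w e - p * q = f w e * (g w e - q) + q * (f w e - p)" by (simp add: algebra_simps)
    ultimately have 2: "\<bar>f w e * g w e - p * q\<bar> \<le> 10 * A * (B * e ^ 9) + 9 * B * (A * e ^ 9)" by linarith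
    have "\<bar>f w e * g w e - (\<Sum>j<9. (\<Sum>i\<le>j. a i w * b (j - i) w) * e ^ j)\<bar> \<le> 81 * (A * B) * e ^ 9 + (10 * A * (B * e ^ 9) + 9 * B * (A * e ^ 9))"
      using 1 2 by linarith
    also have "\<dots> = (81 * (A * B) + (10 * A * B + 9 * B * A)) * e ^ 9" by (simp add: algebra_simps)
    also have "\<dots> \<le> (9 * (A * B) + (81 * (A * B) + (10 * A * B + 9 * B * A))) * e ^ 9"
      using AB e9 by (intro mult_right_mono) auto
    finally show "\<bar>f w e * g w e - (\<Sum>j<9. (\<Sum>i\<le>j. a i w * b (j - i) w) * e ^ j)\<bar> \<le> \<dots>" .
  qed
qed

lemma has_trunc_w:
  assumes "continuous_on {-1..1} c"
  shows "has_trunc (\<lambda>w e. c w) (\<lambda>j w. if j = 0 then c w else 0)"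
proof (rule has_trunc_cong[OF has_trunc_polynomial])
  show "continuous_on {- 1..1} ((\<lambda>j w. if j = 0 then c w else 0) j)" for j :: nat using assms by (cases "j = 0") auto
  show "(\<Sum>j<9. (if j = 0 then c w else 0) * e ^ j) = c w" for w e :: real
    by (simp add: if_distrib[of "\<lambda>x. x * _"] cong: if_cong)
qed simp

lemma has_trunc_scale:
  assumes "continuous_on {-1..1} c" "has_trunc f a"
  shows "has_trunc (\<lambda>w e. c w * f w e) (\<lambda>j w. c w * a j w)"
proof (rule has_trunc_cong[OF has_trunc_mult[OF has_trunc_w[OF assms(1)] assms(2)]])
  fix j :: nat and w :: real
  have "(\<Sum>i\<le>j. (if i = 0 then c w else 0) * a (j - i) w) = (\<Sum>i\<in>{0}. (if i = 0 then c w else 0) * a (j - i) w)"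
    by (rule sum.mono_neutral_right) auto
  then show "(\<Sum>i\<le>j. (if i = 0 then c w else 0) * a (j - i) w) = c w * a j w" by simp
qed simp

text \<open>Compares with the explicit leading coefficient, which keeps the approximating curve
  positive for small \<open>e\<close>.\<close>

lemma has_trunc_order:
  assumes "has_trunc f a"
  shows "\<exists>C\<ge>0. \<forall>w e. \<bar>w\<bar> \<le> 1 \<longrightarrow> 0 \<le> e \<longrightarrow> e \<le> 1 \<longrightarrow> \<bar>f w e - a 0 w\<bar> \<le> C * e"
proof -
  obtain A where A: "0 \<le> A" "\<And>j w. j < 9 \<Longrightarrow> \<bar>w\<bar> \<le> 1 \<Longrightarrow> \<bar>a j w\<bar> \<le> A"
    "\<And>w e. \<bar>w\<bar> \<le> 1 \<Longrightarrow> 0 \<le> e \<Longrightarrow> e \<le> 1 \<Longrightarrow> \<bar>f w e - (\<Sum>j<9. a j w * e ^ j)\<bar> \<le> A * e ^ 9"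
    using has_truncD[OF assms(1)] by blast
  have "\<bar>f w e - a 0 w\<bar> \<le> 9 * A * e" if w: "\<bar>w\<bar> \<le> 1" and e: "0 \<le> e" "e \<le> 1" for w e
  proof -
    have ej: "e ^ Suc j \<le> e" for j using e by (simp add: mult_left_le power_le_one)
    have "\<bar>\<Sum>j<8. a (Suc j) w * e ^ Suc j\<bar> \<le> (\<Sum>j<8::nat. A * e)"
    proof (intro order_trans[OF sum_abs] sum_mono)
      fix j :: nat assume "j \<in> {..<8}"
      then show "\<bar>a (Suc j) w * e ^ Suc j\<bar> \<le> A * e"
        unfolding abs_mult using A w e ej[of j] by (intro mult_mono) auto
    qed
    moreover have "(\<Sum>j<9. a j w * e ^ j) = a 0 w + (\<Sum>j<8. a (Suc j) w * e ^ Suc j)"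
      using sum.lessThan_Suc_shift[of "\<lambda>j. a j w * e ^ j" 8] by simp
    moreover have "A * e ^ 9 \<le> A * e" using ej[of 8] A(1) by (intro mult_left_mono) auto
    ultimately show ?thesis using A(3)[OF w e] by simp
  qed
  then show ?thesis using A(1) by (intro exI[of _ "9 * A"]) auto
qed

lemma sum_atMost_le_8: "j < (9::nat) \<Longrightarrow> (\<Sum>i\<le>j. h i) = (\<Sum>i\<leftarrow>[0..<Suc j]. h i :: real)"
  by (simp add: sum_list_distinct_conv_sum_set atLeast0LessThan lessThan_Suc_atMost del: upt_Suc)

text \<open>Replaces a Cauchy product by a list of numerals computed in advance, so that iterated
  products do not unfold into nested sums.\<close>

lemma has_trunc_list_mult:
  assumes "has_trunc f (\<lambda>j w. l w ! j)" "has_trunc g (\<lambda>j w. m w ! j)"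
    and "\<And>w. list_all (\<lambda>j. (\<Sum>i\<leftarrow>[0..<Suc j]. l w ! i * m w ! (j - i)) = r w ! j) [0..<9]"
  shows "has_trunc (\<lambda>w e. f w e * g w e) (\<lambda>j w. r w ! j)"
proof (rule has_trunc_cong[OF has_trunc_mult[OF assms(1,2)] refl])
  fix j :: nat and w :: real assume "j < 9"
  then show "(\<Sum>i\<le>j. l w ! i * m w ! (j - i)) = r w ! j"
    using assms(3)[of w] by (auto simp: sum_atMost_le_8 list_all_iff simp del: upt_Suc)
qed

text \<open>
  The formal expansion of the loop in powers of \<open>e\<close>: the coefficients of \<open>p\<close> are polynomials in \<open>w\<close>,
  found together with those of \<open>s\<close> and \<open>k\<close> by making the residual vanish order by order.
\<close>
definition s_coeffs :: "real list" where "s_coeffs = [1, 0, 9 / 392, 0, - 10611 / 10756480, 0, 1958067 / 33129958400, 0, - 77451403567203 / 12739932023762944000]"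
text \<open>This list and the following ones up to \<open>B3_coeffs\<close> expand
  \<open>B = 2 + s^2\<close>, \<open>B * s\<close>, \<open>B^2\<close> and \<open>B^3\<close>; they
  are consequences of the expansion of \<open>s\<close>.\<close>

definition B_coeffs :: "real list" where "B_coeffs = [3, 0, 9 / 196, 0, - 243 / 168070, 0, 1056753 / 14494356800, 0, - 52700348817 / 6220669933478000]"
definition Bs_coeffs :: "real list" where "Bs_coeffs = [3, 0, 45 / 392, 0, - 7209 / 2151296, 0, 1592973 / 9276388352, 0, - 53242727181309 / 2547986404752588800]"
definition B2_coeffs :: "real list" where "B2_coeffs = [9, 0, 27 / 98, 0, - 8829 / 1344560, 0, 2207979 / 7247178400, 0, - 2092376504781 / 49765359467824000]"
definition B3_coeffs :: "real list" where "B3_coeffs = [27, 0, 243 / 196, 0, - 26973 / 1344560, 0, 225261 / 258827800, 0, - 7903245175857 / 49765359467824000]"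
definition k_coeffs :: "real list" where "k_coeffs = [0, 12 / 7, 0, 36 / 2401, 0, - 7506 / 45294865, 0, - 294120207 / 11108339166925, 0]"
definition phi_coeffs :: "real \<Rightarrow> real list" where "phi_coeffs w = [0, - 9 / 7, 81 / 392 * w, - 243 / 4802 + 27 / 1372 * w ^ 2, 15471 / 5378240 * w - 7047 / 1536640 * w ^ 3, 1033749 / 724717840 + 125847 / 103531120 * w ^ 2 - 2187 / 1056440 * w ^ 4, 4914027 / 231909708800 * w + 100353411 / 231909708800 * w ^ 3 - 112023 / 946570240 * w ^ 5, - 34172497539 / 355466853341600 - 7180084269 / 101561958097600 * w ^ 2 + 3498471 / 259086627800 * w ^ 4 + 1406241 / 9421331920 * w ^ 6, - 20070783335061 / 3184983005940736000 * w - 2562902679501 / 69999626504192000 * w ^ 3 - 14904698301 / 265304706867200 * w ^ 5 + 33908238711 / 675321072025600 * w ^ 7]"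
definition phi_deriv_coeffs :: "real \<Rightarrow> real list" where "phi_deriv_coeffs w = [0, 0, 81 / 392, 27 / 686 * w, 15471 / 5378240 - 21141 / 1536640 * w ^ 2, 125847 / 51765560 * w - 2187 / 264110 * w ^ 3, 4914027 / 231909708800 + 301060233 / 231909708800 * w ^ 2 - 112023 / 189314048 * w ^ 4, - 7180084269 / 50780979048800 * w + 3498471 / 64771656950 * w ^ 3 + 4218723 / 4710665960 * w ^ 5, - 20070783335061 / 3184983005940736000 - 7688708038503 / 69999626504192000 * w ^ 2 - 14904698301 / 53060941373440 * w ^ 4 + 33908238711 / 96474438860800 * w ^ 6]"

lemmas coeffs_simps = sum_atMost_le_8 upt_rec phi_coeffs_def phi_deriv_coeffs_def s_coeffs_def k_coeffs_def
  B_coeffs_def Bs_coeffs_def B2_coeffs_def B3_coeffs_def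

lemma less_9: "j < (9::nat) \<longleftrightarrow> j \<in> {0, 1, 2, 3, 4, 5, 6, 7, 8}" by auto

lemma phi_coeffs_deriv:
  assumes "j < 9"
  shows "((\<lambda>w. phi_coeffs w ! j) has_real_derivative phi_deriv_coeffs w ! j) (at w)"
  using assms unfolding less_9
  by (auto simp: phi_coeffs_def phi_deriv_coeffs_def intro!: derivative_eq_intros)
definition s_poly :: "real \<Rightarrow> real" where "s_poly e = (\<Sum>j<9. s_coeffs ! j * e ^ j)"
definition k_poly :: "real \<Rightarrow> real" where "k_poly e = (\<Sum>j<9. k_coeffs ! j * e ^ j)"
definition phi_poly :: "real \<Rightarrow> real \<Rightarrow> real" where "phi_poly w e = (\<Sum>j<9. phi_coeffs w ! j * e ^ j)"
definition phi_deriv_poly :: "real \<Rightarrow> real \<Rightarrow> real" where "phi_deriv_poly w e = (\<Sum>j<9. phi_deriv_coeffs w ! j * e ^ j)"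

text \<open>That all nine coefficients of the residual vanish is the formal solution itself; each is
  a polynomial identity in \<open>w\<close> with rational coefficients. The other two expansions
  serve to bound the curve from below.\<close>

lemma has_trunc_residual:
  shows "has_trunc (\<lambda>w e. (2 + (s_poly e)\<^sup>2) * s_poly e + w * phi_poly w e) (\<lambda>j w. Bs_coeffs ! j + w * phi_coeffs w ! j)" (is ?A)
    and "has_trunc (\<lambda>w e. barrier_residual (s_poly e) e (k_poly e) w (phi_poly w e) (phi_deriv_poly w e)) (\<lambda>j w. 0)" (is ?B)
    and "has_trunc (\<lambda>w e. s_poly e) (\<lambda>j w. s_coeffs ! j)" (is ?C)
proof -
  note T = has_trunc_list_mult
  have s: "has_trunc (\<lambda>w e. s_poly e) (\<lambda>j w. s_coeffs ! j)" unfolding s_poly_def[abs_def] by (rule has_trunc_polynomial) auto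
  have k: "has_trunc (\<lambda>w e. k_poly e) (\<lambda>j w. k_coeffs ! j)" unfolding k_poly_def[abs_def] by (rule has_trunc_polynomial) auto
  have phi: "has_trunc phi_poly (\<lambda>j w. phi_coeffs w ! j)" unfolding phi_poly_def[abs_def]
    by (rule has_trunc_polynomial) (auto intro!: continuous_at_imp_continuous_on DERIV_isCont phi_coeffs_deriv)
  have phi': "has_trunc phi_deriv_poly (\<lambda>j w. phi_deriv_coeffs w ! j)" unfolding phi_deriv_poly_def[abs_def]
    by (rule has_trunc_polynomial) (auto simp: less_9 phi_deriv_coeffs_def intro!: continuous_intros)
  have two: "has_trunc (\<lambda>w e. 2) (\<lambda>j w. if j = 0 then 2 else 0)" by (rule has_trunc_w) auto
  have id: "continuous_on {-1..1} (\<lambda>w::real. w)" "continuous_on {-1..1} (\<lambda>w::real. 1 - w\<^sup>2)" by (auto intro!: continuous_intros)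
  have e: "has_trunc (\<lambda>w e. e) (\<lambda>j w. [0, 1, 0, 0, 0, 0, 0, 0, 0] ! j)"
    by (rule has_trunc_cong[OF has_trunc_polynomial[of "\<lambda>j w. [0, 1, 0, 0, 0, 0, 0, 0, 0] ! j"]]) (simp_all add: eval_nat_numeral)
  have B: "has_trunc (\<lambda>w e. 2 + (s_poly e)\<^sup>2) (\<lambda>j w. B_coeffs ! j)"
  proof (rule has_trunc_cong[OF has_trunc_add[OF two T[OF s s, where r = "\<lambda>_. 1 # tl B_coeffs"]]])
    show "list_all (\<lambda>j. (\<Sum>i\<leftarrow>[0..<Suc j]. s_coeffs ! i * s_coeffs ! (j - i)) = (1 # tl B_coeffs) ! j) [0..<9]"
      by (simp add: s_coeffs_def B_coeffs_def upt_rec)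
    show "(if j = 0 then 2 else 0) + (1 # tl B_coeffs) ! j = B_coeffs ! j" for j
      by (cases j) (auto simp: B_coeffs_def)
  qed (simp add: power2_eq_square)
  have Bs: "has_trunc (\<lambda>w e. (2 + (s_poly e)\<^sup>2) * s_poly e) (\<lambda>j w. Bs_coeffs ! j)"
    by (rule T[OF B s]) (simp add: s_coeffs_def B_coeffs_def Bs_coeffs_def upt_rec)
  have B2: "has_trunc (\<lambda>w e. (2 + (s_poly e)\<^sup>2) * (2 + (s_poly e)\<^sup>2)) (\<lambda>j w. B2_coeffs ! j)"
    by (rule T[OF B B]) (simp add: B2_coeffs_def B_coeffs_def upt_rec)
  have B3: "has_trunc (\<lambda>w e. (2 + (s_poly e)\<^sup>2) * (2 + (s_poly e)\<^sup>2) * (2 + (s_poly e)\<^sup>2)) (\<lambda>j w. B3_coeffs ! j)"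
    by (rule T[OF B2 B]) (simp add: B2_coeffs_def B_coeffs_def B3_coeffs_def upt_rec)
  show t: ?A by (rule has_trunc_add[OF Bs has_trunc_scale[OF id(1) phi]])
  show ?C by (rule s)
  let ?t = "\<lambda>w e. (2 + (s_poly e)\<^sup>2) * s_poly e + w * phi_poly w e"
  \<comment> \<open>\<open>P1\<close> to \<open>P5\<close> expand the summands of the residual in
    the order of its definition.\<close>
  note P1 = has_trunc_mult[OF phi has_trunc_add[OF Bs t]]
  note P2 = has_trunc_scale[OF _ has_trunc_mult[OF t t], of "\<lambda>w. - 3 * w"]
  note P3 = has_trunc_scale[OF id(2) has_trunc_mult[OF t has_trunc_add[OF phi has_trunc_scale[OF id(1) phi']]]]
  note P4 = has_trunc_scale[OF id(1) B3]
  note P5 = has_trunc_mult[OF has_trunc_add[OF has_trunc_scale[OF _ has_trunc_mult[OF B k], of "\<lambda>w. -1"]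
    has_trunc_scale[OF id(2) has_trunc_mult[OF e B2]]] t]
  have c: "continuous_on {-1..1} (\<lambda>w::real. - 3 * w)" "continuous_on {-1..1} (\<lambda>w::real. -1 :: real)" by (auto intro!: continuous_intros)
  note P = has_trunc_add[OF has_trunc_add[OF has_trunc_add[OF has_trunc_add[OF P1 P2[OF c(1)]] P3] P4] P5[OF c(2)]]
  show ?B
  proof (rule has_trunc_cong[OF P], goal_cases)
    case (1 w e)
    show ?case unfolding barrier_residual_def by (simp add: algebra_simps power2_eq_square power3_eq_cube)
  next
    case (2 j w)
    txt \<open>\<open>Z\<close> keeps the simplifier from moving terms across the equation, a form that \<open>algebra\<close> may fail to solve.\<close>
    define Z where "Z = (\<lambda>x::real. x = 0)"
    have Z_intro: "x = 0 \<longleftrightarrow> Z x" for x unfolding Z_def ..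
    from 2 consider "j = 0" | "j = 1" | "j = 2" | "j = 3" | "j = 4" | "j = 5" | "j = 6" | "j = 7" | "j = 8" unfolding less_9 by blast
    then show ?case
    proof cases
      case 1 show ?thesis unfolding Z_intro 1 by (simp add: coeffs_simps) (simp only: Z_def, algebra?)
    next
      case 2 show ?thesis unfolding Z_intro 2 by (simp add: coeffs_simps) (simp only: Z_def, algebra?)
    next
      case 3 show ?thesis unfolding Z_intro 3 by (simp add: coeffs_simps) (simp only: Z_def, algebra?)
    next
      case 4 show ?thesis unfolding Z_intro 4 by (simp add: coeffs_simps) (simp only: Z_def, algebra?)
    next
      case 5 show ?thesis unfolding Z_intro 5 by (simp add: coeffs_simps) (simp only: Z_def, algebra?)
    next
      case 6 show ?thesis unfolding Z_intro 6 by (simp add: coeffs_simps) (simp only: Z_def, algebra?)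
    next
      case 7 show ?thesis unfolding Z_intro 7 by (simp add: coeffs_simps) (simp only: Z_def, algebra?)
    next
      case 8 show ?thesis unfolding Z_intro 8 by (simp add: coeffs_simps) (simp only: Z_def, algebra?)
    next
      case 9 show ?thesis unfolding Z_intro 9 by (simp add: coeffs_simps) (simp only: Z_def, algebra?)
    qed
  qed
qed
text \<open>The residual is of order \<open>e^9\<close> uniformly along the curve while
  \<open>B * \<theta>\<close> stays bounded below, so the damping is known up to the same
  order.\<close>

theorem loop_graph_k_asymptotic:
  "\<exists>C e1. 0 < C \<and> 0 < e1 \<and> (\<forall>\<epsilon> k B f g. 0 < \<epsilon> \<longrightarrow> sqrt 2 * \<epsilon> \<le> e1 \<longrightarrow> loop_graph \<epsilon> k B f g \<longrightarrow>
     \<bar>sqrt 2 * k - k_poly (sqrt 2 * \<epsilon>)\<bar> < C * (sqrt 2 * \<epsilon>) ^ 9)"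
proof -
  note T = has_trunc_residual
  obtain C1 where C1: "0 \<le> C1" "\<And>w e. \<bar>w\<bar> \<le> 1 \<Longrightarrow> 0 \<le> e \<Longrightarrow> e \<le> 1 \<Longrightarrow>
      \<bar>(2 + (s_poly e)\<^sup>2) * s_poly e + w * phi_poly w e - (Bs_coeffs ! 0 + w * phi_coeffs w ! 0)\<bar> \<le> C1 * e"
    using has_trunc_order[OF T(1)] by blast
  obtain C2 where C2: "0 \<le> C2" "\<And>e. 0 \<le> e \<Longrightarrow> e \<le> 1 \<Longrightarrow> \<bar>s_poly e - s_coeffs ! 0\<bar> \<le> C2 * e"
    using has_trunc_order[OF T(3)] by (metis abs_zero zero_le_one)
  obtain C where C: "0 \<le> C" "\<And>w e. \<bar>w\<bar> \<le> 1 \<Longrightarrow> 0 \<le> e \<Longrightarrow> e \<le> 1 \<Longrightarrow>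
      \<bar>barrier_residual (s_poly e) e (k_poly e) w (phi_poly w e) (phi_deriv_poly w e)\<bar> \<le> C * e ^ 9"
    using has_truncD[OF T(2)] by auto
  \<comment> \<open>Keeps \<open>s\<close> within \<open>1 / 2\<close> of its leading value 1 and
    the curve factor within 1 of its leading value 3.\<close>
  define e1 where "e1 = min 1 (min (1 / (C1 + 1)) (1 / (2 * (C2 + 1))))"
  have e1: "0 < e1" "e1 \<le> 1" "e1 \<le> 1 / (C1 + 1)" "e1 \<le> 1 / (2 * (C2 + 1))" unfolding e1_def using C1(1) C2(1) by auto
  have main: "\<bar>sqrt 2 * k - k_poly (sqrt 2 * \<epsilon>)\<bar> < (C + 1) * (sqrt 2 * \<epsilon>) ^ 9"
    if \<epsilon>: "0 < \<epsilon>" "sqrt 2 * \<epsilon> \<le> e1" and lg: "loop_graph \<epsilon> k B f g" for \<epsilon> k B f g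
  proof -
    define e where "e = sqrt 2 * \<epsilon>"
    have e: "0 < e" "0 \<le> e" "e \<le> 1" "e \<le> 1 / (C1 + 1)" "e \<le> 1 / (2 * (C2 + 1))" unfolding e_def using \<epsilon> e1 by auto
    have ce1: "C1 * e \<le> 1"
    proof -
      have "(C1 + 1) * e \<le> 1" using e(4) C1(1) by (simp add: pos_le_divide_eq mult.commute)
      then show ?thesis using e(1) by (simp add: distrib_right)
    qed
    have ce2: "C2 * e \<le> 1 / 2"
    proof -
      have "2 * (C2 + 1) * e \<le> 1" using e(5) C2(1) by (simp add: pos_le_divide_eq mult.commute)
      then show ?thesis using e(1) by (simp add: distrib_right)
    qed
    have s: "1 / 2 \<le> s_poly e" using C2(2)[OF e(2,3)] ce2 by (simp add: s_coeffs_def abs_le_iff)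
    have \<theta>: "2 \<le> (2 + (s_poly e)\<^sup>2) * s_poly e + w * phi_poly w e" if "\<bar>w\<bar> \<le> 1" for w
      using C1(2)[OF that e(2,3)] ce1 unfolding Bs_coeffs_def phi_coeffs_def nth_Cons_0 by (simp add: abs_le_iff)
    have "\<bar>sqrt 2 * k - k_poly e\<bar> < (C + 1) * e ^ 9"
    proof (rule loop_barrier_abs[OF lg, where s = "s_poly e" and \<Phi> = "\<lambda>w. phi_poly w e" and \<Phi>' = "\<lambda>w. phi_deriv_poly w e"])
      show "0 < s_poly e" using s by simp
      show "((\<lambda>w. phi_poly w e) has_real_derivative phi_deriv_poly w e) (at w)" for w
        unfolding phi_poly_def[abs_def] phi_deriv_poly_def[abs_def] by (intro DERIV_sum DERIV_cmult_right phi_coeffs_deriv) auto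
      show "0 < (2 + (s_poly e)\<^sup>2) * s_poly e + w * phi_poly w e" if "\<bar>w\<bar> < 1" for w using \<theta>[of w] that by simp
      fix w :: real assume w: "w \<noteq> 0" "\<bar>w\<bar> < 1"
      have "\<bar>barrier_residual (s_poly e) e (k_poly e) w (phi_poly w e) (phi_deriv_poly w e)\<bar> \<le> C * e ^ 9" using C(2)[of w e] e w by simp
      also have "\<dots> < (C + 1) * e ^ 9 * 1" using e(1) by (simp add: distrib_right)
      also have "\<dots> \<le> (C + 1) * e ^ 9 * ((2 + (s_poly e)\<^sup>2) * ((2 + (s_poly e)\<^sup>2) * s_poly e + w * phi_poly w e))"
      proof (rule mult_left_mono)
        have "1 * 1 \<le> (2 + (s_poly e)\<^sup>2) * ((2 + (s_poly e)\<^sup>2) * s_poly e + w * phi_poly w e)"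
          using \<theta>[of w] w by (intro mult_mono) (auto simp: add_nonneg_nonneg)
        then show "1 \<le> (2 + (s_poly e)\<^sup>2) * ((2 + (s_poly e)\<^sup>2) * s_poly e + w * phi_poly w e)" by simp
      qed (use C(1) e in simp)
      finally show "\<bar>barrier_residual (s_poly e) (sqrt 2 * \<epsilon>) (k_poly e) w (phi_poly w e) (phi_deriv_poly w e)\<bar>
          < (C + 1) * e ^ 9 * ((2 + (s_poly e)\<^sup>2) * ((2 + (s_poly e)\<^sup>2) * s_poly e + w * phi_poly w e))"
        unfolding e_def[symmetric] .
    qed
    then show ?thesis unfolding e_def .
  qed
  show ?thesis
    using main C(1) e1(1) by (intro exI[of _ "C + 1"] exI[of _ e1]) auto
qed

section \<open>The bifurcation curve\<close>

lemma fourth_root_powr: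
  fixes \<epsilon> :: real
  assumes "0 < \<epsilon>"
  shows "(\<epsilon> ^ 4) powr (1 / 2) = \<epsilon>\<^sup>2" "(\<epsilon> ^ 4) powr (5 / 4) = \<epsilon> ^ 5" "(\<epsilon> ^ 4) powr (3 / 2) = \<epsilon> ^ 6" "(\<epsilon> ^ 4) powr (5 / 2) = \<epsilon> ^ 10"
    "sqrt (\<epsilon> ^ 4) = \<epsilon>\<^sup>2"
proof -
  have "(\<epsilon> ^ 4) powr a = \<epsilon> powr (4 * a)" for a
    using powr_powr[of \<epsilon> 4 a] powr_realpow[OF assms, of 4] by simp
  then show "(\<epsilon> ^ 4) powr (1 / 2) = \<epsilon>\<^sup>2" "(\<epsilon> ^ 4) powr (5 / 4) = \<epsilon> ^ 5" "(\<epsilon> ^ 4) powr (3 / 2) = \<epsilon> ^ 6" "(\<epsilon> ^ 4) powr (5 / 2) = \<epsilon> ^ 10"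
    using powr_realpow[OF assms, of 2] powr_realpow[OF assms, of 5] powr_realpow[OF assms, of 6] powr_realpow[OF assms, of 10] by simp_all
  show "sqrt (\<epsilon> ^ 4) = \<epsilon>\<^sup>2" using assms by (intro real_sqrt_unique) (auto simp: power_mult[symmetric])
qed

lemma fourth_root_exists:
  fixes n :: real
  assumes "0 < n"
  shows "\<exists>\<epsilon>. 0 < \<epsilon> \<and> n = \<epsilon> ^ 4 \<and> \<epsilon> = sqrt (sqrt n)"
proof -
  have "sqrt (sqrt n) ^ 4 = ((sqrt (sqrt n))\<^sup>2)\<^sup>2" by (simp only: power_mult[symmetric]) simp
  then show ?thesis using assms by simp
qed

lemma k_poly_eq: "k_poly e = 12 / 7 * e + 36 / 2401 * e ^ 3 - 7506 / 45294865 * e ^ 5 - 294120207 / 11108339166925 * e ^ 7"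
proof -
  have "{..<9::nat} = {0, 1, 2, 3, 4, 5, 6, 7, 8}" by auto
  then show ?thesis unfolding k_poly_def by (simp add: k_coeffs_def)
qed

text \<open>In terms of \<open>e\<close> the formula
  \<open>b = \<epsilon> * (k - \<epsilon>)\<close> becomes \<open>e / 2 * (sqrt 2 * k - e)\<close>.
  It is split at an approximation \<open>x\<close> of \<open>sqrt 2 * k\<close>, whose error is
  thereby multiplied by \<open>e / 2\<close>.\<close>

lemma bstar_error:
  assumes "0 < \<epsilon>" "e = sqrt 2 * \<epsilon>"
  shows "bstar (\<epsilon> ^ 4) = e / 2 * (x - e) + e / 2 * (sqrt 2 * loop_k \<epsilon> - x)"
proof -
  have "r * \<epsilon> / 2 * (r * k - r * \<epsilon>) = (r * r) * \<epsilon> * (k - \<epsilon>) / 2" for r k by algebra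
  then have "e / 2 * (sqrt 2 * loop_k \<epsilon> - e) = (sqrt 2 * sqrt 2) * \<epsilon> * (loop_k \<epsilon> - \<epsilon>) / 2"
    unfolding assms(2) .
  then have "bstar (\<epsilon> ^ 4) = e / 2 * (sqrt 2 * loop_k \<epsilon> - e)" unfolding bstar_eq_loop_k[OF assms(1)] by simp
  then show ?thesis by (simp add: distrib_left[symmetric] right_diff_distrib[symmetric] add_divide_distrib[symmetric])
qed

lemma sqrt2_powers:
  fixes \<epsilon> :: real
  assumes "e = sqrt 2 * \<epsilon>"
  shows "e\<^sup>2 = 2 * \<epsilon>\<^sup>2" "e ^ 4 = 4 * \<epsilon> ^ 4" "e ^ 5 = 4 * sqrt 2 * \<epsilon> ^ 5" "e ^ 6 = 8 * \<epsilon> ^ 6" "e ^ 8 = 16 * \<epsilon> ^ 8" "e ^ 10 = 32 * \<epsilon> ^ 10"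
proof -
  have 2: "e\<^sup>2 = 2 * \<epsilon>\<^sup>2" unfolding assms by (simp add: power_mult_distrib)
  have ev: "e ^ (2 * m) = 2 ^ m * \<epsilon> ^ (2 * m)" for m unfolding power_mult 2 by (simp add: power_mult_distrib)
  show "e\<^sup>2 = 2 * \<epsilon>\<^sup>2" by (rule 2)
  show "e ^ 4 = 4 * \<epsilon> ^ 4" "e ^ 6 = 8 * \<epsilon> ^ 6" "e ^ 8 = 16 * \<epsilon> ^ 8" "e ^ 10 = 32 * \<epsilon> ^ 10"
    using ev[of 2] ev[of 3] ev[of 4] ev[of 5] by simp_all
  have "e ^ 5 = e ^ 4 * e" "\<epsilon> ^ 5 = \<epsilon> ^ 4 * \<epsilon>" by (simp_all add: eval_nat_numeral)
  then show "e ^ 5 = 4 * sqrt 2 * \<epsilon> ^ 5" using \<open>e ^ 4 = 4 * \<epsilon> ^ 4\<close> assms by simp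
qed

lemma bstar_cubic_bound:
  assumes n: "0 < n" "n \<le> 1 / 40"
  shows "\<bar>5 / 7 * sqrt n + 72 / 2401 * n - bstar n\<bar> < 11 / 4 * n powr (5 / 4)"
proof -
  obtain \<epsilon> where \<epsilon>: "0 < \<epsilon>" "n = \<epsilon> ^ 4" using fourth_root_exists[OF n(1)] by blast
  define e where "e = sqrt 2 * \<epsilon>"
  have e0: "0 < e" unfolding e_def using \<epsilon> by simp
  note e = sqrt2_powers[OF e_def]
  \<comment> \<open>Here \<open>e^4 = 4 * n \<le> 1 / 10\<close>, which is just below
    \<open>(9 / 16)^4\<close>; this links the range of \<open>n\<close> to that of
    \<open>e\<close>.\<close>
  have "e ^ 4 \<le> (9 / 16) ^ 4" unfolding e(2) using n unfolding \<epsilon>(2) by (simp add: power_divide)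
  then have e1: "e \<le> 9 / 16" using e0 by (simp add: power_mono_iff)
  obtain B f g where "loop_graph \<epsilon> (loop_k \<epsilon>) B f g" using loop_k_graph[of \<epsilon>] \<epsilon>(1) by auto
  from loop_graph_k_cubic[OF this \<epsilon>(1) e_def e1]
  have "e / 2 * \<bar>sqrt 2 * loop_k \<epsilon> - (12 / 7 * e + 36 / 2401 * e ^ 3)\<bar> < e / 2 * (9 / 10 * e ^ 4)"
    using e0 by (intro mult_strict_left_mono) auto
  also have "\<dots> = 9 / 20 * e ^ 5" by (simp add: eval_nat_numeral)
  also have "\<dots> \<le> 11 / 4 * \<epsilon> ^ 5"
  proof -
    \<comment> \<open>The resulting constant \<open>9 / 20 * 4 * sqrt 2\<close> is at most
      \<open>27 / 10\<close>, slightly less than \<open>11 / 4\<close>; the \<open>9 / 10\<close> in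
      the bound for the damping is adapted to this.\<close>
    have "sqrt 2 \<le> 3 / 2" by (rule real_le_lsqrt) (auto simp: power2_eq_square)
    then have "9 / 20 * (4 * sqrt 2) * \<epsilon> ^ 5 \<le> 11 / 4 * \<epsilon> ^ 5" using \<epsilon>(1) by (intro mult_right_mono) auto
    then show ?thesis unfolding e(3) by simp
  qed
  finally have lt: "e / 2 * \<bar>sqrt 2 * loop_k \<epsilon> - (12 / 7 * e + 36 / 2401 * e ^ 3)\<bar> < 11 / 4 * \<epsilon> ^ 5" .
  have "e / 2 * (12 / 7 * e + 36 / 2401 * e ^ 3 - e) = 5 / 14 * e\<^sup>2 + 18 / 2401 * e ^ 4"
    by (simp add: eval_nat_numeral algebra_simps)
  also have "\<dots> = 5 / 7 * \<epsilon>\<^sup>2 + 72 / 2401 * \<epsilon> ^ 4" unfolding e by simp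
  finally have "5 / 7 * \<epsilon>\<^sup>2 + 72 / 2401 * \<epsilon> ^ 4 - bstar n = - (e / 2 * (sqrt 2 * loop_k \<epsilon> - (12 / 7 * e + 36 / 2401 * e ^ 3)))"
    unfolding \<epsilon>(2) bstar_error[OF \<epsilon>(1) e_def, of "12 / 7 * e + 36 / 2401 * e ^ 3"] by linarith
  then have "\<bar>5 / 7 * \<epsilon>\<^sup>2 + 72 / 2401 * \<epsilon> ^ 4 - bstar n\<bar> = e / 2 * \<bar>sqrt 2 * loop_k \<epsilon> - (12 / 7 * e + 36 / 2401 * e ^ 3)\<bar>"
    using e0 by (simp add: abs_mult)
  then show ?thesis using lt unfolding \<epsilon>(2) fourth_root_powr[OF \<epsilon>(1)] by simp
qed

lemma bstar_expansion:
  "(\<lambda>n. bstar n - (5/7 * n powr (1/2) + 72/2401 * n - 30024/45294865 * n powr (3/2) - 2352961656/11108339166925 * n^2))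
    \<in> O[at_right 0](\<lambda>n. n powr (5/2))"
proof -
  obtain C e1 where C: "0 < C" "0 < e1" and b: "\<And>\<epsilon> k B f g. 0 < \<epsilon> \<Longrightarrow> sqrt 2 * \<epsilon> \<le> e1 \<Longrightarrow> loop_graph \<epsilon> k B f g \<Longrightarrow>
     \<bar>sqrt 2 * k - k_poly (sqrt 2 * \<epsilon>)\<bar> < C * (sqrt 2 * \<epsilon>) ^ 9"
    using loop_graph_k_asymptotic by blast
  define n0 where "n0 = (e1 / sqrt 2) ^ 4"
  have n0: "0 < n0" unfolding n0_def using C by simp
  have main: "\<bar>bstar n - (5/7 * n powr (1/2) + 72/2401 * n - 30024/45294865 * n powr (3/2) - 2352961656/11108339166925 * n^2)\<bar>
      \<le> 16 * C * n powr (5/2)" if n: "0 < n" "n < n0" for n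
  proof -
    obtain \<epsilon> where \<epsilon>: "0 < \<epsilon>" "n = \<epsilon> ^ 4" using fourth_root_exists[OF n(1)] by blast
    define e where "e = sqrt 2 * \<epsilon>"
    have e0: "0 < e" unfolding e_def using \<epsilon> by simp
    note e = sqrt2_powers[OF e_def]
    have "\<epsilon> < e1 / sqrt 2" using n(2) C(2) unfolding \<epsilon>(2) n0_def by (intro power_less_imp_less_base[of \<epsilon> 4]) auto
    then have e1: "e \<le> e1" unfolding e_def by (simp add: field_simps)
    obtain B f g where "loop_graph \<epsilon> (loop_k \<epsilon>) B f g" using loop_k_graph[of \<epsilon>] \<epsilon>(1) by auto
    from b[OF \<epsilon>(1) e1[unfolded e_def] this, folded e_def]
    have "e / 2 * \<bar>sqrt 2 * loop_k \<epsilon> - k_poly e\<bar> \<le> e / 2 * (C * e ^ 9)"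
      using e0 by (intro mult_left_mono) auto
    also have "\<dots> = C / 2 * e ^ 10" by (simp add: eval_nat_numeral)
    also have "\<dots> = 16 * C * \<epsilon> ^ 10" unfolding e by simp
    finally have le: "e / 2 * \<bar>sqrt 2 * loop_k \<epsilon> - k_poly e\<bar> \<le> 16 * C * \<epsilon> ^ 10" .
    have "e / 2 * (k_poly e - e) = 5 / 14 * e\<^sup>2 + 18 / 2401 * e ^ 4 - 3753 / 45294865 * e ^ 6 - 294120207 / 22216678333850 * e ^ 8"
      unfolding k_poly_eq by (simp add: eval_nat_numeral algebra_simps)
    also have "\<dots> = 5/7 * \<epsilon>\<^sup>2 + 72/2401 * \<epsilon> ^ 4 - 30024/45294865 * \<epsilon> ^ 6 - 2352961656/11108339166925 * \<epsilon> ^ 8"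
      unfolding e by simp
    finally have eq: "bstar n - (5/7 * \<epsilon>\<^sup>2 + 72/2401 * \<epsilon> ^ 4 - 30024/45294865 * \<epsilon> ^ 6 - 2352961656/11108339166925 * \<epsilon> ^ 8)
        = e / 2 * (sqrt 2 * loop_k \<epsilon> - k_poly e)"
      unfolding \<epsilon>(2) bstar_error[OF \<epsilon>(1) e_def, of "k_poly e"] by linarith
    have "\<bar>e / 2 * a\<bar> = e / 2 * \<bar>a\<bar>" for a using e0 by (simp add: abs_mult)
    then have "\<bar>bstar n - (5/7 * \<epsilon>\<^sup>2 + 72/2401 * \<epsilon> ^ 4 - 30024/45294865 * \<epsilon> ^ 6 - 2352961656/11108339166925 * \<epsilon> ^ 8)\<bar>
        = e / 2 * \<bar>sqrt 2 * loop_k \<epsilon> - k_poly e\<bar>"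
      unfolding eq .
    moreover have "n\<^sup>2 = \<epsilon> ^ 8" unfolding \<epsilon>(2) by (simp add: power_mult[symmetric])
    ultimately show ?thesis using le unfolding \<open>n\<^sup>2 = \<epsilon> ^ 8\<close> unfolding \<epsilon>(2) fourth_root_powr[OF \<epsilon>(1)] by simp
  qed
  show ?thesis
  proof (rule bigoI[where c = "16 * C"])
    show "\<forall>\<^sub>F n in at_right 0. norm (bstar n - (5/7 * n powr (1/2) + 72/2401 * n - 30024/45294865 * n powr (3/2) - 2352961656/11108339166925 * n^2))
      \<le> 16 * C * norm (n powr (5/2))"
      by (rule eventually_at_rightI[OF _ n0]) (use main in simp)
  qed
qed

theorem theorem1p2:
  shows "(\<exists>H :: real \<Rightarrow> real. analytic_restriction_on H {0..} \<and>
            (\<forall>n>0. bstar n = H (sqrt n))) \<and>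
         (\<forall>n. 0 < n \<and> n \<le> 1/40 \<longrightarrow>
            \<bar>5/7 * sqrt n + 72/2401 * n - bstar n\<bar> < 11/4 * n powr (5/4)) \<and>
         (\<lambda>n. bstar n -
            (5/7 * n powr (1/2) + 72/2401 * n - 30024/45294865 * n powr (3/2)
               - 2352961656/11108339166925 * n^2))
           \<in> O[at_right 0](\<lambda>n. n powr (5/2))"
proof -
  have "bstar n = sqrt (sqrt n) * loop_k (sqrt (sqrt n)) - sqrt n" if n: "0 < n" for n
  proof -
    obtain \<epsilon> where \<epsilon>: "0 < \<epsilon>" "n = \<epsilon> ^ 4" "\<epsilon> = sqrt (sqrt n)" using fourth_root_exists[OF n] by blast
    have "bstar n = \<epsilon> * (loop_k \<epsilon> - \<epsilon>)" using bstar_eq_loop_k[OF \<epsilon>(1)] \<epsilon>(2) by simp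
    moreover have "\<epsilon> * \<epsilon> = sqrt n" using n unfolding \<epsilon>(3) by simp
    ultimately show ?thesis unfolding \<epsilon>(3)[symmetric] by (simp add: right_diff_distrib)
  qed
  then show ?thesis
    using loop_function_analytic bstar_cubic_bound bstar_expansion by blast
qed

end
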